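(* Let $f\in L^2(\Omega)$, let $u\in H_0^1(\Omega)$ be the solution of $(\nabla u,\nabla v)=(f,v)$ for all $v\in H_0^1(\Omega)$, and let $u_h^{\mathrm{CR}}\in V_{h,0}^{\mathrm{CR}}$ be the solution of $(\nabla_hu_h^{\mathrm{CR}},\nabla_hv_h)=(f,v_h)$ for all $v_h\in V_{h,0}^{\mathrm{CR}}$. With $$\mathfrak E_h(f):=C_{0,h}\|f-\Pi_h^0f\|_{L^2(\Omega)}+\kappa_{M,h}\|\Pi_h^0f\|_{L^2(\Omega)},\qquad M_h:=\sqrt{C_{0,h}^2+\kappa_{M,h}^2},$$ one has $$|u-u_h^{\mathrm{CR}}|_{H^1(\mathbb T_h)}\le2\mathfrak E_h(f)\le2M_h\|f\|_{L^2(\Omega)}$$ and $$\|u-u_h^{\mathrm{CR}}\|_{L^2(\Omega)}\le M_h^2\|f\|_{L^2(\Omega)}.$$ (These bounds hold on any non-degenerate conforming simplicial mesh; neither convexity of $\Omega$ nor global $H^2$-regularity is assumed.)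
   Context: Let $d\in\{2,3\}$, let $\Omega\subset\mathbb R^d$ be a bounded polyhedral Lipschitz domain, and let $\mathbb T_h$ be a finite conforming triangulation of $\overline\Omega$ into non-degenerate closed $d$-simplices (the intersection of two distinct elements is empty or a common subsimplex); no shape regularity is assumed. $(\cdot,\cdot)$ is the $L^2(\Omega)$ inner product (scalar or vector valued). For elementwise $H^1$ functions $v$, $\nabla_hv$ is the elementwise (broken) gradient and $|v|_{H^1(\mathbb T_h)}:=\|\nabla_hv\|_{L^2(\Omega)^d}$. $X_h$ is the space of functions constant on each $T\in\mathbb T_h$, and $\Pi_h^0:L^2(\Omega)\to X_h$ is the $L^2$-orthogonal projection (elementwise mean). $V_h^c:=\{v\in H_0^1(\Omega): v|_T \text{ affine } \forall T\in\mathbb T_h\}$. The Crouzeix--Raviart space $V_{h,0}^{\mathrm{CR}}$ consists of the elementwise affine functions $v$ such that $\int_F[\![v]\!]\,ds=0$ for all faces $F$, where $[\![v]\!]$ is the jump across an interior face and the trace of $v$ on a boundary face. For $g_h\in X_h$: $z_h^c(g_h)\in V_h^c$ is the unique solution of $(\nabla z_h^c(g_h),\nabla v_h)=(g_h,v_h)$ for all $v_h\in V_h^c$; $z_h^{\mathrm{CR}}(g_h)\in V_{h,0}^{\mathrm{CR}}$ is the unique solution of $(\nabla_h z_h^{\mathrm{CR}}(g_h),\nabla_h v_h)=(g_h,v_h)$ for all $v_h\in V_{h,0}^{\mathrm{CR}}$; the Marini flux is $\bm\sigma_h^M(g_h)|_T:=\nabla_h z_h^{\mathrm{CR}}(g_h)|_T-\frac{g_h|_T}{d}(\bm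 x-\bm x_T)$, with $\bm x_T$ the barycentre of $T$; and $$\kappa_{M,h}:=\sup_{0\ne g_h\in X_h}\frac{\|\bm\sigma_h^M(g_h)-\nabla z_h^c(g_h)\|_{L^2(\Omega)^d}}{\|g_h\|_{L^2(\Omega)}}.$$ The optimal Poincaré constants are $C_0(T):=\sup\{\|v\|_{L^2(T)}/\|\nabla v\|_{L^2(T)^d}: 0\ne v\in H^1(T),\ \int_Tv\,dx=0\}$ and $C_{0,h}:=\max_{T\in\mathbb T_h}C_0(T)$. *)

theory Defs
  imports "HOL-Analysis.Analysis"
begin

text \<open>
  Elements of \<open>L\<^sup>2\<close> and \<open>H\<^sup>1\<close> are represented by functions on the whole space, of which only the
  values almost everywhere on the set \<open>S\<close> matter.
\<close>

definition L2_space :: "'a::euclidean_space set \<Rightarrow> ('a \<Rightarrow> 'b::euclidean_space) set" where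
  "L2_space S = {v. v \<in> borel_measurable (lebesgue_on S) \<and>
                    integrable (lebesgue_on S) (\<lambda>x. (norm (v x))\<^sup>2)}"

definition l2_inner :: "'a::euclidean_space set \<Rightarrow> ('a \<Rightarrow> 'b::euclidean_space) \<Rightarrow> ('a \<Rightarrow> 'b) \<Rightarrow> real" where
  "l2_inner S v w = (\<integral>x. v x \<bullet> w x \<partial>lebesgue_on S)"

definition l2_norm :: "'a::euclidean_space set \<Rightarrow> ('a \<Rightarrow> 'b::euclidean_space) \<Rightarrow> real" where
  "l2_norm S v = sqrt (\<integral>x. (norm (v x))\<^sup>2 \<partial>lebesgue_on S)"

primrec Ck :: "nat \<Rightarrow> ('a::euclidean_space \<Rightarrow> real) \<Rightarrow> bool" where
  "Ck 0 \<phi> \<longleftrightarrow> continuous_on UNIV \<phi>"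
| "Ck (Suc k) \<phi> \<longleftrightarrow> (\<forall>x. \<phi> differentiable (at x)) \<and>
                  (\<forall>b\<in>Basis. Ck k (\<lambda>x. frechet_derivative \<phi> (at x) b))"

text \<open>\<open>C\<^sub>c\<^sup>\<infinity>(S)\<close>, each function being extended by zero to the whole space.\<close>

definition test_functions :: "'a::euclidean_space set \<Rightarrow> ('a \<Rightarrow> real) set" where
  "test_functions S = {\<phi>. (\<forall>k. Ck k \<phi>) \<and> compact (closure {x. \<phi> x \<noteq> 0}) \<and>
                          closure {x. \<phi> x \<noteq> 0} \<subseteq> S}"

definition has_weak_gradient ::
    "'a::euclidean_space set \<Rightarrow> ('a \<Rightarrow> real) \<Rightarrow> ('a \<Rightarrow> 'a) \<Rightarrow> bool" where
  "has_weak_gradient S v G \<longleftrightarrow> v \<in> L2_space S \<and> G \<in> L2_space S \<and>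
     (\<forall>\<phi>\<in>test_functions S. \<forall>b\<in>Basis.
        (\<integral>x. v x * frechet_derivative \<phi> (at x) b \<partial>lebesgue_on S)
          = - (\<integral>x. (G x \<bullet> b) * \<phi> x \<partial>lebesgue_on S))"

text \<open>The weak gradient is unique only almost everywhere; a representative is selected.\<close>

definition weak_grad :: "'a::euclidean_space set \<Rightarrow> ('a \<Rightarrow> real) \<Rightarrow> 'a \<Rightarrow> 'a" where
  "weak_grad S v = (SOME G. has_weak_gradient S v G)"

definition H1 :: "'a::euclidean_space set \<Rightarrow> ('a \<Rightarrow> real) set" where
  "H1 S = {v. \<exists>G. has_weak_gradient S v G}"

definition h1_norm :: "'a::euclidean_space set \<Rightarrow> ('a \<Rightarrow> real) \<Rightarrow> real" where
  "h1_norm S v = sqrt ((l2_norm S v)\<^sup>2 + (l2_norm S (weak_grad S v))\<^sup>2)"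

definition H10 :: "'a::euclidean_space set \<Rightarrow> ('a \<Rightarrow> real) set" where
  "H10 S = {v\<in>H1 S. \<exists>\<phi>. (\<forall>n. \<phi> n \<in> test_functions S) \<and>
                       (\<lambda>n. h1_norm S (\<lambda>x. v x - \<phi> n x)) \<longlonglongrightarrow> 0}"

text \<open>
  Near each boundary point the domain lies strictly on one side of the graph of a Lipschitz function
  defined on the hyperplane orthogonal to a unit vector \<open>n\<close>; the coordinates of \<open>y\<close> along \<open>n\<close> and
  in that hyperplane are \<open>y \<bullet> n\<close> and \<open>y - (y \<bullet> n) n\<close>.
\<close>

definition lipschitz_boundary :: "'a::euclidean_space set \<Rightarrow> bool" where
  "lipschitz_boundary \<Omega> \<longleftrightarrow>
     (\<forall>x\<in>frontier \<Omega>. \<exists>r>0. \<exists>n \<gamma> L. norm n = 1 \<and> L-lipschitz_on {y. y \<bullet> n = 0} \<gamma> \<and>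
        \<Omega> \<inter> ball x r = {y\<in>ball x r. y \<bullet> n > \<gamma> (y - (y \<bullet> n) *\<^sub>R n)})"

definition polyhedral_lipschitz_domain :: "'a::euclidean_space set \<Rightarrow> bool" where
  "polyhedral_lipschitz_domain \<Omega> \<longleftrightarrow>
     open \<Omega> \<and> connected \<Omega> \<and> \<Omega> \<noteq> {} \<and> bounded \<Omega> \<and> lipschitz_boundary \<Omega> \<and>
     (\<exists>P. finite P \<and> (\<forall>p\<in>P. polytope p) \<and> closure \<Omega> = \<Union>P)"

definition simplicial_mesh :: "'a::euclidean_space set \<Rightarrow> 'a set set \<Rightarrow> bool" where
  "simplicial_mesh \<Omega> \<T> \<longleftrightarrow>
     triangulation \<T> \<and> (\<forall>T\<in>\<T>. int DIM('a) simplex T) \<and> \<Union>\<T> = closure \<Omega>"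

definition barycentre :: "'a::euclidean_space set \<Rightarrow> 'a" where
  "barycentre T = (let V = {p. p extreme_point_of T} in (1 / real (card V)) *\<^sub>R (\<Sum>p\<in>V. p))"

text \<open>
  The surface measure on the affine hull of \<open>F\<close> is Lebesgue measure in Cartesian coordinates \<open>c\<close> with
  respect to an origin \<open>a\<close> and an orthonormal basis \<open>B\<close> of the direction space. It does not depend on
  the choice of \<open>a\<close> and \<open>B\<close>.
\<close>

definition cartesian_frame :: "'a::euclidean_space set \<Rightarrow> 'a \<Rightarrow> 'a set \<Rightarrow> bool" where
  "cartesian_frame F a B \<longleftrightarrow> a \<in> F \<and> pairwise orthogonal B \<and> (\<forall>b\<in>B. norm b = 1) \<and>
     affine hull F = (\<lambda>y. a + y) ` span B"

definition surface_measure :: "'a::euclidean_space set \<Rightarrow> 'a measure" where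
  "surface_measure F = (let (a, B) = (SOME (a, B). cartesian_frame F a B) in
     distr (Pi\<^sub>M B (\<lambda>_. lborel)) borel (\<lambda>c. a + (\<Sum>b\<in>B. c b *\<^sub>R b)))"

definition face_integral :: "'a::euclidean_space set \<Rightarrow> ('a \<Rightarrow> real) \<Rightarrow> real" where
  "face_integral F w = set_lebesgue_integral (surface_measure F) F w"

text \<open>
  Piecewise conditions are imposed on the interiors of the elements, so that piecewise functions may
  be discontinuous across faces; their values on the mesh skeleton, a null set, are irrelevant.
\<close>

definition piecewise_constant :: "'a::euclidean_space set set \<Rightarrow> ('a \<Rightarrow> real) set" where
  "piecewise_constant \<T> = {g. \<forall>T\<in>\<T>. \<exists>c. \<forall>x\<in>interior T. g x = c}"

definition piecewise_affine :: "'a::euclidean_space set set \<Rightarrow> ('a \<Rightarrow> real) set" where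
  "piecewise_affine \<T> = {v. \<forall>T\<in>\<T>. \<exists>a c. \<forall>x\<in>interior T. v x = a \<bullet> x + c}"

definition broken_grad :: "'a::euclidean_space set set \<Rightarrow> ('a \<Rightarrow> real) \<Rightarrow> 'a \<Rightarrow> 'a" where
  "broken_grad \<T> v x = (\<Sum>T\<in>\<T>. indicator (interior T) x *\<^sub>R weak_grad (interior T) v x)"

definition broken_h1_seminorm ::
    "'a::euclidean_space set \<Rightarrow> 'a set set \<Rightarrow> ('a \<Rightarrow> real) \<Rightarrow> real" where
  "broken_h1_seminorm \<Omega> \<T> v = l2_norm \<Omega> (broken_grad \<T> v)"

definition element_trace :: "'a::euclidean_space set \<Rightarrow> ('a \<Rightarrow> real) \<Rightarrow> 'a \<Rightarrow> real" where
  "element_trace T v x = Lim (at x within interior T) v"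

definition P0_projection ::
    "'a::euclidean_space set \<Rightarrow> 'a set set \<Rightarrow> ('a \<Rightarrow> real) \<Rightarrow> 'a \<Rightarrow> real" where
  "P0_projection \<Omega> \<T> f = (SOME p. p \<in> piecewise_constant \<T> \<and>
     (\<forall>g\<in>piecewise_constant \<T>. l2_inner \<Omega> (\<lambda>x. f x - p x) g = 0))"

definition conforming_space :: "'a::euclidean_space set \<Rightarrow> 'a set set \<Rightarrow> ('a \<Rightarrow> real) set" where
  "conforming_space \<Omega> \<T> = H10 \<Omega> \<inter> piecewise_affine \<T>"

text \<open>The sign of the jump is irrelevant here, so no orientation of the interior faces is fixed.\<close>

definition cr_space :: "'a::euclidean_space set \<Rightarrow> 'a set set \<Rightarrow> ('a \<Rightarrow> real) set" where
  "cr_space \<Omega> \<T> = {v\<in>piecewise_affine \<T>.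
     (\<forall>T\<in>\<T>. \<forall>T'\<in>\<T>. \<forall>F. T \<noteq> T' \<and> F facet_of T \<and> F facet_of T' \<and> \<not> F \<subseteq> frontier \<Omega> \<longrightarrow>
        face_integral F (\<lambda>x. element_trace T v x - element_trace T' v x) = 0) \<and>
     (\<forall>T\<in>\<T>. \<forall>F. F facet_of T \<and> F \<subseteq> frontier \<Omega> \<longrightarrow>
        face_integral F (element_trace T v) = 0)}"

definition weak_solution :: "'a::euclidean_space set \<Rightarrow> ('a \<Rightarrow> real) \<Rightarrow> ('a \<Rightarrow> real) \<Rightarrow> bool" where
  "weak_solution \<Omega> f u \<longleftrightarrow> u \<in> H10 \<Omega> \<and>
     (\<forall>v\<in>H10 \<Omega>. l2_inner \<Omega> (weak_grad \<Omega> u) (weak_grad \<Omega> v) = l2_inner \<Omega> f v)"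

definition conforming_solution ::
    "'a::euclidean_space set \<Rightarrow> 'a set set \<Rightarrow> ('a \<Rightarrow> real) \<Rightarrow> ('a \<Rightarrow> real) \<Rightarrow> bool" where
  "conforming_solution \<Omega> \<T> f z \<longleftrightarrow> z \<in> conforming_space \<Omega> \<T> \<and>
     (\<forall>v\<in>conforming_space \<Omega> \<T>.
        l2_inner \<Omega> (weak_grad \<Omega> z) (weak_grad \<Omega> v) = l2_inner \<Omega> f v)"

definition cr_solution ::
    "'a::euclidean_space set \<Rightarrow> 'a set set \<Rightarrow> ('a \<Rightarrow> real) \<Rightarrow> ('a \<Rightarrow> real) \<Rightarrow> bool" where
  "cr_solution \<Omega> \<T> f z \<longleftrightarrow> z \<in> cr_space \<Omega> \<T> \<and>
     (\<forall>v\<in>cr_space \<Omega> \<T>. l2_inner \<Omega> (broken_grad \<T> z) (broken_grad \<T> v) = l2_inner \<Omega> f v)"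

text \<open>The discrete solutions are unique up to null sets; representatives are selected.\<close>

definition z_conf :: "'a::euclidean_space set \<Rightarrow> 'a set set \<Rightarrow> ('a \<Rightarrow> real) \<Rightarrow> 'a \<Rightarrow> real" where
  "z_conf \<Omega> \<T> g = (SOME z. conforming_solution \<Omega> \<T> g z)"

definition z_cr :: "'a::euclidean_space set \<Rightarrow> 'a set set \<Rightarrow> ('a \<Rightarrow> real) \<Rightarrow> 'a \<Rightarrow> real" where
  "z_cr \<Omega> \<T> g = (SOME z. cr_solution \<Omega> \<T> g z)"

definition marini_flux :: "'a::euclidean_space set \<Rightarrow> 'a set set \<Rightarrow> ('a \<Rightarrow> real) \<Rightarrow> 'a \<Rightarrow> 'a" where
  "marini_flux \<Omega> \<T> g x = broken_grad \<T> (z_cr \<Omega> \<T> g) x -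
     (\<Sum>T\<in>\<T>. indicator (interior T) x *\<^sub>R ((g x / real DIM('a)) *\<^sub>R (x - barycentre T)))"

definition kappa_M :: "'a::euclidean_space set \<Rightarrow> 'a set set \<Rightarrow> real" where
  "kappa_M \<Omega> \<T> =
     Sup {l2_norm \<Omega> (\<lambda>x. marini_flux \<Omega> \<T> g x - weak_grad \<Omega> (z_conf \<Omega> \<T> g) x) / l2_norm \<Omega> g | g.
            g \<in> piecewise_constant \<T> \<and> \<not> (AE x in lebesgue_on \<Omega>. g x = 0)}"

definition poincare_const :: "'a::euclidean_space set \<Rightarrow> real" where
  "poincare_const T =
     Sup {l2_norm (interior T) v / l2_norm (interior T) (weak_grad (interior T) v) | v.
            v \<in> H1 (interior T) \<and> \<not> (AE x in lebesgue_on (interior T). v x = 0) \<and>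
            (\<integral>x. v x \<partial>lebesgue_on (interior T)) = 0}"

definition max_poincare_const :: "'a::euclidean_space set set \<Rightarrow> real" where
  "max_poincare_const \<T> = Max (poincare_const ` \<T>)"

definition error_bound ::
    "'a::euclidean_space set \<Rightarrow> 'a set set \<Rightarrow> ('a \<Rightarrow> real) \<Rightarrow> real" where
  "error_bound \<Omega> \<T> f =
     max_poincare_const \<T> * l2_norm \<Omega> (\<lambda>x. f x - P0_projection \<Omega> \<T> f x)
       + kappa_M \<Omega> \<T> * l2_norm \<Omega> (P0_projection \<Omega> \<T> f)"

definition M_const :: "'a::euclidean_space set \<Rightarrow> 'a set set \<Rightarrow> real" where
  "M_const \<Omega> \<T> = sqrt ((max_poincare_const \<T>)\<^sup>2 + (kappa_M \<Omega> \<T>)\<^sup>2)"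

end

theory Submission
  imports Defs
begin

text \<open>
  Call a function that is \<open>H\<^sup>1\<close> on each element \<^emph>\<open>matched\<close> if its means over the two sides of every
  interior facet agree and its means over the boundary facets vanish. Functions in \<open>H\<^sub>0\<^sup>1\<close> and
  Crouzeix--Raviart functions are matched. Put \<open>b = z\<^sub>h\<^sup>c(\<Pi>f)\<close> and \<open>\<sigma> = \<sigma>\<^sub>h\<^sup>M(\<Pi>f)\<close>. Since
  \<open>(\<sigma>, \<nabla>\<^sub>h w) = (\<Pi>f, w)\<close> for matched \<open>w\<close>,
  \<open>(f, w) - (\<nabla>b, \<nabla>\<^sub>h w) = (f - \<Pi>f, w - \<Pi>w) + (\<sigma> - \<nabla>b, \<nabla>\<^sub>h w)\<close>,
  and this residual is at most \<open>\<E>\<^sub>h(f) |w|\<close> by the Poincare inequality on the elements. The energies of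
  \<open>u - b\<close> and \<open>u\<^sub>C\<^sub>R - b\<close> add up to the residual of the sum of these two functions, which controls their
  difference. For the \<open>L\<^sup>2\<close> estimate, take \<open>f = w = e = u - u\<^sub>C\<^sub>R\<close> in the identity: now
  \<open>(\<nabla>b, \<nabla>\<^sub>h e) = 0\<close> because \<open>b\<close> is admissible in both problems, so the residual equals \<open>\<parallel>e\<parallel>\<^sup>2\<close>.
\<close>

section \<open>Smooth test functions\<close>

text \<open>The constants in the bounds are suprema of sets of reals, so nothing can be estimated by
  them until those sets are known to be nonempty and bounded above. This calls for two results whose
  own constants then disappear: a Poincare inequality on bounded convex open sets, proved by
  integrating translates, and a discrete Friedrichs inequality, proved by representing finitely many
  functionals. The discrete solutions are selected by choice, so their existence must be shown as
  well; it rests on the definiteness of the broken energy on the Crouzeix--Raviart space.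

  Facet means of Sobolev functions would require traces. They are replaced by volume integrals,
  which are continuous in \<open>H\<^sup>1\<close> and so pass from test functions to limits;
  surface integrals occur only for affine functions, where symmetry reduces them to values at
  barycentres.

  The energy estimate is proved with factor 1 instead of 2. The second estimate consumes exactly
  this: it multiplies the error bound of e by the energy error, which then yields the square of
  \<open>M_const\<close> without a further factor.\<close>

lemma Ck_const [simp]: "Ck k (\<lambda>x. c)"
  by (induction k arbitrary: c) auto

text \<open>The product rule leaves one factor undifferentiated, so the induction in
  \<open>Ck_mult\<close> has to lower the order of that factor.\<close>

lemma Ck_Suc_imp: "Ck (Suc k) f \<Longrightarrow> Ck k f"
proof (induction k arbitrary: f)
  case 0
  then show ?case
    by (auto simp: continuous_on_eq_continuous_at differentiable_imp_continuous_within)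
next
  case (Suc k)
  then show ?case by (meson Ck.simps(2))
qed

lemma Ck_add:
  assumes "Ck k f" "Ck k g"
  shows "Ck k (\<lambda>x. f x + g x)"
  using assms
proof (induction k arbitrary: f g)
  case 0 then show ?case by (auto intro: continuous_intros)
next
  case (Suc k)
  have "frechet_derivative (\<lambda>x. f x + g x) (at x)
      = (\<lambda>b. frechet_derivative f (at x) b + frechet_derivative g (at x) b)" for x
    by (rule frechet_derivative_at[symmetric], rule has_derivative_add)
       (use Suc.prems in \<open>auto simp: frechet_derivative_works[symmetric]\<close>)
  with Suc show ?case by auto
qed

lemma Ck_mult:
  assumes "Ck k f" "Ck k g"
  shows "Ck k (\<lambda>x. f x * g x)"
  using assms
proof (induction k arbitrary: f g)
  case 0 then show ?case by (auto intro: continuous_intros)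
next
  case (Suc k)
  have *: "frechet_derivative (\<lambda>x. f x * g x) (at x)
      = (\<lambda>b. f x * frechet_derivative g (at x) b + frechet_derivative f (at x) b * g x)" for x
    by (rule frechet_derivative_at[symmetric], rule has_derivative_mult)
       (use Suc.prems in \<open>auto simp: frechet_derivative_works[symmetric]\<close>)
  have "Ck k f" "Ck k g" using Suc.prems Ck_Suc_imp by blast+
  moreover have "(\<lambda>x. f x * g x) differentiable at x" for x
    using Suc.prems by auto
  ultimately show ?case
    using Suc by (auto simp: * intro!: Ck_add)
qed

lemma Ck_prod: "(\<And>i. i \<in> I \<Longrightarrow> Ck k (f i)) \<Longrightarrow> Ck k (\<lambda>x. \<Prod>i\<in>I. f i x)"
  by (induction I rule: infinite_finite_induct) (auto intro: Ck_mult)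

lemma Ck_translate: "Ck k f \<Longrightarrow> Ck k (\<lambda>x. f (x - h))"
proof (induction k arbitrary: f)
  case 0
  then have "continuous_on UNIV f" by simp
  then show ?case
    using continuous_on_compose2[of UNIV f UNIV "\<lambda>x. x - h"] by (simp add: continuous_on_op_minus continuous_on_diff)
next
  case (Suc k)
  have d: "((\<lambda>x. f (x - h)) has_derivative frechet_derivative f (at (x - h))) (at x)" for x
  proof -
    have "((\<lambda>x. x - h) has_derivative (\<lambda>x. x)) (at x)" by (auto intro!: derivative_eq_intros)
    moreover have "(f has_derivative frechet_derivative f (at (x - h))) (at (x - h))"
      using Suc.prems by (auto simp: frechet_derivative_works[symmetric])
    ultimately show ?thesis using has_derivative_compose by fastforce
  qed
  then have "frechet_derivative (\<lambda>x. f (x - h)) (at x) = frechet_derivative f (at (x - h))" for x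
    by (metis frechet_derivative_at)
  moreover have "(\<lambda>x. f (x - h)) differentiable at x" for x
    using d by (auto simp: differentiable_def)
  moreover have "Ck k (\<lambda>x. frechet_derivative f (at (x - h)) b)" if "b \<in> Basis" for b
    using Suc.IH[of "\<lambda>x. frechet_derivative f (at x) b"] Suc.prems that by simp
  ultimately show ?case by simp
qed

section \<open>Smooth bump functions on boxes\<close>

definition flat_exp :: "nat \<Rightarrow> real \<Rightarrow> real" where
  "flat_exp m y = (if y > 0 then (1 / y) ^ m * exp (- (1 / y)) else 0)"

lemma flat_exp_tendsto_0: "(flat_exp m \<longlongrightarrow> 0) (at 0)"
proof -
  \<comment> \<open>With z = 1/y this is the decay of z^m / exp z at infinity.\<close>
  have "((\<lambda>y. (1 / y) ^ m / exp (1 / y)) \<longlongrightarrow> (0::real)) (at_right 0)"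
    by (rule filterlim_compose[OF tendsto_power_div_exp_0])
       (simp add: filterlim_inverse_at_top_right flip: inverse_eq_divide)
  then have "(flat_exp m \<longlongrightarrow> 0) (at_right 0)"
    by (rule Lim_transform_eventually)
       (auto simp: flat_exp_def eventually_at_right_less exp_minus field_simps
         intro!: eventually_at_rightI[of 0 1])
  moreover have "(flat_exp m \<longlongrightarrow> 0) (at_left 0)"
    by (rule tendsto_eventually) (auto simp: flat_exp_def intro!: eventually_at_leftI[of "-1" 0])
  ultimately show ?thesis by (simp add: filterlim_split_at_real)
qed

text \<open>The functions y^(-m) exp(-1/y), extended by zero to y <= 0, form a family that is closed
  under differentiation up to linear combinations. Smoothness of every member then follows by one
  induction on the order, with m arbitrary.\<close>

lemma flat_exp_deriv:
  "(flat_exp m has_real_derivative (flat_exp (m + 2) y - m * flat_exp (m + 1) y)) (at y)"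
proof -
  consider "y > 0" | "y < 0" | "y = 0" by linarith
  then show ?thesis
  proof cases
    case pos: 1
    have "((\<lambda>z. z ^ m * exp (- z)) has_real_derivative
        (m * z ^ (m - 1) * exp (- z) - z ^ m * exp (- z))) (at z)" for z :: real
      by (auto intro!: derivative_eq_intros)
    moreover have "((\<lambda>y. 1 / y) has_real_derivative - ((1 / y)\<^sup>2)) (at y)"
      using pos by (auto intro!: derivative_eq_intros simp: power2_eq_square)
    ultimately have D: "((\<lambda>y. (1 / y) ^ m * exp (- (1 / y))) has_real_derivative
        (m * (1 / y) ^ (m - 1) * exp (- (1 / y)) - (1 / y) ^ m * exp (- (1 / y))) * - ((1 / y)\<^sup>2)) (at y)"
      by (rule DERIV_chain2)
    \<comment> \<open>The truncated exponent \<open>m - 1\<close> is harmless, since both sides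
      vanish for m = 0.\<close>
    have 1: "m * (1 / y) ^ (m - 1) * (1 / y)\<^sup>2 = m * (1 / y) ^ (m + 1)"
      by (cases m) (auto simp: power2_eq_square)
    have "(M * e - w * e) * - q = w * q * e - (M * q) * e" for M e w q :: real
      by (simp add: algebra_simps)
    from D[unfolded this 1] have "((\<lambda>y. (1 / y) ^ m * exp (- (1 / y))) has_real_derivative
        ((1 / y) ^ m * (1 / y)\<^sup>2 * exp (- (1 / y)) - m * (1 / y) ^ (m + 1) * exp (- (1 / y)))) (at y)" .
    then have "((\<lambda>y. (1 / y) ^ m * exp (- (1 / y))) has_real_derivative
        (flat_exp (m + 2) y - m * flat_exp (m + 1) y)) (at y)"
      using pos by (simp add: flat_exp_def power2_eq_square mult.assoc)
    then show ?thesis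
      by (rule has_field_derivative_transform_within_open[of _ _ _ "{0<..}"])
         (use pos in \<open>auto simp: flat_exp_def\<close>)
  next
    case 2
    have "((\<lambda>y. 0) has_real_derivative (flat_exp (m + 2) y - m * flat_exp (m + 1) y)) (at y)"
      using 2 by (simp add: flat_exp_def)
    then show ?thesis
      by (rule has_field_derivative_transform_within_open[of _ _ _ "{..<0}"])
         (use 2 in \<open>auto simp: flat_exp_def\<close>)
  next
    case 3
    \<comment> \<open>The difference quotient at 0 is \<open>flat_exp (Suc m)\<close> away from the
      origin.\<close>
    have "((\<lambda>h. flat_exp m h / h) \<longlongrightarrow> 0) (at 0)"
      by (rule Lim_transform_eventually[OF flat_exp_tendsto_0[of "Suc m"]])
         (auto simp: flat_exp_def eventually_at_filter)
    then show ?thesis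
      using 3 by (simp add: DERIV_def flat_exp_def)
  qed
qed

lemma Ck_flat_exp: "Ck k (\<lambda>x. flat_exp m (\<alpha> \<bullet> x + \<beta>))"
proof (induction k arbitrary: m)
  case 0
  have "continuous_on UNIV (flat_exp m)"
    by (meson flat_exp_deriv DERIV_isCont continuous_at_imp_continuous_on)
  then show ?case
    by (auto intro!: continuous_on_compose2[of UNIV "flat_exp m"] continuous_intros)
next
  case (Suc k)
  have d: "((\<lambda>x. flat_exp m (\<alpha> \<bullet> x + \<beta>)) has_derivative
     (\<lambda>h. (flat_exp (m + 2) (\<alpha> \<bullet> x + \<beta>) + (- real m) * flat_exp (m + 1) (\<alpha> \<bullet> x + \<beta>)) * (\<alpha> \<bullet> h))) (at x)" for x
    using has_derivative_compose[of "\<lambda>x. \<alpha> \<bullet> x + \<beta>" "\<lambda>h. \<alpha> \<bullet> h" x UNIV "flat_exp m"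
        "\<lambda>h. (flat_exp (m + 2) (\<alpha> \<bullet> x + \<beta>) - m * flat_exp (m + 1) (\<alpha> \<bullet> x + \<beta>)) * h"]
      flat_exp_deriv[of m "\<alpha> \<bullet> x + \<beta>"]
    by (simp add: has_field_derivative_def has_derivative_inner_right has_derivative_add_const)
  have "frechet_derivative (\<lambda>x. flat_exp m (\<alpha> \<bullet> x + \<beta>)) (at x) =
     (\<lambda>h. (flat_exp (m + 2) (\<alpha> \<bullet> x + \<beta>) + (- real m) * flat_exp (m + 1) (\<alpha> \<bullet> x + \<beta>)) * (\<alpha> \<bullet> h))" for x
    using frechet_derivative_at[OF d[of x]] by simp
  moreover have "Ck k (\<lambda>x. (flat_exp (m + 2) (\<alpha> \<bullet> x + \<beta>) + (- real m) * flat_exp (m + 1) (\<alpha> \<bullet> x + \<beta>)) * (\<alpha> \<bullet> b))" for b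
    by (intro Ck_mult Ck_add Ck_const Suc.IH)
  moreover have "(\<lambda>x. flat_exp m (\<alpha> \<bullet> x + \<beta>)) differentiable at x" for x
    using d by (auto simp: differentiable_def)
  ultimately show ?case by simp
qed

text \<open>The set where the bump is nonzero does not depend on n. The factor \<open>Suc n\<close>
  turns each one-dimensional factor into exp(-1/((n+1) s)), with s > 0 inside the box; this tends to
  1, so the bumps converge boundedly to the indicator of the open box.\<close>

definition box_bump :: "nat \<Rightarrow> 'a::euclidean_space \<Rightarrow> 'a \<Rightarrow> 'a \<Rightarrow> real" where
  "box_bump n a c x = (\<Prod>b\<in>Basis. flat_exp 0 (real (Suc n) * (x \<bullet> b - a \<bullet> b)) *
                                   flat_exp 0 (real (Suc n) * (c \<bullet> b - x \<bullet> b)))"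

lemma box_bump_nonzero_iff: "box_bump n a c x \<noteq> 0 \<longleftrightarrow> x \<in> box a c"
proof -
  have "real (Suc n) * s > 0 \<longleftrightarrow> s > 0" for s by (simp add: zero_less_mult_iff)
  then show ?thesis
    by (simp add: box_bump_def flat_exp_def mem_box del: of_nat_Suc) blast
qed

lemma box_bump_bounds: "0 \<le> box_bump n a c x" "box_bump n a c x \<le> 1"
  by (auto simp: box_bump_def flat_exp_def intro!: prod_nonneg prod_le_1 mult_le_one)

lemma box_bump_test:
  assumes "cbox a c \<subseteq> S"
  shows "box_bump n a c \<in> test_functions S"
proof -
  have "flat_exp 0 (real (Suc n) * (x \<bullet> b - a \<bullet> b)) * flat_exp 0 (real (Suc n) * (c \<bullet> b - x \<bullet> b)) =
      flat_exp 0 ((real (Suc n) *\<^sub>R b) \<bullet> x + (- real (Suc n) * (a \<bullet> b))) *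
      flat_exp 0 ((- real (Suc n) *\<^sub>R b) \<bullet> x + real (Suc n) * (c \<bullet> b))" for b x
    by (simp add: algebra_simps inner_commute)
  then have "Ck k (box_bump n a c)" for k
    unfolding box_bump_def by (simp only:) (intro Ck_prod Ck_mult Ck_flat_exp)
  moreover have "closure {x. box_bump n a c x \<noteq> 0} \<subseteq> cbox a c"
    by (rule closure_minimal) (use box_subset_cbox in \<open>auto simp: box_bump_nonzero_iff\<close>)
  ultimately show ?thesis
    using assms unfolding test_functions_def
    by (auto intro!: bounded_subset[OF bounded_cbox[of a c]] dest: subsetD[OF closure_subset]
       simp: box_bump_nonzero_iff subsetD[OF box_subset_cbox])
qed

lemma box_bump_tendsto: "(\<lambda>n. box_bump n a c x) \<longlonglongrightarrow> indicator (box a c) x"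
proof (cases "x \<in> box a c")
  case True
  have *: "(\<lambda>n. flat_exp 0 (real (Suc n) * s)) \<longlonglongrightarrow> 1" if "s > 0" for s
  proof -
    have "(\<lambda>n. exp (- (1 / s * inverse (real (Suc n))))) \<longlonglongrightarrow> exp (- (1 / s * 0))"
      by (intro tendsto_intros LIMSEQ_inverse_real_of_nat)
    then show ?thesis using that by (simp add: flat_exp_def field_simps del: of_nat_Suc)
  qed
  have "(\<lambda>n. box_bump n a c x) \<longlonglongrightarrow> (\<Prod>b\<in>(Basis::'a set). 1 * 1)"
    unfolding box_bump_def using True
    by (intro tendsto_prod tendsto_mult *) (auto simp: mem_box)
  then show ?thesis using True by simp
next
  case False
  then have "box_bump n a c x = 0" for n using box_bump_nonzero_iff by blast
  then show ?thesis using False by simp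
qed

section \<open>Gradient vectors of test functions\<close>

definition grad :: "('a::euclidean_space \<Rightarrow> real) \<Rightarrow> 'a \<Rightarrow> 'a" where
  "grad \<phi> x = (\<Sum>b\<in>Basis. frechet_derivative \<phi> (at x) b *\<^sub>R b)"

lemma grad_inner_Basis: "b \<in> Basis \<Longrightarrow> grad \<phi> x \<bullet> b = frechet_derivative \<phi> (at x) b"
  by (simp add: grad_def)

lemma grad_has_derivative:
  assumes "\<phi> differentiable (at x)"
  shows "(\<phi> has_derivative (\<lambda>h. grad \<phi> x \<bullet> h)) (at x)"
proof -
  have "linear (frechet_derivative \<phi> (at x))"
    using assms by (simp add: linear_frechet_derivative)
  then have "frechet_derivative \<phi> (at x) h = grad \<phi> x \<bullet> h" for h
    using Linear_Algebra.linear_componentwise[of "frechet_derivative \<phi> (at x)" h 1]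
    by (simp add: grad_def inner_sum_left inner_sum_right mult.commute inner_commute)
  moreover have "(\<phi> has_derivative frechet_derivative \<phi> (at x)) (at x)"
    using assms frechet_derivative_works by blast
  ultimately show ?thesis by presburger
qed

lemma grad_unique:
  assumes "(\<phi> has_derivative (\<lambda>h. g \<bullet> h)) (at x)"
  shows "grad \<phi> x = g"
  using frechet_derivative_at[OF assms]
  by (auto intro!: euclidean_eqI[of "grad \<phi> x"] simp: grad_inner_Basis)

lemma
  fixes \<phi> :: "'a::euclidean_space \<Rightarrow> real"
  assumes "\<phi> \<in> test_functions S"
  shows test_differentiable: "\<phi> differentiable (at x)"
    and test_continuous: "continuous_on UNIV \<phi>"
    and test_grad_continuous: "continuous_on UNIV (grad \<phi>)"
    and test_zero_outside: "x \<notin> S \<Longrightarrow> \<phi> x = 0"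
    and test_grad_zero_outside: "x \<notin> S \<Longrightarrow> grad \<phi> x = 0"
    and test_bounded: "\<exists>B. \<forall>x. \<bar>\<phi> x\<bar> \<le> B"
    and test_grad_bounded: "\<exists>B. \<forall>x. norm (grad \<phi> x) \<le> B"
proof -
  let ?S = "closure {x. \<phi> x \<noteq> 0}"
  have C: "Ck k \<phi>" for k using assms by (auto simp: test_functions_def)
  have K: "compact ?S" "?S \<subseteq> S" using assms unfolding test_functions_def by blast+
  show "\<phi> differentiable (at x)" using C[of 1] by simp
  show c1: "continuous_on UNIV \<phi>" using C[of 0] by simp
  show c2: "continuous_on UNIV (grad \<phi>)"
    unfolding grad_def using C[of 1] by (auto intro!: continuous_intros)
  show "x \<notin> S \<Longrightarrow> \<phi> x = 0" using K(2) closure_subset[of "{x. \<phi> x \<noteq> 0}"] by auto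
  have 0: "\<phi> x = 0" if "x \<notin> ?S" for x using that closure_subset[of "{x. \<phi> x \<noteq> 0}"] by auto
  \<comment> \<open>Off the closed support the function vanishes on a whole neighbourhood, and hence
    so does its derivative.\<close>
  have 1: "grad \<phi> x = 0" if "x \<notin> ?S" for x
  proof (rule grad_unique)
    have "((\<lambda>x. 0) has_derivative (\<bullet>) (0::'a)) (at x)"
      using has_derivative_const[of "0::real"] by (simp add: inner_zero_left[abs_def])
    then show "(\<phi> has_derivative (\<bullet>) 0) (at x)"
    proof (rule has_derivative_transform_within_open)
      show "open (- ?S)" "x \<in> - ?S" using that by (auto simp only: open_Compl closed_closure ComplI)
      show "0 = \<phi> z" if "z \<in> - ?S" for z using 0[OF ComplD[OF that]] by (rule sym)
    qed
  qed
  then show "x \<notin> S \<Longrightarrow> grad \<phi> x = 0" using K(2) by blast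
  have "\<exists>B. \<forall>x. norm (f x) \<le> B" if "continuous_on UNIV f" "\<And>x. x \<notin> ?S \<Longrightarrow> f x = 0"
    for f :: "'a \<Rightarrow> 'b::real_normed_vector"
  proof -
    have "compact (f ` ?S)" using that(1) K(1)
      by (meson compact_continuous_image continuous_on_subset subset_UNIV)
    then obtain B where "\<forall>x\<in>?S. norm (f x) \<le> B" by (metis bounded_iff compact_imp_bounded image_eqI)
    then have "norm (f x) \<le> max B 0" for x using that(2)[of x] by (cases "x \<in> ?S") fastforce+
    then show ?thesis by blast
  qed
  from this[OF c1 0] this[OF c2 1]
  show "\<exists>B. \<forall>x. \<bar>\<phi> x\<bar> \<le> B" "\<exists>B. \<forall>x. norm (grad \<phi> x) \<le> B" by auto
qed

lemma lipschitz_of_grad_bound: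
  fixes \<phi> :: "'a::euclidean_space \<Rightarrow> real"
  assumes "\<And>x. (\<phi> has_derivative (\<lambda>h. g x \<bullet> h)) (at x)" "\<And>x. norm (g x) \<le> B"
  shows "\<bar>\<phi> x - \<phi> y\<bar> \<le> B * norm (x - y)"
proof -
  have "onorm (\<lambda>h. g x \<bullet> h) \<le> B" for x
  proof (rule onorm_bound)
    show "0 \<le> B" using assms(2)[of x] norm_ge_zero order_trans by blast
    show "norm (g x \<bullet> h) \<le> B * norm h" for h
      using Cauchy_Schwarz_ineq2[of "g x" h] mult_right_mono[OF assms(2)[of x] norm_ge_zero[of h]] by simp
  qed
  then show ?thesis
    using differentiable_bound[of UNIV \<phi> "\<lambda>x h. g x \<bullet> h" B y x] assms(1)
    by (simp add: abs_minus_commute norm_minus_commute)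
qed

lemma test_lipschitz:
  assumes "\<phi> \<in> test_functions S"
  obtains B where "\<And>x y. \<bar>\<phi> x - \<phi> y\<bar> \<le> B * norm (x - y)"
proof -
  obtain B where "\<And>x. norm (grad \<phi> x) \<le> B" using test_grad_bounded[OF assms] by blast
  then show ?thesis
    using that lipschitz_of_grad_bound grad_has_derivative test_differentiable assms by meson
qed

lemma test_functions_mono: "S \<subseteq> S' \<Longrightarrow> test_functions S \<subseteq> test_functions S'"
  by (auto simp: test_functions_def)

lemma test_functions_translate:
  assumes "\<phi> \<in> test_functions S" "(+) h ` S \<subseteq> S'"
  shows "(\<lambda>x. \<phi> (x - h)) \<in> test_functions S'"
proof -
  have "{x. \<phi> (x - h) \<noteq> 0} = (+) h ` {x. \<phi> x \<noteq> 0}"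
    by (force simp: image_iff)
  then have "closure {x. \<phi> (x - h) \<noteq> 0} = (+) h ` closure {x. \<phi> x \<noteq> 0}"
    by (simp add: closure_translation)
  moreover have "compact ((+) h ` closure {x. \<phi> x \<noteq> 0})" "(+) h ` closure {x. \<phi> x \<noteq> 0} \<subseteq> S'"
    using assms by (auto simp: test_functions_def intro!: compact_translation simp del: compact_closure)
  ultimately show ?thesis
    using assms(1) unfolding test_functions_def by (simp add: Ck_translate del: compact_closure)
qed

lemma grad_translate:
  assumes "\<phi> differentiable (at (x - h))"
  shows "grad (\<lambda>x. \<phi> (x - h)) x = grad \<phi> (x - h)"
proof (rule grad_unique)
  have "((\<lambda>x. x - h) has_derivative (\<lambda>x. x)) (at x)" by (auto intro!: derivative_eq_intros)
  from has_derivative_compose[OF this grad_has_derivative[OF assms]]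
  show "((\<lambda>x. \<phi> (x - h)) has_derivative (\<bullet>) (grad \<phi> (x - h))) (at x)" .
qed

section \<open>Square-integrable functions and weak gradients\<close>

text \<open>Completeness of Lebesgue measure: preimages that differ by a null set are measurable
  together. Exchanging representatives of almost-everywhere classes rests on this.\<close>

lemma borel_measurable_lebesgue_on_cong_AE:
  fixes f g :: "'a::euclidean_space \<Rightarrow> 'b::euclidean_space"
  assumes f: "f \<in> borel_measurable (lebesgue_on S)" and S: "S \<in> sets lebesgue"
    and ae: "AE x in lebesgue_on S. f x = g x"
  shows "g \<in> borel_measurable (lebesgue_on S)"
proof -
  let ?f = "\<lambda>x. if x \<in> S then f x else 0" and ?g = "\<lambda>x. if x \<in> S then g x else 0"
  have f': "?f \<in> borel_measurable lebesgue" using f S by (simp add: borel_measurable_if)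
  have ae': "AE x in lebesgue. ?f x = ?g x"
    using ae S by (simp add: AE_restrict_space_iff)
  have "?g \<in> borel_measurable lebesgue"
  proof (rule measurableI)
    fix A :: "'b set" assume "A \<in> sets borel"
    then have "?f -` A \<inter> space lebesgue \<in> sets lebesgue" using f' measurable_sets by blast
    moreover have "AE x in lebesgue. x \<in> ?f -` A \<inter> space lebesgue \<longleftrightarrow> x \<in> ?g -` A \<inter> space lebesgue"
      using ae' by (auto elim: eventually_mono)
    moreover have "complete_measure (lebesgue :: 'a measure)" by unfold_locales
    ultimately show "?g -` A \<inter> space lebesgue \<in> sets lebesgue"
      using complete_measure.in_sets_AE[of lebesgue "?f -` A \<inter> space lebesgue" "?g -` A \<inter> space lebesgue"]
      by (metis (no_types, lifting) inf_le2)
  qed simp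
  then show ?thesis using S by (simp add: borel_measurable_if)
qed

lemma integral_lebesgue_on:
  fixes f :: "'a::euclidean_space \<Rightarrow> 'b::{banach, second_countable_topology}"
  shows "S \<in> sets lebesgue \<Longrightarrow>
    integral\<^sup>L (lebesgue_on S) f = integral\<^sup>L lebesgue (\<lambda>x. indicator S x *\<^sub>R f x)"
  using Bochner_Integration.integral_restrict_space[of S lebesgue f] by simp

lemma integrable_lebesgue_on:
  fixes f :: "'a::euclidean_space \<Rightarrow> 'b::{banach, second_countable_topology}"
  shows "S \<in> sets lebesgue \<Longrightarrow>
    integrable (lebesgue_on S) f \<longleftrightarrow> integrable lebesgue (\<lambda>x. indicator S x *\<^sub>R f x)"
  using Bochner_Integration.integrable_restrict_space[of S lebesgue f] by simp

lemma AE_lebesgue_on: "S \<in> sets lebesgue \<Longrightarrow>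
    (AE x in lebesgue_on S. P x) \<longleftrightarrow> (AE x in lebesgue. x \<in> S \<longrightarrow> P x)"
  by (simp add: AE_restrict_space_iff)

lemma integrable_bounded_lebesgue_on:
  fixes f :: "'a::euclidean_space \<Rightarrow> 'b::euclidean_space"
  assumes "S \<in> lmeasurable" "f \<in> borel_measurable (lebesgue_on S)" "\<And>x. x \<in> S \<Longrightarrow> norm (f x) \<le> B"
  shows "integrable (lebesgue_on S) f"
  using finite_measure.integrable_const_bound[OF finite_measure_lebesgue_on[OF assms(1)], of f B]
    assms(2,3) AE_I2[of "lebesgue_on S" "\<lambda>x. norm (f x) \<le> B"] by simp

section \<open>The space of square-integrable functions\<close>

lemma L2_measurable: "v \<in> L2_space S \<Longrightarrow> v \<in> borel_measurable (lebesgue_on S)"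
  by (simp add: L2_space_def)

lemma L2_integrable_inner:
  assumes "v \<in> L2_space S" "w \<in> L2_space S"
  shows "integrable (lebesgue_on S) (\<lambda>x. v x \<bullet> w x)"
proof (rule Bochner_Integration.integrable_bound)
  show "integrable (lebesgue_on S) (\<lambda>x. (norm (v x))\<^sup>2 + (norm (w x))\<^sup>2)"
    using assms by (simp add: L2_space_def)
  show "(\<lambda>x. v x \<bullet> w x) \<in> borel_measurable (lebesgue_on S)"
    using assms L2_measurable by (intro borel_measurable_inner) auto
  have "\<bar>a \<bullet> b\<bar> \<le> (norm a)\<^sup>2 + (norm b)\<^sup>2" for a b :: 'b
    using Cauchy_Schwarz_ineq2[of a b] sum_squares_bound[of "norm a" "norm b"]
      mult_nonneg_nonneg[OF norm_ge_zero[of a] norm_ge_zero[of b]] by linarith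
  then show "AE x in lebesgue_on S. norm (v x \<bullet> w x) \<le> norm ((norm (v x))\<^sup>2 + (norm (w x))\<^sup>2)"
    by simp
qed

lemma L2_integrable_mult:
  fixes v w :: "'a::euclidean_space \<Rightarrow> real"
  shows "v \<in> L2_space S \<Longrightarrow> w \<in> L2_space S \<Longrightarrow> integrable (lebesgue_on S) (\<lambda>x. v x * w x)"
  using L2_integrable_inner[of v S w] by simp

lemma L2_zero [simp]: "(\<lambda>x. 0) \<in> L2_space S"
  by (simp add: L2_space_def)

lemma L2_scaleR: "v \<in> L2_space S \<Longrightarrow> (\<lambda>x. c *\<^sub>R v x) \<in> L2_space S"
  by (auto simp: L2_space_def power_mult_distrib)

lemma L2_add:
  assumes "v \<in> L2_space S" "w \<in> L2_space S"
  shows "(\<lambda>x. v x + w x) \<in> L2_space S"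
proof -
  have "(\<lambda>x. (norm (v x + w x))\<^sup>2) = (\<lambda>x. (norm (v x))\<^sup>2 + (norm (w x))\<^sup>2 + 2 * (v x \<bullet> w x))"
    by (simp add: power2_norm_eq_inner inner_add inner_commute algebra_simps)
  then show ?thesis
    using assms L2_integrable_inner[OF assms] by (simp add: L2_space_def borel_measurable_add)
qed

lemma L2_diff:
  assumes "v \<in> L2_space S" "w \<in> L2_space S"
  shows "(\<lambda>x. v x - w x) \<in> L2_space S"
  using L2_add[OF assms(1) L2_scaleR[OF assms(2), of "-1"]] by simp

lemma L2_sum: "(\<And>i. i \<in> I \<Longrightarrow> v i \<in> L2_space S) \<Longrightarrow> (\<lambda>x. \<Sum>i\<in>I. v i x) \<in> L2_space S"
  by (induction I rule: infinite_finite_induct) (auto intro: L2_add)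

lemma L2_cong_AE:
  assumes "v \<in> L2_space S" "S \<in> sets lebesgue" "AE x in lebesgue_on S. v x = w x"
  shows "w \<in> L2_space S"
proof -
  have w: "w \<in> borel_measurable (lebesgue_on S)"
    using borel_measurable_lebesgue_on_cong_AE assms L2_measurable by blast
  moreover have "integrable (lebesgue_on S) (\<lambda>x. (norm (w x))\<^sup>2)"
  proof (rule integrable_cong_AE_imp)
    show "integrable (lebesgue_on S) (\<lambda>x. (norm (v x))\<^sup>2)" using assms by (simp add: L2_space_def)
    show "AE x in lebesgue_on S. (norm (v x))\<^sup>2 = (norm (w x))\<^sup>2" using assms(3) by auto
  qed (use w in simp)
  ultimately show ?thesis by (simp add: L2_space_def)
qed

lemma L2_bounded:
  fixes f :: "'a::euclidean_space \<Rightarrow> 'b::euclidean_space"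
  assumes "S \<in> lmeasurable" "f \<in> borel_measurable (lebesgue_on S)" "\<And>x. x \<in> S \<Longrightarrow> norm (f x) \<le> B"
  shows "f \<in> L2_space S"
proof -
  have "norm ((norm (f x))\<^sup>2) \<le> B\<^sup>2" if "x \<in> S" for x
    using assms(3)[OF that] by (simp add: power_mono)
  then show ?thesis
    using assms(1,2) by (auto simp: L2_space_def intro!: integrable_bounded_lebesgue_on)
qed

lemma continuous_borel_measurable_lebesgue:
  fixes f :: "'a::euclidean_space \<Rightarrow> 'b::euclidean_space"
  assumes "continuous_on UNIV f"
  shows "f \<in> borel_measurable lebesgue"
  by (rule measurable_completion) (simp add: borel_measurable_continuous_onI assms)

lemma L2_continuous:
  fixes f :: "'a::euclidean_space \<Rightarrow> 'b::euclidean_space"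
  assumes "bounded S" "S \<in> sets lebesgue" "continuous_on UNIV f"
  shows "f \<in> L2_space S"
proof -
  have "compact (closure S)" using assms by simp
  then have "bounded (f ` closure S)"
    using assms(3) by (meson compact_continuous_image compact_imp_bounded continuous_on_subset subset_UNIV)
  then obtain B where "\<And>x. x \<in> closure S \<Longrightarrow> norm (f x) \<le> B" by (auto simp: bounded_iff)
  moreover have "f \<in> borel_measurable lebesgue"
    using assms(3) by (rule continuous_borel_measurable_lebesgue)
  ultimately show ?thesis
    using assms(1,2) closure_subset[of S] bounded_set_imp_lmeasurable
    by (intro L2_bounded[of S f B]) (auto intro: measurable_restrict_space1)
qed

lemma L2_integrable:
  assumes "v \<in> L2_space S" "S \<in> lmeasurable"
  shows "integrable (lebesgue_on S) v"
proof (rule Bochner_Integration.integrable_bound)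
  have "integrable (lebesgue_on S) (\<lambda>x. 1 :: real)"
    using assms(2) by (rule integrable_bounded_lebesgue_on[where B = 1]) auto
  then show "integrable (lebesgue_on S) (\<lambda>x. 1 + (norm (v x))\<^sup>2)"
    using assms by (simp add: L2_space_def)
  have "norm a \<le> 1 + (norm a)\<^sup>2" for a :: 'b
    using sum_squares_bound[of "norm a" 1] norm_ge_zero[of a] by (simp del: norm_ge_zero)
  then show "AE x in lebesgue_on S. norm (v x) \<le> norm (1 + (norm (v x))\<^sup>2)" by simp
qed (use assms L2_measurable in auto)

lemma L2_subset:
  assumes "v \<in> L2_space S" "S' \<subseteq> S" "S \<in> sets lebesgue" "S' \<in> sets lebesgue"
  shows "v \<in> L2_space S'"
proof -
  have v: "v \<in> borel_measurable (lebesgue_on S')"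
    using measurable_restrict_mono assms L2_measurable by blast
  have "integrable (lebesgue_on S') (\<lambda>x. (norm (v x))\<^sup>2)"
    unfolding integrable_lebesgue_on[OF assms(4)]
  proof (rule Bochner_Integration.integrable_bound)
    show "integrable lebesgue (\<lambda>x. indicator S x *\<^sub>R (norm (v x))\<^sup>2)"
      using assms by (simp add: L2_space_def integrable_lebesgue_on)
    have "(\<lambda>x. (norm (v x))\<^sup>2) \<in> borel_measurable (lebesgue_on S')" using v by simp
    then show "(\<lambda>x. indicator S' x *\<^sub>R (norm (v x))\<^sup>2) \<in> borel_measurable lebesgue"
      using assms(4) borel_measurable_restrict_space_iff[of S' lebesgue "\<lambda>x. (norm (v x))\<^sup>2"]
      by (simp add: mult.commute)
  qed (use assms(2) in \<open>auto simp: indicator_def\<close>)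
  with v show ?thesis by (simp add: L2_space_def)
qed

section \<open>Inner product, norm and the Cauchy--Schwarz inequality\<close>

lemma l2_norm_sq: "(l2_norm S v)\<^sup>2 = l2_inner S v v"
  by (simp add: l2_norm_def l2_inner_def power2_norm_eq_inner)

lemma l2_norm_nonneg [simp]: "0 \<le> l2_norm S v"
  by (simp add: l2_norm_def)

lemma l2_inner_commute: "l2_inner S v w = l2_inner S w v"
  by (simp add: l2_inner_def inner_commute)

lemma l2_inner_add_left:
  "u \<in> L2_space S \<Longrightarrow> v \<in> L2_space S \<Longrightarrow> w \<in> L2_space S \<Longrightarrow>
    l2_inner S (\<lambda>x. u x + v x) w = l2_inner S u w + l2_inner S v w"
  by (simp add: l2_inner_def inner_add_left L2_integrable_inner)

lemma l2_inner_diff_left: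
  "u \<in> L2_space S \<Longrightarrow> v \<in> L2_space S \<Longrightarrow> w \<in> L2_space S \<Longrightarrow>
    l2_inner S (\<lambda>x. u x - v x) w = l2_inner S u w - l2_inner S v w"
  by (simp add: l2_inner_def inner_diff_left L2_integrable_inner)

lemma l2_inner_scaleR_left: "l2_inner S (\<lambda>x. c *\<^sub>R v x) w = c * l2_inner S v w"
  by (simp add: l2_inner_def)

lemma l2_inner_add_right:
  "u \<in> L2_space S \<Longrightarrow> v \<in> L2_space S \<Longrightarrow> w \<in> L2_space S \<Longrightarrow>
    l2_inner S w (\<lambda>x. u x + v x) = l2_inner S w u + l2_inner S w v"
  by (simp add: l2_inner_add_left l2_inner_commute[of S w])

lemma l2_inner_diff_right:
  "u \<in> L2_space S \<Longrightarrow> v \<in> L2_space S \<Longrightarrow> w \<in> L2_space S \<Longrightarrow>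
    l2_inner S w (\<lambda>x. u x - v x) = l2_inner S w u - l2_inner S w v"
  by (simp add: l2_inner_diff_left l2_inner_commute[of S w])

lemma l2_inner_cong_AE:
  assumes "AE x in lebesgue_on S. v x = v' x" "AE x in lebesgue_on S. w x = w' x"
    "v \<in> L2_space S" "w \<in> L2_space S" "S \<in> sets lebesgue"
  shows "l2_inner S v w = l2_inner S v' w'"
proof -
  have "v' \<in> L2_space S" "w' \<in> L2_space S" using L2_cong_AE assms by blast+
  then have "(\<lambda>x. v' x \<bullet> w' x) \<in> borel_measurable (lebesgue_on S)"
    using L2_integrable_inner by blast
  moreover have "(\<lambda>x. v x \<bullet> w x) \<in> borel_measurable (lebesgue_on S)"
    using assms L2_integrable_inner by blast
  moreover have "AE x in lebesgue_on S. v x \<bullet> w x = v' x \<bullet> w' x"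
    using assms(1,2) by eventually_elim simp
  ultimately show ?thesis unfolding l2_inner_def by (intro integral_cong_AE)
qed

lemma l2_norm_cong_AE:
  assumes "AE x in lebesgue_on S. v x = v' x" "v \<in> L2_space S" "S \<in> sets lebesgue"
  shows "l2_norm S v = l2_norm S v'"
  using l2_inner_cong_AE[OF assms(1,1,2,2,3)] l2_norm_sq[of S v] l2_norm_sq[of S v']
  by (metis l2_norm_nonneg power2_eq_imp_eq)

text \<open>The discriminant criterion behind both Cauchy--Schwarz inequalities of the development.
  A negative leading coefficient is excluded by the nonnegativity itself.\<close>

lemma quadratic_nonneg_imp:
  fixes a b c :: real
  assumes "\<And>t. 0 \<le> a + 2 * t * b + t\<^sup>2 * c"
  shows "b\<^sup>2 \<le> a * c"
proof (cases "c = 0")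
  case True
  have "b = 0"
  proof (rule ccontr)
    assume "b \<noteq> 0"
    \<comment> \<open>This t is the point where the affine function a + 2 t b takes the value
      -1.\<close>
    then have "a + 2 * (- (a + 1) / (2 * b)) * b = -1" by (simp add: field_simps)
    with assms[of "- (a + 1) / (2 * b)"] True show False by simp
  qed
  with True show ?thesis by simp
next
  case False
  have "c > 0"
  proof (rule ccontr)
    assume "\<not> c > 0"
    with False have c: "c < 0" by simp
    \<comment> \<open>Chosen such that |c| t = |c| + |a| + 2|b|. After multiplication by t >= 1 the
      quadratic term outweighs the two others.\<close>
    define t where "t = 1 + \<bar>a\<bar> / \<bar>c\<bar> + 2 * \<bar>b\<bar> / \<bar>c\<bar>"
    have t1: "1 \<le> t" by (simp add: t_def)
    have "\<bar>c\<bar> * t = \<bar>c\<bar> + \<bar>a\<bar> + 2 * \<bar>b\<bar>" using False by (simp add: t_def field_simps)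
    then have "t\<^sup>2 * \<bar>c\<bar> = t * \<bar>c\<bar> + t * \<bar>a\<bar> + t * (2 * \<bar>b\<bar>)"
      by (simp add: power2_eq_square algebra_simps)
    moreover have "t * \<bar>a\<bar> \<ge> \<bar>a\<bar>" "t * \<bar>c\<bar> > 0" using t1 False
      by (auto simp: mult_le_cancel_right1 abs_ge_zero)
    moreover have "2 * t * b \<le> t * (2 * \<bar>b\<bar>)" using t1 by (simp add: mult_left_mono)
    moreover have "t\<^sup>2 * c = - (t\<^sup>2 * \<bar>c\<bar>)" using c by simp
    ultimately have "a + 2 * t * b + t\<^sup>2 * c < 0" using abs_ge_self[of a] by linarith
    with assms[of t] show False by simp
  qed
  \<comment> \<open>The quadratic is evaluated at its minimum.\<close>
  moreover have "a + 2 * (- b / c) * b + (- b / c)\<^sup>2 * c = a - b\<^sup>2 / c"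
    using False by (simp add: field_simps power2_eq_square)
  ultimately have "b\<^sup>2 / c \<le> a" "c > 0"
    using assms[of "- b / c"] by simp_all
  then show ?thesis by (simp add: pos_divide_le_eq)
qed

lemma l2_norm_add_scaleR_sq:
  assumes "v \<in> L2_space S" "w \<in> L2_space S"
  shows "(l2_norm S (\<lambda>x. v x + t *\<^sub>R w x))\<^sup>2
    = (l2_norm S v)\<^sup>2 + 2 * t * l2_inner S v w + t\<^sup>2 * (l2_norm S w)\<^sup>2"
  unfolding l2_norm_sq using assms
  by (simp add: l2_inner_add_left l2_inner_add_right L2_scaleR L2_add l2_inner_scaleR_left
      l2_inner_commute[of S _ "\<lambda>x. t *\<^sub>R w x"] l2_inner_commute[of S w v] power2_eq_square algebra_simps)

lemma l2_Cauchy_Schwarz: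
  assumes "v \<in> L2_space S" "w \<in> L2_space S"
  shows "\<bar>l2_inner S v w\<bar> \<le> l2_norm S v * l2_norm S w"
proof -
  have "(l2_inner S v w)\<^sup>2 \<le> (l2_norm S v)\<^sup>2 * (l2_norm S w)\<^sup>2"
    by (rule quadratic_nonneg_imp) (metis l2_norm_add_scaleR_sq[OF assms] zero_le_power2)
  then show ?thesis
    using abs_le_square_iff[of "l2_inner S v w" "l2_norm S v * l2_norm S w"]
    by (simp add: power_mult_distrib)
qed

lemma l2_norm_triangle:
  assumes "v \<in> L2_space S" "w \<in> L2_space S"
  shows "l2_norm S (\<lambda>x. v x + w x) \<le> l2_norm S v + l2_norm S w"
proof -
  have "(l2_norm S (\<lambda>x. v x + w x))\<^sup>2 \<le> (l2_norm S v + l2_norm S w)\<^sup>2"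
    using l2_norm_add_scaleR_sq[OF assms, of 1] l2_Cauchy_Schwarz[OF assms]
    by (simp add: power2_sum)
  then show ?thesis by (rule power2_le_imp_le) (simp add: add_nonneg_nonneg)
qed

lemma l2_norm_scaleR: "l2_norm S (\<lambda>x. c *\<^sub>R v x) = \<bar>c\<bar> * l2_norm S v"
  by (simp add: l2_norm_def power_mult_distrib real_sqrt_mult)

lemma l2_norm_mono_AE:
  assumes v: "v \<in> L2_space S" and w: "w \<in> L2_space S" and le: "AE x in lebesgue_on S. norm (v x) \<le> norm (w x)"
  shows "l2_norm S v \<le> l2_norm S w"
proof -
  have "(\<integral>x. (norm (v x))\<^sup>2 \<partial>lebesgue_on S) \<le> (\<integral>x. (norm (w x))\<^sup>2 \<partial>lebesgue_on S)"
    by (rule integral_mono_AE)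
       (use v w in \<open>auto simp: L2_space_def intro: eventually_mono[OF le] power_mono\<close>)
  then show ?thesis by (simp add: l2_norm_def)
qed

lemma l2_norm_AE_zero:
  fixes v :: "'a::euclidean_space \<Rightarrow> 'b::euclidean_space"
  assumes "AE x in lebesgue_on S. v x = 0" "S \<in> sets lebesgue" shows "l2_norm S v = 0"
proof -
  have "l2_norm S (\<lambda>x. 0 :: 'b) = l2_norm S v"
    by (rule l2_norm_cong_AE[OF _ L2_zero assms(2)]) (rule eventually_mono[OF assms(1)], simp)
  then show ?thesis by (simp add: l2_norm_def)
qed

lemma l2_norm_minus: "l2_norm S (\<lambda>x. - v x) = l2_norm S v"
  by (simp add: l2_norm_def)

lemma l2_norm_triangle_diff:
  assumes "v \<in> L2_space S" "w \<in> L2_space S"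
  shows "l2_norm S (\<lambda>x. v x - w x) \<le> l2_norm S v + l2_norm S w"
  using l2_norm_triangle[OF assms(1) L2_scaleR[OF assms(2), of "-1"]] by (simp add: l2_norm_minus)

section \<open>The fundamental lemma and integration by parts\<close>

lemma open_lmeasurable: "open S \<Longrightarrow> bounded S \<Longrightarrow> S \<in> lmeasurable"
  by (simp add: bounded_set_imp_lmeasurable lmeasurable_open)

lemma open_sets_lebesgue: "open S \<Longrightarrow> S \<in> sets lebesgue"
  by (simp add: borel_open)

lemma integrable_mult_bounded:
  fixes w \<phi> :: "'a::euclidean_space \<Rightarrow> real"
  assumes "integrable (lebesgue_on S) w" "continuous_on UNIV \<phi>" "\<And>x. \<bar>\<phi> x\<bar> \<le> B"
  shows "integrable (lebesgue_on S) (\<lambda>x. w x * \<phi> x)"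
proof (rule Bochner_Integration.integrable_bound)
  show "integrable (lebesgue_on S) (\<lambda>x. B * w x)" using assms(1) by simp
  have "\<phi> \<in> borel_measurable lebesgue"
    using assms(2) by (rule continuous_borel_measurable_lebesgue)
  then have "\<phi> \<in> borel_measurable (lebesgue_on S)" by (rule measurable_restrict_space1)
  then show "(\<lambda>x. w x * \<phi> x) \<in> borel_measurable (lebesgue_on S)"
    using assms(1) by (intro borel_measurable_times) auto
  have "\<bar>w x * \<phi> x\<bar> \<le> \<bar>B * w x\<bar>" for x
    using mult_left_mono[OF order_trans[OF assms(3)[of x] abs_ge_self], of "\<bar>w x\<bar>"] by (simp add: abs_mult mult.commute)
  then show "AE x in lebesgue_on S. norm (w x * \<phi> x) \<le> norm (B * w x)" by simp
qed

text \<open>Bumps converging to the indicator of a box show that w has integral zero over every box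
  whose closed version lies in S. Lebesgue differentiation along shrinking cubes turns this into w =
  0 almost everywhere.\<close>

lemma fundamental_lemma:
  fixes w :: "'a::euclidean_space \<Rightarrow> real"
  assumes S: "open S" and w: "integrable (lebesgue_on S) w"
    and 0: "\<And>\<phi>. \<phi> \<in> test_functions S \<Longrightarrow> (\<integral>x. w x * \<phi> x \<partial>lebesgue_on S) = 0"
  shows "AE x in lebesgue_on S. w x = 0"
proof -
  have mS: "S \<in> sets lebesgue" using S by (rule open_sets_lebesgue)
  define f where "f = (\<lambda>x. if x \<in> S then w x else 0)"
  have f: "integrable lebesgue f"
    unfolding f_def using Lebesgue_Measure.integrable_restrict_UNIV[OF mS, of w] w by simp
  have fi: "integrable (lebesgue_on (cbox a c)) f" for a c
    using Bochner_Integration.integrable_mult_indicator[OF _ f] by (subst integrable_lebesgue_on) auto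
  have box0: "integral (cbox a c) f = 0" if sub: "cbox a c \<subseteq> S" for a c
  proof -
    have "(\<lambda>n. \<integral>x. w x * box_bump n a c x \<partial>lebesgue_on S)
        \<longlonglongrightarrow> (\<integral>x. w x * indicator (box a c) x \<partial>lebesgue_on S)"
    proof (rule integral_dominated_convergence[where w = "\<lambda>x. \<bar>w x\<bar>"])
      have "box_bump n a c \<in> test_functions S" for n using box_bump_test[OF sub] .
      then have i: "integrable (lebesgue_on S) (\<lambda>x. w x * box_bump n a c x)" for n
        using box_bump_bounds[of n a c] test_continuous[OF box_bump_test[OF sub]]
        by (intro integrable_mult_bounded[OF w, where B = 1]) auto
      then show "(\<lambda>x. w x * box_bump n a c x) \<in> borel_measurable (lebesgue_on S)" for n by blast
      show "(\<lambda>x. w x * indicator (box a c) x) \<in> borel_measurable (lebesgue_on S)"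
        using w measurable_restrict_space1[OF borel_measurable_indicator[of "box a c" lebesgue], of S]
        by (intro borel_measurable_times) auto
      show "AE x in lebesgue_on S. (\<lambda>n. w x * box_bump n a c x) \<longlonglongrightarrow> w x * indicator (box a c) x"
        by (intro AE_I2 tendsto_mult tendsto_const box_bump_tendsto)
      show "AE x in lebesgue_on S. norm (w x * box_bump n a c x) \<le> \<bar>w x\<bar>" for n
        using box_bump_bounds[of n a c] by (intro AE_I2) (simp add: abs_mult mult_left_le)
    qed (use w in auto)
    moreover have "(\<integral>x. w x * box_bump n a c x \<partial>lebesgue_on S) = 0" for n
      by (rule 0, rule box_bump_test, rule sub)
    ultimately have "(\<integral>x. w x * indicator (box a c) x \<partial>lebesgue_on S) = 0"
      by (simp add: LIMSEQ_const_iff)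
    moreover have "(\<integral>x. w x * indicator (box a c) x \<partial>lebesgue_on S) = (\<integral>x. f x \<partial>lebesgue_on (box a c))"
      unfolding integral_lebesgue_on[OF mS] integral_lebesgue_on[OF open_sets_lebesgue[OF open_box]]
      by (intro Bochner_Integration.integral_cong refl)
         (use sub box_subset_cbox in \<open>auto simp: f_def indicator_def\<close>)
    moreover have "integrable (lebesgue_on (box a c)) f"
      using Bochner_Integration.integrable_mult_indicator[OF _ f] by (subst integrable_lebesgue_on) auto
    then have "(\<integral>x. f x \<partial>lebesgue_on (box a c)) = integral (box a c) f"
      by (simp add: lebesgue_integral_eq_integral)
    ultimately show ?thesis by (simp add: integral_open_interval)
  qed
  have fb: "f integrable_on cbox a c" for a c
    using integrable_on_lebesgue_on[OF fi, of a c] by simp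
  \<comment> \<open>Lebesgue differentiation with cubes that have x as their lower corner.\<close>
  obtain N where N: "negligible N" and lim: "\<And>x e. \<lbrakk>x \<notin> N; 0 < e\<rbrakk> \<Longrightarrow>
      \<exists>d>0. \<forall>h. 0 < h \<and> h < d \<longrightarrow> norm (integral (cbox x (x + h *\<^sub>R One)) f /\<^sub>R h ^ DIM('a) - f x) < e"
    by (rule integrable_ccontinuous_explicit[OF fb], erule that, blast)
  have "f x = 0" if xS: "x \<in> S" and xN: "x \<notin> N" for x
  proof (rule ccontr)
    assume "f x \<noteq> 0"
    with lim[OF xN, of "norm (f x)"] obtain d where d: "d > 0" "\<And>h. 0 < h \<and> h < d \<Longrightarrow>
      norm (integral (cbox x (x + h *\<^sub>R One)) f /\<^sub>R h ^ DIM('a) - f x) < norm (f x)" by auto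
    obtain r where r: "r > 0" "ball x r \<subseteq> S" using S xS by (meson open_contains_ball)
    \<comment> \<open>The first bound makes the mean over the cube close to \<open>f x\<close>. The
      second keeps the cube inside the ball, because its points have l1 distance at most
      \<open>DIM('a) * h\<close> from x.\<close>
    define h where "h = min (d / 2) (r / (2 * DIM('a)))"
    have h: "0 < h" "h < d" "DIM('a) * h < r"
    proof -
      show "0 < h" "h < d" using d r by (auto simp: h_def min_def)
      have "DIM('a) * h \<le> DIM('a) * (r / (2 * DIM('a)))" by (intro mult_left_mono) (auto simp: h_def)
      also have "\<dots> < r" using r by (simp add: field_simps)
      finally show "DIM('a) * h < r" .
    qed
    have "cbox x (x + h *\<^sub>R One) \<subseteq> S"
    proof
      fix y assume y: "y \<in> cbox x (x + h *\<^sub>R One)"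
      have "norm (y - x) \<le> (\<Sum>b\<in>Basis. \<bar>(y - x) \<bullet> b\<bar>)" by (rule norm_le_l1)
      also have "\<dots> \<le> (\<Sum>b\<in>(Basis::'a set). h)"
        using y by (intro sum_mono) (auto simp: mem_box inner_simps abs_le_iff)
      also have "\<dots> < r" using h by simp
      finally show "y \<in> S" using r(2) by (auto simp: dist_norm norm_minus_commute)
    qed
    then have "integral (cbox x (x + h *\<^sub>R One)) f = 0" by (rule box0)
    with d(2)[of h] h show False by simp
  qed
  moreover have "AE x in lebesgue. x \<notin> N"
    using N by (simp add: negligible_iff_null_sets AE_not_in)
  ultimately show ?thesis
    using mS by (simp add: AE_lebesgue_on f_def) (auto elim: eventually_mono)
qed

lemma lborel_integral_translate:
  fixes F :: "'a::euclidean_space \<Rightarrow> 'b::{banach, second_countable_topology}"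
  assumes "F \<in> borel_measurable borel"
  shows "(\<integral>x. F (h + x) \<partial>lborel) = (\<integral>x. F x \<partial>lborel)"
  using assms by (subst (2) lborel_distr_plus[of h, symmetric], subst integral_distr) auto

lemma integrable_indicator_cball: "integrable lborel (indicator (cball x r) :: 'a::euclidean_space \<Rightarrow> real)"
  using emeasure_bounded_finite[OF bounded_cball, of x r] by (simp add: integrable_indicator_iff)

text \<open>By translation invariance every difference quotient of F has integral zero, and
  dominated convergence transfers this to the directional derivative. The bounded support takes care
  of integrability, so that no boundary terms arise.\<close>

lemma integral_directional_derivative_zero:
  fixes F :: "'a::euclidean_space \<Rightarrow> real"
  assumes d: "\<And>x. (F has_derivative (\<lambda>h. H x \<bullet> h)) (at x)"
    and c: "continuous_on UNIV H" and B: "\<And>x. norm (H x) \<le> B"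
    and K: "bounded K" "\<And>x. x \<notin> K \<Longrightarrow> F x = 0"
  shows "(\<integral>x. H x \<bullet> b \<partial>lborel) = 0"
proof -
  have Fc: "continuous_on UNIV F"
    using d by (meson continuous_at_imp_continuous_on has_derivative_continuous)
  have [measurable]: "F \<in> borel_measurable borel" "H \<in> borel_measurable borel"
    using Fc c borel_measurable_continuous_onI by auto
  obtain R where R: "\<And>x. x \<in> K \<Longrightarrow> norm x \<le> R" using K(1) by (auto simp: bounded_iff)
  obtain M where M: "\<And>x. \<bar>F x\<bar> \<le> M"
  proof -
    have "compact (F ` cball 0 R)" 
      by (meson Fc compact_cball compact_continuous_image continuous_on_subset subset_UNIV)
    then obtain M where M: "\<And>x. x \<in> cball 0 R \<Longrightarrow> norm (F x) \<le> M" 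
      using compact_imp_bounded bounded_iff by (metis image_eqI)
    have "\<bar>F x\<bar> \<le> max M 0" for x
      using M[of x] K(2)[of x] R[of x] by (cases "x \<in> K") auto
    then show ?thesis using that by blast
  qed
  have Fi: "integrable lborel F"
  proof (rule Bochner_Integration.integrable_bound)
    show "integrable lborel (\<lambda>x. M * indicator (cball 0 R) x :: real)"
      by (intro integrable_mult_right integrable_indicator_cball)
    show "AE x in lborel. norm (F x) \<le> norm (M * indicator (cball 0 R) x)"
      using M K(2) R by (intro AE_I2) (auto simp: indicator_def intro: order_trans[OF M abs_ge_self])
  qed simp
  have Fti: "integrable lborel (\<lambda>x. F (h + x))" for h
    using Fi by (subst (asm) lborel_distr_plus[of h, symmetric], subst (asm) integrable_distr_eq) auto
  define D where "D = (\<lambda>n x. real (Suc n) * (F (inverse (real (Suc n)) *\<^sub>R b + x) - F x))"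
  have D0: "(\<integral>x. D n x \<partial>lborel) = 0" for n
    unfolding D_def using Fi Fti by (simp add: lborel_integral_translate del: of_nat_Suc)
  \<comment> \<open>The shift is at most \<open>norm b\<close> long, so the quotient vanishes
    outside a slightly enlarged ball; inside it the Lipschitz bound applies.\<close>
  have bound: "\<bar>D n x\<bar> \<le> B * norm b * indicator (cball 0 (R + norm b)) x" for n x
  proof (cases "norm x \<le> R + norm b")
    case True
    have "\<bar>F (inverse (real (Suc n)) *\<^sub>R b + x) - F x\<bar> \<le> B * norm (inverse (real (Suc n)) *\<^sub>R b + x - x)"
      by (rule lipschitz_of_grad_bound[OF d B])
    then have "\<bar>D n x\<bar> \<le> real (Suc n) * (B * (inverse (real (Suc n)) * norm b))"
      unfolding D_def abs_mult abs_of_nat by (intro mult_left_mono) (auto simp del: of_nat_Suc)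
    also have "\<dots> = B * norm b" by (simp add: field_simps del: of_nat_Suc)
    finally show ?thesis using True by simp
  next
    case False
    have "inverse (real (Suc n)) * norm b \<le> 1 * norm b"
      by (intro mult_right_mono) (auto simp: field_simps)
    then have "norm x \<le> norm (inverse (real (Suc n)) *\<^sub>R b + x) + norm b"
      using norm_triangle_ineq4[of "inverse (real (Suc n)) *\<^sub>R b + x" "inverse (real (Suc n)) *\<^sub>R b"] by (simp del: of_nat_Suc)
    with False have "norm (inverse (real (Suc n)) *\<^sub>R b + x) > R" by simp
    then have "F (inverse (real (Suc n)) *\<^sub>R b + x) = 0" using K(2) R leD by blast
    moreover have "F x = 0" using K(2) R[of x] False norm_ge_zero[of b] by fastforce
    moreover have "0 \<le> B" using B[of 0] norm_ge_zero order_trans by blast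
    ultimately show ?thesis by (simp add: D_def)
  qed
  have "(\<lambda>n. \<integral>x. D n x \<partial>lborel) \<longlonglongrightarrow> (\<integral>x. H x \<bullet> b \<partial>lborel)"
  proof (rule integral_dominated_convergence[where w = "\<lambda>x. B * norm b * indicator (cball 0 (R + norm b)) x"])
    show "integrable lborel (\<lambda>x. B * norm b * indicator (cball 0 (R + norm b)) x :: real)"
      by (intro integrable_mult_right integrable_indicator_cball)
    show "D n \<in> borel_measurable lborel" for n
      unfolding D_def by measurable
    show "AE x in lborel. (\<lambda>n. D n x) \<longlonglongrightarrow> H x \<bullet> b"
    proof (rule AE_I2)
      fix x
      have "((\<lambda>s. F (s *\<^sub>R b + x)) has_derivative (\<lambda>s. H x \<bullet> (s *\<^sub>R b))) (at 0)"
        using has_derivative_compose[of "\<lambda>s. s *\<^sub>R b + x" "\<lambda>s. s *\<^sub>R b" 0 UNIV F "\<lambda>h. H x \<bullet> h"] d[of x]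
        by (simp add: has_derivative_add_const has_derivative_scaleR_left)
      then have "((\<lambda>s. F (s *\<^sub>R b + x)) has_real_derivative (H x \<bullet> b)) (at 0)"
        by (simp add: has_field_derivative_def mult.commute[of _ "H x \<bullet> b"] fun_eq_iff has_derivative_def)
           
      then have "((\<lambda>s. (F (s *\<^sub>R b + x) - F x) / s) \<longlongrightarrow> H x \<bullet> b) (at 0)"
        by (simp add: DERIV_def)
      then have "(\<lambda>n. (F (inverse (real (Suc n)) *\<^sub>R b + x) - F x) / inverse (real (Suc n))) \<longlonglongrightarrow> H x \<bullet> b"
        by (rule filterlim_compose)
           (auto simp: filterlim_at simp del: of_nat_Suc intro!: LIMSEQ_inverse_real_of_nat)
      then show "(\<lambda>n. D n x) \<longlonglongrightarrow> H x \<bullet> b"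
        by (simp add: D_def divide_inverse mult.commute del: of_nat_Suc)
    qed
  qed (use bound in auto)
  then show ?thesis by (simp add: D0 LIMSEQ_const_iff)
qed

text \<open>The product of \<phi> with a test function has bounded support and a continuous
  gradient, so its directional derivatives have integral zero; the product rule splits this into the
  two sides of the definition.\<close>

lemma weak_gradient_C1:
  fixes \<phi> :: "'a::euclidean_space \<Rightarrow> real"
  assumes S: "open S" "bounded S"
    and d: "\<And>x. (\<phi> has_derivative (\<lambda>h. g x \<bullet> h)) (at x)" and c: "continuous_on UNIV g"
  shows "has_weak_gradient S \<phi> g"
proof -
  have mS: "S \<in> sets lebesgue" using S(1) by (rule open_sets_lebesgue)
  have c\<phi>: "continuous_on UNIV \<phi>"
    using d by (meson continuous_at_imp_continuous_on has_derivative_continuous)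
  have L: "\<phi> \<in> L2_space S" "g \<in> L2_space S" using L2_continuous S mS c c\<phi> by blast+
  have "(\<integral>x. \<phi> x * frechet_derivative \<psi> (at x) b \<partial>lebesgue_on S) = - (\<integral>x. (g x \<bullet> b) * \<psi> x \<partial>lebesgue_on S)"
    if \<psi>: "\<psi> \<in> test_functions S" and b: "b \<in> Basis" for \<psi> b
  proof -
    let ?H = "\<lambda>x. \<phi> x *\<^sub>R grad \<psi> x + \<psi> x *\<^sub>R g x"
    have dF: "((\<lambda>x. \<phi> x * \<psi> x) has_derivative (\<lambda>h. ?H x \<bullet> h)) (at x)" for x
      using has_derivative_mult[OF d[of x] grad_has_derivative[OF test_differentiable[OF \<psi>]]]
      by (simp add: inner_add_left mult.commute)
    have c1: "continuous_on UNIV ?H"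
      using c c\<phi> test_continuous[OF \<psi>] test_grad_continuous[OF \<psi>] by (intro continuous_intros)
    have z: "?H x = 0" if "x \<notin> S" for x
      using that test_zero_outside[OF \<psi>] test_grad_zero_outside[OF \<psi>] by simp
    obtain B where B: "\<And>x. norm (?H x) \<le> B"
    proof -
      have "compact (?H ` closure S)"
        using S c1 by (meson compact_closure compact_continuous_image continuous_on_subset subset_UNIV)
      then obtain B where B: "\<And>x. x \<in> closure S \<Longrightarrow> norm (?H x) \<le> B"
        using compact_imp_bounded bounded_iff by (metis (no_types, lifting) image_eqI)
      have "norm (?H x) \<le> max B 0" for x
      proof (cases "x \<in> S")
        case True then show ?thesis using B[of x] closure_subset[of S] by fastforce
      next
        case False then show ?thesis using z[of x] by simp
      qed
      then show ?thesis using that by blast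
    qed
    have "(\<integral>x. ?H x \<bullet> b \<partial>lborel) = 0"
      by (rule integral_directional_derivative_zero[OF dF c1 B S(2)])
         (simp add: test_zero_outside[OF \<psi>])
    moreover have "(\<lambda>x. ?H x \<bullet> b) \<in> borel_measurable borel"
      by (intro borel_measurable_continuous_onI continuous_on_inner c1 continuous_on_const)
    ultimately have "(\<integral>x. ?H x \<bullet> b \<partial>lebesgue) = 0" by (simp add: integral_completion)
    moreover have "(\<integral>x. ?H x \<bullet> b \<partial>lebesgue) = (\<integral>x. ?H x \<bullet> b \<partial>lebesgue_on S)"
      unfolding integral_lebesgue_on[OF mS]
      by (rule Bochner_Integration.integral_cong) (use z in \<open>auto simp: indicator_def\<close>)
    moreover have "(\<integral>x. ?H x \<bullet> b \<partial>lebesgue_on S) =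
        (\<integral>x. \<phi> x * frechet_derivative \<psi> (at x) b \<partial>lebesgue_on S) + (\<integral>x. (g x \<bullet> b) * \<psi> x \<partial>lebesgue_on S)"
    proof -
      have 1: "(\<lambda>x. grad \<psi> x \<bullet> b) \<in> L2_space S" "(\<lambda>x. g x \<bullet> b) \<in> L2_space S" "\<psi> \<in> L2_space S"
        using S mS c test_continuous[OF \<psi>] test_grad_continuous[OF \<psi>]
        by (auto intro!: L2_continuous continuous_on_inner continuous_on_const)
      have "(\<integral>x. ?H x \<bullet> b \<partial>lebesgue_on S) = (\<integral>x. \<phi> x * (grad \<psi> x \<bullet> b) + (g x \<bullet> b) * \<psi> x \<partial>lebesgue_on S)"
        by (simp add: inner_add_left mult.commute)
      also have "\<dots> = (\<integral>x. \<phi> x * (grad \<psi> x \<bullet> b) \<partial>lebesgue_on S) + (\<integral>x. (g x \<bullet> b) * \<psi> x \<partial>lebesgue_on S)"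
        using 1 L by (intro Bochner_Integration.integral_add L2_integrable_mult)
      finally show ?thesis by (simp add: grad_inner_Basis[OF b])
    qed
    ultimately show ?thesis by linarith
  qed
  with L show ?thesis by (simp add: has_weak_gradient_def)
qed

section \<open>Weak gradients: examples, linearity, uniqueness and restriction\<close>

lemma weak_gradient_test:
  "open S \<Longrightarrow> bounded S \<Longrightarrow> \<phi> \<in> test_functions S' \<Longrightarrow> has_weak_gradient S \<phi> (grad \<phi>)"
  by (rule weak_gradient_C1)
     (auto intro: grad_has_derivative test_differentiable test_grad_continuous)

lemma weak_gradient_affine:
  "open S \<Longrightarrow> bounded S \<Longrightarrow> has_weak_gradient S (\<lambda>x. a \<bullet> x + c) (\<lambda>x. a)"
  by (rule weak_gradient_C1)
     (auto simp: has_derivative_inner_right has_derivative_add_const)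

lemma
  assumes "has_weak_gradient S v G"
  shows weak_gradient_L2: "v \<in> L2_space S" and weak_gradient_L2': "G \<in> L2_space S"
  using assms by (auto simp: has_weak_gradient_def)

lemma L2_inner_const:
  assumes "G \<in> L2_space S"
  shows "(\<lambda>x. G x \<bullet> b) \<in> L2_space S"
proof -
  have m: "(\<lambda>x. G x \<bullet> b) \<in> borel_measurable (lebesgue_on S)"
    using L2_measurable[OF assms] by simp
  have "integrable (lebesgue_on S) (\<lambda>x. (norm (G x \<bullet> b))\<^sup>2)"
  proof (rule Bochner_Integration.integrable_bound)
    show "integrable (lebesgue_on S) (\<lambda>x. (norm b)\<^sup>2 * (norm (G x))\<^sup>2)"
      using assms by (simp add: L2_space_def)
    show "AE x in lebesgue_on S. norm ((norm (G x \<bullet> b))\<^sup>2) \<le> norm ((norm b)\<^sup>2 * (norm (G x))\<^sup>2)"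
    proof (rule AE_I2)
      fix x
      have "\<bar>G x \<bullet> b\<bar>\<^sup>2 \<le> (norm (G x) * norm b)\<^sup>2"
        by (rule power_mono[OF Cauchy_Schwarz_ineq2]) simp
      then show "norm ((norm (G x \<bullet> b))\<^sup>2) \<le> norm ((norm b)\<^sup>2 * (norm (G x))\<^sup>2)"
        by (simp add: power_mult_distrib mult.commute)
    qed
  qed (use m in simp)
  with m show ?thesis by (simp add: L2_space_def)
qed

lemma test_L2:
  assumes "open S" "bounded S" "\<phi> \<in> test_functions S'"
  shows "\<phi> \<in> L2_space S" "grad \<phi> \<in> L2_space S"
  using weak_gradient_test[OF assms] by (auto simp: has_weak_gradient_def)

lemma weak_gradient_add_scaleR:
  assumes S: "open S" "bounded S" and v: "has_weak_gradient S v G" and w: "has_weak_gradient S w H"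
  shows "has_weak_gradient S (\<lambda>x. v x + c * w x) (\<lambda>x. G x + c *\<^sub>R H x)"
proof -
  note L = weak_gradient_L2[OF v] weak_gradient_L2'[OF v] weak_gradient_L2[OF w] weak_gradient_L2'[OF w]
  have "(\<integral>x. (v x + c * w x) * frechet_derivative \<phi> (at x) b \<partial>lebesgue_on S)
          = - (\<integral>x. ((G x + c *\<^sub>R H x) \<bullet> b) * \<phi> x \<partial>lebesgue_on S)"
    if \<phi>: "\<phi> \<in> test_functions S" and b: "b \<in> Basis" for \<phi> b
  proof -
    note T = test_L2[OF S \<phi>]
    have i: "integrable (lebesgue_on S) (\<lambda>x. f x * frechet_derivative \<phi> (at x) b)"
      if "f \<in> L2_space S" for f
      using L2_integrable_mult[OF that L2_inner_const[OF T(2), of b]] by (simp add: grad_inner_Basis[OF b])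
    have j: "integrable (lebesgue_on S) (\<lambda>x. (F x \<bullet> b) * \<phi> x)" if "F \<in> L2_space S" for F
      using L2_integrable_mult[OF L2_inner_const[OF that] T(1)] .
    have "(\<integral>x. (v x + c * w x) * frechet_derivative \<phi> (at x) b \<partial>lebesgue_on S) =
      (\<integral>x. v x * frechet_derivative \<phi> (at x) b \<partial>lebesgue_on S) + c * (\<integral>x. w x * frechet_derivative \<phi> (at x) b \<partial>lebesgue_on S)"
      using i[OF L(1)] i[OF L(3)] by (simp add: distrib_right mult.assoc)
    also have "\<dots> = - (\<integral>x. (G x \<bullet> b) * \<phi> x \<partial>lebesgue_on S) - c * (\<integral>x. (H x \<bullet> b) * \<phi> x \<partial>lebesgue_on S)"
      using v w \<phi> b by (simp add: has_weak_gradient_def)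
    also have "\<dots> = - (\<integral>x. ((G x + c *\<^sub>R H x) \<bullet> b) * \<phi> x \<partial>lebesgue_on S)"
      using j[OF L(2)] j[OF L(4)] by (simp add: inner_add_left distrib_right mult.assoc)
    finally show ?thesis .
  qed
  moreover have "(\<lambda>x. v x + c * w x) \<in> L2_space S" "(\<lambda>x. G x + c *\<^sub>R H x) \<in> L2_space S"
    using L2_add[OF L(1) L2_scaleR[OF L(3), of c]] L2_add[OF L(2) L2_scaleR[OF L(4), of c]] by auto
  ultimately show ?thesis by (simp add: has_weak_gradient_def)
qed

lemma weak_gradient_unique:
  assumes S: "open S" "bounded S" and v: "has_weak_gradient S v G" and v': "has_weak_gradient S v H"
  shows "AE x in lebesgue_on S. G x = H x"
proof -
  have D: "(\<lambda>x. G x - H x) \<in> L2_space S"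
    using v v' by (auto intro: L2_diff weak_gradient_L2')
  have "AE x in lebesgue_on S. (G x - H x) \<bullet> b = 0" if b: "b \<in> Basis" for b
  proof (rule fundamental_lemma[OF S(1)])
    show "integrable (lebesgue_on S) (\<lambda>x. (G x - H x) \<bullet> b)"
      using L2_integrable[OF L2_inner_const[OF D]] open_lmeasurable S by blast
    fix \<phi> assume \<phi>: "\<phi> \<in> test_functions S"
    have "(\<integral>x. (G x \<bullet> b) * \<phi> x \<partial>lebesgue_on S) = (\<integral>x. (H x \<bullet> b) * \<phi> x \<partial>lebesgue_on S)"
      using v v' \<phi> b by (simp add: has_weak_gradient_def)
    moreover have "integrable (lebesgue_on S) (\<lambda>x. (F x \<bullet> b) * \<phi> x)" if "F \<in> L2_space S" for F
      using L2_integrable_mult[OF L2_inner_const[OF that] test_L2(1)[OF S \<phi>]] .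
    ultimately show "(\<integral>x. ((G x - H x) \<bullet> b) * \<phi> x \<partial>lebesgue_on S) = 0"
      using weak_gradient_L2'[OF v] weak_gradient_L2'[OF v'] by (simp add: inner_diff_left left_diff_distrib)
  qed
  then have "AE x in lebesgue_on S. \<forall>b\<in>Basis. (G x - H x) \<bullet> b = 0"
    by (intro AE_finite_allI) auto
  then show ?thesis
  proof (rule eventually_mono)
    fix x assume "\<forall>b\<in>Basis. (G x - H x) \<bullet> b = 0"
    then have "G x \<bullet> b = H x \<bullet> b" if "b \<in> Basis" for b
      using that by (metis eq_iff_diff_eq_0 inner_diff_left)
    then show "G x = H x" by (rule euclidean_eqI)
  qed
qed

lemma weak_gradient_weak_grad:
  "has_weak_gradient S v G \<Longrightarrow> has_weak_gradient S v (weak_grad S v)"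
  unfolding weak_grad_def by (metis someI_ex)

lemma weak_grad_AE:
  "open S \<Longrightarrow> bounded S \<Longrightarrow> has_weak_gradient S v G \<Longrightarrow> AE x in lebesgue_on S. weak_grad S v x = G x"
  by (rule weak_gradient_unique) (auto intro: weak_gradient_weak_grad)

lemma weak_gradient_cong_AE:
  assumes S: "open S" "bounded S" and v: "has_weak_gradient S v G"
    and ae: "AE x in lebesgue_on S. v x = v' x" "AE x in lebesgue_on S. G x = G' x"
  shows "has_weak_gradient S v' G'"
proof -
  have mS: "S \<in> sets lebesgue" using S open_sets_lebesgue by blast
  note L = weak_gradient_L2[OF v] weak_gradient_L2'[OF v]
  have L': "v' \<in> L2_space S" "G' \<in> L2_space S" using L2_cong_AE L mS ae by blast+
  have "(\<integral>x. v' x * frechet_derivative \<phi> (at x) b \<partial>lebesgue_on S)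
          = - (\<integral>x. (G' x \<bullet> b) * \<phi> x \<partial>lebesgue_on S)"
    if \<phi>: "\<phi> \<in> test_functions S" and b: "b \<in> Basis" for \<phi> b
  proof -
    note T = test_L2[OF S \<phi>]
    have "l2_inner S v (\<lambda>x. grad \<phi> x \<bullet> b) = l2_inner S v' (\<lambda>x. grad \<phi> x \<bullet> b)"
      by (rule l2_inner_cong_AE[OF ae(1) _ L(1) L2_inner_const[OF T(2)] mS]) simp
    moreover have "l2_inner S (\<lambda>x. G x \<bullet> b) \<phi> = l2_inner S (\<lambda>x. G' x \<bullet> b) \<phi>"
      by (rule l2_inner_cong_AE[OF _ _ L2_inner_const[OF L(2)] T(1) mS]) (use ae(2) in auto)
    ultimately show ?thesis
      using v \<phi> b by (simp add: has_weak_gradient_def l2_inner_def grad_inner_Basis[OF b])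
  qed
  with L' show ?thesis by (simp add: has_weak_gradient_def)
qed

lemma weak_gradient_subset:
  assumes S: "open S" "open S'" "S' \<subseteq> S" and v: "has_weak_gradient S v G"
  shows "has_weak_gradient S' v G"
proof -
  have mS: "S \<in> sets lebesgue" "S' \<in> sets lebesgue" using S open_sets_lebesgue by blast+
  have "(\<integral>x. v x * frechet_derivative \<phi> (at x) b \<partial>lebesgue_on S')
          = - (\<integral>x. (G x \<bullet> b) * \<phi> x \<partial>lebesgue_on S')"
    if \<phi>: "\<phi> \<in> test_functions S'" and b: "b \<in> Basis" for \<phi> b
  proof -
    \<comment> \<open>A test function on the smaller set vanishes outside it together with its
      derivatives, so both integrals can be enlarged to S.\<close>
    have "frechet_derivative \<phi> (at x) b = 0" if "x \<notin> S'" for x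
      using test_grad_zero_outside[OF \<phi> that] grad_inner_Basis[OF b, of \<phi> x] by simp
    then have "(\<integral>x. v x * frechet_derivative \<phi> (at x) b \<partial>lebesgue_on S')
        = (\<integral>x. v x * frechet_derivative \<phi> (at x) b \<partial>lebesgue_on S)"
      unfolding integral_lebesgue_on[OF mS(1)] integral_lebesgue_on[OF mS(2)]
      using S(3) by (intro Bochner_Integration.integral_cong refl) (auto simp: indicator_def)
    moreover have "(\<integral>x. (G x \<bullet> b) * \<phi> x \<partial>lebesgue_on S') = (\<integral>x. (G x \<bullet> b) * \<phi> x \<partial>lebesgue_on S)"
      unfolding integral_lebesgue_on[OF mS(1)] integral_lebesgue_on[OF mS(2)]
      using S(3) test_zero_outside[OF \<phi>] by (intro Bochner_Integration.integral_cong refl) (auto simp: indicator_def)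
    moreover have "\<phi> \<in> test_functions S" using \<phi> test_functions_mono S(3) by blast
    ultimately show ?thesis using v b by (simp add: has_weak_gradient_def)
  qed
  then show ?thesis
    using v L2_subset[of v, OF _ S(3) mS] L2_subset[of G, OF _ S(3) mS] by (simp add: has_weak_gradient_def)
qed

section \<open>The Poincare inequality on convex sets\<close>

text \<open>The definition tests coordinate directions only, while the translation argument for the
  Poincare inequality needs an arbitrary direction h.\<close>

lemma weak_gradient_direction:
  assumes S: "open S" "bounded S" and v: "has_weak_gradient S v G" and \<phi>: "\<phi> \<in> test_functions S"
  shows "(\<integral>x. v x * (grad \<phi> x \<bullet> h) \<partial>lebesgue_on S) = - (\<integral>x. (G x \<bullet> h) * \<phi> x \<partial>lebesgue_on S)"
proof -
  note T = test_L2[OF S \<phi>] and L = weak_gradient_L2[OF v] weak_gradient_L2'[OF v]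
  have split: "f \<bullet> h = (\<Sum>b\<in>Basis. (h \<bullet> b) * (f \<bullet> b))" for f :: 'a
    by (subst euclidean_inner) (simp add: mult.commute)
  have e1: "(\<lambda>x. v x * (grad \<phi> x \<bullet> h)) = (\<lambda>x. \<Sum>b\<in>Basis. (h \<bullet> b) * (v x * (grad \<phi> x \<bullet> b)))"
    by (rule ext, subst split) (simp add: sum_distrib_left mult.left_commute)
  have e2: "(\<lambda>x. (G x \<bullet> h) * \<phi> x) = (\<lambda>x. \<Sum>b\<in>Basis. (h \<bullet> b) * ((G x \<bullet> b) * \<phi> x))"
    by (rule ext, subst split) (simp add: sum_distrib_right mult.assoc)
  have "(\<integral>x. v x * (grad \<phi> x \<bullet> h) \<partial>lebesgue_on S)
      = (\<Sum>b\<in>Basis. (h \<bullet> b) * (\<integral>x. v x * (grad \<phi> x \<bullet> b) \<partial>lebesgue_on S))"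
    unfolding e1 using L2_integrable_mult[OF L(1) L2_inner_const[OF T(2)]]
    by (subst Bochner_Integration.integral_sum) auto
  also have "\<dots> = (\<Sum>b\<in>Basis. (h \<bullet> b) * - (\<integral>x. (G x \<bullet> b) * \<phi> x \<partial>lebesgue_on S))"
    using v \<phi> by (intro sum.cong refl) (simp add: has_weak_gradient_def grad_inner_Basis)
  also have "\<dots> = - (\<integral>x. (G x \<bullet> h) * \<phi> x \<partial>lebesgue_on S)"
    unfolding e2 using L2_integrable_mult[OF L2_inner_const[OF L(2)] T(1)]
    by (subst Bochner_Integration.integral_sum) (auto simp: sum_negf)
  finally show ?thesis .
qed

lemma nn_integral_lborel_translate:
  fixes F :: "'a::euclidean_space \<Rightarrow> ennreal"
  assumes "F \<in> borel_measurable borel"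
  shows "(\<integral>\<^sup>+x. F (h + x) \<partial>lborel) = (\<integral>\<^sup>+x. F x \<partial>lborel)"
  using assms by (subst (2) lborel_distr_plus[of h, symmetric], subst nn_integral_distr) auto

text \<open>Borel representatives that vanish off K turn all integrals into integrals over
  \<open>lborel\<close>, where Tonelli's theorem and translation invariance are at hand.\<close>

context
  fixes K :: "'a::euclidean_space set" and v :: "'a \<Rightarrow> real" and G :: "'a \<Rightarrow> 'a"
  assumes K: "open K" "convex K" "bounded K" and wg: "has_weak_gradient K v G"
    and v_meas [measurable]: "v \<in> borel_measurable borel" and G_meas [measurable]: "G \<in> borel_measurable borel"
    and v_out: "\<And>x. x \<notin> K \<Longrightarrow> v x = 0" and G_out: "\<And>x. x \<notin> K \<Longrightarrow> G x = 0"
begin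

lemma mK: "K \<in> sets lebesgue" "K \<in> lmeasurable"
  using K open_sets_lebesgue open_lmeasurable by auto

lemma K_borel [measurable]: "K \<in> sets borel"
  using K by simp

lemma lborel_eq_K:
  fixes f :: "'a \<Rightarrow> 'b::euclidean_space"
  assumes "f \<in> borel_measurable borel" "\<And>x. x \<notin> K \<Longrightarrow> f x = 0"
  shows "integral\<^sup>L lborel f = integral\<^sup>L (lebesgue_on K) f"
    and "integrable lborel f \<longleftrightarrow> integrable (lebesgue_on K) f"
proof -
  have f: "(\<lambda>x. indicator K x *\<^sub>R f x) = f" using assms(2) by (auto simp: indicator_def)
  show "integral\<^sup>L lborel f = integral\<^sup>L (lebesgue_on K) f"
    unfolding integral_lebesgue_on[OF mK(1)] f using assms(1) by (simp add: integral_completion)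
  show "integrable lborel f \<longleftrightarrow> integrable (lebesgue_on K) f"
    unfolding integrable_lebesgue_on[OF mK(1)] f using assms(1) by (simp add: integrable_completion)
qed

lemma v_int: "integrable lborel v"
  using lborel_eq_K(2)[OF v_meas v_out] L2_integrable[OF weak_gradient_L2[OF wg] mK(2)] by blast

lemma G_int: "integrable lborel G"
  using lborel_eq_K(2)[OF G_meas G_out] L2_integrable[OF weak_gradient_L2'[OF wg] mK(2)] by blast

lemma v2_int: "integrable lborel (\<lambda>x. (v x)\<^sup>2)"
  using weak_gradient_L2[OF wg] by (subst lborel_eq_K) (auto simp: v_out L2_space_def)

lemma G2_int: "integrable lborel (\<lambda>x. (norm (G x))\<^sup>2)"
  using weak_gradient_L2'[OF wg] by (subst lborel_eq_K) (auto simp: G_out L2_space_def)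

text \<open>Prepares Fubini's theorem for the average of G along the segments from x to x +
  h.\<close>

lemma G_pair_integrable:
  "integrable (lborel \<Otimes>\<^sub>M lborel) (\<lambda>(t::real, x). indicator {0..1} t * (G (t *\<^sub>R h + x) \<bullet> h))"
proof (rule integrableI_bounded)
  have cs: "\<bar>G y \<bullet> h\<bar> \<le> norm h * norm (G y)" for y
    by (metis Cauchy_Schwarz_ineq2 mult.commute)
  have "(\<integral>\<^sup>+ z. ennreal (norm (case z of (t::real, x) \<Rightarrow> indicator {0..1} t * (G (t *\<^sub>R h + x) \<bullet> h))) \<partial>(lborel \<Otimes>\<^sub>M lborel))
      = (\<integral>\<^sup>+ t. \<integral>\<^sup>+ x. ennreal (norm (indicator {0..1::real} t * (G (t *\<^sub>R h + x) \<bullet> h))) \<partial>lborel \<partial>lborel)"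
    by (subst lborel.nn_integral_fst[symmetric]) (auto simp: split_beta')
  also have "\<dots> \<le> (\<integral>\<^sup>+ t. \<integral>\<^sup>+ x. ennreal (norm h) * indicator {0..1::real} t * ennreal (norm (G (t *\<^sub>R h + x))) \<partial>lborel \<partial>lborel)"
    using cs by (intro nn_integral_mono)
       (auto simp: indicator_def abs_mult ennreal_mult'[symmetric] intro!: ennreal_leI)
  also have "\<dots> = (\<integral>\<^sup>+ t. ennreal (norm h) * indicator {0..1::real} t * (\<integral>\<^sup>+ x. ennreal (norm (G x)) \<partial>lborel) \<partial>lborel)"
    by (intro nn_integral_cong) (subst nn_integral_cmult, auto simp: nn_integral_lborel_translate[of "\<lambda>x. ennreal (norm (G x))"])
  also have "\<dots> = ennreal (norm h) * (\<integral>\<^sup>+ x. ennreal (norm (G x)) \<partial>lborel)"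
    by (simp add: nn_integral_multc nn_integral_cmult)
  also have "\<dots> < \<infinity>"
    using G_int by (auto simp: integrable_iff_bounded ennreal_mult_less_top)
  finally show "(\<integral>\<^sup>+ z. ennreal (norm (case z of (t::real, x) \<Rightarrow> indicator {0..1} t * (G (t *\<^sub>R h + x) \<bullet> h))) \<partial>(lborel \<Otimes>\<^sub>M lborel)) < \<infinity>" .
qed auto

text \<open>The increment v(x + h) - v(x) as the fundamental theorem of calculus along the segment
  predicts it. Where the integrand is not integrable, the Bochner integral is 0 by default.\<close>

definition "difference_kernel h x = (\<integral>t. indicator {0..1::real} t * (G (t *\<^sub>R h + x) \<bullet> h) \<partial>lborel)"

lemma difference_kernel_int: "integrable lborel (difference_kernel h)"
  using lborel_pair.integrable_snd[OF G_pair_integrable[of h]] unfolding difference_kernel_def .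

text \<open>A fundamental theorem of calculus for weakly differentiable functions. After pairing
  with a test function the translation falls on the test function, where it can be differentiated
  classically; moving that derivative back onto v produces the weak gradient.\<close>

lemma difference_AE:
  assumes Kh: "Kh = {x \<in> K. h + x \<in> K}"
  shows "AE x in lebesgue_on Kh. v (h + x) - v x - difference_kernel h x = 0"
proof -
  have "Kh = K \<inter> (+) (- h) ` K" unfolding Kh by (force simp: image_iff)
  then have Ko: "open Kh" using K by (simp add: open_translation_subtract open_Int)
  have mKh: "Kh \<in> sets lebesgue" using Ko by (rule open_sets_lebesgue)
  have vt: "integrable lborel (\<lambda>x. v (h + x))"
    using v_int by (subst (asm) lborel_distr_plus[of h, symmetric], subst (asm) integrable_distr_eq) auto
  let ?w = "\<lambda>x. v (h + x) - v x - difference_kernel h x"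
  have w: "integrable lborel ?w" using vt v_int difference_kernel_int by simp
  have D_meas [measurable]: "difference_kernel h \<in> borel_measurable borel"
    using borel_measurable_integrable[OF difference_kernel_int] by simp
  have wL: "integrable lebesgue ?w" using w by (subst integrable_completion) auto
  show ?thesis
  proof (rule fundamental_lemma[OF Ko])
    show "integrable (lebesgue_on Kh) ?w"
      unfolding integrable_lebesgue_on[OF mKh]
      using Bochner_Integration.integrable_mult_indicator[OF mKh wL] by simp
    fix \<phi> assume \<phi>: "\<phi> \<in> test_functions Kh"
    have [measurable]: "\<phi> \<in> borel_measurable borel" "grad \<phi> \<in> borel_measurable borel"
      using test_continuous[OF \<phi>] test_grad_continuous[OF \<phi>] borel_measurable_continuous_onI by auto
    obtain B where B: "\<And>x. \<bar>\<phi> x\<bar> \<le> B" using test_bounded[OF \<phi>] by blast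
    obtain C where C: "\<And>x y. \<bar>\<phi> x - \<phi> y\<bar> \<le> C * norm (x - y)" using test_lipschitz[OF \<phi>] by blast
    have mult_int: "integrable lborel (\<lambda>x. f x * \<phi> (x - k))" if "integrable lborel f" for f and k :: 'a
    proof (rule Bochner_Integration.integrable_bound)
      show "integrable lborel (\<lambda>x. B * f x)" using that by simp
      have "\<bar>f x * \<phi> (x - k)\<bar> \<le> \<bar>B * f x\<bar>" for x
        using mult_left_mono[OF order_trans[OF B[of "x - k"] abs_ge_self], of "\<bar>f x\<bar>"]
        by (simp add: abs_mult mult.commute)
      then show "AE x in lborel. norm (f x * \<phi> (x - k)) \<le> norm (B * f x)" by simp
      show "(\<lambda>x. f x * \<phi> (x - k)) \<in> borel_measurable lborel"
        using that by (intro borel_measurable_times) auto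
    qed
    \<comment> \<open>Shifting the test function is the same as shifting v in the opposite
      direction, so g interpolates between the pairings of the test function with \<open>v x\<close>
      at t = 0 and with \<open>v (h + x)\<close> at t = 1.\<close>
    define g where "g t = (\<integral>x. v x * \<phi> (x - t *\<^sub>R h) \<partial>lborel)" for t :: real
    define g' where "g' t = (\<integral>x. (G (t *\<^sub>R h + x) \<bullet> h) * \<phi> x \<partial>lborel)" for t :: real
    have der: "(g has_real_derivative g' t) (at t)" if t: "0 \<le> t" "t \<le> 1" for t
    proof -
      \<comment> \<open>Convexity enters here: the segment from x to h + x stays in K, so the
        shifted function is still a test function on K.\<close>
      have sub: "(+) (t *\<^sub>R h) ` Kh \<subseteq> K"
      proof
        fix y assume "y \<in> (+) (t *\<^sub>R h) ` Kh"
        then obtain x where x: "x \<in> K" "h + x \<in> K" "y = t *\<^sub>R h + x" by (auto simp: Kh)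
        have "(1 - t) *\<^sub>R x + t *\<^sub>R (h + x) \<in> K"
          using K(2) x t by (simp add: convexD)
        then show "y \<in> K" by (simp add: x algebra_simps)
      qed
      let ?\<psi> = "\<lambda>x. \<phi> (x - t *\<^sub>R h)"
      have \<psi>: "?\<psi> \<in> test_functions K" by (rule test_functions_translate[OF \<phi> sub])
      have "(\<lambda>s. (g (t + s) - g t) / s) \<midarrow>0\<rightarrow> (\<integral>x. - (v x * (grad ?\<psi> x \<bullet> h)) \<partial>lborel)"
        unfolding tendsto_at_iff_sequentially comp_def
      proof (intro allI impI)
        fix s :: "nat \<Rightarrow> real" assume s: "\<forall>i. s i \<in> UNIV - {0}" "s \<longlonglongrightarrow> 0"
        have "(\<lambda>n. \<integral>x. v x * ((\<phi> (x - (t + s n) *\<^sub>R h) - \<phi> (x - t *\<^sub>R h)) / s n) \<partial>lborel) \<longlonglongrightarrow>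
            (\<integral>x. - (v x * (grad ?\<psi> x \<bullet> h)) \<partial>lborel)"
        \<comment> \<open>The Lipschitz constant C of the test function bounds all difference
          quotients.\<close>
        proof (rule integral_dominated_convergence[where w = "\<lambda>x. C * norm h * \<bar>v x\<bar>"])
          show "integrable lborel (\<lambda>x. C * norm h * \<bar>v x\<bar>)" using v_int by simp
          have "grad ?\<psi> \<in> borel_measurable borel"
            using test_grad_continuous[OF \<psi>] borel_measurable_continuous_onI by auto
          then show "(\<lambda>x. - (v x * (grad ?\<psi> x \<bullet> h))) \<in> borel_measurable lborel" by simp
          show "AE x in lborel. (\<lambda>n. v x * ((\<phi> (x - (t + s n) *\<^sub>R h) - \<phi> (x - t *\<^sub>R h)) / s n))
              \<longlonglongrightarrow> - (v x * (grad ?\<psi> x \<bullet> h))"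
          proof (rule AE_I2)
            fix x
            let ?a = "x - t *\<^sub>R h"
            have "((\<lambda>s. ?a - s *\<^sub>R h) has_derivative (\<lambda>s. - (s *\<^sub>R h))) (at 0)"
              by (auto intro!: derivative_eq_intros)
            from has_derivative_compose[OF this, of \<phi> "\<lambda>k. grad \<phi> ?a \<bullet> k"]
            have "((\<lambda>s. \<phi> (?a - s *\<^sub>R h)) has_derivative (\<lambda>s. grad \<phi> ?a \<bullet> (- (s *\<^sub>R h)))) (at 0)"
              using grad_has_derivative[OF test_differentiable[OF \<phi>], of ?a] by simp
            then have "((\<lambda>s. \<phi> (?a - s *\<^sub>R h)) has_real_derivative - (grad \<phi> ?a \<bullet> h)) (at 0)"
              by (rule has_derivative_imp_has_field_derivative) simp
            then have "(\<lambda>s. (\<phi> (?a - s *\<^sub>R h) - \<phi> ?a) / s) \<midarrow>0\<rightarrow> - (grad \<phi> ?a \<bullet> h)"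
              by (simp add: DERIV_def)
            then have "(\<lambda>n. (\<phi> (?a - s n *\<^sub>R h) - \<phi> ?a) / s n) \<longlonglongrightarrow> - (grad \<phi> ?a \<bullet> h)"
              using s by (auto simp: tendsto_at_iff_sequentially comp_def)
            moreover have "grad ?\<psi> x = grad \<phi> ?a" by (rule grad_translate) (rule test_differentiable[OF \<phi>])
            moreover have "x - (t + s n) *\<^sub>R h = ?a - s n *\<^sub>R h" for n by (simp add: algebra_simps)
            ultimately have "(\<lambda>n. (\<phi> (x - (t + s n) *\<^sub>R h) - \<phi> ?a) / s n) \<longlonglongrightarrow> - (grad ?\<psi> x \<bullet> h)" by (simp only:)
            from tendsto_mult_left[OF this, of "v x"]
            show "(\<lambda>n. v x * ((\<phi> (x - (t + s n) *\<^sub>R h) - \<phi> (x - t *\<^sub>R h)) / s n))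
              \<longlonglongrightarrow> - (v x * (grad ?\<psi> x \<bullet> h))" by simp
          qed
          show "AE x in lborel. norm (v x * ((\<phi> (x - (t + s n) *\<^sub>R h) - \<phi> (x - t *\<^sub>R h)) / s n))
              \<le> C * norm h * \<bar>v x\<bar>" for n
          proof (rule AE_I2)
            fix x
            have "\<bar>\<phi> (x - (t + s n) *\<^sub>R h) - \<phi> (x - t *\<^sub>R h)\<bar> \<le> C * norm (- (s n *\<^sub>R h))"
              using C[of "x - (t + s n) *\<^sub>R h" "x - t *\<^sub>R h"] by (simp add: algebra_simps)
            then have "\<bar>(\<phi> (x - (t + s n) *\<^sub>R h) - \<phi> (x - t *\<^sub>R h)) / s n\<bar> \<le> C * norm h"
              using s(1) by (auto simp: field_simps abs_mult)
            from mult_left_mono[OF this, of "\<bar>v x\<bar>"]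
            show "norm (v x * ((\<phi> (x - (t + s n) *\<^sub>R h) - \<phi> (x - t *\<^sub>R h)) / s n)) \<le> C * norm h * \<bar>v x\<bar>"
              by (simp add: abs_mult mult.commute)
          qed
        qed simp
        moreover have "(\<integral>x. v x * ((\<phi> (x - (t + s n) *\<^sub>R h) - \<phi> (x - t *\<^sub>R h)) / s n) \<partial>lborel)
            = (g (t + s n) - g t) / s n" for n
        proof -
          have "(\<integral>x. v x * ((\<phi> (x - (t + s n) *\<^sub>R h) - \<phi> (x - t *\<^sub>R h)) / s n) \<partial>lborel) =
              (\<integral>x. (v x * \<phi> (x - (t + s n) *\<^sub>R h) - v x * \<phi> (x - t *\<^sub>R h)) / s n \<partial>lborel)"
            by (simp add: right_diff_distrib)
          then show ?thesis
            unfolding g_def using mult_int[OF v_int] by simp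
        qed
        ultimately show "(\<lambda>n. (g (t + s n) - g t) / s n) \<longlonglongrightarrow> (\<integral>x. - (v x * (grad ?\<psi> x \<bullet> h)) \<partial>lborel)"
          by (simp only:)
      qed
      moreover have "(\<integral>x. - (v x * (grad ?\<psi> x \<bullet> h)) \<partial>lborel) = g' t"
      proof -
        have [measurable]: "grad ?\<psi> \<in> borel_measurable borel"
          using test_grad_continuous[OF \<psi>] borel_measurable_continuous_onI by auto
        have "(\<integral>x. v x * (grad ?\<psi> x \<bullet> h) \<partial>lborel) = (\<integral>x. v x * (grad ?\<psi> x \<bullet> h) \<partial>lebesgue_on K)"
          by (rule lborel_eq_K) (auto simp: v_out)
        also have "\<dots> = - (\<integral>x. (G x \<bullet> h) * ?\<psi> x \<partial>lebesgue_on K)"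
          by (rule weak_gradient_direction[OF K(1,3) wg \<psi>])
        also have "(\<integral>x. (G x \<bullet> h) * ?\<psi> x \<partial>lebesgue_on K) = (\<integral>x. (G x \<bullet> h) * ?\<psi> x \<partial>lborel)"
          by (rule lborel_eq_K(1)[symmetric]) (auto simp: G_out)
        also have "\<dots> = g' t"
          unfolding g'_def by (subst lborel_integral_translate[of _ "t *\<^sub>R h", symmetric]) simp_all
        finally show ?thesis by simp
      qed
      ultimately show ?thesis by (simp add: DERIV_def)
    qed
    have FTC: "(g' has_integral (g 1 - g 0)) {0..1}"
    proof (rule fundamental_theorem_of_calculus)
      fix t :: real assume "t \<in> {0..1}"
      then have "(g has_real_derivative g' t) (at t)" using der[of t] by simp
      then have "(g has_real_derivative g' t) (at t within {0..1})"
        by (rule has_field_derivative_at_within)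
      then show "(g has_vector_derivative g' t) (at t within {0..1})"
        by (simp add: has_real_derivative_iff_has_vector_derivative)
    qed simp
    let ?Q = "\<lambda>(t::real, x). indicator {0..1} t * (G (t *\<^sub>R h + x) \<bullet> h) * \<phi> x"
    have Q: "integrable (lborel \<Otimes>\<^sub>M lborel) ?Q"
    proof (rule Bochner_Integration.integrable_bound)
      show "integrable (lborel \<Otimes>\<^sub>M lborel) (\<lambda>z. B * (case z of (t::real, x) \<Rightarrow> indicator {0..1} t * (G (t *\<^sub>R h + x) \<bullet> h)))"
        using G_pair_integrable by (rule integrable_mult_right)
      show "AE z in lborel \<Otimes>\<^sub>M lborel. norm (?Q z) \<le> norm (B * (case z of (t::real, x) \<Rightarrow> indicator {0..1} t * (G (t *\<^sub>R h + x) \<bullet> h)))"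
      proof (intro AE_I2)
        fix z :: "real \<times> 'a"
        let ?q = "indicator {0..1} (fst z) * (G (fst z *\<^sub>R h + snd z) \<bullet> h)"
        have "\<bar>?q\<bar> * \<bar>\<phi> (snd z)\<bar> \<le> \<bar>?q\<bar> * \<bar>B\<bar>"
          by (intro mult_left_mono order_trans[OF B abs_ge_self]) simp
        then show "norm (?Q z) \<le> norm (B * (case z of (t::real, x) \<Rightarrow> indicator {0..1} t * (G (t *\<^sub>R h + x) \<bullet> h)))"
          by (simp add: split_beta' abs_mult mult.commute)
      qed
    qed auto
    have "(\<integral>t. indicator {0..1} t * g' t \<partial>lborel) = (\<integral>x. difference_kernel h x * \<phi> x \<partial>lborel)"
    proof -
      have "(\<integral>t. indicator {0..1} t * g' t \<partial>lborel) = (\<integral>t. \<integral>x. ?Q (t, x) \<partial>lborel \<partial>lborel)"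
        unfolding g'_def by (simp add: mult.assoc)
      also have "\<dots> = (\<integral>x. \<integral>t. ?Q (t, x) \<partial>lborel \<partial>lborel)"
        using lborel_pair.Fubini_integral[of "\<lambda>t x. ?Q (t, x)"] Q by (simp add: split_beta')
      also have "\<dots> = (\<integral>x. difference_kernel h x * \<phi> x \<partial>lborel)"
        unfolding difference_kernel_def by simp
      finally show ?thesis .
    qed
    moreover have "integrable lborel (\<lambda>t. indicator {0..1} t * g' t)"
      using lborel_pair.integrable_fst[OF Q] unfolding g'_def by (simp add: mult.assoc)
    then have "set_integrable lborel {0..1} g'" by (simp add: set_integrable_def)
    then have "(\<integral>t. indicator {0..1} t * g' t \<partial>lborel) = g 1 - g 0"
      using set_borel_integral_eq_integral(2)[of "{0..1}" g'] integral_unique[OF FTC]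
      by (simp add: set_lebesgue_integral_def)
    moreover have "g 1 = (\<integral>x. v (h + x) * \<phi> x \<partial>lborel)"
      unfolding g_def by (subst lborel_integral_translate[of _ h, symmetric]) simp_all
    moreover have "g 0 = (\<integral>x. v x * \<phi> x \<partial>lborel)" by (simp add: g_def)
    moreover have "(\<integral>x. ?w x * \<phi> x \<partial>lborel) = (\<integral>x. v (h + x) * \<phi> x \<partial>lborel) - (\<integral>x. v x * \<phi> x \<partial>lborel)
        - (\<integral>x. difference_kernel h x * \<phi> x \<partial>lborel)"
      using mult_int[OF vt, of 0] mult_int[OF v_int, of 0] mult_int[OF difference_kernel_int[of h], of 0]
      by (simp add: left_diff_distrib)
    ultimately have "(\<integral>x. ?w x * \<phi> x \<partial>lborel) = 0" by simp
    then have "(\<integral>x. ?w x * \<phi> x \<partial>lebesgue) = 0" by (subst integral_completion) auto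
    moreover have "(\<integral>x. ?w x * \<phi> x \<partial>lebesgue) = (\<integral>x. ?w x * \<phi> x \<partial>lebesgue_on Kh)"
      unfolding integral_lebesgue_on[OF mKh]
      by (rule Bochner_Integration.integral_cong) (use test_zero_outside[OF \<phi>] in \<open>auto simp: indicator_def\<close>)
    ultimately show "(\<integral>x. ?w x * \<phi> x \<partial>lebesgue_on Kh) = 0" by simp
  qed
qed

text \<open>Cauchy--Schwarz on the unit interval, which has measure one. Extended nonnegative
  integrals include those x for which the kernel is 0 by default.\<close>

lemma kernel_sq_le:
  "ennreal ((difference_kernel h x)\<^sup>2) \<le>
    (\<integral>\<^sup>+t. ennreal ((norm h)\<^sup>2) * (indicator {0..1::real} t * ennreal ((norm (G (t *\<^sub>R h + x)))\<^sup>2)) \<partial>lborel)"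
proof -
  let ?q = "\<lambda>t::real. indicator {0..1} t * (G (t *\<^sub>R h + x) \<bullet> h)"
  have "ennreal \<bar>difference_kernel h x\<bar> \<le> (\<integral>\<^sup>+t. ennreal \<bar>?q t\<bar> \<partial>lborel)"
  proof (cases "integrable lborel ?q")
    case True
    then show ?thesis unfolding difference_kernel_def using integral_norm_bound_ennreal[OF True] by simp
  next
    case False then show ?thesis by (simp add: difference_kernel_def not_integrable_integral_eq)
  qed
  also have "\<dots> = (\<integral>\<^sup>+t. ennreal \<bar>?q t\<bar> * indicator {0..1} t \<partial>lborel)"
    by (intro nn_integral_cong) (auto simp: indicator_def)
  finally have "(ennreal \<bar>difference_kernel h x\<bar>)\<^sup>2 \<le> (\<integral>\<^sup>+t. ennreal \<bar>?q t\<bar> * indicator {0..1} t \<partial>lborel)\<^sup>2"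
    by (rule power_mono) simp
  also have "\<dots> \<le> (\<integral>\<^sup>+t. (ennreal \<bar>?q t\<bar>)\<^sup>2 \<partial>lborel) * (\<integral>\<^sup>+t. (indicator {0..1::real} t)\<^sup>2 \<partial>lborel)"
    by (rule Cauchy_Schwarz_nn_integral) auto
  also have "(\<integral>\<^sup>+t. (indicator {0..1::real} t)\<^sup>2 \<partial>lborel) = (1::ennreal)"
    by (subst nn_integral_cong[of _ _ "indicator {0..1::real}"]) (auto simp: indicator_def)
  also have "(\<integral>\<^sup>+t. (ennreal \<bar>?q t\<bar>)\<^sup>2 \<partial>lborel) \<le>
      (\<integral>\<^sup>+t. ennreal ((norm h)\<^sup>2) * (indicator {0..1::real} t * ennreal ((norm (G (t *\<^sub>R h + x)))\<^sup>2)) \<partial>lborel)"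
  proof (rule nn_integral_mono)
    fix t
    have "\<bar>G (t *\<^sub>R h + x) \<bullet> h\<bar>\<^sup>2 \<le> (norm h)\<^sup>2 * (norm (G (t *\<^sub>R h + x)))\<^sup>2"
      using power_mono[OF Cauchy_Schwarz_ineq2[of "G (t *\<^sub>R h + x)" h], of 2]
      by (simp add: power_mult_distrib mult.commute)
    then show "(ennreal \<bar>?q t\<bar>)\<^sup>2 \<le> ennreal ((norm h)\<^sup>2) * (indicator {0..1::real} t * ennreal ((norm (G (t *\<^sub>R h + x)))\<^sup>2))"
      by (auto simp: indicator_def ennreal_power ennreal_mult'[symmetric] intro!: ennreal_leI)
  qed
  finally show ?thesis by (simp add: ennreal_power mult_right_mono)
qed

text \<open>The square of the increment is averaged over the segment, and by translation invariance
  every t contributes the same integral of |G|^2.\<close>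

lemma difference_bound:
  "(\<integral>\<^sup>+x. indicator {x \<in> K. h + x \<in> K} x * ennreal ((v (h + x) - v x)\<^sup>2) \<partial>lborel)
    \<le> ennreal ((norm h)\<^sup>2 * (\<integral>x. (norm (G x))\<^sup>2 \<partial>lborel))"
proof -
  let ?Kh = "{x \<in> K. h + x \<in> K}"
  have "?Kh = K \<inter> (+) (- h) ` K" by (force simp: image_iff)
  then have "open ?Kh" using K by (simp add: open_translation_subtract open_Int)
  then have mKh: "?Kh \<in> sets lebesgue" by (rule open_sets_lebesgue)
  have "AE x in lborel. x \<in> ?Kh \<longrightarrow> v (h + x) - v x - difference_kernel h x = 0"
    using difference_AE[OF refl, of h] unfolding AE_lebesgue_on[OF mKh] by (simp only: AE_completion_iff)
  then have "(\<integral>\<^sup>+x. indicator ?Kh x * ennreal ((v (h + x) - v x)\<^sup>2) \<partial>lborel)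
      \<le> (\<integral>\<^sup>+x. ennreal ((difference_kernel h x)\<^sup>2) \<partial>lborel)"
    by (intro nn_integral_mono_AE) (auto elim!: eventually_mono simp: indicator_def)
  also have "\<dots> \<le> (\<integral>\<^sup>+x. \<integral>\<^sup>+t. ennreal ((norm h)\<^sup>2) * (indicator {0..1::real} t * ennreal ((norm (G (t *\<^sub>R h + x)))\<^sup>2)) \<partial>lborel \<partial>lborel)"
    by (intro nn_integral_mono kernel_sq_le)
  also have "\<dots> = (\<integral>\<^sup>+t. \<integral>\<^sup>+x. ennreal ((norm h)\<^sup>2) * (indicator {0..1::real} t * ennreal ((norm (G (t *\<^sub>R h + x)))\<^sup>2)) \<partial>lborel \<partial>lborel)"
    by (rule lborel_pair.Fubini') simp
  also have "\<dots> = (\<integral>\<^sup>+t. ennreal ((norm h)\<^sup>2) * (indicator {0..1::real} t * (\<integral>\<^sup>+x. ennreal ((norm (G x))\<^sup>2) \<partial>lborel)) \<partial>lborel)"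
    by (intro nn_integral_cong)
       (simp add: nn_integral_cmult nn_integral_lborel_translate[of "\<lambda>x. ennreal ((norm (G x))\<^sup>2)"])
  also have "\<dots> = ennreal ((norm h)\<^sup>2) * (\<integral>\<^sup>+x. ennreal ((norm (G x))\<^sup>2) \<partial>lborel)"
    by (simp add: nn_integral_multc nn_integral_cmult)
  also have "(\<integral>\<^sup>+x. ennreal ((norm (G x))\<^sup>2) \<partial>lborel) = ennreal (\<integral>x. (norm (G x))\<^sup>2 \<partial>lborel)"
    by (rule nn_integral_eq_integral[OF G2_int]) simp
  finally show ?thesis by (simp add: ennreal_mult')
qed

text \<open>For mean zero, the double integral of |v(x) - v(y)|^2 over K times K is 2|K| times the
  integral of v^2. With y = x + h only |h| <= R matters, and the bound on increments is integrated
  over that ball.\<close>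

lemma poincare_aux:
  assumes R: "\<And>x y. x \<in> K \<Longrightarrow> y \<in> K \<Longrightarrow> norm (x - y) \<le> R" "R \<ge> 0" and mean: "(\<integral>x. v x \<partial>lborel) = 0"
  shows "2 * measure lborel K * (\<integral>x. (v x)\<^sup>2 \<partial>lborel) \<le>
    R\<^sup>2 * measure lborel (cball (0::'a) R) * (\<integral>x. (norm (G x))\<^sup>2 \<partial>lborel)"
proof -
  let ?V = "\<integral>x. (v x)\<^sup>2 \<partial>lborel" and ?G = "\<integral>x. (norm (G x))\<^sup>2 \<partial>lborel" and ?m = "measure lborel K"
  have Ki: "integrable lborel (indicator K :: 'a \<Rightarrow> real)"
    using emeasure_bounded_finite[OF K(3)] by (simp add: integrable_indicator_iff)
  have V0: "0 \<le> ?V" "0 \<le> ?G" by auto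
  \<comment> \<open>The mixed term of the square integrates to zero because v has mean zero.\<close>
  have inner: "(\<integral>\<^sup>+y. indicator K y * ennreal ((v y - a)\<^sup>2) \<partial>lborel) = ennreal (?V + ?m * a\<^sup>2)" for a
  proof -
    have eq: "indicator K y * (v y - a)\<^sup>2 = (v y)\<^sup>2 - 2 * a * v y + a\<^sup>2 * indicator K y" for y
      using v_out[of y] by (auto simp: indicator_def power2_diff)
    have "(\<integral>\<^sup>+y. indicator K y * ennreal ((v y - a)\<^sup>2) \<partial>lborel) = (\<integral>\<^sup>+y. ennreal (indicator K y * (v y - a)\<^sup>2) \<partial>lborel)"
      by (intro nn_integral_cong) (auto simp: indicator_def)
    also have "\<dots> = ennreal (\<integral>y. indicator K y * (v y - a)\<^sup>2 \<partial>lborel)"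
    proof (rule nn_integral_eq_integral)
      show "integrable lborel (\<lambda>y. indicator K y * (v y - a)\<^sup>2)"
        unfolding eq using v2_int v_int Ki by simp
    qed simp
    also have "(\<integral>y. indicator K y * (v y - a)\<^sup>2 \<partial>lborel) = ?V - 2 * a * (\<integral>y. v y \<partial>lborel) + a\<^sup>2 * ?m"
      unfolding eq using v2_int v_int Ki by simp
    finally show ?thesis by (simp add: mean mult.commute)
  qed
  have "ennreal (2 * ?m * ?V) = (\<integral>\<^sup>+x. indicator K x * (\<integral>\<^sup>+y. indicator K y * ennreal ((v y - v x)\<^sup>2) \<partial>lborel) \<partial>lborel)"
  proof -
    have "(\<integral>\<^sup>+x. indicator K x * ennreal (?V + ?m * (v x)\<^sup>2) \<partial>lborel) = (\<integral>\<^sup>+x. ennreal (?V * indicator K x + ?m * (v x)\<^sup>2) \<partial>lborel)"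
      by (intro nn_integral_cong) (auto simp: indicator_def v_out)
    also have "\<dots> = ennreal (\<integral>x. ?V * indicator K x + ?m * (v x)\<^sup>2 \<partial>lborel)"
      by (rule nn_integral_eq_integral) (use v2_int Ki V0 in auto)
    also have "\<dots> = ennreal (2 * ?m * ?V)" using v2_int Ki by simp
    finally show ?thesis by (simp add: inner)
  qed
  also have "\<dots> = (\<integral>\<^sup>+x. \<integral>\<^sup>+h. indicator K x * (indicator K (x + h) * ennreal ((v (x + h) - v x)\<^sup>2)) \<partial>lborel \<partial>lborel)"
    by (intro nn_integral_cong)
       (subst nn_integral_lborel_translate[of "\<lambda>y. indicator K y * ennreal ((v y - v _)\<^sup>2)", symmetric],
        auto simp: nn_integral_cmult)
  also have "\<dots> = (\<integral>\<^sup>+h. \<integral>\<^sup>+x. indicator K x * (indicator K (x + h) * ennreal ((v (x + h) - v x)\<^sup>2)) \<partial>lborel \<partial>lborel)"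
    by (rule lborel_pair.Fubini') simp
  also have "\<dots> \<le> (\<integral>\<^sup>+h. ennreal (R\<^sup>2 * ?G) * indicator (cball (0::'a) R) h \<partial>lborel)"
  proof (rule nn_integral_mono)
    fix h :: 'a
    have e: "(\<integral>\<^sup>+x. indicator K x * (indicator K (x + h) * ennreal ((v (x + h) - v x)\<^sup>2)) \<partial>lborel) =
       (\<integral>\<^sup>+x. indicator {x \<in> K. h + x \<in> K} x * ennreal ((v (h + x) - v x)\<^sup>2) \<partial>lborel)"
      by (intro nn_integral_cong) (auto simp: indicator_def add.commute)
    show "(\<integral>\<^sup>+x. indicator K x * (indicator K (x + h) * ennreal ((v (x + h) - v x)\<^sup>2)) \<partial>lborel)
        \<le> ennreal (R\<^sup>2 * ?G) * indicator (cball (0::'a) R) h"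
    proof (cases "norm h \<le> R")
      case True
      have "ennreal ((norm h)\<^sup>2 * ?G) \<le> ennreal (R\<^sup>2 * ?G)"
        using True R(2) by (intro ennreal_leI mult_right_mono power_mono) auto
      then show ?thesis using True order_trans[OF difference_bound[of h]] unfolding e by simp
    next
      case False
      have "{x \<in> K. h + x \<in> K} = {}"
      proof -
        have "norm h \<le> R" if "x \<in> K" "h + x \<in> K" for x
          using R(1)[OF that(2,1)] by simp
        with False show ?thesis by auto
      qed
      then show ?thesis unfolding e by simp
    qed
  qed
  also have "\<dots> = ennreal (R\<^sup>2 * ?G) * emeasure lborel (cball (0::'a) R)"
    by (simp add: nn_integral_cmult_indicator)
  also have "\<dots> = ennreal (R\<^sup>2 * ?G * measure lborel (cball (0::'a) R))"
    using emeasure_bounded_finite[OF bounded_cball, of "0::'a" R] V0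
    by (simp add: emeasure_eq_ennreal_measure less_top[symmetric] ennreal_mult')
  finally have "ennreal (2 * ?m * ?V) \<le> ennreal (R\<^sup>2 * ?G * measure lborel (cball (0::'a) R))" .
  then show ?thesis using V0 by (subst (asm) ennreal_le_iff) (auto simp: mult.commute mult.left_commute)
qed

end

text \<open>It bounds the set whose supremum is \<open>poincare_const\<close>, so C has to be finite
  but its size does not matter.\<close>

lemma poincare_convex:
  fixes K :: "'a::euclidean_space set"
  assumes K: "open K" "convex K" "bounded K" "K \<noteq> {}"
  obtains C where "0 \<le> C" "\<And>v G. has_weak_gradient K v G \<Longrightarrow> (\<integral>x. v x \<partial>lebesgue_on K) = 0 \<Longrightarrow>
      l2_norm K v \<le> C * l2_norm K G"
proof -
  obtain M where M: "\<And>x. x \<in> K \<Longrightarrow> norm x \<le> M" using K(3) by (auto simp: bounded_iff)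
  \<comment> \<open>Twice a bound on the norms bounds the diameter; the maximum with 0 makes R
    nonnegative without knowing the sign of M.\<close>
  define R where "R = 2 * max M 0"
  have R: "R \<ge> 0" "norm (x - y) \<le> R" if "x \<in> K" "y \<in> K" for x y
    using M[OF that(1)] M[OF that(2)] norm_triangle_ineq4[of x y] by (auto simp: R_def)
  have R0: "R \<ge> 0" by (simp add: R_def)
  have mK: "K \<in> sets lebesgue" using K open_sets_lebesgue by blast
  have [measurable]: "K \<in> sets borel" using K by simp
  have pos: "measure lborel K > 0"
  proof -
    have "emeasure lborel K \<noteq> 0" using K open_not_negligible[of K]
      by (auto simp: negligible_iff_null_sets null_sets_completion_iff null_sets_def)
    then show ?thesis
      using emeasure_bounded_finite[OF K(3)] by (simp add: measure_def enn2real_positive_iff zero_less_iff_neq_zero)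
  qed
  define C where "C = sqrt (R\<^sup>2 * measure lborel (cball (0::'a) R) / (2 * measure lborel K))"
  have "l2_norm K v \<le> C * l2_norm K G" if wg: "has_weak_gradient K v G" and mean: "(\<integral>x. v x \<partial>lebesgue_on K) = 0" for v G
  proof -
    have mv: "v \<in> borel_measurable (lebesgue_on K)" and mG: "G \<in> borel_measurable (lebesgue_on K)"
      using wg weak_gradient_L2 weak_gradient_L2' L2_measurable by blast+
    \<comment> \<open>Lebesgue measurable functions are exchanged for Borel functions that agree
      almost everywhere, as the product measure arguments require; G is treated coordinate by
      coordinate.\<close>
    have ex: "\<exists>f'. f' \<in> borel_measurable borel \<and> (AE x in lebesgue_on K. f x = f' x)"
      if "f \<in> borel_measurable (lebesgue_on K)" for f :: "'a \<Rightarrow> real"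
    proof -
      have "(\<lambda>x. if x \<in> K then f x else 0) \<in> borel_measurable lebesgue"
        using that mK by (simp add: borel_measurable_if)
      then obtain f' where "f' \<in> borel_measurable lborel" "AE x in lborel. (if x \<in> K then f x else 0) = f' x"
        using completion_ex_borel_measurable_real by blast
      then have "f' \<in> borel_measurable borel" "AE x in lebesgue_on K. f x = f' x"
        unfolding AE_lebesgue_on[OF mK] AE_completion_iff by (auto elim!: eventually_mono)
      then show ?thesis by blast
    qed
    obtain v1 where v1: "v1 \<in> borel_measurable borel" "AE x in lebesgue_on K. v x = v1 x" using ex[OF mv] by blast
    have "\<exists>g'. g' \<in> borel_measurable borel \<and> (AE x in lebesgue_on K. G x \<bullet> b = g' x)" for b
      by (rule ex) (use mG in simp)
    then obtain g where g: "\<And>b. g b \<in> borel_measurable borel" "\<And>b. AE x in lebesgue_on K. G x \<bullet> b = g b x" by metis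
    define v0 where "v0 = (\<lambda>x. indicator K x * v1 x)"
    define G0 where "G0 = (\<lambda>x. \<Sum>b\<in>Basis. (indicator K x * g b x) *\<^sub>R b)"
    have aev: "AE x in lebesgue_on K. v x = v0 x"
      using v1(2) unfolding AE_lebesgue_on[OF mK] v0_def by (auto elim!: eventually_mono)
    have "AE x in lebesgue_on K. \<forall>b\<in>Basis. G x \<bullet> b = g b x"
      using g(2) by (intro AE_finite_allI) auto
    moreover have G0b: "G0 x \<bullet> b = indicator K x * g b x" if "b \<in> Basis" for x b
      using that by (simp add: G0_def)
    ultimately have aeG: "AE x in lebesgue_on K. G x = G0 x"
      unfolding AE_lebesgue_on[OF mK]
    proof (elim eventually_mono, intro impI)
      fix x assume a: "x \<in> K \<longrightarrow> (\<forall>b\<in>Basis. G x \<bullet> b = g b x)" and x: "x \<in> K"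
      show "G x = G0 x"
      proof (rule euclidean_eqI)
        fix b :: 'a assume b: "b \<in> Basis"
        show "G x \<bullet> b = G0 x \<bullet> b" unfolding G0b[OF b] using a x b by simp
      qed
    qed
    have wg0: "has_weak_gradient K v0 G0" by (rule weak_gradient_cong_AE[OF K(1,3) wg aev aeG])
    have m0: "v0 \<in> borel_measurable borel" "G0 \<in> borel_measurable borel"
      using v1(1) g(1) unfolding v0_def G0_def by measurable
    have out: "v0 x = 0" "G0 x = 0" if "x \<notin> K" for x using that by (auto simp: v0_def G0_def)
    have L: "(\<integral>x. f x \<partial>lborel) = (\<integral>x. f x \<partial>lebesgue_on K)"
      if "f \<in> borel_measurable borel" "\<And>x. x \<notin> K \<Longrightarrow> f x = 0" for f :: "'a \<Rightarrow> real"
      by (rule lborel_eq_K(1)[OF K(1-3) wg0 m0]) (use that out in auto)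
    have "(\<integral>x. v0 x \<partial>lebesgue_on K) = (\<integral>x. v x \<partial>lebesgue_on K)"
      by (rule integral_cong_AE) (use aev m0 mv L2_measurable[OF weak_gradient_L2[OF wg0]] in auto)
    then have mean0: "(\<integral>x. v0 x \<partial>lborel) = 0" using L[OF m0(1) out(1)] mean by simp
    have "(\<integral>x. (v0 x)\<^sup>2 \<partial>lborel) = (l2_norm K v0)\<^sup>2" "(\<integral>x. (norm (G0 x))\<^sup>2 \<partial>lborel) = (l2_norm K G0)\<^sup>2"
      using L[of "\<lambda>x. (v0 x)\<^sup>2"] L[of "\<lambda>x. (norm (G0 x))\<^sup>2"] m0 out by (simp_all add: l2_norm_def)
    moreover have "2 * measure lborel K * (\<integral>x. (v0 x)\<^sup>2 \<partial>lborel) \<le>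
        R\<^sup>2 * measure lborel (cball (0::'a) R) * (\<integral>x. (norm (G0 x))\<^sup>2 \<partial>lborel)"
      by (rule poincare_aux[OF K(1-3) wg0 m0 _ _ _ R0 mean0]) (use out R in auto)
    ultimately have "2 * measure lborel K * (l2_norm K v0)\<^sup>2 \<le> R\<^sup>2 * measure lborel (cball (0::'a) R) * (l2_norm K G0)\<^sup>2"
      by simp
    then have "(l2_norm K v0)\<^sup>2 \<le> (R\<^sup>2 * measure lborel (cball (0::'a) R) / (2 * measure lborel K)) * (l2_norm K G0)\<^sup>2"
      using pos by (simp add: field_simps)
    also have "\<dots> = (C * l2_norm K G0)\<^sup>2"
      using pos by (simp add: C_def power_mult_distrib)
    finally have "l2_norm K v0 \<le> C * l2_norm K G0"
      by (rule power2_le_imp_le) (use pos in \<open>simp add: C_def\<close>)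
    moreover have "l2_norm K v = l2_norm K v0" "l2_norm K G = l2_norm K G0"
      using l2_norm_cong_AE[OF aev weak_gradient_L2[OF wg] mK] l2_norm_cong_AE[OF aeG weak_gradient_L2'[OF wg] mK] by auto
    ultimately show ?thesis by simp
  qed
  moreover have "0 \<le> C" using pos by (simp add: C_def)
  ultimately show ?thesis using that by blast
qed

section \<open>Translation-invariant measures on subspaces\<close>

text \<open>The measures live on the ambient space and are merely concentrated on W, so that volume
  and the measures on the planes of facets are instances of one notion.\<close>

definition invariant_on :: "'a::euclidean_space set \<Rightarrow> 'a measure \<Rightarrow> bool" where
  "invariant_on W \<nu> \<longleftrightarrow> sets \<nu> = sets borel \<and> sigma_finite_measure \<nu> \<and> (AE x in \<nu>. x \<in> W) \<and>
     (\<forall>w\<in>W. distr \<nu> borel ((+) w) = \<nu>)"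

lemma
  assumes "invariant_on W \<nu>"
  shows invariant_on_sets: "sets \<nu> = sets borel"
    and invariant_on_sigma_finite: "sigma_finite_measure \<nu>"
    and invariant_on_AE: "AE x in \<nu>. x \<in> W"
    and invariant_on_distr: "w \<in> W \<Longrightarrow> distr \<nu> borel ((+) w) = \<nu>"
  using assms by (auto simp: invariant_on_def)

lemma invariant_on_translate:
  assumes "invariant_on W \<nu>" "w \<in> W" "F \<in> borel_measurable borel"
  shows "(\<integral>\<^sup>+x. F (w + x) \<partial>\<nu>) = (\<integral>\<^sup>+x. F x \<partial>\<nu>)"
proof -
  have [measurable_cong]: "sets \<nu> = sets borel" using assms(1) by (rule invariant_on_sets)
  show ?thesis
    by (subst (2) invariant_on_distr[OF assms(1,2), symmetric], subst nn_integral_distr) (use assms(3) in auto)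
qed

text \<open>
  Weil's uniqueness argument for Haar measures: apply Tonelli's theorem to
  \<open>(x, y) \<mapsto> 1\<^sub>A x * 1\<^sub>B (x + y)\<close>.
\<close>

lemma invariant_on_unique:
  fixes \<mu> \<nu> :: "'a::euclidean_space measure"
  assumes \<mu>: "invariant_on W \<mu>" and \<nu>: "invariant_on W \<nu>" and u: "distr \<nu> borel uminus = \<nu>"
    and A [measurable]: "A \<in> sets borel" and B [measurable]: "B \<in> sets borel"
  shows "emeasure \<mu> A * emeasure \<nu> B = emeasure \<nu> A * emeasure \<mu> B"
proof -
  have sm [measurable_cong]: "sets \<mu> = sets borel" and sn [measurable_cong]: "sets \<nu> = sets borel"
    using \<mu> \<nu> invariant_on_sets by auto
  interpret \<mu>: sigma_finite_measure \<mu> using \<mu> by (rule invariant_on_sigma_finite)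
  interpret \<nu>: sigma_finite_measure \<nu> using \<nu> by (rule invariant_on_sigma_finite)
  interpret pair_sigma_finite \<mu> \<nu> ..
  have "emeasure \<mu> A * emeasure \<nu> B = (\<integral>\<^sup>+x. indicator A x * emeasure \<nu> B \<partial>\<mu>)"
    by (simp add: nn_integral_multc sm)
  also have "\<dots> = (\<integral>\<^sup>+x. indicator A x * (\<integral>\<^sup>+y. indicator B (x + y) \<partial>\<nu>) \<partial>\<mu>)"
  proof (rule nn_integral_cong_AE)
    show "AE x in \<mu>. indicator A x * emeasure \<nu> B = indicator A x * (\<integral>\<^sup>+y. indicator B (x + y) \<partial>\<nu>)"
      using invariant_on_AE[OF \<mu>]
    proof eventually_elim
      case (elim x)
      then show ?case using invariant_on_translate[OF \<nu> elim, of "indicator B"] by (simp add: sn)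
    qed
  qed
  also have "\<dots> = (\<integral>\<^sup>+x. \<integral>\<^sup>+y. indicator A x * indicator B (x + y) \<partial>\<nu> \<partial>\<mu>)"
    by (intro nn_integral_cong) (subst nn_integral_cmult, auto)
  also have "\<dots> = (\<integral>\<^sup>+y. \<integral>\<^sup>+x. indicator A x * indicator B (x + y) \<partial>\<mu> \<partial>\<nu>)"
    by (rule Fubini'[symmetric]) simp
  also have "\<dots> = (\<integral>\<^sup>+y. \<integral>\<^sup>+x. indicator A (x - y) * indicator B x \<partial>\<mu> \<partial>\<nu>)"
  proof (rule nn_integral_cong_AE)
    show "AE y in \<nu>. (\<integral>\<^sup>+x. indicator A x * indicator B (x + y) \<partial>\<mu>) = (\<integral>\<^sup>+x. indicator A (x - y) * indicator B x \<partial>\<mu>)"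
      using invariant_on_AE[OF \<nu>]
    proof eventually_elim
      case (elim y)
      have "(\<integral>\<^sup>+x. indicator A (y + x - y) * indicator B (y + x) \<partial>\<mu>) = (\<integral>\<^sup>+x. indicator A (x - y) * indicator B x \<partial>\<mu>)"
        by (rule invariant_on_translate[OF \<mu> elim, of "\<lambda>x. indicator A (x - y) * indicator B x"]) simp
      then show ?case by (simp add: add.commute)
    qed
  qed
  also have "\<dots> = (\<integral>\<^sup>+x. \<integral>\<^sup>+y. indicator A (x - y) * indicator B x \<partial>\<nu> \<partial>\<mu>)"
    by (rule Fubini') simp
  also have "\<dots> = (\<integral>\<^sup>+x. emeasure \<nu> A * indicator B x \<partial>\<mu>)"
  proof (rule nn_integral_cong_AE)
    show "AE x in \<mu>. (\<integral>\<^sup>+y. indicator A (x - y) * indicator B x \<partial>\<nu>) = emeasure \<nu> A * indicator B x"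
      using invariant_on_AE[OF \<mu>]
    proof eventually_elim
      case (elim x)
      have "(\<integral>\<^sup>+y. indicator A (x - y) \<partial>\<nu>) = (\<integral>\<^sup>+y. indicator A (x - y) \<partial>distr \<nu> borel uminus)"
        by (simp add: u)
      also have "\<dots> = (\<integral>\<^sup>+y. indicator A (x + y) \<partial>\<nu>)"
        by (subst nn_integral_distr) auto
      also have "\<dots> = (\<integral>\<^sup>+y. indicator A y \<partial>\<nu>)"
        by (rule invariant_on_translate[OF \<nu> elim]) simp
      finally have "(\<integral>\<^sup>+y. indicator A (x - y) \<partial>\<nu>) = emeasure \<nu> A" by (simp add: sn)
      then show ?case by (subst nn_integral_multc) auto
    qed
  qed
  also have "\<dots> = emeasure \<nu> A * emeasure \<mu> B" by (simp add: nn_integral_cmult sm)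
  finally show ?thesis .
qed

section \<open>Affine maps as changes of variables\<close>

definition affine_map :: "('a::euclidean_space \<Rightarrow> 'b::euclidean_space) \<Rightarrow> bool" where
  "affine_map f \<longleftrightarrow> (\<exists>L c. linear L \<and> (\<forall>x. f x = L x + c))"

lemma affine_map_continuous: "affine_map f \<Longrightarrow> continuous_on S f"
  unfolding affine_map_def by (metis (no_types, lifting) continuous_on_add continuous_on_const continuous_on_cong linear_continuous_on linear_linear)

lemma affine_map_measurable: "affine_map f \<Longrightarrow> f \<in> borel_measurable borel"
  by (simp add: affine_map_continuous borel_measurable_continuous_onI)

text \<open>The exchange of two vertices of a simplex and the displacement of its apex, the affine
  maps needed for the centroids and the facet means, both have this form.\<close>

lemma affine_map_shift:
  "affine_map (\<lambda>x. x + (g \<bullet> x + c) *\<^sub>R w)"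
proof -
  have "linear (\<lambda>x. x + (g \<bullet> x) *\<^sub>R w)"
    by (rule linearI) (auto simp: inner_add_right algebra_simps)
  moreover have "x + (g \<bullet> x + c) *\<^sub>R w = (x + (g \<bullet> x) *\<^sub>R w) + c *\<^sub>R w" for x
    by (simp add: algebra_simps)
  ultimately show ?thesis unfolding affine_map_def by blast
qed

text \<open>Translating by w after A is the same as translating by \<open>L' w\<close> before A,
  where \<open>L'\<close> is the linear part of the inverse. Sigma-finiteness is recovered by
  pulling the image measure back.\<close>

lemma invariant_on_affine_image:
  assumes \<nu>: "invariant_on W \<nu>" and W: "subspace W"
    and A: "affine_map A" and A': "affine_map A'" and inv: "\<And>x. A' (A x) = x" "\<And>x. A (A' x) = x"
    and AW: "\<And>x. x \<in> W \<Longrightarrow> A x \<in> W" "\<And>x. x \<in> W \<Longrightarrow> A' x \<in> W"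
  shows "invariant_on W (distr \<nu> borel A)"
  unfolding invariant_on_def
proof (intro conjI ballI)
  have sn [measurable_cong]: "sets \<nu> = sets borel" using \<nu> by (rule invariant_on_sets)
  have [measurable]: "A \<in> borel_measurable borel" "A' \<in> borel_measurable borel"
    using A A' affine_map_measurable by auto
  show "sets (distr \<nu> borel A) = sets borel" by simp
  have "distr (distr \<nu> borel A) borel A' = distr \<nu> borel (\<lambda>x. x)"
    by (subst distr_distr) (auto simp: comp_def inv)
  also have "\<dots> = \<nu>" by (rule distr_id2) (simp add: sn)
  finally have "distr (distr \<nu> borel A) borel A' = \<nu>" .
  then have "sigma_finite_measure (distr (distr \<nu> borel A) borel A')"
    using invariant_on_sigma_finite[OF \<nu>] by (simp only:)
  then show "sigma_finite_measure (distr \<nu> borel A)"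
    by (rule sigma_finite_measure_distr) simp
  have "closed W" using W by (rule closed_subspace)
  then have [measurable]: "W \<in> sets borel" by simp
  show "AE x in distr \<nu> borel A. x \<in> W"
    using invariant_on_AE[OF \<nu>] AW(1) by (subst AE_distr_iff) auto
  fix w assume w: "w \<in> W"
  obtain L c where L: "linear L" "\<And>x. A x = L x + c" using A by (auto simp: affine_map_def)
  obtain L' c' where L': "linear L'" "\<And>x. A' x = L' x + c'" using A' by (auto simp: affine_map_def)
  have "L' w = A' w - A' 0" by (simp add: L' linear_0)
  then have "L' w \<in> W" using AW(2) w W by (simp add: subspace_0 subspace_diff)
  have "A (A' w) - A (A' 0) = L (A' w - A' 0)" by (simp add: L(2) linear_diff[OF L(1)])
  then have "L (L' w) = w" by (simp add: inv \<open>L' w = A' w - A' 0\<close>)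
  then have "w + A x = A (L' w + x)" for x by (simp add: L(2) linear_add[OF L(1)])
  then have "distr (distr \<nu> borel A) borel ((+) w) = distr (distr \<nu> borel ((+) (L' w))) borel A"
    by (subst (1 2) distr_distr) (auto simp: comp_def)
  then show "distr (distr \<nu> borel A) borel ((+) w) = distr \<nu> borel A"
    using invariant_on_distr[OF \<nu> \<open>L' w \<in> W\<close>] by simp
qed

text \<open>A change of variables without determinants: by uniqueness of invariant measures the
  image measure is a multiple of \<nu>, and the factor is read off from one pair of sets that
  correspond under A.\<close>

lemma invariant_on_affine_scaling:
  assumes \<nu>: "invariant_on W \<nu>" "distr \<nu> borel uminus = \<nu>" and W: "subspace W"
    and A: "affine_map A" and A': "affine_map A'" and inv: "\<And>x. A' (A x) = x" "\<And>x. A (A' x) = x"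
    and AW: "\<And>x. x \<in> W \<Longrightarrow> A x \<in> W" "\<And>x. x \<in> W \<Longrightarrow> A' x \<in> W"
    and T: "T \<in> sets borel" "T' \<in> sets borel" "A -` T' = T"
    and pos: "measure \<nu> T > 0" "measure \<nu> T' > 0"
  shows "distr \<nu> borel A = density \<nu> (\<lambda>_. ennreal (measure \<nu> T / measure \<nu> T'))"
proof (rule measure_eqI)
  have sn [measurable_cong]: "sets \<nu> = sets borel" using \<nu> invariant_on_sets by blast
  then have spn: "space \<nu> = UNIV" by (metis sets_eq_imp_space_eq space_borel)
  have [measurable]: "A \<in> borel_measurable borel" using A affine_map_measurable by auto
  \<comment> \<open>\<open>measure\<close> is 0 on sets of infinite measure, so positivity implies
    finiteness.\<close>
  have fin: "emeasure \<nu> T = ennreal (measure \<nu> T)" "emeasure \<nu> T' = ennreal (measure \<nu> T')"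
    using pos by (metis emeasure_eq_ennreal_measure measure_zero_top less_irrefl top.extremum_strict)+
  show "sets (distr \<nu> borel A) = sets (density \<nu> (\<lambda>_. ennreal (measure \<nu> T / measure \<nu> T')))"
    by (simp add: sn)
  fix X assume "X \<in> sets (distr \<nu> borel A)"
  then have [measurable]: "X \<in> sets borel" by simp
  have "emeasure (distr \<nu> borel A) X * emeasure \<nu> T' = emeasure \<nu> X * emeasure (distr \<nu> borel A) T'"
    by (rule invariant_on_unique[OF invariant_on_affine_image[OF \<nu>(1) W A A' inv AW] \<nu>]) (use T in auto)
  also have "emeasure (distr \<nu> borel A) T' = emeasure \<nu> T"
    using T by (subst emeasure_distr) (auto simp: spn)
  finally have "emeasure (distr \<nu> borel A) X * ennreal (measure \<nu> T') = emeasure \<nu> X * ennreal (measure \<nu> T)"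
    by (simp add: fin)
  then have "emeasure (distr \<nu> borel A) X * ennreal (measure \<nu> T') * ennreal (1 / measure \<nu> T') =
      emeasure \<nu> X * ennreal (measure \<nu> T) * ennreal (1 / measure \<nu> T')" by simp
  then have "emeasure (distr \<nu> borel A) X = emeasure \<nu> X * ennreal (measure \<nu> T / measure \<nu> T')"
    using pos by (simp add: mult.assoc ennreal_mult'[symmetric])
  then show "emeasure (distr \<nu> borel A) X = emeasure (density \<nu> (\<lambda>_. ennreal (measure \<nu> T / measure \<nu> T'))) X"
    by (subst emeasure_density) (auto simp: sn nn_integral_cmult_indicator mult.commute[of "emeasure \<nu> X"])
qed

lemma lborel_invariant:
  "invariant_on UNIV (lborel :: 'a measure)" "distr lborel borel uminus = (lborel :: 'a::euclidean_space measure)"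
proof -
  show "invariant_on UNIV (lborel :: 'a measure)"
    by (auto simp: invariant_on_def lborel_distr_plus sigma_finite_lborel)
  show "distr lborel borel uminus = (lborel :: 'a::euclidean_space measure)"
    using lborel_affine[of "-1" "0::'a"] by (simp add: density_1)
qed

text \<open>The ratio of the two volumes stands in for the Jacobian determinant.\<close>

lemma affine_change_of_variables:
  fixes A A' :: "'a::euclidean_space \<Rightarrow> 'a" and g :: "'a \<Rightarrow> real"
  assumes A: "affine_map A" "affine_map A'" and inv: "\<And>x. A' (A x) = x" "\<And>x. A (A' x) = x"
    and T: "T \<in> sets borel" "T' \<in> sets borel" "\<And>x. A x \<in> T' \<longleftrightarrow> x \<in> T"
    and pos: "measure lborel T > 0" "measure lborel T' > 0" and g: "g \<in> borel_measurable borel"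
  shows "(\<integral>x. indicator T x * g (A x) \<partial>lborel) =
    measure lborel T / measure lborel T' * (\<integral>x. indicator T' x * g x \<partial>lborel)"
proof -
  have [measurable]: "A \<in> borel_measurable borel" using A affine_map_measurable by auto
  have "(\<integral>x. indicator T x * g (A x) \<partial>lborel) = (\<integral>x. indicator T' (A x) * g (A x) \<partial>lborel)"
    by (intro Bochner_Integration.integral_cong refl) (use T(3) in \<open>auto simp: indicator_def\<close>)
  also have "\<dots> = (\<integral>x. indicator T' x * g x \<partial>distr lborel borel A)"
    using T g by (subst integral_distr) auto
  also have "distr lborel borel A = density lborel (\<lambda>_. ennreal (measure lborel T / measure lborel T'))"
    by (rule invariant_on_affine_scaling[OF lborel_invariant _ A inv]) (use T pos in auto)
  also have "(\<integral>x. indicator T' x * g x \<partial>\<dots>) = (\<integral>x. measure lborel T / measure lborel T' * (indicator T' x * g x) \<partial>lborel)"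
    using T g by (subst integral_density) auto
  finally show ?thesis by simp
qed

section \<open>Lebesgue measure on a linear subspace, in orthonormal coordinates\<close>

definition plane_measure :: "'a::euclidean_space set \<Rightarrow> 'a measure" where
  "plane_measure B = distr (Pi\<^sub>M B (\<lambda>_. lborel)) borel (\<lambda>c. \<Sum>b\<in>B. c b *\<^sub>R b)"

locale orthonormal =
  fixes B :: "'a::euclidean_space set"
  assumes fin: "finite B" and orth: "pairwise orthogonal B" and unit: "\<And>b. b \<in> B \<Longrightarrow> norm b = 1"
begin

sublocale P: product_sigma_finite "\<lambda>_::'a. lborel :: real measure"
  by standard

abbreviation "PB \<equiv> Pi\<^sub>M B (\<lambda>_. lborel :: real measure)"
abbreviation "emb c \<equiv> (\<Sum>b\<in>B. c b *\<^sub>R b)"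

lemma inner_B: "b \<in> B \<Longrightarrow> b' \<in> B \<Longrightarrow> b \<bullet> b' = (if b = b' then 1 else 0)"
  using orth unit[of b] by (auto simp: pairwise_def orthogonal_def norm_eq_1)

lemma emb_inner: "b \<in> B \<Longrightarrow> emb c \<bullet> b = c b"
proof -
  assume b: "b \<in> B"
  have "emb c \<bullet> b = (\<Sum>b'\<in>B. if b' = b then c b' else 0)"
    unfolding inner_sum_left by (rule sum.cong) (use b in \<open>auto simp: inner_B\<close>)
  then show ?thesis using b fin by simp
qed

lemma emb_span: "emb c \<in> span B"
  by (intro span_sum span_scale span_base)

lemma emb_expand: "w \<in> span B \<Longrightarrow> emb (\<lambda>b. w \<bullet> b) = w"
proof -
  assume "w \<in> span B"
  then obtain u where "w = emb u" using span_finite[OF fin] by auto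
  then show ?thesis using emb_inner by (metis (no_types, lifting) sum.cong)
qed

lemma emb_measurable [measurable]: "emb \<in> borel_measurable PB"
  by measurable

lemma plane_distr: "plane_measure B = distr PB borel emb"
  by (simp add: plane_measure_def)

text \<open>Applied to translations and to reflections of the coordinates, this gives the two
  symmetries of the plane measure.\<close>

lemma shift_PB:
  assumes T: "\<And>b. b \<in> B \<Longrightarrow> T b \<in> borel_measurable borel" "\<And>b. b \<in> B \<Longrightarrow> distr lborel borel (T b) = (lborel :: real measure)"
  shows "distr PB PB (\<lambda>c. \<lambda>b\<in>B. T b (c b)) = PB"
proof (rule P.PiM_eqI[OF fin])
  have m: "(\<lambda>c. \<lambda>b\<in>B. T b (c b)) \<in> measurable PB PB"
    using T(1) by (intro measurable_restrict) (auto intro: measurable_compose[OF measurable_component_singleton])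
  show "sets (distr PB PB (\<lambda>c. \<lambda>b\<in>B. T b (c b))) = sets PB" by simp
  fix X :: "'a \<Rightarrow> real set" assume X: "\<And>b. b \<in> B \<Longrightarrow> X b \<in> sets lborel"
  have "emeasure (distr PB PB (\<lambda>c. \<lambda>b\<in>B. T b (c b))) (Pi\<^sub>E B X) =
      emeasure PB ((\<lambda>c. \<lambda>b\<in>B. T b (c b)) -` Pi\<^sub>E B X \<inter> space PB)"
    by (rule emeasure_distr[OF m]) (use X fin in \<open>auto intro!: sets_PiM_I_finite\<close>)
  also have "(\<lambda>c. \<lambda>b\<in>B. T b (c b)) -` Pi\<^sub>E B X \<inter> space PB = Pi\<^sub>E B (\<lambda>b. T b -` X b)"
    by (auto simp: space_PiM PiE_iff)
  also have "emeasure PB \<dots> = (\<Prod>b\<in>B. emeasure lborel (T b -` X b))"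
    by (rule P.emeasure_PiM[OF fin]) (use X T(1) in \<open>auto intro: measurable_sets_borel\<close>)
  also have "\<dots> = (\<Prod>b\<in>B. emeasure lborel (X b))"
  proof (rule prod.cong[OF refl])
    fix b assume b: "b \<in> B"
    have "emeasure lborel (T b -` X b) = emeasure (distr lborel borel (T b)) (X b)"
      using X[OF b] T(1)[OF b] by (subst emeasure_distr) auto
    then show "emeasure lborel (T b -` X b) = emeasure lborel (X b)" by (simp add: T(2)[OF b])
  qed
  finally show "emeasure (distr PB PB (\<lambda>c. \<lambda>b\<in>B. T b (c b))) (Pi\<^sub>E B X) = (\<Prod>b\<in>B. emeasure lborel (X b))" .
qed

text \<open>In coordinates, translation by w in the span shifts the entry of b by
  \<open>w \<bullet> b\<close>. Sigma-finiteness comes from the product measure, which is recovered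
  by mapping the plane measure back to coordinates.\<close>

lemma plane_invariant: "invariant_on (span B) (plane_measure B)"
  unfolding invariant_on_def
proof (intro conjI ballI)
  show "sets (plane_measure B) = sets borel" by (simp add: plane_measure_def)
  have m: "(\<lambda>x. \<lambda>b\<in>B. x \<bullet> b) \<in> measurable borel PB"
    by (intro measurable_restrict) auto
  have "distr (plane_measure B) PB (\<lambda>x. \<lambda>b\<in>B. x \<bullet> b) = distr PB PB (\<lambda>c. \<lambda>b\<in>B. emb c \<bullet> b)"
    unfolding plane_distr using m by (subst distr_distr) (auto simp: comp_def)
  also have "\<dots> = distr PB PB (\<lambda>c. c)"
  proof (rule distr_cong)
    fix c assume "c \<in> space PB"
    then have "c b = undefined" if "b \<notin> B" for b using that by (auto simp: space_PiM PiE_def extensional_def)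
    then show "(\<lambda>b\<in>B. emb c \<bullet> b) = c" by (auto simp: fun_eq_iff emb_inner)
  qed auto
  finally have "distr (plane_measure B) PB (\<lambda>x. \<lambda>b\<in>B. x \<bullet> b) = PB" by simp
  moreover have "sigma_finite_measure PB" by (rule P.sigma_finite[OF fin])
  ultimately have "sigma_finite_measure (distr (plane_measure B) PB (\<lambda>x. \<lambda>b\<in>B. x \<bullet> b))"
    by (simp only:)
  then show "sigma_finite_measure (plane_measure B)"
    by (rule sigma_finite_measure_distr) (use m in \<open>simp add: plane_measure_def\<close>)
  have "closed (span B)" by (rule closed_subspace) simp
  then show "AE x in plane_measure B. x \<in> span B"
    unfolding plane_distr by (subst AE_distr_iff) (auto simp: emb_span)
  fix w assume w: "w \<in> span B"
  have s: "(\<lambda>c. \<lambda>b\<in>B. w \<bullet> b + c b) \<in> measurable PB PB"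
    by (intro measurable_restrict) auto
  have "distr (plane_measure B) borel ((+) w) = distr PB borel (\<lambda>c. w + emb c)"
    unfolding plane_distr by (subst distr_distr) (auto simp: comp_def)
  also have "(\<lambda>c. w + emb c) = emb \<circ> (\<lambda>c. \<lambda>b\<in>B. w \<bullet> b + c b)"
  proof
    fix c
    have "w + emb c = emb (\<lambda>b. w \<bullet> b) + emb c" by (simp add: emb_expand[OF w])
    then show "w + emb c = (emb \<circ> (\<lambda>c. \<lambda>b\<in>B. w \<bullet> b + c b)) c"
      by (simp add: scaleR_add_left sum.distrib)
  qed
  also have "distr PB borel \<dots> = distr (distr PB PB (\<lambda>c. \<lambda>b\<in>B. w \<bullet> b + c b)) borel emb"
    using s by (subst distr_distr) auto
  also have "distr PB PB (\<lambda>c. \<lambda>b\<in>B. w \<bullet> b + c b) = PB"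
    by (rule shift_PB) (auto simp: lborel_distr_plus)
  finally show "distr (plane_measure B) borel ((+) w) = plane_measure B" by (simp add: plane_distr)
qed

lemma plane_uminus: "distr (plane_measure B) borel uminus = plane_measure B"
proof -
  have s: "(\<lambda>c. \<lambda>b\<in>B. - c b) \<in> measurable PB PB"
    by (intro measurable_restrict) auto
  have "distr (plane_measure B) borel uminus = distr PB borel (\<lambda>c. - emb c)"
    unfolding plane_distr by (subst distr_distr) (auto simp: comp_def)
  also have "(\<lambda>c. - emb c) = emb \<circ> (\<lambda>c. \<lambda>b\<in>B. - c b)"
    by (auto simp: fun_eq_iff sum_negf)
  also have "distr PB borel \<dots> = distr (distr PB PB (\<lambda>c. \<lambda>b\<in>B. - c b)) borel emb"
    using s by (subst distr_distr) auto
  also have "distr PB PB (\<lambda>c. \<lambda>b\<in>B. - c b) = PB"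
    by (rule shift_PB) (auto simp: lborel_distr_uminus)
  finally show ?thesis by (simp add: plane_distr)
qed

lemma plane_bounded_finite:
  assumes "bounded S" "S \<in> sets borel"
  shows "emeasure (plane_measure B) S < \<infinity>"
proof -
  obtain R where R: "\<And>x. x \<in> S \<Longrightarrow> norm x \<le> R" using assms(1) by (auto simp: bounded_iff)
  have "emeasure (plane_measure B) S = emeasure PB (emb -` S \<inter> space PB)"
    unfolding plane_distr using assms(2) by (simp add: emeasure_distr)
  also have "\<dots> \<le> emeasure PB (Pi\<^sub>E B (\<lambda>_. {- R..R}))"
  proof (rule emeasure_mono)
    show "emb -` S \<inter> space PB \<subseteq> Pi\<^sub>E B (\<lambda>_. {- R..R})"
    proof
      fix c assume c: "c \<in> emb -` S \<inter> space PB"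
      have "\<bar>c b\<bar> \<le> R" if b: "b \<in> B" for b
        using Cauchy_Schwarz_ineq2[of "emb c" b] R[of "emb c"] c by (simp add: emb_inner[OF b] unit[OF b])
      then show "c \<in> Pi\<^sub>E B (\<lambda>_. {- R..R})" using c by (auto simp: space_PiM PiE_iff abs_le_iff minus_le_iff)
    qed
    show "Pi\<^sub>E B (\<lambda>_. {- R..R}) \<in> sets PB" using fin by (auto intro!: sets_PiM_I_finite)
  qed
  also have "\<dots> = (\<Prod>b\<in>B. emeasure lborel {- R..R})" by (rule P.emeasure_PiM[OF fin]) simp
  also have "\<dots> < \<infinity>" by (simp add: less_top[symmetric] emeasure_lborel_Icc_eq power_eq_top_ennreal)
  finally show ?thesis .
qed

lemma plane_positive:
  assumes z: "z \<in> span B" and r: "r > 0" and S: "S \<in> sets borel" "span B \<inter> ball z r \<subseteq> S"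
  shows "emeasure (plane_measure B) S > 0"
proof -
  \<comment> \<open>If all coordinates are within d of those of z, the triangle inequality keeps the
    point inside the ball. The added 1 covers the zero-dimensional case of an empty B.\<close>
  define d where "d = r / (2 * (card B + 1))"
  have d: "d > 0" "card B * d < r" using r by (auto simp: d_def field_simps add_nonneg_pos)
  have "(0::ennreal) < (\<Prod>b\<in>B. emeasure lborel {z \<bullet> b - d..z \<bullet> b + d})"
  proof -
    have "emeasure lborel {z \<bullet> b - d..z \<bullet> b + d} = ennreal (2 * d)" for b
      using d by (simp add: emeasure_lborel_Icc_eq)
    then have "(\<Prod>b\<in>B. emeasure lborel {z \<bullet> b - d..z \<bullet> b + d}) = ennreal ((2 * d) ^ card B)"
      using d by (simp add: ennreal_power)
    then show ?thesis using d by simp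
  qed
  also have "\<dots> = emeasure PB (Pi\<^sub>E B (\<lambda>b. {z \<bullet> b - d..z \<bullet> b + d}))"
    by (rule P.emeasure_PiM[OF fin, symmetric]) simp
  also have "\<dots> \<le> emeasure PB (emb -` S \<inter> space PB)"
  proof (rule emeasure_mono)
    show "Pi\<^sub>E B (\<lambda>b. {z \<bullet> b - d..z \<bullet> b + d}) \<subseteq> emb -` S \<inter> space PB"
    proof
      fix c assume c: "c \<in> Pi\<^sub>E B (\<lambda>b. {z \<bullet> b - d..z \<bullet> b + d})"
      have "emb c - z = emb c - emb (\<lambda>b. z \<bullet> b)" by (simp add: emb_expand[OF z])
      also have "\<dots> = emb (\<lambda>b. c b - z \<bullet> b)" by (simp add: scaleR_diff_left sum_subtractf)
      finally have "norm (emb c - z) \<le> (\<Sum>b\<in>B. norm ((c b - z \<bullet> b) *\<^sub>R b))" by (simp only: norm_sum)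
      also have "\<dots> \<le> (\<Sum>b\<in>B. d)"
      proof (rule sum_mono)
        fix b assume b: "b \<in> B"
        then have "\<bar>c b - z \<bullet> b\<bar> \<le> d" using c by (auto simp: PiE_iff abs_le_iff)
        then show "norm ((c b - z \<bullet> b) *\<^sub>R b) \<le> d" by (simp add: unit[OF b])
      qed
      also have "\<dots> < r" using d by simp
      finally have "emb c \<in> span B \<inter> ball z r" using emb_span by (simp add: dist_norm norm_minus_commute)
      then show "c \<in> emb -` S \<inter> space PB" using S(2) c by (auto simp: space_PiM PiE_iff)
    qed
    show "emb -` S \<inter> space PB \<in> sets PB" using S(1) by (rule measurable_sets[OF emb_measurable])
  qed
  also have "\<dots> = emeasure (plane_measure B) S"
    unfolding plane_distr using S(1) by (simp add: emeasure_distr)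
  finally show ?thesis .
qed

end

section \<open>Simplices\<close>

text \<open>The coordinate of p is a normalised inner product with z, the part of
  \<open>p - q0\<close> that is orthogonal to the directions spanned by the remaining vertices.
  Affine independence makes z nonzero.\<close>

lemma barycentric_coordinates_exist:
  fixes V :: "'a::euclidean_space set"
  assumes V: "\<not> affine_dependent V"
  shows "\<exists>g k. \<forall>p\<in>V. \<forall>q\<in>V. g p \<bullet> q + k p = (if p = q then 1 else (0::real))"
proof -
  have "\<exists>g k. \<forall>q\<in>V. g \<bullet> q + k = (if p = q then 1 else (0::real))" if p: "p \<in> V" for p
  proof (cases "V = {p}")
    case True
    then have "\<forall>q\<in>V. 0 \<bullet> q + 1 = (if p = q then 1 else (0::real))" by auto
    then show ?thesis by blast
  next
    case False
    then obtain q0 where q0: "q0 \<in> V - {p}" using p by blast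
    let ?S = "(\<lambda>q. - q0 + q) ` (V - {p} - {q0})"
    have "p \<notin> affine hull (V - {p})" using V p by (auto simp: affine_dependent_def)
    also have "affine hull (V - {p}) = (\<lambda>x. q0 + x) ` span ?S"
      using affine_hull_span2[OF q0] .
    finally have notin: "p - q0 \<notin> span ?S" by (force simp: image_iff)
    obtain y z where yz: "y \<in> span ?S" "\<And>w. w \<in> span ?S \<Longrightarrow> orthogonal z w" "p - q0 = y + z"
      using orthogonal_subspace_decomp_exists[of ?S "p - q0"] by blast
    have z0: "z \<noteq> 0" using yz notin by auto
    have zq: "z \<bullet> q = z \<bullet> q0" if "q \<in> V" "q \<noteq> p" for q
    proof (cases "q = q0")
      case False
      with that have "q - q0 \<in> span ?S" by (intro span_base) (auto simp: image_iff)
      then show ?thesis using yz(2) by (fastforce simp: orthogonal_def inner_diff_right)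
    qed simp
    have zp: "z \<bullet> p - z \<bullet> q0 = z \<bullet> z"
    proof -
      have "z \<bullet> (p - q0) = z \<bullet> y + z \<bullet> z" by (simp add: yz(3) inner_add_right)
      moreover have "z \<bullet> y = 0" using yz(1,2) by (auto simp: orthogonal_def)
      ultimately show ?thesis by (simp add: inner_diff_right)
    qed
    have "\<forall>q\<in>V. (z /\<^sub>R (z \<bullet> z)) \<bullet> q + - (z \<bullet> q0) / (z \<bullet> z) = (if p = q then 1 else (0::real))"
    proof
      fix q assume q: "q \<in> V"
      have "(z /\<^sub>R (z \<bullet> z)) \<bullet> q + - (z \<bullet> q0) / (z \<bullet> z) = (z \<bullet> q - z \<bullet> q0) / (z \<bullet> z)"
        by (simp add: field_simps diff_divide_distrib)
      then show "(z /\<^sub>R (z \<bullet> z)) \<bullet> q + - (z \<bullet> q0) / (z \<bullet> z) = (if p = q then 1 else (0::real))"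
        using zp zq[OF q] z0 by auto
    qed
    then show ?thesis by blast
  qed
  then show ?thesis by metis
qed

text \<open>The coordinates are affine functions on the whole space, also for lower-dimensional
  simplices such as facets, where the values off the affine hull depend on the selection.\<close>

definition bary_coeffs :: "'a::euclidean_space set \<Rightarrow> ('a \<Rightarrow> 'a) \<times> ('a \<Rightarrow> real)" where
  "bary_coeffs V = (SOME (g, k). \<forall>p\<in>V. \<forall>q\<in>V. g p \<bullet> q + k p = (if p = q then 1 else 0))"

definition "bgrad V = fst (bary_coeffs V)"
definition "bary V p x = bgrad V p \<bullet> x + snd (bary_coeffs V) p"

lemma bary_vertex:
  assumes "\<not> affine_dependent V" "p \<in> V" "q \<in> V"
  shows "bary V p q = (if p = q then 1 else 0)"
proof -
  have "\<exists>x. case x of (g, k) \<Rightarrow> \<forall>p\<in>V. \<forall>q\<in>V. g p \<bullet> q + k p = (if p = q then 1 else (0::real))"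
    using barycentric_coordinates_exist[OF assms(1)] by auto
  from someI_ex[OF this] show ?thesis
    using assms(2,3) unfolding bary_def bgrad_def bary_coeffs_def by (auto simp: split_beta')
qed

lemma bary_diff: "bary V p x - bary V p y = bgrad V p \<bullet> (x - y)"
  by (simp add: bary_def inner_diff_right)

lemma bary_continuous: "continuous_on S (bary V p)"
  unfolding bary_def by (intro continuous_intros)

lemma bary_measurable [measurable]: "bary V p \<in> borel_measurable borel"
  by (intro borel_measurable_continuous_onI bary_continuous)

lemma bary_affine_comb:
  assumes "finite V" "sum u V = 1"
  shows "bary W p (\<Sum>q\<in>V. u q *\<^sub>R q) = (\<Sum>q\<in>V. u q * bary W p q)"
proof -
  have "(\<Sum>q\<in>V. u q * bary W p q) = (\<Sum>q\<in>V. u q * (bgrad W p \<bullet> q)) + sum u V * snd (bary_coeffs W) p"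
    by (simp add: bary_def distrib_left sum.distrib sum_distrib_right)
  then show ?thesis using assms by (simp add: bary_def inner_sum_right)
qed

lemma bary_of_affine_comb:
  assumes "\<not> affine_dependent V" "sum u V = 1" "p \<in> V"
  shows "bary V p (\<Sum>q\<in>V. u q *\<^sub>R q) = u p"
proof -
  have f: "finite V" using assms(1) aff_independent_finite by blast
  have "(\<Sum>q\<in>V. u q * bary V p q) = (\<Sum>q\<in>V. if q = p then u q else 0)"
    by (rule sum.cong) (use assms in \<open>auto simp: bary_vertex\<close>)
  then show ?thesis using f assms bary_affine_comb[OF f assms(2)] by simp
qed

lemma
  assumes "\<not> affine_dependent V" "x \<in> affine hull V"
  shows bary_sum: "(\<Sum>p\<in>V. bary V p x) = 1" and bary_repr: "(\<Sum>p\<in>V. bary V p x *\<^sub>R p) = x"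
proof -
  have f: "finite V" using assms(1) aff_independent_finite by blast
  then obtain u where u: "sum u V = 1" "(\<Sum>q\<in>V. u q *\<^sub>R q) = x"
    using assms(2) by (auto simp: affine_hull_finite)
  then have "bary V p x = u p" if "p \<in> V" for p
    using bary_of_affine_comb[OF assms(1) u(1) that] by simp
  then show "(\<Sum>p\<in>V. bary V p x) = 1" "(\<Sum>p\<in>V. bary V p x *\<^sub>R p) = x" using u by simp_all
qed

lemma in_simplex_iff:
  assumes "\<not> affine_dependent V" "x \<in> affine hull V"
  shows "x \<in> convex hull V \<longleftrightarrow> (\<forall>p\<in>V. 0 \<le> bary V p x)"
proof
  have f: "finite V" using assms(1) aff_independent_finite by blast
  assume "x \<in> convex hull V"
  then obtain u where u: "\<forall>p\<in>V. 0 \<le> u p" "sum u V = 1" "(\<Sum>q\<in>V. u q *\<^sub>R q) = x"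
    using f by (auto simp: convex_hull_finite)
  then show "\<forall>p\<in>V. 0 \<le> bary V p x"
    using bary_of_affine_comb[OF assms(1) u(2)] by auto
next
  have f: "finite V" using assms(1) aff_independent_finite by blast
  assume "\<forall>p\<in>V. 0 \<le> bary V p x"
  then show "x \<in> convex hull V"
    using bary_sum[OF assms] bary_repr[OF assms] f
    by (auto simp: convex_hull_finite intro!: exI[of _ "\<lambda>p. bary V p x"])
qed

section \<open>Full-dimensional simplices\<close>

locale full_simplex =
  fixes V :: "'a::euclidean_space set"
  assumes indep: "\<not> affine_dependent V" and card: "card V = DIM('a) + 1"
begin

lemma finite [simp]: "finite V"
  using indep aff_independent_finite by blast

lemma hull [simp]: "affine hull V = UNIV"
proof -
  have "aff_dim (affine hull V) = DIM('a)"
    using aff_dim_affine_independent[OF indep] card by simp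
  then show ?thesis using affine_affine_hull aff_dim_eq_full[of "affine hull V"] by (simp add: hull_hull)
qed

lemmas sum1 = bary_sum[OF indep, simplified] and repr = bary_repr[OF indep, simplified]
  and in_iff = in_simplex_iff[OF indep, simplified]

lemma grad_sum: "(\<Sum>p\<in>V. bgrad V p) = 0"
proof (rule euclidean_eqI)
  fix b :: 'a
  have "(\<Sum>p\<in>V. bary V p b - bary V p 0) = 0" by (simp add: sum_subtractf sum1)
  then show "(\<Sum>p\<in>V. bgrad V p) \<bullet> b = 0 \<bullet> b" by (simp add: bary_diff inner_sum_left)
qed

text \<open>In matrix form, the sum over p of the outer products of p with its coordinate gradient
  is the identity; \<open>grad_repr'\<close> is the transpose of this. Both follow from reproduction
  of affine functions by differencing.\<close>

lemma grad_repr: "(\<Sum>p\<in>V. (bgrad V p \<bullet> w) *\<^sub>R p) = w"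
proof -
  have "(\<Sum>p\<in>V. (bary V p w - bary V p 0) *\<^sub>R p) = w"
    by (simp add: scaleR_diff_left sum_subtractf repr)
  then show ?thesis by (simp add: bary_diff)
qed

lemma grad_repr': "(\<Sum>p\<in>V. (w \<bullet> p) *\<^sub>R bgrad V p) = w"
proof (rule euclidean_eqI)
  fix b :: 'a
  have "(\<Sum>p\<in>V. (w \<bullet> p) *\<^sub>R bgrad V p) \<bullet> b = w \<bullet> (\<Sum>p\<in>V. (bgrad V p \<bullet> b) *\<^sub>R p)"
    by (simp add: inner_sum_left inner_sum_right mult.commute)
  then show "(\<Sum>p\<in>V. (w \<bullet> p) *\<^sub>R bgrad V p) \<bullet> b = w \<bullet> b" by (simp add: grad_repr)
qed

lemma card_ge_2: "2 \<le> card V"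
  using card DIM_positive[where 'a='a] by linarith

lemma grad_nonzero: "p \<in> V \<Longrightarrow> bgrad V p \<noteq> 0"
proof
  assume p: "p \<in> V" and 0: "bgrad V p = 0"
  have "V - {p} \<noteq> {}" using card_ge_2 p by (metis card_1_singleton_iff card_gt_0_iff finite insert_Diff_single insert_absorb One_nat_def card.empty card_insert_disjoint finite.emptyI less_irrefl not_numeral_le_zero Suc_1 Suc_n_not_le_n insert_not_empty)
  then obtain q where "q \<in> V" "q \<noteq> p" by blast
  then have "bary V p p - bary V p q = 1" using p by (simp add: bary_vertex[OF indep])
  then show False by (simp add: bary_diff 0)
qed

lemma interior_iff: "x \<in> interior (convex hull V) \<longleftrightarrow> (\<forall>p\<in>V. 0 < bary V p x)"
proof
  assume x: "x \<in> interior (convex hull V)"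
  show "\<forall>p\<in>V. 0 < bary V p x"
  proof
    fix p assume p: "p \<in> V"
    obtain e where e: "e > 0" "ball x e \<subseteq> convex hull V" using x by (meson mem_interior)
    \<comment> \<open>A small step against the gradient stays in the simplex, where the coordinate
      is still nonnegative, and yet it strictly lowers the coordinate.\<close>
    define t where "t = e / (2 * norm (bgrad V p))"
    have t: "t > 0" "t * norm (bgrad V p) < e" using e grad_nonzero[OF p] by (auto simp: t_def)
    then have "x - t *\<^sub>R bgrad V p \<in> ball x e" by (simp add: dist_norm)
    then have "0 \<le> bary V p (x - t *\<^sub>R bgrad V p)" using e(2) p in_iff by blast
    moreover have "bary V p x - bary V p (x - t *\<^sub>R bgrad V p) = t * (bgrad V p \<bullet> bgrad V p)"
      by (simp add: bary_diff)
    moreover have "t * (bgrad V p \<bullet> bgrad V p) > 0" using t grad_nonzero[OF p] by simp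
    ultimately show "0 < bary V p x" by linarith
  qed
next
  assume x: "\<forall>p\<in>V. 0 < bary V p x"
  let ?U = "\<Inter>p\<in>V. {y. 0 < bary V p y}"
  have "open ?U"
    by (intro open_INT ballI finite open_Collect_less continuous_on_const bary_continuous)
  moreover have "?U \<subseteq> convex hull V" by (force simp: in_iff less_imp_le)
  moreover have "x \<in> ?U" using x by auto
  ultimately show "x \<in> interior (convex hull V)" using interiorI by blast
qed

lemma interior_nonempty: "interior (convex hull V) \<noteq> {}"
proof -
  have "bary V p (\<Sum>q\<in>V. (1 / card V) *\<^sub>R q) = 1 / card V" if "p \<in> V" for p
    using bary_of_affine_comb[OF indep _ that, of "\<lambda>_. 1 / card V"] card by simp
  then have "(\<Sum>q\<in>V. (1 / card V) *\<^sub>R q) \<in> interior (convex hull V)"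
    unfolding interior_iff using card by simp
  then show ?thesis by blast
qed

lemma compact_T: "compact (convex hull V)"
  by (simp add: finite_imp_compact_convex_hull)

lemma T_borel [measurable]: "convex hull V \<in> sets borel"
  using compact_T by (simp add: borel_compact)

lemma open_K: "open (interior (convex hull V))" and bounded_K: "bounded (interior (convex hull V))"
  using compact_T by (auto intro: bounded_subset[OF compact_imp_bounded interior_subset])

lemma K_lmeasurable: "interior (convex hull V) \<in> lmeasurable"
  using open_K bounded_K open_lmeasurable by blast

lemma AE_interior: "AE x in lebesgue. x \<in> convex hull V \<longrightarrow> x \<in> interior (convex hull V)"
proof -
  have "negligible (frontier (convex hull V))" by (rule negligible_convex_frontier) simp
  then have "AE x in lebesgue. x \<notin> frontier (convex hull V)"
    by (simp add: negligible_iff_null_sets AE_not_in)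
  then show ?thesis
    by (rule eventually_mono) (use closure_subset in \<open>auto simp: frontier_def\<close>)
qed

text \<open>The function spaces use Lebesgue measure on open elements, the geometric arguments use
  \<open>lborel\<close> on closed simplices. The boundary of a convex set is null.\<close>

lemma integral_T:
  fixes f :: "'a \<Rightarrow> 'b::euclidean_space"
  assumes "f \<in> borel_measurable borel"
  shows "(\<integral>x. f x \<partial>lebesgue_on (interior (convex hull V))) = (\<integral>x. indicator (convex hull V) x *\<^sub>R f x \<partial>lborel)"
proof -
  have "(\<integral>x. f x \<partial>lebesgue_on (interior (convex hull V))) = (\<integral>x. indicator (interior (convex hull V)) x *\<^sub>R f x \<partial>lebesgue)"
    by (rule integral_lebesgue_on) (rule open_sets_lebesgue[OF open_K])
  also have "\<dots> = (\<integral>x. indicator (convex hull V) x *\<^sub>R f x \<partial>lebesgue)"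
  proof (rule integral_cong_AE)
    have f': "f \<in> borel_measurable lebesgue" using assms by (intro measurable_completion) simp
    show "(\<lambda>x. indicat_real (interior (convex hull V)) x *\<^sub>R f x) \<in> borel_measurable lebesgue"
      by (intro borel_measurable_scaleR borel_measurable_indicator f') (rule open_sets_lebesgue[OF open_K])
    show "(\<lambda>x. indicat_real (convex hull V) x *\<^sub>R f x) \<in> borel_measurable lebesgue"
      by (intro borel_measurable_scaleR borel_measurable_indicator f') simp
    show "AE x in lebesgue. indicat_real (interior (convex hull V)) x *\<^sub>R f x = indicat_real (convex hull V) x *\<^sub>R f x"
      using AE_interior by (rule eventually_mono) (use interior_subset in \<open>auto simp: indicator_def\<close>)
  qed
  also have "\<dots> = (\<integral>x. indicator (convex hull V) x *\<^sub>R f x \<partial>lborel)"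
    using assms by (intro integral_completion) simp
  finally show ?thesis .
qed

lemma measure_K: "measure lebesgue (interior (convex hull V)) = measure lborel (convex hull V)"
proof -
  have "measure lebesgue (interior (convex hull V)) = (\<integral>x. 1 \<partial>lebesgue_on (interior (convex hull V)))"
    using K_lmeasurable by (simp add: lmeasure_integral lebesgue_integral_eq_integral measure_restrict_space fmeasurableD)
  also have "\<dots> = measure lborel (convex hull V)"
    by (subst integral_T) auto
  finally show ?thesis .
qed

lemma measure_pos: "0 < measure lborel (convex hull V)"
proof -
  have "\<not> negligible (interior (convex hull V))"
    using open_not_negligible open_K interior_nonempty by blast
  then have "measure lebesgue (interior (convex hull V)) \<noteq> 0"
    using K_lmeasurable negligible_iff_measure by blast
  then have "measure lborel (convex hull V) \<noteq> 0" using measure_K by metis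
  then show ?thesis by (simp add: zero_less_measure_iff)
qed

lemma continuous_T_int:
  fixes f :: "'a \<Rightarrow> 'b::euclidean_space"
  assumes "continuous_on UNIV f"
  shows "integrable lborel (\<lambda>x. indicator (convex hull V) x *\<^sub>R f x)"
  using borel_integrable_compact[OF compact_T, of f] assms continuous_on_subset
  by (auto simp: indicator_scaleR_eq_if if_distrib)

end

text \<open>The affine involution that exchanges the vertices p and q maps the simplex onto itself
  and exchanges the two coordinates. It preserves the measure, since its scaling factor can be read
  off on the simplex itself and is therefore 1.\<close>

lemma swap_invariant:
  fixes \<nu> :: "'a::euclidean_space measure"
  assumes \<nu>: "invariant_on W \<nu>" "distr \<nu> borel uminus = \<nu>" and W: "subspace W"
    and V: "\<not> affine_dependent V" and a: "affine hull V = (+) a ` W"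
    and pq: "p \<in> V" "q \<in> V"
    and pos: "0 < measure \<nu> ((+) (- a) ` (convex hull V))"
  defines "T \<equiv> (+) (- a) ` (convex hull V)"
  shows "(\<integral>x. indicator (convex hull V) (a + x) * bary V p (a + x) \<partial>\<nu>) =
     (\<integral>x. indicator (convex hull V) (a + x) * bary V q (a + x) \<partial>\<nu> :: real)"
proof (cases "p = q")
  case False
  have f: "finite V" using V aff_independent_finite by blast
  have sn [measurable_cong]: "sets \<nu> = sets borel" using \<nu> invariant_on_sets by blast
  \<comment> \<open>The amount by which the two coordinates differ is moved from one vertex to the
    other, which exchanges them and leaves the remaining ones alone.\<close>
  define S where "S = (\<lambda>x. x + (bary V p x - bary V q x) *\<^sub>R (q - p))"
  define S' where "S' = (\<lambda>x. S (a + x) - a)"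
  have sb: "bary V r (S x) = bary V r x + (bary V p x - bary V q x) * (bary V r q - bary V r p)" for r x
  proof -
    have "bgrad V r \<bullet> (S x - x) = (bary V p x - bary V q x) * (bgrad V r \<bullet> (q - p))"
      by (simp add: S_def)
    then show ?thesis using bary_diff[of V r "S x" x] bary_diff[of V r q p] by simp
  qed
  have sp: "bary V p (S x) = bary V q x" "bary V q (S x) = bary V p x" for x
    unfolding sb using False pq by (simp_all add: bary_vertex[OF V])
  have so: "bary V r (S x) = bary V r x" if "r \<in> V" "r \<noteq> p" "r \<noteq> q" for r x
    unfolding sb using that pq by (simp add: bary_vertex[OF V])
  have invol: "S (S x) = x" for x
    unfolding S_def[THEN fun_cong, of "S x"] sp by (simp add: S_def algebra_simps)
  have qp: "q - p \<in> W"
  proof -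
    have "p \<in> (+) a ` W" "q \<in> (+) a ` W" using pq hull_inc[of _ V affine] a by auto
    then obtain u v where "u \<in> W" "v \<in> W" "p = a + u" "q = a + v" by auto
    then show ?thesis using subspace_diff[OF W] by simp
  qed
  have S'W: "S' x \<in> W" if "x \<in> W" for x
  proof -
    have "S' x = x + (bary V p (a + x) - bary V q (a + x)) *\<^sub>R (q - p)" by (simp add: S'_def S_def)
    then show ?thesis using that qp W by (simp add: subspace_add subspace_scale)
  qed
  have aff: "affine_map S'"
  proof -
    have "S' = (\<lambda>x. x + ((bgrad V p - bgrad V q) \<bullet> x + (bary V p a - bary V q a)) *\<^sub>R (q - p))"
      by (simp add: fun_eq_iff S'_def S_def bary_def inner_diff_left inner_add_right algebra_simps)
    then show ?thesis by (simp only: affine_map_shift)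
  qed
  have inv': "S' (S' x) = x" for x by (simp add: S'_def invol)
  have ST: "S y \<in> convex hull V \<longleftrightarrow> y \<in> convex hull V" if y: "y \<in> affine hull V" for y
  proof -
    have Sy: "S y \<in> affine hull V"
      using y S'W unfolding a S'_def by (auto simp: image_iff) (metis add_diff_cancel_left' add_diff_eq)
    have 1: "\<forall>r\<in>V. 0 \<le> bary V r (S z)" if nn: "\<forall>r\<in>V. 0 \<le> bary V r z" for z
    proof
      fix r assume r: "r \<in> V"
      consider "r = p" | "r = q" | "r \<noteq> p" "r \<noteq> q" by blast
      then show "0 \<le> bary V r (S z)"
        using nn pq r by cases (simp_all add: sp so)
    qed
    show ?thesis
      unfolding in_simplex_iff[OF V y] in_simplex_iff[OF V Sy]
      using 1[of y] 1[of "S y", unfolded invol] by blast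
  qed
  have aT: "a + x \<in> convex hull V \<longleftrightarrow> x \<in> T" for x
    unfolding T_def by (force simp: image_iff)
  have vim: "S' -` T = T"
  proof -
    have "S' x \<in> T \<longleftrightarrow> x \<in> T" for x
    proof (cases "x \<in> W")
      case True
      then have "a + x \<in> affine hull V" using a by auto
      then show ?thesis using ST[of "a + x"] by (simp add: aT[symmetric] S'_def)
    next
      \<comment> \<open>An involution that preserves W also preserves its complement, which T does
        not meet.\<close>
      case False
      have TW: "y \<in> W" if "y \<in> T" for y
      proof -
        have "a + y \<in> affine hull V" using that convex_hull_subset_affine_hull[of V] aT by blast
        then show ?thesis unfolding a by (auto simp: image_iff)
      qed
      then show ?thesis using False S'W[of "S' x"] inv' by metis
    qed
    then show ?thesis by auto
  qed
  have Tb [measurable]: "T \<in> sets borel"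
    unfolding T_def using f by (intro borel_compact compact_translation finite_imp_compact_convex_hull)
  have [measurable]: "S' \<in> borel_measurable borel" using aff by (rule affine_map_measurable)
  have "distr \<nu> borel S' = density \<nu> (\<lambda>_. ennreal (measure \<nu> T / measure \<nu> T))"
    by (rule invariant_on_affine_scaling[OF \<nu> W aff aff inv' inv' S'W S'W Tb Tb vim]) (use pos in \<open>auto simp: T_def\<close>)
  then have d: "distr \<nu> borel S' = \<nu>" using pos by (simp add: T_def density_1)
  let ?h = "\<lambda>r x. indicator T x * bary V r (a + x) :: real"
  have "(\<integral>x. ?h p x \<partial>\<nu>) = (\<integral>x. ?h p x \<partial>distr \<nu> borel S')" by (simp add: d)
  also have "\<dots> = (\<integral>x. ?h p (S' x) \<partial>\<nu>)"
    by (subst integral_distr) auto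
  also have "\<dots> = (\<integral>x. ?h q x \<partial>\<nu>)"
  proof (rule Bochner_Integration.integral_cong[OF refl])
    fix x
    have "indicator T (S' x) = (indicator T x :: real)" using vim by (auto simp: indicator_def)
    moreover have "a + S' x = S (a + x)" by (simp add: S'_def)
    ultimately show "?h p (S' x) = ?h q x" by (simp add: sp)
  qed
  finally show ?thesis by (simp add: indicator_def aT)
qed simp

text \<open>By symmetry all barycentric coordinates have the same integral; as they add up to 1 on
  the simplex, each has mean \<open>1 / card V\<close>. An affine function is the combination of its
  vertex values with these coordinates. The statement serves both volumes and facets.\<close>

lemma simplex_centroid:
  fixes \<nu> :: "'a::euclidean_space measure" and c :: 'a
  assumes \<nu>: "invariant_on W \<nu>" "distr \<nu> borel uminus = \<nu>" and W: "subspace W"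
    and V: "\<not> affine_dependent V" "V \<noteq> {}" and a: "affine hull V = (+) a ` W"
    and pos: "0 < measure \<nu> ((+) (- a) ` (convex hull V))"
  shows "(\<integral>x. indicator (convex hull V) (a + x) * (c \<bullet> (a + x) + k) \<partial>\<nu>) =
     measure \<nu> ((+) (- a) ` (convex hull V)) * (c \<bullet> ((1 / card V) *\<^sub>R \<Sum>V) + k)"
proof -
  have f: "finite V" using V aff_independent_finite by blast
  have sn [measurable_cong]: "sets \<nu> = sets borel" using \<nu> invariant_on_sets by blast
  let ?T = "(+) (- a) ` (convex hull V)"
  have aT: "a + x \<in> convex hull V \<longleftrightarrow> x \<in> ?T" for x by (force simp: image_iff)
  have ind: "indicator (convex hull V) (a + x) = (indicator ?T x :: real)" for x
    using aT by (simp add: indicator_def)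
  have cT: "compact ?T" using f by (intro compact_translation finite_imp_compact_convex_hull)
  then have Tb [measurable]: "?T \<in> sets borel" by (rule borel_compact)
  have fin: "emeasure \<nu> ?T < \<infinity>"
    using pos by (metis infinity_ennreal_def less_irrefl measure_zero_top top.not_eq_extremum)
  have int: "integrable \<nu> (\<lambda>x. indicator ?T x * (d \<bullet> (a + x) + l))" for d :: 'a and l :: real
  proof -
    have "compact ((\<lambda>x. d \<bullet> (a + x) + l) ` ?T)"
      by (intro compact_continuous_image continuous_intros cT)
    then have "bounded ((\<lambda>x. d \<bullet> (a + x) + l) ` ?T)" by (rule compact_imp_bounded)
    then obtain M where "\<forall>y\<in>(\<lambda>x. d \<bullet> (a + x) + l) ` ?T. norm y \<le> M"
      unfolding bounded_iff by blast
    then have M: "\<And>x. x \<in> ?T \<Longrightarrow> \<bar>d \<bullet> (a + x) + l\<bar> \<le> M" by (metis image_eqI real_norm_def)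
    show ?thesis
    proof (rule Bochner_Integration.integrable_bound)
      show "integrable \<nu> (\<lambda>x. M * indicator ?T x)"
        by (intro integrable_mult_right integrable_real_indicator) (simp_all only: fin sn Tb)
      show "AE x in \<nu>. norm (indicator ?T x * (d \<bullet> (a + x) + l)) \<le> norm (M * indicator ?T x)"
        using M by (intro AE_I2) (auto simp: indicator_def intro: order_trans[OF _ abs_ge_self])
    qed measurable
  qed
  define J where "J p = (\<integral>x. indicator ?T x * bary V p (a + x) \<partial>\<nu>)" for p
  have bint: "integrable \<nu> (\<lambda>x. indicator ?T x * bary V p (a + x))" for p
    unfolding bary_def by (rule int)
  have Jeq: "J p = J q" if "p \<in> V" "q \<in> V" for p q
    using swap_invariant[OF \<nu> W V(1) a that pos] unfolding J_def ind by simp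
  have Jsum: "(\<Sum>p\<in>V. J p) = measure \<nu> ?T"
  proof -
    have "(\<Sum>p\<in>V. J p) = (\<integral>x. (\<Sum>p\<in>V. indicator ?T x * bary V p (a + x)) \<partial>\<nu>)"
      unfolding J_def using bint by (subst Bochner_Integration.integral_sum) auto
    also have "\<dots> = (\<integral>x. indicator ?T x \<partial>\<nu>)"
    proof (rule Bochner_Integration.integral_cong[OF refl])
      fix x
      show "(\<Sum>p\<in>V. indicator ?T x * bary V p (a + x)) = (indicator ?T x :: real)"
      proof (cases "x \<in> ?T")
        case True
        then have "a + x \<in> affine hull V" using convex_hull_subset_affine_hull[of V] aT by blast
        then show ?thesis using True by (simp add: bary_sum[OF V(1)])
      qed simp
    qed
    finally show ?thesis using sets_eq_imp_space_eq[OF sn] by simp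
  qed
  have J: "J p = measure \<nu> ?T / card V" if p: "p \<in> V" for p
  proof -
    have "(\<Sum>q\<in>V. J q) = (\<Sum>q\<in>V. J p)" by (rule sum.cong[OF refl]) (rule Jeq[OF _ p])
    then have "measure \<nu> ?T = card V * J p" using Jsum by simp
    moreover have "card V \<noteq> 0" using f V(2) by simp
    ultimately show ?thesis by (simp add: field_simps)
  qed
  have "(\<integral>x. indicator ?T x * (c \<bullet> (a + x) + k) \<partial>\<nu>) =
      (\<integral>x. (\<Sum>p\<in>V. (c \<bullet> p + k) * (indicator ?T x * bary V p (a + x))) \<partial>\<nu>)"
  proof (rule Bochner_Integration.integral_cong[OF refl])
    fix x
    show "indicator ?T x * (c \<bullet> (a + x) + k) = (\<Sum>p\<in>V. (c \<bullet> p + k) * (indicator ?T x * bary V p (a + x)))"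
    proof (cases "x \<in> ?T")
      case True
      then have h: "a + x \<in> affine hull V" using convex_hull_subset_affine_hull[of V] aT by blast
      have "c \<bullet> (a + x) + k = c \<bullet> (\<Sum>p\<in>V. bary V p (a + x) *\<^sub>R p) + k * (\<Sum>p\<in>V. bary V p (a + x))"
        by (simp only: bary_sum[OF V(1) h] bary_repr[OF V(1) h] mult_1_right)
      also have "\<dots> = (\<Sum>p\<in>V. (c \<bullet> p + k) * bary V p (a + x))"
        by (simp add: inner_sum_right sum_distrib_left sum.distrib[symmetric] algebra_simps)
      finally show ?thesis using True by simp
    qed simp
  qed
  also have "\<dots> = (\<Sum>p\<in>V. (c \<bullet> p + k) * J p)"
    unfolding J_def using bint by (subst Bochner_Integration.integral_sum) auto
  also have "\<dots> = (\<Sum>p\<in>V. (c \<bullet> p + k)) * (measure \<nu> ?T / card V)"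
    unfolding sum_distrib_right by (rule sum.cong[OF refl]) (simp only: J)
  also have "(\<Sum>p\<in>V. (c \<bullet> p + k)) = c \<bullet> \<Sum>V + card V * k"
    by (simp add: inner_sum_right sum.distrib)
  finally show ?thesis
    unfolding ind using f V(2) by (simp add: field_simps)
qed

context full_simplex
begin

lemma centroid_integral:
  "(\<integral>x. (c \<bullet> x + k) \<partial>lebesgue_on (interior (convex hull V))) =
    measure lborel (convex hull V) * (c \<bullet> ((1 / card V) *\<^sub>R \<Sum>V) + k)"
proof -
  have V0: "V \<noteq> {}" using card by auto
  have "(\<integral>x. (c \<bullet> x + k) \<partial>lebesgue_on (interior (convex hull V))) = (\<integral>x. indicator (convex hull V) x * (c \<bullet> x + k) \<partial>lborel)"
    by (subst integral_T) auto
  also have "\<dots> = measure lborel (convex hull V) * (c \<bullet> ((1 / card V) *\<^sub>R \<Sum>V) + k)"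
    using simplex_centroid[OF lborel_invariant subspace_UNIV indep V0, of 0 c k] measure_pos by simp
  finally show ?thesis .
qed

end

text \<open>Reduces the integral conditions of the Crouzeix--Raviart space to point values at facet
  barycentres. The frame in \<open>surface_measure\<close> is selected by choice, so the argument
  has to work for whichever frame is obtained.\<close>

lemma face_integral_affine:
  fixes Q :: "'a::euclidean_space set"
  assumes Q: "\<not> affine_dependent Q" "Q \<noteq> {}"
  obtains m where "m > 0" "\<And>c k. face_integral (convex hull Q) (\<lambda>x. c \<bullet> x + k) = m * (c \<bullet> ((1 / card Q) *\<^sub>R \<Sum>Q) + k)"
proof -
  have f: "finite Q" using Q aff_independent_finite by blast
  let ?F = "convex hull Q"
  have F0: "?F \<noteq> {}" using Q by simp
  have "\<exists>x. case x of (a, B) \<Rightarrow> cartesian_frame ?F a B"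
  proof -
    obtain a where a: "a \<in> ?F" using F0 by blast
    define D where "D = (+) (- a) ` (affine hull ?F)"
    have sD: "subspace D" unfolding D_def using a by (metis affine_affine_hull affine_diffs_subspace hull_inc)
    have "\<exists>B. pairwise orthogonal B \<and> (\<forall>x\<in>B. norm x = 1) \<and> span B = D"
      by (rule orthonormal_basis_subspace[OF sD]) blast
    then obtain B where B: "pairwise orthogonal B" "\<forall>x\<in>B. norm x = 1" "span B = D" by blast
    have "affine hull ?F = (\<lambda>y. a + y) ` span B"
      unfolding B(3) D_def by (simp add: image_image)
    then have "cartesian_frame ?F a B" using a B by (simp add: cartesian_frame_def)
    then show ?thesis by blast
  qed
  then obtain a B where sel: "(SOME (a, B). cartesian_frame ?F a B) = (a, B)" and fr: "cartesian_frame ?F a B"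
    using someI_ex[of "\<lambda>x. case x of (a, B) \<Rightarrow> cartesian_frame ?F a B"] by (metis (mono_tags, lifting) case_prodE)
  have "independent B"
    using fr by (intro pairwise_orthogonal_independent) (auto simp: cartesian_frame_def)
  then interpret orthonormal B
    using fr by unfold_locales (auto simp: cartesian_frame_def independent_imp_finite)
  let ?\<nu> = "plane_measure B" and ?T = "(+) (- a) ` ?F"
  have sn [measurable_cong]: "sets ?\<nu> = sets borel" by (simp add: plane_measure_def)
  have hull: "affine hull Q = (+) a ` span B" using fr by (simp add: cartesian_frame_def)
  have sm: "surface_measure ?F = distr ?\<nu> borel ((+) a)"
    unfolding surface_measure_def sel Let_def prod.case plane_distr
    by (subst distr_distr) (auto simp: comp_def)
  have cF: "compact ?F" using f by (rule finite_imp_compact_convex_hull)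
  then have cT: "compact ?T" by (rule compact_translation)
  then have Tb: "?T \<in> sets borel" by (rule borel_compact)
  have Fb [measurable]: "?F \<in> sets borel" using cF by (rule borel_compact)
  \<comment> \<open>A relative ball inside the facet, translated into the subspace, gives positive
    plane measure.\<close>
  have "rel_interior ?F \<noteq> {}" using F0 by (simp add: rel_interior_eq_empty)
  then obtain z r where z: "z \<in> ?F" and r: "r > 0" "ball z r \<inter> affine hull ?F \<subseteq> ?F"
    by (auto simp: rel_interior_ball)
  have "0 < emeasure ?\<nu> ?T"
  proof (rule plane_positive[of "z - a" r])
    have "z \<in> affine hull Q" using z convex_hull_subset_affine_hull[of Q] by blast
    then show "z - a \<in> span B" unfolding hull by auto
    show "span B \<inter> ball (z - a) r \<subseteq> ?T"
    proof
      fix x assume x: "x \<in> span B \<inter> ball (z - a) r"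
      then have "a + x \<in> ball z r" by (simp add: dist_norm algebra_simps)
      moreover have "a + x \<in> affine hull ?F" using x hull by simp
      ultimately have "a + x \<in> ?F" using r(2) by blast
      then show "x \<in> ?T" by (force simp: image_iff)
    qed
  qed (use r Tb in auto)
  moreover have "emeasure ?\<nu> ?T < \<infinity>" using plane_bounded_finite[OF compact_imp_bounded[OF cT] Tb] .
  ultimately have pos: "0 < measure ?\<nu> ?T" by (simp add: measure_def enn2real_positive_iff)
  have "face_integral ?F (\<lambda>x. c \<bullet> x + k) = measure ?\<nu> ?T * (c \<bullet> ((1 / card Q) *\<^sub>R \<Sum>Q) + k)" for c k
  proof -
    have "face_integral ?F (\<lambda>x. c \<bullet> x + k) = (\<integral>x. indicator ?F (a + x) * (c \<bullet> (a + x) + k) \<partial>?\<nu>)"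
      unfolding face_integral_def set_lebesgue_integral_def sm by (subst integral_distr) auto
    also have "\<dots> = measure ?\<nu> ?T * (c \<bullet> ((1 / card Q) *\<^sub>R \<Sum>Q) + k)"
      by (rule simplex_centroid[OF plane_invariant plane_uminus subspace_span Q hull pos])
    finally show ?thesis .
  qed
  with pos show ?thesis using that by blast
qed

section \<open>Facet means without traces\<close>

lemma lborel_integral_affine:
  fixes F :: "'a::euclidean_space \<Rightarrow> real"
  assumes "F \<in> borel_measurable borel" "c \<noteq> 0"
  shows "(\<integral>x. F x \<partial>lborel) = \<bar>c\<bar> ^ DIM('a) * (\<integral>x. F (t + c *\<^sub>R x) \<partial>lborel)"
  using assms
  by (subst lborel_affine[of c t]) (auto simp: integral_density integral_distr)

text \<open>
  Both sides of the divergence theorem for the field \<open>x \<mapsto> \<psi> x (x - p)\<close>, whose normal component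
  vanishes on the facets through \<open>p\<close>. Differentiating the integral of \<open>\<psi>\<close> over the dilations of the
  simplex about \<open>p\<close> avoids surface integrals.
\<close>

lemma cone_flux_zero:
  fixes \<psi> :: "'a::euclidean_space \<Rightarrow> real"
  assumes Q: "finite Q" "Q \<noteq> {}"
    and d: "\<And>x. (\<psi> has_derivative (\<lambda>h. H x \<bullet> h)) (at x)" and cH: "continuous_on UNIV H"
    and L: "\<And>x y. \<bar>\<psi> x - \<psi> y\<bar> \<le> L * norm (x - y)"
    and 0: "\<And>x. x \<in> convex hull Q \<Longrightarrow> \<psi> x = 0"
  shows "(\<integral>x. indicator (convex hull (insert p Q)) x * (real DIM('a) * \<psi> x + H x \<bullet> (x - p)) \<partial>lborel) = 0"
proof -
  let ?T = "convex hull (insert p Q)" and ?d = "DIM('a)"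
  have c\<psi>: "continuous_on UNIV \<psi>"
    using d by (meson continuous_at_imp_continuous_on has_derivative_continuous)
  have [measurable]: "\<psi> \<in> borel_measurable borel" "H \<in> borel_measurable borel"
    using c\<psi> cH by (auto intro: borel_measurable_continuous_onI)
  have cT: "compact ?T" using Q by (simp add: finite_imp_compact_convex_hull)
  have Tb [measurable]: "?T \<in> sets borel" using cT by (rule borel_compact)
  have L0: "0 \<le> L"
  proof -
    obtain b :: 'a where "b \<in> Basis" using nonempty_Basis by blast
    then show ?thesis using L[of b 0] by (simp add: order_trans[OF abs_ge_zero])
  qed
  have "bounded ((\<lambda>x. x - p) ` ?T)"
    by (intro compact_imp_bounded compact_continuous_image continuous_intros cT)
  then obtain R0 where "\<forall>y\<in>(\<lambda>x. x - p) ` ?T. norm y \<le> R0" unfolding bounded_iff by blast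
  then have R0: "norm (x - p) \<le> R0" if "x \<in> ?T" for x using that by blast
  define R where "R = max R0 0"
  have R: "norm (x - p) \<le> R" if "x \<in> ?T" for x using R0[OF that] by (simp add: R_def)
  have ci: "integrable lborel (\<lambda>x. indicator ?T x * f x)" if "continuous_on UNIV f" for f :: "'a \<Rightarrow> real"
    using borel_integrable_compact[OF cT, of f] continuous_on_subset[OF that, of ?T]
    by (auto simp: if_distrib indicator_def cong: if_cong)
  define \<mu> where "\<mu> = measure lborel ?T"
  have iT: "integrable lborel (indicator ?T :: 'a \<Rightarrow> real)" using ci[of "\<lambda>_. 1"] by simp
  \<comment> \<open>The dilation about p with ratio 1 - t. It makes \<open>I t\<close> an integral
    over the fixed simplex, while (1 - t)^d times \<open>I t\<close> is the integral of \<psi> over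
    the dilated one.\<close>
  define \<beta> where "\<beta> t x = t *\<^sub>R p + (1 - t) *\<^sub>R x" for t and x :: 'a
  define I where "I t = (\<integral>x. indicator ?T x * \<psi> (\<beta> t x) \<partial>lborel)" for t
  have c\<beta>: "continuous_on UNIV (\<lambda>x. \<psi> (\<beta> t x))" for t
    unfolding \<beta>_def by (intro continuous_on_compose2[OF c\<psi>] continuous_intros) auto
  \<comment> \<open>In the layer that the dilation removes, every point is within R t of the facet
    opposite p, where \<psi> vanishes; hence \<psi> is at most L R t there. The volume of the layer
    tends to zero as well, so the difference is o(t).\<close>
  have bound: "\<bar>I 0 - (1 - t) ^ ?d * I t\<bar> \<le> L * R * t * (\<mu> - (1 - t) ^ ?d * \<mu>)" if t: "0 < t" "t < 1" for t
  proof -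
    let ?Tt = "\<beta> t ` ?T"
    have injb: "\<beta> t x \<in> ?Tt \<longleftrightarrow> x \<in> ?T" for x
      using t by (auto simp: \<beta>_def image_iff)
    have cTt: "compact ?Tt" unfolding \<beta>_def by (intro compact_continuous_image continuous_intros cT)
    then have [measurable]: "?Tt \<in> sets borel" by (rule borel_compact)
    have sub: "?Tt \<subseteq> ?T"
    proof
      fix y assume "y \<in> ?Tt"
      then obtain x where "x \<in> ?T" "y = \<beta> t x" by blast
      then show "y \<in> ?T" unfolding \<beta>_def
        using t by (simp add: convexD[OF convex_convex_hull] hull_inc)
    qed
    have scale: "(\<integral>x. indicator ?Tt x * f x \<partial>lborel) = (1 - t) ^ ?d * (\<integral>x. indicator ?T x * f (\<beta> t x) \<partial>lborel)"
      if "f \<in> borel_measurable borel" for f :: "'a \<Rightarrow> real"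
    proof -
      have "(\<integral>x. indicator ?Tt x * f x \<partial>lborel) = \<bar>1 - t\<bar> ^ ?d * (\<integral>x. indicator ?Tt (\<beta> t x) * f (\<beta> t x) \<partial>lborel)"
        unfolding \<beta>_def[of t] using t that \<open>?Tt \<in> sets borel\<close>[unfolded \<beta>_def[abs_def]]
        by (intro lborel_integral_affine borel_measurable_times borel_measurable_indicator) auto
      then show ?thesis using t injb by (simp add: indicator_def)
    qed
    have iTt: "integrable lborel (indicator ?Tt :: 'a \<Rightarrow> real)"
      using emeasure_bounded_finite[OF compact_imp_bounded[OF cTt]] by (simp add: integrable_indicator_iff)
    have i\<psi>t: "integrable lborel (\<lambda>x. indicator ?Tt x * \<psi> x)"
      using borel_integrable_compact[OF cTt, of \<psi>] continuous_on_subset[OF c\<psi>, of ?Tt]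
      by (auto simp: if_distrib indicator_def cong: if_cong)
    have "(\<integral>x. indicator ?Tt x \<partial>lborel) = (1 - t) ^ ?d * \<mu>"
      using scale[of "\<lambda>_. 1"] by (simp add: \<mu>_def)
    then have diff: "(\<integral>x. L * R * t * (indicator ?T x - indicator ?Tt x) \<partial>lborel) = L * R * t * (\<mu> - (1 - t) ^ ?d * \<mu>)"
      using iT iTt by (simp add: \<mu>_def)
    have "I 0 - (1 - t) ^ ?d * I t = (\<integral>x. indicator ?T x * \<psi> x - indicator ?Tt x * \<psi> x \<partial>lborel)"
      using scale[of \<psi>] ci[OF c\<psi>] i\<psi>t by (simp add: I_def \<beta>_def)
    also have "\<bar>\<dots>\<bar> \<le> (\<integral>x. L * R * t * (indicator ?T x - indicator ?Tt x) \<partial>lborel)"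
    proof (rule integral_abs_bound[THEN order_trans], rule integral_mono)
      show "integrable lborel (\<lambda>x. \<bar>indicator ?T x * \<psi> x - indicator ?Tt x * \<psi> x\<bar>)"
        using ci[OF c\<psi>] i\<psi>t by simp
      show "integrable lborel (\<lambda>x. L * R * t * (indicator ?T x - indicator ?Tt x :: real))"
        using iT iTt by simp
      fix x :: 'a
      show "\<bar>indicator ?T x * \<psi> x - indicator ?Tt x * \<psi> x\<bar> \<le> L * R * t * (indicator ?T x - indicator ?Tt x)"
      proof (cases "x \<in> ?T - ?Tt")
        case True
        then obtain u v b where uv: "0 \<le> u" "0 \<le> v" "b \<in> convex hull Q" "u + v = 1" "x = u *\<^sub>R p + v *\<^sub>R b"
          by (auto simp: convex_hull_insert[OF Q(2)])
        \<comment> \<open>Otherwise the weight of p could be lowered to (u - t) / (1 - t), which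
          gives a preimage of x under the dilation.\<close>
        have "u < t"
        proof (rule ccontr)
          assume "\<not> u < t"
          define y where "y = ((u - t) / (1 - t)) *\<^sub>R p + (v / (1 - t)) *\<^sub>R b"
          have "(u - t) / (1 - t) + v / (1 - t) = 1" using uv(4) t
            by (simp add: add_divide_distrib[symmetric] add_diff_eq[symmetric] diff_add_eq)
          moreover have "0 \<le> (u - t) / (1 - t)" "0 \<le> v / (1 - t)" using \<open>\<not> u < t\<close> uv t by auto
          ultimately have "y \<in> ?T"
            unfolding convex_hull_insert[OF Q(2)] y_def using uv(3) by blast
          moreover have "\<beta> t y = x"
            using t uv by (simp add: \<beta>_def y_def scaleR_add_right scaleR_add_left[symmetric] add.assoc[symmetric])
          ultimately show False using True by blast
        qed
        have "\<bar>\<psi> x\<bar> = \<bar>\<psi> x - \<psi> b\<bar>" by (simp add: 0[OF uv(3)])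
        also have "\<dots> \<le> L * norm (x - b)" by (rule L)
        also have "x - b = u *\<^sub>R (p - b)"
        proof -
          have "x - b = u *\<^sub>R p + v *\<^sub>R b - (u + v) *\<^sub>R b" by (simp add: uv(4,5))
          then show ?thesis by (simp add: scaleR_add_left scaleR_diff_right)
        qed
        also have "L * norm (u *\<^sub>R (p - b)) \<le> L * (t * R)"
        proof (intro mult_left_mono L0)
          have "b \<in> ?T" using uv(3) hull_mono[of Q "insert p Q" convex] by blast
          then have "norm (p - b) \<le> R" using R[of b] by (simp add: norm_minus_commute)
          then show "norm (u *\<^sub>R (p - b)) \<le> t * R"
            using uv(1) \<open>u < t\<close> by (simp add: mult_mono)
        qed
        finally show ?thesis using True by (simp add: mult.commute mult.left_commute)
      next
        case False
        then show ?thesis using sub by (auto simp: indicator_def)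
      qed
    qed
    also have "\<dots> = L * R * t * (\<mu> - (1 - t) ^ ?d * \<mu>)" by (rule diff)
    finally show ?thesis .
  qed
  \<comment> \<open>The shift by two keeps the parameters strictly below 1.\<close>
  define s where "s n = inverse (real (Suc (Suc n)))" for n
  have s01: "0 < s n" "s n < 1" for n by (auto simp: s_def field_simps)
  have s_lim: "s \<longlonglongrightarrow> 0"
    unfolding s_def using LIMSEQ_Suc[OF LIMSEQ_inverse_real_of_nat] .
  have pow_lim: "(\<lambda>n. (1 - (1 - s n) ^ ?d) / s n) \<longlonglongrightarrow> real ?d"
  proof -
    have "((\<lambda>t::real. (1 - t) ^ ?d) has_real_derivative - real ?d) (at 0)"
      by (auto intro!: derivative_eq_intros)
    then have "(\<lambda>t. ((1 - t) ^ ?d - 1) / t) \<midarrow>0\<rightarrow> - real ?d" by (simp add: DERIV_def)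
    then have "(\<lambda>n. ((1 - s n) ^ ?d - 1) / s n) \<longlonglongrightarrow> - real ?d"
      by (rule filterlim_compose) (use s_lim s01 in \<open>auto simp: filterlim_at less_imp_neq[symmetric]\<close>)
    from tendsto_minus[OF this] show ?thesis
      by (simp only: minus_minus minus_divide_left minus_diff_eq)
  qed
  let ?J = "\<integral>x. indicator ?T x * (H x \<bullet> (x - p)) \<partial>lborel"
  have quot: "(\<lambda>n. (I 0 - I (s n)) / s n) \<longlonglongrightarrow> ?J"
  proof -
    have "(\<lambda>n. \<integral>x. indicator ?T x * ((\<psi> x - \<psi> (\<beta> (s n) x)) / s n) \<partial>lborel) \<longlonglongrightarrow> ?J"
    proof (rule integral_dominated_convergence[where w = "\<lambda>x. L * R * indicator ?T x"])
      show "integrable lborel (\<lambda>x. L * R * indicator ?T x)" using iT by simp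
      show "(\<lambda>x. indicator ?T x * ((\<psi> x - \<psi> (\<beta> (s n) x)) / s n)) \<in> borel_measurable lborel" for n
        unfolding \<beta>_def by measurable
      show "AE x in lborel. (\<lambda>n. indicator ?T x * ((\<psi> x - \<psi> (\<beta> (s n) x)) / s n)) \<longlonglongrightarrow> indicator ?T x * (H x \<bullet> (x - p))"
      proof (intro AE_I2 tendsto_mult tendsto_const)
        fix x
        have "((\<lambda>t. x - t *\<^sub>R (x - p)) has_derivative (\<lambda>t. - (t *\<^sub>R (x - p)))) (at 0)"
          by (auto intro!: derivative_eq_intros)
        from has_derivative_compose[OF this, of \<psi> "\<lambda>k. H x \<bullet> k"]
        have "((\<lambda>t. \<psi> (x - t *\<^sub>R (x - p))) has_derivative (\<lambda>t. H x \<bullet> (- (t *\<^sub>R (x - p))))) (at 0)"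
          using d[of x] by simp
        then have "((\<lambda>t. \<psi> (x - t *\<^sub>R (x - p))) has_real_derivative - (H x \<bullet> (x - p))) (at 0)"
          by (rule has_derivative_imp_has_field_derivative) simp
        then have "(\<lambda>t. (\<psi> (x - t *\<^sub>R (x - p)) - \<psi> x) / t) \<midarrow>0\<rightarrow> - (H x \<bullet> (x - p))"
          by (simp add: DERIV_def)
        then have "(\<lambda>n. (\<psi> (x - s n *\<^sub>R (x - p)) - \<psi> x) / s n) \<longlonglongrightarrow> - (H x \<bullet> (x - p))"
          by (rule filterlim_compose) (use s_lim s01 in \<open>auto simp: filterlim_at less_imp_neq[symmetric]\<close>)
        from tendsto_minus[OF this]
        have "(\<lambda>n. (\<psi> x - \<psi> (x - s n *\<^sub>R (x - p))) / s n) \<longlonglongrightarrow> H x \<bullet> (x - p)"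
          by (simp only: minus_minus minus_divide_left minus_diff_eq)
        moreover have "x - s n *\<^sub>R (x - p) = \<beta> (s n) x" for n by (simp add: \<beta>_def algebra_simps)
        ultimately show "(\<lambda>n. (\<psi> x - \<psi> (\<beta> (s n) x)) / s n) \<longlonglongrightarrow> H x \<bullet> (x - p)" by (simp only:)
      qed
      show "AE x in lborel. norm (indicator ?T x * ((\<psi> x - \<psi> (\<beta> (s n) x)) / s n)) \<le> L * R * indicator ?T x" for n
      proof (rule AE_I2)
        fix x
        show "norm (indicator ?T x * ((\<psi> x - \<psi> (\<beta> (s n) x)) / s n)) \<le> L * R * indicator ?T x"
        proof (cases "x \<in> ?T")
          case True
          have "\<bar>\<psi> x - \<psi> (\<beta> (s n) x)\<bar> \<le> L * norm (x - \<beta> (s n) x)" by (rule L)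
          also have "x - \<beta> (s n) x = s n *\<^sub>R (x - p)" by (simp add: \<beta>_def algebra_simps)
          also have "L * norm (s n *\<^sub>R (x - p)) \<le> L * (s n * R)"
            using R[OF True] s01[of n] L0 by (simp add: mult_left_mono)
          finally show ?thesis using True s01[of n] by (simp add: field_simps)
        qed simp
      qed
    qed simp
    moreover have "(\<integral>x. indicator ?T x * ((\<psi> x - \<psi> (\<beta> (s n) x)) / s n) \<partial>lborel) = (I 0 - I (s n)) / s n" for n
    proof -
      have "(\<integral>x. indicator ?T x * ((\<psi> x - \<psi> (\<beta> (s n) x)) / s n) \<partial>lborel) =
         (\<integral>x. (indicator ?T x * \<psi> x - indicator ?T x * \<psi> (\<beta> (s n) x)) / s n \<partial>lborel)"
        by (simp add: right_diff_distrib)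
      then show ?thesis
        using ci[OF c\<psi>] ci[OF c\<beta>] by (simp add: I_def \<beta>_def[of 0])
    qed
    ultimately show ?thesis by (simp only:)
  qed
  have I_lim: "(\<lambda>n. I (s n)) \<longlonglongrightarrow> I 0"
  proof -
    have "(\<lambda>n. I 0 - s n * ((I 0 - I (s n)) / s n)) \<longlonglongrightarrow> I 0 - 0 * ?J"
      by (intro tendsto_intros s_lim quot)
    moreover have "I 0 - s n * ((I 0 - I (s n)) / s n) = I (s n)" for n
      using s01[of n] by simp
    ultimately show ?thesis by simp
  qed
  \<comment> \<open>The product rule for the integral over the dilated simplex, as a limit of
    quotients. The layer estimate shows that the same quotients tend to 0.\<close>
  have "(\<lambda>n. (I 0 - I (s n)) / s n + (1 - (1 - s n) ^ ?d) / s n * I (s n)) \<longlonglongrightarrow> ?J + real ?d * I 0"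
    by (intro tendsto_intros quot pow_lim I_lim)
  moreover have "(I 0 - I (s n)) / s n + (1 - (1 - s n) ^ ?d) / s n * I (s n) = (I 0 - (1 - s n) ^ ?d * I (s n)) / s n" for n
    using s01[of n] by (simp add: field_simps)
  ultimately have lim1: "(\<lambda>n. (I 0 - (1 - s n) ^ ?d * I (s n)) / s n) \<longlonglongrightarrow> ?J + real ?d * I 0" by simp
  have lim0: "(\<lambda>n. (I 0 - (1 - s n) ^ ?d * I (s n)) / s n) \<longlonglongrightarrow> 0"
  proof (rule Lim_null_comparison)
    show "\<forall>\<^sub>F n in sequentially. norm ((I 0 - (1 - s n) ^ ?d * I (s n)) / s n) \<le> L * R * (\<mu> - (1 - s n) ^ ?d * \<mu>)"
    proof (intro always_eventually allI)
      fix n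
      have "norm ((I 0 - (1 - s n) ^ ?d * I (s n)) / s n) = \<bar>I 0 - (1 - s n) ^ ?d * I (s n)\<bar> / s n"
        using s01[of n] by simp
      also have "\<dots> \<le> L * R * s n * (\<mu> - (1 - s n) ^ ?d * \<mu>) / s n"
        using bound[OF s01[of n]] s01[of n] by (intro divide_right_mono) auto
      also have "\<dots> = L * R * (\<mu> - (1 - s n) ^ ?d * \<mu>)" using s01(1)[of n] by simp
      finally show "norm ((I 0 - (1 - s n) ^ ?d * I (s n)) / s n) \<le> L * R * (\<mu> - (1 - s n) ^ ?d * \<mu>)" .
    qed
    have "(\<lambda>n. L * R * (\<mu> - (1 - s n) ^ ?d * \<mu>)) \<longlonglongrightarrow> L * R * (\<mu> - (1 - 0) ^ ?d * \<mu>)"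
      by (intro tendsto_intros s_lim)
    then show "(\<lambda>n. L * R * (\<mu> - (1 - s n) ^ ?d * \<mu>)) \<longlonglongrightarrow> 0" by simp
  qed
  have "?J + real ?d * I 0 = 0" using LIMSEQ_unique[OF lim1 lim0] .
  moreover have "(\<integral>x. indicator ?T x * (real ?d * \<psi> x + H x \<bullet> (x - p)) \<partial>lborel) = real ?d * I 0 + ?J"
  proof -
    have "(\<integral>x. indicator ?T x * (real ?d * \<psi> x + H x \<bullet> (x - p)) \<partial>lborel) =
       (\<integral>x. real ?d * (indicator ?T x * \<psi> x) + indicator ?T x * (H x \<bullet> (x - p)) \<partial>lborel)"
      by (simp add: distrib_left mult.left_commute)
    also have "\<dots> = real ?d * I 0 + ?J"
      using ci[OF c\<psi>] ci[of "\<lambda>x. H x \<bullet> (x - p)"] cH by (simp add: I_def \<beta>_def continuous_intros)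
    finally show ?thesis .
  qed
  ultimately show ?thesis by simp
qed

text \<open>
  For an \<open>H\<^sup>1\<close> function \<open>v\<close> with gradient \<open>G\<close>, this is the mean of \<open>v\<close> over the facet opposite \<open>p\<close>, by
  the divergence theorem for the field \<open>x \<mapsto> v x (x - p)\<close>.
\<close>

definition face_mean :: "'a::euclidean_space set \<Rightarrow> 'a \<Rightarrow> ('a \<Rightarrow> real) \<Rightarrow> ('a \<Rightarrow> 'a) \<Rightarrow> real" where
  "face_mean V p v G = (\<integral>x. (real DIM('a) * v x + G x \<bullet> (x - p)) \<partial>lebesgue_on (interior (convex hull V))) /
     (real DIM('a) * measure lborel (convex hull V))"

lemma full_simplex_facet_nonempty:
  assumes "full_simplex (insert p Q)"
  shows "finite Q" "Q \<noteq> {}"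
proof -
  interpret full_simplex "insert p Q" by fact
  show "finite Q" using finite by simp
  show "Q \<noteq> {}" using card_ge_2 by auto
qed

lemma face_mean_zero:
  fixes \<phi> :: "'a::euclidean_space \<Rightarrow> real"
  assumes V: "full_simplex (insert p Q)"
    and d: "\<And>x. (\<phi> has_derivative (\<lambda>h. g x \<bullet> h)) (at x)" and c: "continuous_on UNIV g"
    and L: "\<And>x y. \<bar>\<phi> x - \<phi> y\<bar> \<le> L * norm (x - y)" and 0: "\<And>x. x \<in> convex hull Q \<Longrightarrow> \<phi> x = 0"
  shows "face_mean (insert p Q) p \<phi> g = 0"
proof -
  interpret full_simplex "insert p Q" by fact
  have "continuous_on UNIV \<phi>" using d by (meson continuous_at_imp_continuous_on has_derivative_continuous)
  then have [measurable]: "\<phi> \<in> borel_measurable borel" "g \<in> borel_measurable borel"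
    using c by (auto intro: borel_measurable_continuous_onI)
  show ?thesis
    unfolding face_mean_def using cone_flux_zero[OF full_simplex_facet_nonempty[OF V] d c L 0, of p]
    by (subst integral_T) auto
qed

text \<open>A fixes the facet Q and sends the apex p to p', hence it transports barycentric
  coordinates from one simplex to the other.\<close>

lemma facet_affine_map:
  fixes Q :: "'a::euclidean_space set"
  assumes V: "full_simplex (insert p Q)" and V': "full_simplex (insert p' Q)" and p: "p \<notin> Q" "p' \<notin> Q"
  defines "A \<equiv> \<lambda>x. x + bary (insert p Q) p x *\<^sub>R (p' - p)"
  shows "q \<in> Q \<Longrightarrow> bary (insert p' Q) q (A x) = bary (insert p Q) q x"
    and "bary (insert p' Q) p' (A x) = bary (insert p Q) p x"
proof -
  interpret V: full_simplex "insert p Q" by fact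
  interpret V': full_simplex "insert p' Q" by fact
  have fQ: "finite Q" using V.finite by simp
  let ?l = "\<lambda>q. bary (insert p Q) q x"
  \<comment> \<open>The coordinates of x, with the entry of p handed over to p'.\<close>
  define u where "u q = (if q = p' then ?l p else ?l q)" for q
  have uQ: "(\<Sum>q\<in>Q. f (u q) q) = (\<Sum>q\<in>Q. f (?l q) q)" for f :: "real \<Rightarrow> 'a \<Rightarrow> 'b::comm_monoid_add"
    by (rule sum.cong) (use p in \<open>auto simp: u_def\<close>)
  have "sum u (insert p' Q) = ?l p + (\<Sum>q\<in>Q. ?l q)" using fQ p uQ[of "\<lambda>a b. a"] by (simp add: u_def)
  then have u1: "sum u (insert p' Q) = 1" using V.sum1[of x] fQ p by simp
  have "(\<Sum>q\<in>insert p' Q. u q *\<^sub>R q) = ?l p *\<^sub>R p' + (\<Sum>q\<in>Q. ?l q *\<^sub>R q)"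
    using fQ p uQ[of "\<lambda>a b. a *\<^sub>R b"] by (simp add: u_def)
  also have "\<dots> = A x" using V.repr[of x] fQ p by (simp add: A_def algebra_simps)
  finally have uA: "(\<Sum>q\<in>insert p' Q. u q *\<^sub>R q) = A x" .
  show "bary (insert p' Q) p' (A x) = bary (insert p Q) p x"
    using bary_of_affine_comb[OF V'.indep u1, of p'] uA by (simp add: u_def)
  show "q \<in> Q \<Longrightarrow> bary (insert p' Q) q (A x) = bary (insert p Q) q x"
    using bary_of_affine_comb[OF V'.indep u1, of q] uA p by (auto simp: u_def)
qed

text \<open>With A the map that fixes the facet and exchanges the apices, \<phi> - \<phi> o A
  vanishes on the facet, so its facet mean seen from p is zero. The facet mean of \<phi> o A seen
  from p is that of \<phi> seen from p', by the change of variables A.\<close>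

lemma face_mean_match:
  fixes \<phi> :: "'a::euclidean_space \<Rightarrow> real"
  assumes V: "full_simplex (insert p Q)" and V': "full_simplex (insert p' Q)" and p: "p \<notin> Q" "p' \<notin> Q"
    and d: "\<And>x. (\<phi> has_derivative (\<lambda>h. g x \<bullet> h)) (at x)" and c: "continuous_on UNIV g"
    and B: "\<And>x. norm (g x) \<le> B"
  shows "face_mean (insert p Q) p \<phi> g = face_mean (insert p' Q) p' \<phi> g"
proof -
  interpret V: full_simplex "insert p Q" by fact
  interpret V': full_simplex "insert p' Q" by fact
  let ?V = "insert p Q" and ?V' = "insert p' Q"
  let ?T = "convex hull ?V" and ?T' = "convex hull ?V'"
  have c\<phi>: "continuous_on UNIV \<phi>" using d by (meson continuous_at_imp_continuous_on has_derivative_continuous)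
  have [measurable]: "\<phi> \<in> borel_measurable borel" "g \<in> borel_measurable borel"
    using c c\<phi> by (auto intro: borel_measurable_continuous_onI)
  define \<gamma> where "\<gamma> = bgrad ?V p"
  define A where "A x = x + bary ?V p x *\<^sub>R (p' - p)" for x
  define A' where "A' x = x + bary ?V' p' x *\<^sub>R (p - p')" for x
  note bA = facet_affine_map[OF V V' p, folded A_def] and bA' = facet_affine_map[OF V' V p(2,1), folded A'_def]
  have inv: "A' (A x) = x" "A (A' x) = x" for x
    unfolding A'_def[of "A x"] A_def[of "A' x"] bA(2) bA'(2) by (simp_all add: A_def A'_def algebra_simps)
  have aff: "affine_map A" "affine_map A'"
    unfolding A_def[abs_def] A'_def[abs_def] bary_def by (rule affine_map_shift)+
  have [measurable]: "A \<in> borel_measurable borel" using aff affine_map_measurable by blast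
  have cA: "continuous_on UNIV A" using aff affine_map_continuous by blast
  have AT: "A x \<in> ?T' \<longleftrightarrow> x \<in> ?T" for x
    unfolding V.in_iff V'.in_iff using bA by auto
  have Ap: "A p = p'" using bary_vertex[OF V.indep, of p p] by (simp add: A_def)
  have Adiff: "A x - p' = (x - p) + (\<gamma> \<bullet> (x - p)) *\<^sub>R (p' - p)" for x
  proof -
    have "A x - A p = (x - p) + (bary ?V p x - bary ?V p p) *\<^sub>R (p' - p)"
      by (simp add: A_def algebra_simps)
    then show ?thesis by (simp add: Ap bary_diff \<gamma>_def)
  qed
  define H where "H x = g (A x) + (g (A x) \<bullet> (p' - p)) *\<^sub>R \<gamma>" for x
  have dA: "((\<lambda>x. \<phi> (A x)) has_derivative (\<lambda>h. H x \<bullet> h)) (at x)" for x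
  proof -
    have "(A has_derivative (\<lambda>h. h + (\<gamma> \<bullet> h) *\<^sub>R (p' - p))) (at x)"
      unfolding A_def[abs_def] bary_def \<gamma>_def by (auto intro!: derivative_eq_intros)
    from has_derivative_compose[OF this d[of "A x"]]
    have "((\<lambda>x. \<phi> (A x)) has_derivative (\<lambda>h. g (A x) \<bullet> (h + (\<gamma> \<bullet> h) *\<^sub>R (p' - p)))) (at x)" .
    moreover have "g (A x) \<bullet> (h + (\<gamma> \<bullet> h) *\<^sub>R (p' - p)) = H x \<bullet> h" for h
      by (simp add: H_def inner_add_left inner_add_right algebra_simps)
    ultimately show ?thesis by (simp only:)
  qed
  have cgA: "continuous_on UNIV (\<lambda>x. g (A x))"
    by (rule continuous_on_compose2[OF c cA]) auto
  have cH: "continuous_on UNIV H"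
    unfolding H_def by (intro continuous_intros cgA)
  have BH: "norm (H x) \<le> B + B * norm (p' - p) * norm \<gamma>" for x
  proof -
    have "\<bar>g (A x) \<bullet> (p' - p)\<bar> \<le> B * norm (p' - p)"
      by (rule order_trans[OF Cauchy_Schwarz_ineq2]) (intro mult_right_mono B norm_ge_zero)
    then have "norm ((g (A x) \<bullet> (p' - p)) *\<^sub>R \<gamma>) \<le> B * norm (p' - p) * norm \<gamma>"
      by (simp add: mult_right_mono)
    then show ?thesis unfolding H_def using norm_triangle_le B[of "A x"] add_mono by blast
  qed
  have "face_mean ?V p (\<lambda>x. \<phi> x - \<phi> (A x)) (\<lambda>x. g x - H x) = 0"
  proof (rule face_mean_zero[OF V])
    show d2: "((\<lambda>x. \<phi> x - \<phi> (A x)) has_derivative (\<bullet>) (g x - H x)) (at x)" for x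
      using has_derivative_diff[OF d[of x] dA[of x]] by (simp add: inner_diff_left[abs_def])
    show "continuous_on UNIV (\<lambda>x. g x - H x)" by (intro continuous_intros c cH)
    have "norm (g x - H x) \<le> B + (B + B * norm (p' - p) * norm \<gamma>)" for x
      using norm_triangle_ineq4[of "g x" "H x"] B[of x] BH[of x] by linarith
    then show "\<bar>\<phi> x - \<phi> (A x) - (\<phi> y - \<phi> (A y))\<bar> \<le> (B + (B + B * norm (p' - p) * norm \<gamma>)) * norm (x - y)" for x y
      by (rule lipschitz_of_grad_bound[OF d2])
    fix x assume x: "x \<in> convex hull Q"
    have "bary ?V p x = 0"
    proof -
      obtain u where u: "sum u Q = 1" "(\<Sum>q\<in>Q. u q *\<^sub>R q) = x" and fQ: "finite Q"
        using x full_simplex_facet_nonempty[OF V] by (auto simp: convex_hull_finite)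
      have "bary ?V p x = (\<Sum>q\<in>Q. u q * bary ?V p q)"
        using bary_affine_comb[OF fQ u(1)] u(2) by metis
      also have "\<dots> = 0" by (rule sum.neutral) (use p in \<open>auto simp: bary_vertex[OF V.indep]\<close>)
      finally show ?thesis .
    qed
    then show "\<phi> x - \<phi> (A x) = 0" by (simp add: A_def)
  qed
  then have z: "(\<integral>x. indicator ?T x * (real DIM('a) * (\<phi> x - \<phi> (A x)) + (g x - H x) \<bullet> (x - p)) \<partial>lborel) = 0"
  proof -
    have "H \<in> borel_measurable borel" using cH by (rule borel_measurable_continuous_onI)
    then show "?thesis" if "face_mean ?V p (\<lambda>x. \<phi> x - \<phi> (A x)) (\<lambda>x. g x - H x) = 0"
      using that V.measure_pos unfolding face_mean_def by (subst (asm) V.integral_T) auto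
  qed
  let ?h = "\<lambda>y. real DIM('a) * \<phi> y + g y \<bullet> (y - p')" and ?f = "\<lambda>y. real DIM('a) * \<phi> y + g y \<bullet> (y - p)"
  have i1: "integrable lborel (\<lambda>x. indicator ?T x * ?f x)"
    using V.continuous_T_int[of ?f] c c\<phi> by (simp add: continuous_intros)
  have i2: "integrable lborel (\<lambda>x. indicator ?T x * ?h (A x))"
  proof -
    have "continuous_on UNIV (\<lambda>x. ?h (A x))"
      by (intro continuous_intros cgA cA continuous_on_compose2[OF c\<phi> cA]) auto
    then show ?thesis using V.continuous_T_int[of "\<lambda>x. ?h (A x)"] by simp
  qed
  \<comment> \<open>The linear part of A carries the radial field about p into the radial field
    about p', so the integrands correspond.\<close>
  have hh: "H x \<bullet> (x - p) = g (A x) \<bullet> (A x - p')" for x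
    unfolding Adiff H_def by (simp add: inner_add_left inner_add_right)
  have "indicator ?T x * (real DIM('a) * (\<phi> x - \<phi> (A x)) + (g x - H x) \<bullet> (x - p)) =
      indicator ?T x * ?f x - indicator ?T x * ?h (A x)" for x
    by (cases "x \<in> ?T") (simp_all add: inner_diff_left right_diff_distrib hh)
  with z have "(\<integral>x. indicator ?T x * ?f x \<partial>lborel) = (\<integral>x. indicator ?T x * ?h (A x) \<partial>lborel)"
    using i1 i2 by simp
  also have "\<dots> = measure lborel ?T / measure lborel ?T' * (\<integral>x. indicator ?T' x * ?h x \<partial>lborel)"
    by (rule affine_change_of_variables[OF aff inv _ _ AT V.measure_pos V'.measure_pos]) auto
  finally have e: "(\<integral>x. indicator ?T x * ?f x \<partial>lborel) = measure lborel ?T / measure lborel ?T' * (\<integral>x. indicator ?T' x * ?h x \<partial>lborel)" .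
  have "(\<integral>x. ?f x \<partial>lebesgue_on (interior ?T)) = (\<integral>x. indicator ?T x * ?f x \<partial>lborel)"
    "(\<integral>x. ?h x \<partial>lebesgue_on (interior ?T')) = (\<integral>x. indicator ?T' x * ?h x \<partial>lborel)"
    by (subst V.integral_T V'.integral_T, auto)+
  then show ?thesis unfolding face_mean_def using e V.measure_pos V'.measure_pos by (simp add: field_simps)
qed

section \<open>Facets and meshes\<close>

definition verts :: "'a::euclidean_space set \<Rightarrow> 'a set" where
  "verts T = {p. p extreme_point_of T}"

lemma barycentre_verts: "barycentre T = (1 / real (card (verts T))) *\<^sub>R \<Sum>(verts T)"
  by (simp add: barycentre_def verts_def Let_def)

lemma verts_convex_hull: "\<not> affine_dependent V \<Longrightarrow> verts (convex hull V) = V"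
  by (auto simp: verts_def extreme_point_of_convex_hull_affine_independent)

text \<open>On one simplex the functions \<open>1 - real DIM('a) * bary V p x\<close> are the
  Crouzeix--Raviart basis: each is 1 at the barycentre of the facet opposite p and 0 at the
  barycentres of the other facets. Thus m lists facet values, indexed by opposite vertices.\<close>

definition interp :: "'a::euclidean_space set \<Rightarrow> ('a \<Rightarrow> real) \<Rightarrow> 'a \<Rightarrow> real" where
  "interp V m x = (\<Sum>p\<in>V. (1 - real DIM('a) * bary V p x) * m p)"

definition interp_grad :: "'a::euclidean_space set \<Rightarrow> ('a \<Rightarrow> real) \<Rightarrow> 'a" where
  "interp_grad V m = - real DIM('a) *\<^sub>R (\<Sum>p\<in>V. m p *\<^sub>R bgrad V p)"

lemma interp_affine: "interp V m x = interp_grad V m \<bullet> x + interp V m 0"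
proof -
  have "interp V m x - interp V m 0 = (\<Sum>p\<in>V. (- real DIM('a)) * (m p * (bary V p x - bary V p 0)))"
    unfolding interp_def sum_subtractf[symmetric] by (rule sum.cong) (auto simp: algebra_simps)
  also have "\<dots> = interp_grad V m \<bullet> x"
    by (simp add: bary_diff interp_grad_def inner_sum_left sum_distrib_left sum_negf)
  finally show ?thesis by simp
qed

context full_simplex
begin

abbreviation "T \<equiv> convex hull V"
abbreviation "K \<equiv> interior (convex hull V)"
abbreviation "\<mu> \<equiv> measure lborel (convex hull V)"

lemma d_pos: "0 < real DIM('a)"
  using DIM_positive[where 'a='a] by simp

lemma verts_T [simp]: "verts T = V"
  by (rule verts_convex_hull[OF indep])

lemma facet_indep: "\<not> affine_dependent (V - {p})"
  using indep affine_independent_subset by blast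

lemma facet_card: "p \<in> V \<Longrightarrow> card (V - {p}) = DIM('a)"
  using card by simp

lemma facet_nonempty: "p \<in> V \<Longrightarrow> V - {p} \<noteq> {}"
  using facet_card[of p] DIM_positive[where 'a='a] by (metis card.empty less_irrefl)

lemma facet_verts: "verts (convex hull (V - {p})) = V - {p}"
  by (rule verts_convex_hull[OF facet_indep])

lemma facet_iff: "F facet_of T \<longleftrightarrow> (\<exists>p\<in>V. F = convex hull (V - {p}))"
proof -
  have "convex hull (V - {p}) \<noteq> {}" if "p \<in> V" for p
    using facet_nonempty[OF that] by simp
  then show ?thesis
    using facet_of_convex_hull_affine_independent[OF indep, of F] by metis
qed

lemma in_facet_iff:
  assumes p: "p \<in> V"
  shows "x \<in> convex hull (V - {p}) \<longleftrightarrow> x \<in> T \<and> bary V p x = 0"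
proof
  assume x: "x \<in> convex hull (V - {p})"
  then obtain u where u: "sum u (V - {p}) = 1" "(\<Sum>q\<in>V - {p}. u q *\<^sub>R q) = x"
    by (auto simp: convex_hull_finite)
  have "bary V p x = (\<Sum>q\<in>V - {p}. u q * bary V p q)"
    using bary_affine_comb[of "V - {p}" u V p] u by simp
  also have "\<dots> = 0" by (rule sum.neutral) (use p in \<open>auto simp: bary_vertex[OF indep]\<close>)
  finally show "x \<in> T \<and> bary V p x = 0" using x hull_mono[of "V - {p}" V convex] by auto
next
  assume x: "x \<in> T \<and> bary V p x = 0"
  have "(\<Sum>q\<in>V - {p}. bary V q x) = 1" "(\<Sum>q\<in>V - {p}. bary V q x *\<^sub>R q) = x"
    using sum1[of x] repr[of x] x p by (simp_all add: sum.remove[of V p])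
  moreover have "\<forall>q\<in>V. 0 \<le> bary V q x" using x in_iff by blast
  ultimately show "x \<in> convex hull (V - {p})"
    unfolding convex_hull_finite[OF finite_Diff[OF finite]] mem_Collect_eq
    by (intro exI[of _ "\<lambda>q. bary V q x"]) auto
qed

lemma bary_facet_barycentre:
  assumes "p \<in> V" "q \<in> V"
  shows "bary V q (barycentre (convex hull (V - {p}))) = (if q = p then 0 else 1 / real DIM('a))"
proof -
  have s: "(\<Sum>r\<in>V - {p}. 1 / real DIM('a)) = 1" using facet_card[OF assms(1)] d_pos by simp
  have "barycentre (convex hull (V - {p})) = (\<Sum>r\<in>V - {p}. (1 / real DIM('a)) *\<^sub>R r)"
    by (simp add: barycentre_verts facet_verts facet_card[OF assms(1)] scaleR_sum_right)
  then have "bary V q (barycentre (convex hull (V - {p}))) = (\<Sum>r\<in>V - {p}. (1 / real DIM('a)) * bary V q r)"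
    using bary_affine_comb[OF _ s, of V q] by simp
  also have "\<dots> = (\<Sum>r\<in>V - {p}. if r = q then 1 / real DIM('a) else 0)"
    by (rule sum.cong) (use assms in \<open>auto simp: bary_vertex[OF indep]\<close>)
  also have "\<dots> = (if q = p then 0 else 1 / real DIM('a))" using assms by simp
  finally show ?thesis .
qed

lemma interp_facet_barycentre:
  assumes p: "p \<in> V"
  shows "interp V m (barycentre (convex hull (V - {p}))) = m p"
proof -
  have "interp V m (barycentre (convex hull (V - {p}))) = (\<Sum>q\<in>V. if q = p then m q else 0)"
    unfolding interp_def by (rule sum.cong) (use p d_pos in \<open>auto simp: bary_facet_barycentre\<close>)
  then show ?thesis using p by simp
qed

lemma L2_const: "(\<lambda>x. c :: 'b::euclidean_space) \<in> L2_space K"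
  using open_K bounded_K by (intro L2_continuous continuous_intros open_sets_lebesgue)

lemma L2_shift: "(\<lambda>x. x - p) \<in> L2_space K"
  using open_K bounded_K by (intro L2_continuous continuous_intros open_sets_lebesgue)

text \<open>Isolates the dependence on the vertex: it enters a facet mean only through the integral
  of G paired with p, so sums over the vertices can be evaluated.\<close>

lemma moment_split:
  assumes "v \<in> L2_space K" "G \<in> L2_space K"
  shows "(\<integral>x. (real DIM('a) * v x + G x \<bullet> (x - p)) \<partial>lebesgue_on K) =
      (\<integral>x. (real DIM('a) * v x + G x \<bullet> x) \<partial>lebesgue_on K) - (\<integral>x. G x \<bullet> p \<partial>lebesgue_on K)"
proof -
  have i: "integrable (lebesgue_on K) v" "integrable (lebesgue_on K) (\<lambda>x. G x \<bullet> x)" "integrable (lebesgue_on K) (\<lambda>x. G x \<bullet> p)"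
    using L2_integrable[OF assms(1) K_lmeasurable] L2_integrable_inner[OF assms(2) L2_shift[of 0]]
      L2_integrable_inner[OF assms(2) L2_const[of p]] by auto
  have "(\<integral>x. (real DIM('a) * v x + G x \<bullet> (x - p)) \<partial>lebesgue_on K) = (\<integral>x. (real DIM('a) * v x + G x \<bullet> x) - G x \<bullet> p \<partial>lebesgue_on K)"
    by (simp add: inner_diff_right add_diff_eq)
  then show ?thesis using i by simp
qed

lemma face_mean_times:
  "real DIM('a) * \<mu> * face_mean V p v G = (\<integral>x. (real DIM('a) * v x + G x \<bullet> (x - p)) \<partial>lebesgue_on K)"
  using measure_pos d_pos by (simp add: face_mean_def)

lemma integral_inner_sum:
  assumes "G \<in> L2_space K"
  shows "(\<integral>x. G x \<bullet> a \<partial>lebesgue_on K) = (\<integral>x. G x \<partial>lebesgue_on K) \<bullet> a"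
  using L2_integrable[OF assms K_lmeasurable] by simp

text \<open>The commuting property of Crouzeix--Raviart interpolation: the gradient of the
  interpolant is the mean of G. The part of the facet means common to all vertices drops out because
  the coordinate gradients sum to zero; the rest is reproduced by \<open>grad_repr'\<close>.\<close>

lemma interp_grad_integral:
  assumes vG: "v \<in> L2_space K" "G \<in> L2_space K"
  shows "\<mu> * (interp_grad V (\<lambda>p. face_mean V p v G) \<bullet> a) = (\<integral>x. G x \<bullet> a \<partial>lebesgue_on K)"
proof -
  let ?I = "\<integral>x. G x \<partial>lebesgue_on K" and ?P = "\<integral>x. (real DIM('a) * v x + G x \<bullet> x) \<partial>lebesgue_on K"
  have "\<mu> * (interp_grad V (\<lambda>p. face_mean V p v G) \<bullet> a) = - (\<Sum>p\<in>V. (real DIM('a) * \<mu> * face_mean V p v G) * (bgrad V p \<bullet> a))"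
    by (simp add: interp_grad_def inner_sum_left sum_distrib_left mult.assoc mult.left_commute sum_negf)
  also have "\<dots> = - (\<Sum>p\<in>V. (?P - ?I \<bullet> p) * (bgrad V p \<bullet> a))"
    by (simp only: face_mean_times moment_split[OF vG] integral_inner_sum[OF vG(2)])
  also have "\<dots> = - ?P * ((\<Sum>p\<in>V. bgrad V p) \<bullet> a) + (\<Sum>p\<in>V. (?I \<bullet> p) * (bgrad V p \<bullet> a))"
    by (simp add: left_diff_distrib sum_subtractf sum_distrib_left inner_sum_left sum_negf)
  also have "(\<Sum>p\<in>V. (?I \<bullet> p) * (bgrad V p \<bullet> a)) = (\<Sum>p\<in>V. (?I \<bullet> p) *\<^sub>R bgrad V p) \<bullet> a"
    by (simp add: inner_sum_left)
  finally show ?thesis by (simp add: grad_sum grad_repr' integral_inner_sum[OF vG(2)])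
qed

text \<open>Interpolation does not preserve the element mean; the defect is the moment of G against
  the distance from the barycentre. This is precisely what the correction term of the Marini flux
  compensates.\<close>

lemma interp_integral:
  assumes vG: "v \<in> L2_space K" "G \<in> L2_space K"
  shows "(\<integral>x. interp V (\<lambda>p. face_mean V p v G) x \<partial>lebesgue_on K) =
    (\<integral>x. v x \<partial>lebesgue_on K) + (1 / real DIM('a)) * (\<integral>x. G x \<bullet> (x - barycentre T) \<partial>lebesgue_on K)"
proof -
  let ?m = "\<lambda>p. face_mean V p v G"
  let ?I = "\<integral>x. G x \<partial>lebesgue_on K" and ?P = "\<integral>x. (real DIM('a) * v x + G x \<bullet> x) \<partial>lebesgue_on K"
  have n: "real (card V) = real DIM('a) + 1" using card by simp
  have bT: "barycentre T = (1 / (real DIM('a) + 1)) *\<^sub>R \<Sum>V" by (simp add: barycentre_verts n)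
  have bb: "bary V p (barycentre T) = 1 / (real DIM('a) + 1)" if "p \<in> V" for p
  proof -
    have "barycentre T = (\<Sum>q\<in>V. (1 / (real DIM('a) + 1)) *\<^sub>R q)" by (simp add: bT scaleR_sum_right)
    then show ?thesis using bary_of_affine_comb[OF indep _ that, of "\<lambda>_. 1 / (real DIM('a) + 1)"] n d_pos by simp
  qed
  have "(\<integral>x. interp V ?m x \<partial>lebesgue_on K) = \<mu> * interp V ?m (barycentre T)"
    using centroid_integral[of "interp_grad V ?m" "interp V ?m 0"]
    by (simp only: interp_affine[symmetric] n bT)
  \<comment> \<open>At the barycentre all coordinates are 1/(d+1), and so each basis function has
    the value 1 - d/(d+1) = 1/(d+1).\<close>
  also have "interp V ?m (barycentre T) = (\<Sum>p\<in>V. (1 - real DIM('a) * (1 / (real DIM('a) + 1))) * ?m p)"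
    unfolding interp_def by (rule sum.cong) (auto simp: bb)
  also have "\<dots> = (1 / (real DIM('a) + 1)) * (\<Sum>p\<in>V. ?m p)"
    using d_pos by (simp add: sum_distrib_left field_simps)
  finally have 1: "real DIM('a) * (real DIM('a) + 1) * (\<integral>x. interp V ?m x \<partial>lebesgue_on K) = (\<Sum>p\<in>V. real DIM('a) * \<mu> * ?m p)"
  proof -
    assume a: "(\<integral>x. interp V ?m x \<partial>lebesgue_on K) = \<mu> * (1 / (real DIM('a) + 1) * sum ?m V)"
    have "(\<Sum>p\<in>V. real DIM('a) * \<mu> * ?m p) = real DIM('a) * \<mu> * sum ?m V" by (simp add: sum_distrib_left)
    then show ?thesis unfolding a using d_pos by simp
  qed
  also have "\<dots> = (\<Sum>p\<in>V. ?P - ?I \<bullet> p)"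
    by (simp only: face_mean_times moment_split[OF vG] integral_inner_sum[OF vG(2)])
  also have "\<dots> = (real DIM('a) + 1) * (?P - ?I \<bullet> barycentre T)"
    using d_pos by (simp add: sum_subtractf n inner_sum_right[symmetric] bT field_simps)
  also have "?P - ?I \<bullet> barycentre T = (\<integral>x. (real DIM('a) * v x + G x \<bullet> (x - barycentre T)) \<partial>lebesgue_on K)"
    by (simp only: moment_split[OF vG] integral_inner_sum[OF vG(2)])
  also have "\<dots> = real DIM('a) * (\<integral>x. v x \<partial>lebesgue_on K) + (\<integral>x. G x \<bullet> (x - barycentre T) \<partial>lebesgue_on K)"
    using L2_integrable[OF vG(1) K_lmeasurable] L2_integrable_inner[OF vG(2) L2_shift] by simp
  finally have "real DIM('a) * (real DIM('a) + 1) * (\<integral>x. interp V ?m x \<partial>lebesgue_on K) =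
    (real DIM('a) + 1) * (real DIM('a) * (\<integral>x. v x \<partial>lebesgue_on K) + (\<integral>x. G x \<bullet> (x - barycentre T) \<partial>lebesgue_on K))" .
  then have "real DIM('a) * (\<integral>x. interp V ?m x \<partial>lebesgue_on K) = real DIM('a) * (\<integral>x. v x \<partial>lebesgue_on K) + (\<integral>x. G x \<bullet> (x - barycentre T) \<partial>lebesgue_on K)"
    using d_pos by (simp add: mult.commute[of "real DIM('a)" "real DIM('a) + 1"] mult.assoc)
  then show ?thesis using d_pos by (simp add: field_simps)
qed

text \<open>Ties the volume formula to the degrees of freedom of the Crouzeix--Raviart space, which
  are values at facet barycentres. It follows from the centroid formula, with d + 1 copies of the
  gradient in the integrand.\<close>

lemma face_mean_affine:
  assumes p: "p \<in> V"
  shows "face_mean V p (\<lambda>x. a \<bullet> x + c) (\<lambda>x. a) = a \<bullet> barycentre (convex hull (V - {p})) + c"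
proof -
  have n: "real (card V) = real DIM('a) + 1" using card by simp
  have "(\<integral>x. (real DIM('a) * (a \<bullet> x + c) + a \<bullet> (x - p)) \<partial>lebesgue_on K) = (\<integral>x. (((real DIM('a) + 1) *\<^sub>R a) \<bullet> x + (real DIM('a) * c - a \<bullet> p)) \<partial>lebesgue_on K)"
    by (simp add: inner_diff_right algebra_simps)
  also have "\<dots> = \<mu> * (((real DIM('a) + 1) *\<^sub>R a) \<bullet> ((1 / (real DIM('a) + 1)) *\<^sub>R \<Sum>V) + (real DIM('a) * c - a \<bullet> p))"
    by (simp only: centroid_integral n)
  also have "\<dots> = \<mu> * (a \<bullet> \<Sum>V - a \<bullet> p + real DIM('a) * c)" using d_pos by (simp add: field_simps inner_add_left)
  also have "a \<bullet> \<Sum>V - a \<bullet> p = a \<bullet> \<Sum>(V - {p})"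
    using p by (simp add: sum.remove[of V p] inner_add_right)
  also have "\<Sum>(V - {p}) = real DIM('a) *\<^sub>R barycentre (convex hull (V - {p}))"
    using d_pos by (simp add: barycentre_verts facet_verts facet_card[OF p])
  finally show ?thesis unfolding face_mean_def using measure_pos d_pos by (simp add: field_simps)
qed

text \<open>Writing the facet mean through two inner products makes it a bounded linear functional
  of the pair (v, G): linearity, continuity and invariance under changes on null sets all follow
  from this form.\<close>

lemma face_mean_l2:
  assumes "v \<in> L2_space K" "G \<in> L2_space K"
  shows "face_mean V p v G = (l2_inner K v (\<lambda>x. real DIM('a)) + l2_inner K G (\<lambda>x. x - p)) / (real DIM('a) * \<mu>)"
proof -
  have "integrable (lebesgue_on K) v" using L2_integrable[OF assms(1) K_lmeasurable] .
  then show ?thesis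
    unfolding face_mean_def l2_inner_def
    using L2_integrable_inner[OF assms(2) L2_shift, of p] by (simp add: mult.commute)
qed

lemma face_mean_diff:
  assumes "v \<in> L2_space K" "G \<in> L2_space K" "w \<in> L2_space K" "H \<in> L2_space K"
  shows "face_mean V p (\<lambda>x. v x - w x) (\<lambda>x. G x - H x) = face_mean V p v G - face_mean V p w H"
  using assms by (simp add: face_mean_l2 L2_diff l2_inner_diff_left L2_const L2_shift diff_divide_distrib add_divide_distrib)

lemma face_mean_add_scaleR:
  assumes "v \<in> L2_space K" "G \<in> L2_space K" "w \<in> L2_space K" "H \<in> L2_space K"
  shows "face_mean V p (\<lambda>x. v x + c * w x) (\<lambda>x. G x + c *\<^sub>R H x) = face_mean V p v G + c * face_mean V p w H"
proof -
  have cw: "(\<lambda>x. c * w x) \<in> L2_space K" using L2_scaleR[OF assms(3), of c] by simp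
  have "l2_inner K (\<lambda>x. c * w x) u = c * l2_inner K w u" for u
    using l2_inner_scaleR_left[of K c w u] by simp
  then show ?thesis
    using assms cw by (simp add: face_mean_l2 L2_add L2_scaleR l2_inner_add_left l2_inner_scaleR_left L2_const L2_shift
        field_simps add_divide_distrib)
qed

lemma face_mean_bound:
  obtains C where "\<And>v G. v \<in> L2_space K \<Longrightarrow> G \<in> L2_space K \<Longrightarrow>
    \<bar>face_mean V p v G\<bar> \<le> C * (l2_norm K v + l2_norm K G)"
proof
  fix v :: "'a \<Rightarrow> real" and G :: "'a \<Rightarrow> 'a" assume vG: "v \<in> L2_space K" "G \<in> L2_space K"
  let ?a = "l2_norm K (\<lambda>x. real DIM('a))" and ?b = "l2_norm K (\<lambda>x. x - p)"
  have "\<bar>l2_inner K v (\<lambda>x. real DIM('a))\<bar> \<le> l2_norm K v * ?a" "\<bar>l2_inner K G (\<lambda>x. x - p)\<bar> \<le> l2_norm K G * ?b"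
    using l2_Cauchy_Schwarz vG L2_const L2_shift by blast+
  moreover have "0 \<le> l2_norm K v * ?b" "0 \<le> l2_norm K G * ?a" by simp_all
  moreover have "(?a + ?b) * (l2_norm K v + l2_norm K G) =
      l2_norm K v * ?a + l2_norm K v * ?b + l2_norm K G * ?a + l2_norm K G * ?b"
    by (simp add: algebra_simps)
  ultimately have "\<bar>l2_inner K v (\<lambda>x. real DIM('a)) + l2_inner K G (\<lambda>x. x - p)\<bar> \<le> (?a + ?b) * (l2_norm K v + l2_norm K G)"
    by linarith
  then show "\<bar>face_mean V p v G\<bar> \<le> ((?a + ?b) / (real DIM('a) * \<mu>)) * (l2_norm K v + l2_norm K G)"
    unfolding face_mean_l2[OF vG] using d_pos measure_pos by (simp add: field_simps abs_divide)
qed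

lemma face_mean_cong_AE:
  assumes "v \<in> L2_space K" "G \<in> L2_space K" "AE x in lebesgue_on K. v x = w x" "AE x in lebesgue_on K. G x = H x"
  shows "face_mean V p v G = face_mean V p w H"
proof -
  have mK: "K \<in> sets lebesgue" using open_K open_sets_lebesgue by blast
  have "w \<in> L2_space K" "H \<in> L2_space K" using L2_cong_AE assms mK by blast+
  moreover have "l2_inner K v (\<lambda>x. real DIM('a)) = l2_inner K w (\<lambda>x. real DIM('a))"
    by (rule l2_inner_cong_AE) (use assms L2_const mK in auto)
  moreover have "l2_inner K G (\<lambda>x. x - p) = l2_inner K H (\<lambda>x. x - p)"
    by (rule l2_inner_cong_AE) (use assms L2_shift mK in auto)
  ultimately show ?thesis using assms by (simp add: face_mean_l2)
qed

end

text \<open>Slits and punctures are excluded because near a boundary point the domain lies on one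
  side of a graph. The mesh covers only the closure, and this equality puts the interiors of the
  elements into \<Omega>.\<close>

lemma lipschitz_domain_interior_closure:
  fixes \<Omega> :: "'a::euclidean_space set"
  assumes "open \<Omega>" "lipschitz_boundary \<Omega>"
  shows "interior (closure \<Omega>) = \<Omega>"
proof
  show "\<Omega> \<subseteq> interior (closure \<Omega>)" using assms(1) by (simp add: closure_subset interior_maximal)
  show "interior (closure \<Omega>) \<subseteq> \<Omega>"
  proof
    fix x assume x: "x \<in> interior (closure \<Omega>)"
    show "x \<in> \<Omega>"
    proof (rule ccontr)
      assume nx: "x \<notin> \<Omega>"
      then have "x \<in> frontier \<Omega>" using x assms(1) interior_subset by (auto simp: frontier_def interior_open)
      then obtain r n \<gamma> L where r: "r > 0" and n: "norm n = 1" and lip: "L-lipschitz_on {y. y \<bullet> n = 0} \<gamma>"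
        and gr: "\<Omega> \<inter> ball x r = {y\<in>ball x r. y \<bullet> n > \<gamma> (y - (y \<bullet> n) *\<^sub>R n)}"
        using assms(2) unfolding lipschitz_boundary_def by blast
      have nn: "n \<bullet> n = 1" using n by (simp add: norm_eq_1)
      define h where "h y = y \<bullet> n - \<gamma> (y - (y \<bullet> n) *\<^sub>R n)" for y
      have "continuous_on UNIV (\<lambda>y. \<gamma> (y - (y \<bullet> n) *\<^sub>R n))"
        by (rule continuous_on_compose2[OF lipschitz_on_continuous_on[OF lip]])
           (auto intro!: continuous_intros simp: inner_diff_left nn)
      then have ch: "continuous_on UNIV h" unfolding h_def by (intro continuous_intros)
      have gr': "y \<in> \<Omega> \<longleftrightarrow> h y > 0" if "y \<in> ball x r" for y
        using arg_cong[OF gr, of "\<lambda>S. y \<in> S"] that by (simp add: h_def)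
      have "h x \<le> 0" using gr'[of x] nx r by auto
      obtain e where e: "e > 0" "ball x e \<subseteq> closure \<Omega>" using x by (meson mem_interior)
      define t where "t = min (e / 2) (r / 2)"
      have t: "t > 0" "t < e" "t < r" using e r by (auto simp: t_def)
      \<comment> \<open>Moving against n leaves the foot point in the hyperplane unchanged, so the
        height above the graph drops by exactly t. The new point is strictly below the graph and has
        a neighbourhood that misses \<Omega>.\<close>
      let ?y = "x - t *\<^sub>R n"
      have hy: "h ?y = h x - t"
      proof -
        have e1: "?y \<bullet> n = x \<bullet> n - t" by (simp add: inner_diff_left nn)
        then have e2: "?y - (?y \<bullet> n) *\<^sub>R n = x - (x \<bullet> n) *\<^sub>R n" by (simp add: algebra_simps)
        show ?thesis unfolding h_def e2 unfolding e1 by simp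
      qed
      have yb: "?y \<in> ball x r" "?y \<in> ball x e" using t n by (auto simp: dist_norm)
      let ?U = "{y. h y < 0} \<inter> ball x r"
      have "open ?U" using ch by (intro open_Int open_Collect_less continuous_on_const) auto
      moreover have "?y \<in> ?U" using hy \<open>h x \<le> 0\<close> t yb by simp
      moreover have "?U \<inter> \<Omega> = {}" using gr' by fastforce
      ultimately have "?y \<notin> closure \<Omega>" by (metis Int_commute disjoint_iff open_Int_closure_eq_empty)
      then show False using e(2) yb by blast
    qed
  qed
qed

section \<open>Elements of a mesh\<close>

locale mesh =
  fixes \<Omega> :: "'a::euclidean_space set" and \<T> :: "'a set set"
  assumes domain: "polyhedral_lipschitz_domain \<Omega>" and mesh: "simplicial_mesh \<Omega> \<T>"
begin

lemma open_\<Omega>: "open \<Omega>" and bounded_\<Omega>: "bounded \<Omega>" and \<Omega>_nonempty: "\<Omega> \<noteq> {}"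
  using domain by (auto simp: polyhedral_lipschitz_domain_def)

lemma interior_closure_\<Omega>: "interior (closure \<Omega>) = \<Omega>"
  using domain by (intro lipschitz_domain_interior_closure) (auto simp: polyhedral_lipschitz_domain_def)

lemma \<Omega>_sets: "\<Omega> \<in> sets lebesgue"
  using open_\<Omega> open_sets_lebesgue by auto

lemma finite_\<T>: "finite \<T>" and Un_\<T>: "\<Union>\<T> = closure \<Omega>"
  and face_Int: "T \<in> \<T> \<Longrightarrow> T' \<in> \<T> \<Longrightarrow> T \<inter> T' face_of T"
  using mesh by (auto simp: simplicial_mesh_def triangulation_def)

lemma \<T>_nonempty: "\<T> \<noteq> {}"
proof
  assume "\<T> = {}"
  then have "closure \<Omega> = {}" using Un_\<T> by simp
  then show False using \<Omega>_nonempty by simp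
qed

lemma
  assumes "T \<in> \<T>"
  shows verts_simplex: "full_simplex (verts T)" and conv_verts [simp]: "convex hull (verts T) = T"
proof -
  have "int DIM('a) simplex T" using mesh assms by (auto simp: simplicial_mesh_def)
  then obtain C where C: "\<not> affine_dependent C" "int (card C) = int DIM('a) + 1" "T = convex hull C"
    by (auto simp: simplex_def)
  then have "verts T = C" by (simp add: verts_convex_hull)
  with C show "full_simplex (verts T)" "convex hull (verts T) = T"
    by (auto simp: full_simplex_def)
qed

lemma elem_subset: "T \<in> \<T> \<Longrightarrow> interior T \<subseteq> \<Omega>"
  using Un_\<T> interior_closure_\<Omega> interior_mono[of T "closure \<Omega>"] by auto

lemma elem_aff_dim: "T \<in> \<T> \<Longrightarrow> aff_dim T = DIM('a)"
  using mesh aff_dim_simplex by (fastforce simp: simplicial_mesh_def)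

lemma elem_convex: "T \<in> \<T> \<Longrightarrow> convex T"
  using conv_verts convex_convex_hull by metis

text \<open>The intersection is a face of both elements. A face that meets the interior of T is all
  of T, so T would be a proper face of T', against equality of dimensions.\<close>

lemma elem_Int_interior:
  assumes T: "T \<in> \<T>" "T' \<in> \<T>" "T \<noteq> T'"
  shows "interior T \<inter> T' = {}"
proof (rule ccontr)
  assume ne: "interior T \<inter> T' \<noteq> {}"
  have "T \<inter> T' = T"
  proof (rule ccontr)
    assume "T \<inter> T' \<noteq> T"
    then have "T \<inter> T' \<inter> interior T = {}" using face_of_disjoint_interior[OF face_Int[OF T(1,2)]] by blast
    then show False using ne interior_subset[of T] by blast
  qed
  then have sub: "T face_of T'" using face_Int[OF T(2,1)] by (simp add: Int_commute)
  then have "aff_dim T < aff_dim T'" using face_of_aff_dim_lt[OF elem_convex[OF T(2)] sub T(3)] by simp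
  then show False using elem_aff_dim T by simp
qed

lemma elem_disjoint: "T \<in> \<T> \<Longrightarrow> T' \<in> \<T> \<Longrightarrow> x \<in> interior T \<Longrightarrow> x \<in> interior T' \<Longrightarrow> T = T'"
  using elem_Int_interior interior_subset by blast

lemma elem_open: "open (interior T)" by simp

lemma elem_bounded: "T \<in> \<T> \<Longrightarrow> bounded (interior T)"
  using elem_subset bounded_\<Omega> bounded_subset by blast

lemma elem_sets: "interior T \<in> sets lebesgue"
  using open_sets_lebesgue[of "interior T"] by simp

lemma elem_lmeasurable: "T \<in> \<T> \<Longrightarrow> interior T \<in> lmeasurable"
  using elem_bounded open_lmeasurable[of "interior T"] by simp

lemma elem_nonempty: "T \<in> \<T> \<Longrightarrow> interior T \<noteq> {}"
  using full_simplex.interior_nonempty[OF verts_simplex] by simp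

lemma AE_elem: "AE x in lebesgue. x \<in> \<Omega> \<longrightarrow> (\<exists>T\<in>\<T>. x \<in> interior T)"
proof -
  have "AE x in lebesgue. \<forall>T\<in>\<T>. x \<in> T \<longrightarrow> x \<in> interior T"
    using finite_\<T> full_simplex.AE_interior[OF verts_simplex] by (intro AE_finite_allI) auto
  then show ?thesis
    by (rule eventually_mono) (use Un_\<T> closure_subset in blast)
qed

lemma AE_elemI:
  assumes "\<And>T. T \<in> \<T> \<Longrightarrow> AE x in lebesgue_on (interior T). P x"
  shows "AE x in lebesgue_on \<Omega>. P x"
proof -
  have "AE x in lebesgue. \<forall>T\<in>\<T>. x \<in> interior T \<longrightarrow> P x"
    using assms finite_\<T> by (intro AE_finite_allI) (auto simp: AE_lebesgue_on[OF elem_sets])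
  with AE_elem show ?thesis
    unfolding AE_lebesgue_on[OF \<Omega>_sets] by eventually_elim blast
qed

lemma AE_elemD:
  assumes "AE x in lebesgue_on \<Omega>. P x" "T \<in> \<T>"
  shows "AE x in lebesgue_on (interior T). P x"
  using assms elem_subset[OF assms(2)] unfolding AE_lebesgue_on[OF \<Omega>_sets] AE_lebesgue_on[OF elem_sets]
  by (auto elim!: eventually_mono)

text \<open>Broken gradients, Marini fluxes and element means are sums weighted by indicators of the
  element interiors; disjointness leaves a single summand.\<close>

lemma elem_sum:
  assumes "T \<in> \<T>" "x \<in> interior T"
  shows "(\<Sum>T'\<in>\<T>. indicator (interior T') x *\<^sub>R f T') = (f T :: 'b::real_vector)"
proof -
  have "(\<Sum>T'\<in>\<T>. indicator (interior T') x *\<^sub>R f T') = (\<Sum>T'\<in>\<T>. if T' = T then f T' else 0)"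
    by (rule sum.cong) (use assms elem_disjoint in \<open>auto simp: indicator_def\<close>)
  then show ?thesis using assms finite_\<T> by simp
qed

lemma integral_elem:
  fixes f :: "'a \<Rightarrow> 'b::euclidean_space"
  assumes f: "integrable (lebesgue_on \<Omega>) f"
  shows "(\<integral>x. f x \<partial>lebesgue_on \<Omega>) = (\<Sum>T\<in>\<T>. \<integral>x. f x \<partial>lebesgue_on (interior T))"
proof -
  have fi: "integrable lebesgue (\<lambda>x. indicator \<Omega> x *\<^sub>R f x)"
    using f integrable_lebesgue_on[OF \<Omega>_sets] by blast
  have i: "integrable lebesgue (\<lambda>x. indicator (interior T) x *\<^sub>R f x)" if "T \<in> \<T>" for T
  proof -
    have "(\<lambda>x. indicator (interior T) x *\<^sub>R (indicator \<Omega> x *\<^sub>R f x)) = (\<lambda>x. indicator (interior T) x *\<^sub>R f x)"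
      by (rule ext) (use elem_subset[OF that] in \<open>auto simp: indicator_def\<close>)
    then show ?thesis
      using Bochner_Integration.integrable_mult_indicator[OF elem_sets fi, of T] by (simp only:)
  qed
  have "(\<integral>x. f x \<partial>lebesgue_on \<Omega>) = (\<integral>x. (\<Sum>T\<in>\<T>. indicator (interior T) x *\<^sub>R f x) \<partial>lebesgue)"
    unfolding integral_lebesgue_on[OF \<Omega>_sets]
  proof (rule integral_cong_AE)
    show "AE x in lebesgue. indicator \<Omega> x *\<^sub>R f x = (\<Sum>T\<in>\<T>. indicator (interior T) x *\<^sub>R f x)"
      using AE_elem
    proof (rule eventually_mono)
      fix x assume x: "x \<in> \<Omega> \<longrightarrow> (\<exists>T\<in>\<T>. x \<in> interior T)"
      show "indicator \<Omega> x *\<^sub>R f x = (\<Sum>T\<in>\<T>. indicator (interior T) x *\<^sub>R f x)"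
      proof (cases "x \<in> \<Omega>")
        case True
        then obtain T where "T \<in> \<T>" "x \<in> interior T" using x by blast
        then show ?thesis using elem_sum[of T x "\<lambda>_. f x"] True by simp
      next
        case False
        then have "x \<notin> interior T" if "T \<in> \<T>" for T using elem_subset that by blast
        then show ?thesis using False by simp
      qed
    qed
  qed (use fi i in auto)
  also have "\<dots> = (\<Sum>T\<in>\<T>. \<integral>x. f x \<partial>lebesgue_on (interior T))"
    using i by (subst Bochner_Integration.integral_sum) (auto simp: integral_lebesgue_on[OF elem_sets])
  finally show ?thesis .
qed

lemma L2_elem: "v \<in> L2_space \<Omega> \<Longrightarrow> T \<in> \<T> \<Longrightarrow> v \<in> L2_space (interior T)"
  using L2_subset elem_subset \<Omega>_sets elem_sets by blast

lemma L2_elemI: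
  fixes v :: "'a \<Rightarrow> 'b::euclidean_space"
  assumes v: "\<And>T. T \<in> \<T> \<Longrightarrow> v \<in> L2_space (interior T)"
  shows "v \<in> L2_space \<Omega>"
proof -
  have L: "(\<lambda>x. indicator (interior T) x *\<^sub>R v x) \<in> L2_space \<Omega>" if T: "T \<in> \<T>" for T
  proof -
    have "(\<lambda>x. indicator (interior T) x *\<^sub>R v x) \<in> borel_measurable lebesgue"
      using L2_measurable[OF v[OF T]] borel_measurable_restrict_space_iff[of "interior T" lebesgue v] elem_sets by simp
    then have "(\<lambda>x. indicator (interior T) x *\<^sub>R v x) \<in> borel_measurable (lebesgue_on \<Omega>)"
      by (rule measurable_restrict_space1)
    moreover have "integrable (lebesgue_on \<Omega>) (\<lambda>x. (norm (indicator (interior T) x *\<^sub>R v x))\<^sup>2)"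
    proof -
      have "indicator \<Omega> x *\<^sub>R (norm (indicator (interior T) x *\<^sub>R v x))\<^sup>2 = indicator (interior T) x *\<^sub>R (norm (v x))\<^sup>2" for x
        using elem_subset[OF T] by (auto simp: indicator_def)
      then show ?thesis
        using v[OF T] unfolding integrable_lebesgue_on[OF \<Omega>_sets] by (simp add: L2_space_def integrable_lebesgue_on[OF elem_sets])
    qed
    ultimately show ?thesis by (simp add: L2_space_def)
  qed
  have "(\<lambda>x. \<Sum>T\<in>\<T>. indicator (interior T) x *\<^sub>R v x) \<in> L2_space \<Omega>" by (rule L2_sum) (rule L)
  then show ?thesis
  proof (rule L2_cong_AE[OF _ \<Omega>_sets])
    show "AE x in lebesgue_on \<Omega>. (\<Sum>T\<in>\<T>. indicator (interior T) x *\<^sub>R v x) = v x"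
      by (rule AE_elemI) (auto simp: AE_lebesgue_on[OF elem_sets] elem_sum)
  qed
qed

lemma l2_inner_elem:
  "v \<in> L2_space \<Omega> \<Longrightarrow> w \<in> L2_space \<Omega> \<Longrightarrow> l2_inner \<Omega> v w = (\<Sum>T\<in>\<T>. l2_inner (interior T) v w)"
  unfolding l2_inner_def by (intro integral_elem L2_integrable_inner)

lemma l2_norm_elem: "v \<in> L2_space \<Omega> \<Longrightarrow> (l2_norm \<Omega> v)\<^sup>2 = (\<Sum>T\<in>\<T>. (l2_norm (interior T) v)\<^sup>2)"
  by (simp add: l2_norm_sq l2_inner_elem)

end

section \<open>Crouzeix--Raviart and matched functions\<close>

definition elem_grad :: "'a::euclidean_space set \<Rightarrow> ('a \<Rightarrow> real) \<Rightarrow> 'a" where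
  "elem_grad T v = (SOME a. \<exists>c. \<forall>x\<in>interior T. v x = a \<bullet> x + c)"

definition elem_off :: "'a::euclidean_space set \<Rightarrow> ('a \<Rightarrow> real) \<Rightarrow> real" where
  "elem_off T v = (SOME c. \<forall>x\<in>interior T. v x = elem_grad T v \<bullet> x + c)"

text \<open>Piecewise affine functions are constrained only in the interiors. Facet values are taken
  from the affine extension, which is defined everywhere.\<close>

definition elem_ext :: "'a::euclidean_space set \<Rightarrow> ('a \<Rightarrow> real) \<Rightarrow> 'a \<Rightarrow> real" where
  "elem_ext T v x = elem_grad T v \<bullet> x + elem_off T v"

lemma affine_unique_on_open:
  fixes a a' :: "'a::euclidean_space"
  assumes "open U" "U \<noteq> {}" "\<And>x. x \<in> U \<Longrightarrow> a \<bullet> x + c = a' \<bullet> x + c'"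
  shows "a = a'" "c = (c'::real)"
proof -
  obtain x where x: "x \<in> U" using assms(2) by blast
  then obtain e where e: "e > 0" "ball x e \<subseteq> U" using assms(1) by (meson open_contains_ball)
  show "a = a'"
  proof (rule ccontr)
    assume ne: "a \<noteq> a'"
    define t where "t = e / (2 * norm (a - a'))"
    have t: "t > 0" "t * norm (a - a') < e" using e ne by (auto simp: t_def)
    then have "x + t *\<^sub>R (a - a') \<in> U" using e(2) by (auto simp: dist_norm)
    from assms(3)[OF this] assms(3)[OF x] have "t * ((a - a') \<bullet> (a - a')) = 0"
      by (simp add: inner_diff_left inner_add_right inner_diff_right algebra_simps)
    then show False using t ne by simp
  qed
  then show "c = c'" using assms(3)[OF x] by simp
qed

definition has_broken_gradient :: "'a::euclidean_space set set \<Rightarrow> ('a \<Rightarrow> real) \<Rightarrow> ('a \<Rightarrow> 'a) \<Rightarrow> bool" where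
  "has_broken_gradient \<T> w G \<longleftrightarrow> (\<forall>T\<in>\<T>. has_weak_gradient (interior T) w G)"

text \<open>A representative of the broken gradient with known values in the element interiors,
  whereas \<open>broken_grad\<close> is assembled from selected weak gradients that are determined
  only almost everywhere.\<close>

definition pw_grad :: "'a::euclidean_space set set \<Rightarrow> ('a \<Rightarrow> real) \<Rightarrow> 'a \<Rightarrow> 'a" where
  "pw_grad \<T> v x = (\<Sum>T\<in>\<T>. indicator (interior T) x *\<^sub>R elem_grad T v)"

lemma face_integral_cong:
  assumes "\<And>x. x \<in> F \<Longrightarrow> f x = g x"
  shows "face_integral F f = face_integral F g"
  unfolding face_integral_def set_lebesgue_integral_def
  by (rule Bochner_Integration.integral_cong) (use assms in \<open>auto simp: indicator_def\<close>)

lemma (in full_simplex) face_integral_facet: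
  assumes p: "p \<in> V"
  obtains m where "m > 0" "\<And>c k. face_integral (convex hull (V - {p})) (\<lambda>x. c \<bullet> x + k) =
      m * (c \<bullet> barycentre (convex hull (V - {p})) + k)"
proof (rule face_integral_affine[OF facet_indep[of p] facet_nonempty[OF p]])
  fix m :: real
  assume m: "0 < m" "\<And>c k. face_integral (convex hull (V - {p})) (\<lambda>x. c \<bullet> x + k) =
     m * (c \<bullet> ((1 / real (card (V - {p}))) *\<^sub>R \<Sum>(V - {p})) + k)"
  show thesis by (rule that[OF m(1)]) (simp only: m(2) barycentre_verts facet_verts)
qed

context mesh
begin

lemma pw_affine_eq:
  assumes "v \<in> piecewise_affine \<T>" "T \<in> \<T>" "x \<in> interior T"
  shows "v x = elem_ext T v x"
proof -
  have "\<exists>a c. \<forall>x\<in>interior T. v x = a \<bullet> x + c" using assms by (simp add: piecewise_affine_def)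
  then have "\<exists>c. \<forall>x\<in>interior T. v x = elem_grad T v \<bullet> x + c"
    unfolding elem_grad_def by (rule someI_ex)
  then have "\<forall>x\<in>interior T. v x = elem_grad T v \<bullet> x + elem_off T v"
    unfolding elem_off_def by (rule someI_ex)
  then show ?thesis using assms(3) by (simp add: elem_ext_def)
qed

lemma elem_unique:
  assumes T: "T \<in> \<T>" and v: "\<And>x. x \<in> interior T \<Longrightarrow> v x = a \<bullet> x + c"
  shows "elem_grad T v = a" "elem_off T v = c" "elem_ext T v x = a \<bullet> x + c"
proof -
  have "\<exists>c. \<forall>x\<in>interior T. v x = elem_grad T v \<bullet> x + c"
    unfolding elem_grad_def by (rule someI_ex) (use v in blast)
  then have "\<forall>x\<in>interior T. v x = elem_grad T v \<bullet> x + elem_off T v"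
    unfolding elem_off_def by (rule someI_ex)
  then have e: "elem_grad T v \<bullet> x + elem_off T v = a \<bullet> x + c" if "x \<in> interior T" for x
    using v that by simp
  show "elem_grad T v = a" "elem_off T v = c"
    using affine_unique_on_open[OF elem_open elem_nonempty[OF T] e] by auto
  then show "elem_ext T v x = a \<bullet> x + c" by (simp add: elem_ext_def)
qed

lemma
  assumes v: "v \<in> piecewise_affine \<T>" and w: "w \<in> piecewise_affine \<T>"
  shows pw_affine_lin: "(\<lambda>x. v x + c * w x) \<in> piecewise_affine \<T>"
    and elem_grad_lin: "T \<in> \<T> \<Longrightarrow> elem_grad T (\<lambda>x. v x + c * w x) = elem_grad T v + c *\<^sub>R elem_grad T w"
    and elem_ext_lin: "T \<in> \<T> \<Longrightarrow> elem_ext T (\<lambda>x. v x + c * w x) y = elem_ext T v y + c * elem_ext T w y"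
proof -
  have e: "v x + c * w x = (elem_grad T v + c *\<^sub>R elem_grad T w) \<bullet> x + (elem_off T v + c * elem_off T w)"
    if "T \<in> \<T>" "x \<in> interior T" for T x
    using pw_affine_eq[OF v that] pw_affine_eq[OF w that] by (simp add: elem_ext_def inner_add_left algebra_simps)
  then show "(\<lambda>x. v x + c * w x) \<in> piecewise_affine \<T>" unfolding piecewise_affine_def by blast
  show "T \<in> \<T> \<Longrightarrow> elem_grad T (\<lambda>x. v x + c * w x) = elem_grad T v + c *\<^sub>R elem_grad T w"
    using elem_unique(1)[OF _ e] by blast
  show "T \<in> \<T> \<Longrightarrow> elem_ext T (\<lambda>x. v x + c * w x) y = elem_ext T v y + c * elem_ext T w y"
    using elem_unique(3)[OF _ e] by (simp add: elem_ext_def inner_add_left algebra_simps)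
qed

lemma elem_closure: "T \<in> \<T> \<Longrightarrow> closure (interior T) = T"
  using convex_closure_interior[OF elem_convex elem_nonempty] full_simplex.compact_T[OF verts_simplex, of T]
  by (simp add: compact_imp_closed)

text \<open>Every point of the closed element is a limit point of its interior, so the limit that
  defines the trace is unique and equals that of the continuous affine extension.\<close>

lemma element_trace_eq:
  assumes v: "v \<in> piecewise_affine \<T>" and T: "T \<in> \<T>" and x: "x \<in> T"
  shows "element_trace T v x = elem_ext T v x"
proof -
  have "x islimpt interior T"
  proof (cases "x \<in> interior T")
    case True then show ?thesis by (simp add: interior_limit_point)
  next
    case False then show ?thesis using elem_closure[OF T] x by (auto simp: closure_def)
  qed
  then have nt: "at x within interior T \<noteq> bot" by (simp add: trivial_limit_within)
  have "continuous_on UNIV (elem_ext T v)" unfolding elem_ext_def by (intro continuous_intros)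
  then have "(elem_ext T v \<longlongrightarrow> elem_ext T v x) (at x within interior T)"
    by (meson UNIV_I continuous_on_def subset_UNIV tendsto_within_subset)
  then have "(v \<longlongrightarrow> elem_ext T v x) (at x within interior T)"
    by (rule Lim_transform_eventually)
       (use pw_affine_eq[OF v T] in \<open>auto simp: eventually_at_filter\<close>)
  then show ?thesis unfolding element_trace_def using tendsto_Lim nt by blast
qed

lemma facet_cases:
  assumes "T \<in> \<T>" "F facet_of T"
  obtains p where "p \<in> verts T" "F = convex hull (verts T - {p})"
  using assms full_simplex.facet_iff[OF verts_simplex, of T F] by auto

lemma facet_conv: "T \<in> \<T> \<Longrightarrow> p \<in> verts T \<Longrightarrow> convex hull (verts T - {p}) facet_of T"
  using full_simplex.facet_iff[OF verts_simplex, of T] by auto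

text \<open>An affine function has facet integral zero iff it vanishes at the facet barycentre. The
  agreement of two sides can then be asked for all pairs of elements: it is trivial for T = T', and
  on boundary facets both values are 0.\<close>

lemma cr_iff:
  "v \<in> cr_space \<Omega> \<T> \<longleftrightarrow> v \<in> piecewise_affine \<T> \<and>
     (\<forall>T\<in>\<T>. \<forall>T'\<in>\<T>. \<forall>F. F facet_of T \<and> F facet_of T' \<longrightarrow>
        elem_ext T v (barycentre F) = elem_ext T' v (barycentre F)) \<and>
     (\<forall>T\<in>\<T>. \<forall>F. F facet_of T \<and> F \<subseteq> frontier \<Omega> \<longrightarrow> elem_ext T v (barycentre F) = 0)"
proof (cases "v \<in> piecewise_affine \<T>")
  case v: True
  have sub: "F \<subseteq> T" if "F facet_of T" for F T :: "'a set"
    using that by (simp add: facet_of_imp_subset)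
  have jump: "face_integral F (\<lambda>x. element_trace T v x - element_trace T' v x) = 0 \<longleftrightarrow>
      elem_ext T v (barycentre F) = elem_ext T' v (barycentre F)"
    if T: "T \<in> \<T>" "T' \<in> \<T>" and F: "F facet_of T" "F facet_of T'" for T T' F
  proof -
    obtain p where p: "p \<in> verts T" "F = convex hull (verts T - {p})" using facet_cases T F by blast
    obtain m where m: "m > 0" "\<And>c k. face_integral F (\<lambda>x. c \<bullet> x + k) = m * (c \<bullet> barycentre F + k)"
      using full_simplex.face_integral_facet[OF verts_simplex[OF T(1)] p(1)] p(2) by metis
    have "face_integral F (\<lambda>x. element_trace T v x - element_trace T' v x) =
        face_integral F (\<lambda>x. (elem_grad T v - elem_grad T' v) \<bullet> x + (elem_off T v - elem_off T' v))"
    proof (rule face_integral_cong)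
      fix x assume "x \<in> F"
      then have "x \<in> T" "x \<in> T'" using sub F by blast+
      then show "element_trace T v x - element_trace T' v x =
          (elem_grad T v - elem_grad T' v) \<bullet> x + (elem_off T v - elem_off T' v)"
        by (simp add: element_trace_eq[OF v] T elem_ext_def inner_diff_left)
    qed
    also have "\<dots> = m * (elem_ext T v (barycentre F) - elem_ext T' v (barycentre F))"
      by (simp only: m(2)) (simp add: elem_ext_def inner_diff_left algebra_simps)
    finally show ?thesis using m(1) by simp
  qed
  have bdry: "face_integral F (element_trace T v) = 0 \<longleftrightarrow> elem_ext T v (barycentre F) = 0"
    if T: "T \<in> \<T>" and F: "F facet_of T" for T F
  proof -
    obtain p where p: "p \<in> verts T" "F = convex hull (verts T - {p})" using facet_cases T F by blast
    obtain m where m: "m > 0" "\<And>c k. face_integral F (\<lambda>x. c \<bullet> x + k) = m * (c \<bullet> barycentre F + k)"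
      using full_simplex.face_integral_facet[OF verts_simplex[OF T(1)] p(1)] p(2) by metis
    have "face_integral F (element_trace T v) = face_integral F (\<lambda>x. elem_grad T v \<bullet> x + elem_off T v)"
      using sub[OF F] by (intro face_integral_cong)
        (auto simp: element_trace_eq[OF v] T elem_ext_def dest!: subsetD)
    then show ?thesis using m by (simp add: elem_ext_def)
  qed
  show ?thesis
  proof
    assume "v \<in> cr_space \<Omega> \<T>"
    then have J0: "\<And>T T' F. T \<in> \<T> \<Longrightarrow> T' \<in> \<T> \<Longrightarrow> T \<noteq> T' \<Longrightarrow> F facet_of T \<Longrightarrow> F facet_of T' \<Longrightarrow> \<not> F \<subseteq> frontier \<Omega> \<Longrightarrow>
        face_integral F (\<lambda>x. element_trace T v x - element_trace T' v x) = 0"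
      and B0: "\<And>T F. T \<in> \<T> \<Longrightarrow> F facet_of T \<Longrightarrow> F \<subseteq> frontier \<Omega> \<Longrightarrow> face_integral F (element_trace T v) = 0"
      unfolding cr_space_def by simp_all
    have J: "elem_ext T v (barycentre F) = elem_ext T' v (barycentre F)"
      if "T \<in> \<T>" "T' \<in> \<T>" "T \<noteq> T'" "F facet_of T" "F facet_of T'" "\<not> F \<subseteq> frontier \<Omega>" for T T' F
      by (rule jump[OF that(1,2,4,5), THEN iffD1, OF J0[OF that]])
    have B: "elem_ext T v (barycentre F) = 0" if "T \<in> \<T>" "F facet_of T" "F \<subseteq> frontier \<Omega>" for T F
      by (rule bdry[OF that(1,2), THEN iffD1, OF B0[OF that]])
    have "elem_ext T v (barycentre F) = elem_ext T' v (barycentre F)"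
      if "T \<in> \<T>" "T' \<in> \<T>" "F facet_of T" "F facet_of T'" for T T' F
      using J[OF that(1,2) _ that(3,4)] B[OF that(1,3)] B[OF that(2,4)] by (cases "T = T'"; cases "F \<subseteq> frontier \<Omega>") auto
    then show "v \<in> piecewise_affine \<T> \<and>
     (\<forall>T\<in>\<T>. \<forall>T'\<in>\<T>. \<forall>F. F facet_of T \<and> F facet_of T' \<longrightarrow>
        elem_ext T v (barycentre F) = elem_ext T' v (barycentre F)) \<and>
     (\<forall>T\<in>\<T>. \<forall>F. F facet_of T \<and> F \<subseteq> frontier \<Omega> \<longrightarrow> elem_ext T v (barycentre F) = 0)"
      using v B by blast
  next
    assume a: "v \<in> piecewise_affine \<T> \<and>
     (\<forall>T\<in>\<T>. \<forall>T'\<in>\<T>. \<forall>F. F facet_of T \<and> F facet_of T' \<longrightarrow>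
        elem_ext T v (barycentre F) = elem_ext T' v (barycentre F)) \<and>
     (\<forall>T\<in>\<T>. \<forall>F. F facet_of T \<and> F \<subseteq> frontier \<Omega> \<longrightarrow> elem_ext T v (barycentre F) = 0)"
    show "v \<in> cr_space \<Omega> \<T>"
      unfolding cr_space_def mem_Collect_eq using a jump bdry by (intro conjI ballI allI impI) metis+
  qed
qed (auto simp: cr_space_def)

lemma cr_pw_affine: "v \<in> cr_space \<Omega> \<T> \<Longrightarrow> v \<in> piecewise_affine \<T>"
  by (simp add: cr_space_def)

lemma cr_lin:
  assumes "v \<in> cr_space \<Omega> \<T>" "w \<in> cr_space \<Omega> \<T>"
  shows "(\<lambda>x. v x + c * w x) \<in> cr_space \<Omega> \<T>"
proof -
  have p: "v \<in> piecewise_affine \<T>" "w \<in> piecewise_affine \<T>" using assms cr_pw_affine by auto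
  have v: "\<And>T T' F. T \<in> \<T> \<Longrightarrow> T' \<in> \<T> \<Longrightarrow> F facet_of T \<Longrightarrow> F facet_of T' \<Longrightarrow> elem_ext T v (barycentre F) = elem_ext T' v (barycentre F)"
    "\<And>T F. T \<in> \<T> \<Longrightarrow> F facet_of T \<Longrightarrow> F \<subseteq> frontier \<Omega> \<Longrightarrow> elem_ext T v (barycentre F) = 0"
    using assms(1) unfolding cr_iff by blast+
  have w: "\<And>T T' F. T \<in> \<T> \<Longrightarrow> T' \<in> \<T> \<Longrightarrow> F facet_of T \<Longrightarrow> F facet_of T' \<Longrightarrow> elem_ext T w (barycentre F) = elem_ext T' w (barycentre F)"
    "\<And>T F. T \<in> \<T> \<Longrightarrow> F facet_of T \<Longrightarrow> F \<subseteq> frontier \<Omega> \<Longrightarrow> elem_ext T w (barycentre F) = 0"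
    using assms(2) unfolding cr_iff by blast+
  show ?thesis
    unfolding cr_iff
  proof (intro conjI ballI allI impI pw_affine_lin[OF p])
    fix T T' F assume h: "T \<in> \<T>" "T' \<in> \<T>" "F facet_of T \<and> F facet_of T'"
    then show "elem_ext T (\<lambda>x. v x + c * w x) (barycentre F) = elem_ext T' (\<lambda>x. v x + c * w x) (barycentre F)"
      unfolding elem_ext_lin[OF p h(1)] elem_ext_lin[OF p h(2)] using v(1)[of T T' F] w(1)[of T T' F] by simp
  next
    fix T F assume h: "T \<in> \<T>" "F facet_of T \<and> F \<subseteq> frontier \<Omega>"
    then show "elem_ext T (\<lambda>x. v x + c * w x) (barycentre F) = 0"
      unfolding elem_ext_lin[OF p h(1)] using v(2)[of T F] w(2)[of T F] by simp
  qed
qed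

section \<open>Broken gradients and matched functions\<close>

lemma pw_grad_elem: "T \<in> \<T> \<Longrightarrow> x \<in> interior T \<Longrightarrow> pw_grad \<T> v x = elem_grad T v"
  unfolding pw_grad_def by (rule elem_sum)

lemma weak_gradient_cong:
  assumes S: "open S" "bounded S" and "has_weak_gradient S v G" "\<And>x. x \<in> S \<Longrightarrow> v x = v' x" "\<And>x. x \<in> S \<Longrightarrow> G x = G' x"
  shows "has_weak_gradient S v' G'"
  by (rule weak_gradient_cong_AE[OF S assms(3)])
     (use assms(4,5) open_sets_lebesgue[OF S(1)] in \<open>auto simp: AE_lebesgue_on\<close>)

lemma pw_affine_gradient:
  assumes v: "v \<in> piecewise_affine \<T>"
  shows "has_broken_gradient \<T> v (pw_grad \<T> v)"
  unfolding has_broken_gradient_def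
proof
  fix T assume T: "T \<in> \<T>"
  show "has_weak_gradient (interior T) v (pw_grad \<T> v)"
    by (rule weak_gradient_cong[OF elem_open elem_bounded[OF T]
          weak_gradient_affine[OF elem_open elem_bounded[OF T], of "elem_grad T v" "elem_off T v"]])
       (use T pw_affine_eq[OF v T] in \<open>auto simp: elem_ext_def pw_grad_elem\<close>)
qed

lemma
  assumes "has_broken_gradient \<T> w G"
  shows broken_L2: "w \<in> L2_space \<Omega>" and broken_L2': "G \<in> L2_space \<Omega>"
    and broken_grad_AE: "AE x in lebesgue_on \<Omega>. broken_grad \<T> w x = G x"
proof -
  have wg: "has_weak_gradient (interior T) w G" if "T \<in> \<T>" for T
    using assms that by (simp add: has_broken_gradient_def)
  show "w \<in> L2_space \<Omega>" "G \<in> L2_space \<Omega>"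
    using wg weak_gradient_L2 weak_gradient_L2' by (blast intro: L2_elemI)+
  show "AE x in lebesgue_on \<Omega>. broken_grad \<T> w x = G x"
  proof (rule AE_elemI)
    fix T assume T: "T \<in> \<T>"
    have "AE x in lebesgue_on (interior T). weak_grad (interior T) w x = G x"
      by (rule weak_grad_AE[OF elem_open elem_bounded[OF T] wg[OF T]])
    then show "AE x in lebesgue_on (interior T). broken_grad \<T> w x = G x"
      unfolding AE_lebesgue_on[OF elem_sets]
      by (rule eventually_mono) (auto simp: broken_grad_def elem_sum[OF T])
  qed
qed

lemma broken_gradient_lin:
  "has_broken_gradient \<T> v G \<Longrightarrow> has_broken_gradient \<T> w H \<Longrightarrow>
    has_broken_gradient \<T> (\<lambda>x. v x + c * w x) (\<lambda>x. G x + c *\<^sub>R H x)"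
  unfolding has_broken_gradient_def
  by (intro ballI weak_gradient_add_scaleR elem_open elem_bounded) auto

lemma weak_gradient_broken: "has_weak_gradient \<Omega> v G \<Longrightarrow> has_broken_gradient \<T> v G"
  unfolding has_broken_gradient_def
  using weak_gradient_subset[OF open_\<Omega> elem_open elem_subset] by blast

lemma broken_gradient_unique:
  assumes "has_broken_gradient \<T> v G" "has_broken_gradient \<T> v H"
  shows "AE x in lebesgue_on \<Omega>. G x = H x"
  using broken_grad_AE[OF assms(1)] broken_grad_AE[OF assms(2)] by eventually_elim simp

text \<open>The gradient is an argument because it enters the facet means. Facets are named by their
  opposite vertices, so that a common facet is expressed by equality of two convex hulls.\<close>

definition matched :: "('a \<Rightarrow> real) \<Rightarrow> ('a \<Rightarrow> 'a) \<Rightarrow> bool" where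
  "matched w G \<longleftrightarrow> has_broken_gradient \<T> w G \<and>
     (\<forall>T\<in>\<T>. \<forall>T'\<in>\<T>. \<forall>p\<in>verts T. \<forall>p'\<in>verts T'. convex hull (verts T - {p}) = convex hull (verts T' - {p'}) \<longrightarrow>
        face_mean (verts T) p w G = face_mean (verts T') p' w G) \<and>
     (\<forall>T\<in>\<T>. \<forall>p\<in>verts T. convex hull (verts T - {p}) \<subseteq> frontier \<Omega> \<longrightarrow> face_mean (verts T) p w G = 0)"

lemma matched_broken: "matched w G \<Longrightarrow> has_broken_gradient \<T> w G"
  by (simp add: matched_def)

lemma broken_elem_L2:
  assumes "has_broken_gradient \<T> w G" "T \<in> \<T>"
  shows "w \<in> L2_space (interior (convex hull (verts T)))" "G \<in> L2_space (interior (convex hull (verts T)))"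
  using assms by (auto simp: has_broken_gradient_def has_weak_gradient_def)

lemma matched_lin:
  assumes "matched v G" "matched w H"
  shows "matched (\<lambda>x. v x + c * w x) (\<lambda>x. G x + c *\<^sub>R H x)"
proof -
  note b = matched_broken[OF assms(1)] matched_broken[OF assms(2)]
  have f: "face_mean (verts T) p (\<lambda>x. v x + c * w x) (\<lambda>x. G x + c *\<^sub>R H x) =
      face_mean (verts T) p v G + c * face_mean (verts T) p w H" if "T \<in> \<T>" for T p
    by (rule full_simplex.face_mean_add_scaleR[OF verts_simplex[OF that]])
       (use broken_elem_L2[OF b(1) that] broken_elem_L2[OF b(2) that] in auto)
  show ?thesis
    unfolding matched_def
  proof (intro conjI ballI impI)
    show "has_broken_gradient \<T> (\<lambda>x. v x + c * w x) (\<lambda>x. G x + c *\<^sub>R H x)"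
      by (rule broken_gradient_lin[OF b])
  next
    fix T T' p p' assume h: "T \<in> \<T>" "T' \<in> \<T>" "p \<in> verts T" "p' \<in> verts T'" "convex hull (verts T - {p}) = convex hull (verts T' - {p'})"
    then have "face_mean (verts T) p v G = face_mean (verts T') p' v G" "face_mean (verts T) p w H = face_mean (verts T') p' w H"
      using assms unfolding matched_def by blast+
    then show "face_mean (verts T) p (\<lambda>x. v x + c * w x) (\<lambda>x. G x + c *\<^sub>R H x) = face_mean (verts T') p' (\<lambda>x. v x + c * w x) (\<lambda>x. G x + c *\<^sub>R H x)"
      unfolding f[OF h(1)] f[OF h(2)] by simp
  next
    fix T p assume h: "T \<in> \<T>" "p \<in> verts T" "convex hull (verts T - {p}) \<subseteq> frontier \<Omega>"
    then have "face_mean (verts T) p v G = 0" "face_mean (verts T) p w H = 0"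
      using assms unfolding matched_def by blast+
    then show "face_mean (verts T) p (\<lambda>x. v x + c * w x) (\<lambda>x. G x + c *\<^sub>R H x) = 0"
      unfolding f[OF h(1)] by simp
  qed
qed

lemma face_mean_pw_affine:
  assumes v: "v \<in> piecewise_affine \<T>" and G: "has_broken_gradient \<T> v G" and T: "T \<in> \<T>" and p: "p \<in> verts T"
  shows "face_mean (verts T) p v G = elem_ext T v (barycentre (convex hull (verts T - {p})))"
proof -
  interpret S: full_simplex "verts T" by (rule verts_simplex[OF T])
  have "AE x in lebesgue_on (interior T). G x = pw_grad \<T> v x"
    using AE_elemD[OF broken_gradient_unique[OF G pw_affine_gradient[OF v]] T] .
  then have "AE x in lebesgue_on (interior T). G x = elem_grad T v"
    unfolding AE_lebesgue_on[OF elem_sets] by (rule eventually_mono) (auto simp: pw_grad_elem T)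
  moreover have "AE x in lebesgue_on (interior T). v x = elem_grad T v \<bullet> x + elem_off T v"
    unfolding AE_lebesgue_on[OF elem_sets] using pw_affine_eq[OF v T] by (auto simp: elem_ext_def)
  moreover have eT: "convex hull (verts T) = T" using T by simp
  ultimately have "face_mean (verts T) p v G = face_mean (verts T) p (\<lambda>x. elem_grad T v \<bullet> x + elem_off T v) (\<lambda>x. elem_grad T v)"
    by (intro S.face_mean_cong_AE[unfolded eT] broken_elem_L2[OF G T, unfolded eT])
  also have "\<dots> = elem_ext T v (barycentre (convex hull (verts T - {p})))"
    unfolding S.face_mean_affine[OF p] by (simp add: elem_ext_def)
  finally show ?thesis .
qed

text \<open>Used in both directions: Crouzeix--Raviart functions inherit everything shown for
  matched functions, and conforming functions, being matched, are seen to lie in the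
  Crouzeix--Raviart space.\<close>

lemma matched_pw_affine_iff:
  assumes v: "v \<in> piecewise_affine \<T>" and G: "has_broken_gradient \<T> v G"
  shows "matched v G \<longleftrightarrow> v \<in> cr_space \<Omega> \<T>"
proof
  assume m: "matched v G"
  show "v \<in> cr_space \<Omega> \<T>"
    unfolding cr_iff
  proof (intro conjI ballI allI impI v)
    fix T T' F assume T: "T \<in> \<T>" "T' \<in> \<T>" and "F facet_of T \<and> F facet_of T'"
    then obtain p p' where p: "p \<in> verts T" "F = convex hull (verts T - {p})" "p' \<in> verts T'" "F = convex hull (verts T' - {p'})"
      using facet_cases by metis
    then have "face_mean (verts T) p v G = face_mean (verts T') p' v G"
      using m T unfolding matched_def by blast
    then show "elem_ext T v (barycentre F) = elem_ext T' v (barycentre F)"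
      using face_mean_pw_affine[OF v G T(1) p(1)] face_mean_pw_affine[OF v G T(2) p(3)] p(2,4) by metis
  next
    fix T F assume T: "T \<in> \<T>" and F: "F facet_of T \<and> F \<subseteq> frontier \<Omega>"
    then obtain p where p: "p \<in> verts T" "F = convex hull (verts T - {p})"
      using facet_cases by metis
    then have "face_mean (verts T) p v G = 0" using m T F unfolding matched_def by blast
    then show "elem_ext T v (barycentre F) = 0"
      using face_mean_pw_affine[OF v G T p(1)] p(2) by metis
  qed
next
  assume c: "v \<in> cr_space \<Omega> \<T>"
  show "matched v G"
    unfolding matched_def
  proof (intro conjI ballI impI G)
    fix T T' p p' assume h: "T \<in> \<T>" "T' \<in> \<T>" "p \<in> verts T" "p' \<in> verts T'" "convex hull (verts T - {p}) = convex hull (verts T' - {p'})"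
    have "convex hull (verts T - {p}) facet_of T" "convex hull (verts T - {p}) facet_of T'"
      using facet_conv[OF h(1,3)] facet_conv[OF h(2,4)] h(5) by auto
    then show "face_mean (verts T) p v G = face_mean (verts T') p' v G"
      unfolding face_mean_pw_affine[OF v G h(1,3)] face_mean_pw_affine[OF v G h(2,4)] h(5)[symmetric]
      using c h(1,2) unfolding cr_iff by blast
  next
    fix T p assume h: "T \<in> \<T>" "p \<in> verts T" "convex hull (verts T - {p}) \<subseteq> frontier \<Omega>"
    then show "face_mean (verts T) p v G = 0"
      unfolding face_mean_pw_affine[OF v G h(1,2)]
      using c facet_conv[OF h(1,2)] unfolding cr_iff by blast
  qed
qed

lemma cr_matched: "v \<in> cr_space \<Omega> \<T> \<Longrightarrow> matched v (pw_grad \<T> v)"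
  using matched_pw_affine_iff pw_affine_gradient cr_pw_affine by blast

text \<open>The Crouzeix--Raviart interpolant, with the facet means as degrees of freedom. On the
  mesh skeleton the sum is empty and gives 0.\<close>

definition cr_interp :: "('a \<Rightarrow> real) \<Rightarrow> ('a \<Rightarrow> 'a) \<Rightarrow> 'a \<Rightarrow> real" where
  "cr_interp w G x = (\<Sum>T\<in>\<T>. indicator (interior T) x *\<^sub>R interp (verts T) (\<lambda>p. face_mean (verts T) p w G) x)"

lemma cr_interp_elem:
  fixes w :: "'a \<Rightarrow> real" and G :: "'a \<Rightarrow> 'a"
  assumes T: "T \<in> \<T>"
  defines "m \<equiv> \<lambda>p. face_mean (verts T) p w G"
  shows "x \<in> interior T \<Longrightarrow> cr_interp w G x = interp (verts T) m x"
    and "elem_grad T (cr_interp w G) = interp_grad (verts T) m"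
    and "elem_ext T (cr_interp w G) y = interp (verts T) m y"
proof -
  show 1: "cr_interp w G x = interp (verts T) m x" if "x \<in> interior T" for x
    unfolding cr_interp_def m_def using elem_sum[OF T that, of "\<lambda>T. interp (verts T) (\<lambda>p. face_mean (verts T) p w G) x"] .
  have 2: "cr_interp w G x = interp_grad (verts T) m \<bullet> x + interp (verts T) m 0" if "x \<in> interior T" for x
    using 1[OF that] interp_affine by metis
  show "elem_grad T (cr_interp w G) = interp_grad (verts T) m"
    using elem_unique(1)[OF T 2] .
  show "elem_ext T (cr_interp w G) y = interp (verts T) m y"
    using elem_unique(3)[OF T 2] interp_affine by metis
qed

lemma cr_interp_space:
  assumes m: "matched w G"
  shows "cr_interp w G \<in> cr_space \<Omega> \<T>"
proof -
  have "cr_interp w G x = interp_grad (verts T) (\<lambda>p. face_mean (verts T) p w G) \<bullet> x + interp (verts T) (\<lambda>p. face_mean (verts T) p w G) 0"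
    if "T \<in> \<T>" "x \<in> interior T" for T x
    using cr_interp_elem(1)[OF that] interp_affine by metis
  then have pa: "cr_interp w G \<in> piecewise_affine \<T>" unfolding piecewise_affine_def by blast
  have e: "elem_ext T (cr_interp w G) (barycentre (convex hull (verts T - {p}))) = face_mean (verts T) p w G"
    if "T \<in> \<T>" "p \<in> verts T" for T p
    unfolding cr_interp_elem(3)[OF that(1)]
    using full_simplex.interp_facet_barycentre[OF verts_simplex[OF that(1)] that(2)] .
  show ?thesis
    unfolding cr_iff
  proof (intro conjI ballI allI impI pa)
    fix T T' F assume T: "T \<in> \<T>" "T' \<in> \<T>" and "F facet_of T \<and> F facet_of T'"
    then obtain p p' where p: "p \<in> verts T" "F = convex hull (verts T - {p})" "p' \<in> verts T'" "F = convex hull (verts T' - {p'})"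
      using facet_cases by metis
    then have "face_mean (verts T) p w G = face_mean (verts T') p' w G"
      using m T unfolding matched_def by blast
    then show "elem_ext T (cr_interp w G) (barycentre F) = elem_ext T' (cr_interp w G) (barycentre F)"
      using e[OF T(1) p(1)] e[OF T(2) p(3)] p(2,4) by metis
  next
    fix T F assume T: "T \<in> \<T>" and F: "F facet_of T \<and> F \<subseteq> frontier \<Omega>"
    then obtain p where p: "p \<in> verts T" "F = convex hull (verts T - {p})"
      using facet_cases by metis
    then have "face_mean (verts T) p w G = 0" using m T F unfolding matched_def by blast
    then show "elem_ext T (cr_interp w G) (barycentre F) = 0" using e[OF T p(1)] p(2) by metis
  qed
qed

text \<open>By conformity \<open>T \<inter> T'\<close> is a face of T. It contains a relative
  interior point of F, hence all of F, and its dimension is below that of T, so it equals F.\<close>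

lemma shared_facet:
  assumes T: "T \<in> \<T>" "T' \<in> \<T>" and F: "F facet_of T" and w: "w \<in> rel_interior F" "w \<in> T'"
  shows "F facet_of T'"
proof (cases "T = T'")
  case False
  have FT: "F face_of T" "F \<noteq> {}" "aff_dim F = aff_dim T - 1" using F by (auto simp: facet_of_def)
  have G: "T \<inter> T' face_of T" "T \<inter> T' face_of T'" using face_Int[OF T] face_Int[OF T(2,1)] by (auto simp: Int_commute)
  have "w \<in> T" using w rel_interior_subset FT(1) face_of_imp_subset by blast
  then have sub: "F \<subseteq> T \<inter> T'"
    using subset_of_face_of[OF G(1) face_of_imp_subset[OF FT(1)]] w by blast
  have "T \<inter> T' \<noteq> T" using elem_Int_interior[OF T False] elem_nonempty[OF T(1)] interior_subset[of T] by blast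
  then have lt: "aff_dim (T \<inter> T') < aff_dim T" using face_of_aff_dim_lt[OF elem_convex[OF T(1)] G(1)] by blast
  have "F face_of T \<inter> T'" using face_of_subset[OF FT(1) sub] by blast
  then have "F = T \<inter> T'"
    using face_of_aff_dim_lt[of "T \<inter> T'" F] convex_Int[OF elem_convex elem_convex] T lt FT(3) by fastforce
  then show ?thesis using G(2) FT elem_aff_dim T by (simp add: facet_of_def)
qed (use F in simp)

text \<open>Only the coordinates that vanish at z restrict the direction, and they do not decrease
  along e; the others are positive at z and remain so for small steps.\<close>

lemma cone_enters:
  assumes T: "T \<in> \<T>" and z: "z \<in> T" and e: "\<And>r. r \<in> verts T \<Longrightarrow> bary (verts T) r z = 0 \<Longrightarrow> 0 \<le> bgrad (verts T) r \<bullet> e"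
  shows "\<forall>\<^sub>F \<tau> in at_right 0. z + \<tau> *\<^sub>R e \<in> T"
proof -
  interpret S: full_simplex "verts T" by (rule verts_simplex[OF T])
  have in_iff: "x \<in> T \<longleftrightarrow> (\<forall>p\<in>verts T. 0 \<le> bary (verts T) p x)" for x using S.in_iff T by simp
  have ev: "\<forall>\<^sub>F \<tau> in at_right 0. 0 \<le> bary (verts T) r (z + \<tau> *\<^sub>R e)" if r: "r \<in> verts T" for r
  proof (cases "bary (verts T) r z = 0")
    case True
    have "0 \<le> bary (verts T) r (z + \<tau> *\<^sub>R e)" if "\<tau> > 0" for \<tau>
      using bary_diff[of "verts T" r "z + \<tau> *\<^sub>R e" z] True e[OF r True] that by simp
    then show ?thesis by (auto simp: eventually_at_filter)
  next
    case False
    then have "0 < bary (verts T) r z" using z r in_iff by force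
    moreover have "((\<lambda>\<tau>. bary (verts T) r (z + \<tau> *\<^sub>R e)) \<longlongrightarrow> bary (verts T) r (z + 0 *\<^sub>R e)) (at_right 0)"
      unfolding bary_def by (intro tendsto_intros)
    ultimately have "\<forall>\<^sub>F \<tau> in at_right 0. 0 < bary (verts T) r (z + \<tau> *\<^sub>R e)"
      by (intro order_tendstoD(1)) auto
    then show ?thesis by (rule eventually_mono) simp
  qed
  then have "\<forall>\<^sub>F \<tau> in at_right 0. \<forall>r\<in>verts T. 0 \<le> bary (verts T) r (z + \<tau> *\<^sub>R e)"
    by (intro eventually_ball_finite) auto
  then show ?thesis using in_iff by simp
qed

lemma closed_avoid:
  assumes "closed S" "z \<notin> S"
  shows "\<forall>\<^sub>F \<tau> in at_right (0::real). z + \<tau> *\<^sub>R e \<notin> (S :: 'a set)"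
proof -
  have "((\<lambda>\<tau>. z + \<tau> *\<^sub>R e) \<longlongrightarrow> z + 0 *\<^sub>R e) (at_right (0::real))" by (intro tendsto_intros)
  then have "\<forall>\<^sub>F \<tau> in at_right (0::real). z + \<tau> *\<^sub>R e \<in> - S"
    by (rule topological_tendstoD) (use assms in auto)
  then show ?thesis by simp
qed

lemma elem_closed: "T \<in> \<T> \<Longrightarrow> closed T"
  using elem_closure closed_closure by metis

definition thin_faces :: "'a set set" where
  "thin_faces = {G. \<exists>T\<in>\<T>. G face_of T \<and> aff_dim G \<le> int DIM('a) - 2}"

lemma finite_thin_faces: "finite thin_faces"
proof -
  have "finite {G. G face_of T}" if "T \<in> \<T>" for T
  proof -
    have "int DIM('a) simplex T" using mesh that by (auto simp: simplicial_mesh_def)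
    then show ?thesis using finite_polytope_faces simplex_imp_polytope by blast
  qed
  then have "finite (\<Union>T\<in>\<T>. {G. G face_of T})" using finite_\<T> by blast
  then show ?thesis by (rule finite_subset[rotated]) (auto simp: thin_faces_def)
qed

text \<open>Two vanishing coordinates would place z in the hull of the remaining d - 1 vertices, a
  face of dimension at most d - 2.\<close>

lemma one_zero_coordinate:
  assumes T: "T \<in> \<T>" and z: "z \<in> T" "z \<notin> \<Union>thin_faces" and qr: "q \<in> verts T" "r \<in> verts T"
    and 0: "bary (verts T) q z = 0" "bary (verts T) r z = 0"
  shows "q = r"
proof (rule ccontr)
  assume ne: "q \<noteq> r"
  interpret S: full_simplex "verts T" by (rule verts_simplex[OF T])
  let ?W = "verts T - {q, r}"
  have "(\<Sum>p\<in>?W. bary (verts T) p z) = (\<Sum>p\<in>verts T. bary (verts T) p z)"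
    by (rule sum.mono_neutral_left) (use 0 in auto)
  moreover have "(\<Sum>p\<in>?W. bary (verts T) p z *\<^sub>R p) = (\<Sum>p\<in>verts T. bary (verts T) p z *\<^sub>R p)"
    by (rule sum.mono_neutral_left) (use 0 in auto)
  moreover have "\<forall>p\<in>verts T. 0 \<le> bary (verts T) p z" using z(1) S.in_iff T by simp
  ultimately have "z \<in> convex hull ?W"
    unfolding convex_hull_finite[OF finite_Diff[OF S.finite]] mem_Collect_eq
    by (intro exI[of _ "\<lambda>p. bary (verts T) p z"]) (auto simp: S.sum1 S.repr)
  moreover have "convex hull ?W face_of T"
    using face_of_convex_hull_affine_independent[OF S.indep, of "convex hull ?W"] T by auto
  moreover have "aff_dim (convex hull ?W) \<le> int DIM('a) - 2"
  proof -
    have "card ?W = DIM('a) - 1" using S.card qr ne by (simp add: card_Diff_subset)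
    moreover have "finite ?W" by simp
    ultimately have "aff_dim ?W \<le> int (DIM('a) - 1) - 1" using aff_dim_le_card[of ?W] by simp
    then show ?thesis using DIM_positive[where 'a='a] by (simp add: aff_dim_convex_hull of_nat_diff)
  qed
  ultimately show False using z(2) T unfolding thin_faces_def by blast
qed

text \<open>The rays from x0 that hit a thin face lie in the affine hull of x0 and that face, which
  has dimension below d and is null. Finitely many of these hulls cannot cover the nonempty open
  complement of the closed domain.\<close>

lemma generic_exit_point:
  obtains y where "y \<notin> closure \<Omega>" "\<And>s. 0 < s \<Longrightarrow> x0 + s *\<^sub>R (y - x0) \<notin> \<Union>thin_faces"
proof -
  have "negligible (\<Union>G\<in>thin_faces. affine hull (insert x0 G))"
  proof (rule negligible_Union[of "(\<lambda>G. affine hull (insert x0 G)) ` thin_faces", simplified])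
    show "finite ((\<lambda>G. affine hull (insert x0 G)) ` thin_faces)" using finite_thin_faces by simp
    fix S assume "S \<in> (\<lambda>G. affine hull (insert x0 G)) ` thin_faces"
    then obtain G where G: "S = affine hull (insert x0 G)" "aff_dim G \<le> int DIM('a) - 2" by (auto simp: thin_faces_def)
    have "aff_dim S \<le> aff_dim G + 1" by (simp add: G(1) aff_dim_insert)
    then have "aff_dim S < DIM('a)" using G(2) by simp
    then have "interior S = {}" using aff_dim_nonempty_interior[of S] by force
    moreover have "convex S" by (simp add: G(1) affine_imp_convex)
    ultimately show "negligible S" by (simp add: negligible_convex_interior)
  qed
  moreover have "\<not> negligible (- closure \<Omega>)"
  proof (rule open_not_negligible)
    show "- closure \<Omega> \<noteq> {}" using bounded_\<Omega> by (metis bounded_closure double_complement compl_bot_eq not_bounded_UNIV)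
  qed auto
  ultimately have "\<not> - closure \<Omega> \<subseteq> (\<Union>G\<in>thin_faces. affine hull (insert x0 G))"
    using negligible_subset by blast
  then obtain y where y: "y \<notin> closure \<Omega>" "\<And>G. G \<in> thin_faces \<Longrightarrow> y \<notin> affine hull (insert x0 G)" by blast
  have "x0 + s *\<^sub>R (y - x0) \<notin> \<Union>thin_faces" if s: "0 < s" for s
  proof
    assume "x0 + s *\<^sub>R (y - x0) \<in> \<Union>thin_faces"
    then obtain G where G: "G \<in> thin_faces" "x0 + s *\<^sub>R (y - x0) \<in> G" by blast
    let ?H = "affine hull (insert x0 G)"
    have "x0 \<in> ?H" "x0 + s *\<^sub>R (y - x0) \<in> ?H" using G(2) by (auto intro: hull_inc)
    then have "(1 - 1 / s) *\<^sub>R x0 + (1 / s) *\<^sub>R (x0 + s *\<^sub>R (y - x0)) \<in> ?H"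
      by (intro mem_affine[OF affine_affine_hull]) auto
    moreover have "(1 - 1 / s) *\<^sub>R x0 + (1 / s) *\<^sub>R (x0 + s *\<^sub>R (y - x0)) = y"
      using s by (simp add: algebra_simps)
    ultimately show False using y(2)[OF G(1)] by simp
  qed
  with y(1) show ?thesis using that by blast
qed

text \<open>
  Follow a segment from an element to a point outside the domain that misses all faces of codimension
  at least two. The value of a piecewise constant Crouzeix--Raviart function does not change along it,
  and the segment leaves the domain through a boundary facet, where the value is 0.
\<close>

lemma cr_kernel:
  assumes v: "v \<in> cr_space \<Omega> \<T>" and g0: "\<And>T. T \<in> \<T> \<Longrightarrow> elem_grad T v = 0" and T0: "T0 \<in> \<T>"
  shows "elem_off T0 v = 0"
proof (rule ccontr)
  let ?c = "\<lambda>T. elem_off T v"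
  assume c0: "?c T0 \<noteq> 0"
  have ext: "elem_ext T v x = ?c T" if "T \<in> \<T>" for T x using g0[OF that] by (simp add: elem_ext_def)
  have share: "?c T = ?c T'" if "T \<in> \<T>" "T' \<in> \<T>" "F facet_of T" "F facet_of T'" for T T' F
    using v ext that unfolding cr_iff by metis
  have bdry: "?c T = 0" if "T \<in> \<T>" "F facet_of T" "F \<subseteq> frontier \<Omega>" for T F
    using v ext that unfolding cr_iff by metis
  obtain x0 where x0: "x0 \<in> interior T0" using elem_nonempty[OF T0] by blast
  obtain y where y: "y \<notin> closure \<Omega>" "\<And>s. 0 < s \<Longrightarrow> x0 + s *\<^sub>R (y - x0) \<notin> \<Union>thin_faces"
    using generic_exit_point[of x0] by blast
  let ?e = "y - x0"
  define pt where "pt s = x0 + s *\<^sub>R ?e" for s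
  \<comment> \<open>The elements that carry the same value as \<open>T0\<close>. The last parameter
    at which the segment is still in this closed set determines the point z.\<close>
  define C where "C = \<Union>{T\<in>\<T>. ?c T = ?c T0}"
  have "closed C" unfolding C_def using finite_\<T> elem_closed by (intro closed_Union) auto
  have "continuous_on UNIV pt" unfolding pt_def by (intro continuous_intros)
  then have "closed (pt -` C)" using \<open>closed C\<close> by (intro closed_vimage)
  define S where "S = {0..1} \<inter> pt -` C"
  have cS: "compact S" unfolding S_def using \<open>closed (pt -` C)\<close> by (intro compact_Int_closed) auto
  have "x0 \<in> C" using x0 T0 interior_subset by (auto simp: C_def)
  then have "0 \<in> S" by (simp add: S_def pt_def)
  then obtain s where s: "s \<in> S" "\<And>t. t \<in> S \<Longrightarrow> t \<le> s"
    using compact_attains_sup[OF cS] by blast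
  define z where "z = pt s"
  have zC: "z \<in> C" and s01: "0 \<le> s" "s \<le> 1" using s(1) by (auto simp: S_def z_def)
  have C_sub: "C \<subseteq> closure \<Omega>" using Un_\<T> by (auto simp: C_def)
  have s1: "s < 1"
  proof -
    have "pt 1 = y" by (simp add: pt_def)
    then have "s \<noteq> 1" using y(1) zC C_sub z_def by auto
    then show ?thesis using s01 by simp
  qed
  have pt_s: "pt (s + \<tau>) = z + \<tau> *\<^sub>R ?e" for \<tau> by (simp add: z_def pt_def algebra_simps)
  have leave: "\<forall>\<^sub>F \<tau> in at_right 0. z + \<tau> *\<^sub>R ?e \<notin> C"
  proof -
    have "z + \<tau> *\<^sub>R ?e \<notin> C" if "0 < \<tau>" "\<tau> < 1 - s" for \<tau>
    proof
      assume "z + \<tau> *\<^sub>R ?e \<in> C"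
      then have "s + \<tau> \<in> S" using that s01 pt_s[of \<tau>] by (simp add: S_def)
      then show False using s(2) that by fastforce
    qed
    then show ?thesis by (intro eventually_at_rightI[of 0 "1 - s"]) (use s1 in auto)
  qed
  have s0: "0 < s"
  proof (rule ccontr)
    assume "\<not> 0 < s"
    then have zx: "z = x0" using s01 by (simp add: z_def pt_def)
    have "\<forall>\<^sub>F \<tau> in at_right 0. x0 + \<tau> *\<^sub>R ?e \<notin> - interior T0"
      by (rule closed_avoid) (use x0 in auto)
    with leave have "\<forall>\<^sub>F \<tau> in at_right (0::real). False"
      unfolding zx
    proof eventually_elim
      case (elim \<tau>)
      then have "x0 + \<tau> *\<^sub>R ?e \<in> T0" using interior_subset by blast
      then show ?case using elim(1) T0 by (auto simp: C_def)
    qed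
    then show False by simp
  qed
  have z_thin: "z \<notin> \<Union>thin_faces" using y(2)[OF s0] by (simp add: z_def pt_def)
  obtain T1 where T1: "T1 \<in> \<T>" "?c T1 = ?c T0" "z \<in> T1" using zC by (auto simp: C_def)
  \<comment> \<open>Since z avoids the thin faces, any two elements at z meet in a common facet,
    across which the value is passed on.\<close>
  have zT: "?c T' = ?c T0" if T': "T' \<in> \<T>" "z \<in> T'" for T'
  proof (cases "T' = T1")
    case False
    let ?G = "T1 \<inter> T'"
    have G: "?G face_of T1" "?G face_of T'" using face_Int[OF T1(1) T'(1)] face_Int[OF T'(1) T1(1)] by (auto simp: Int_commute)
    have "?G \<noteq> T1" using elem_Int_interior[OF T1(1) T'(1)] False elem_nonempty[OF T1(1)] interior_subset[of T1] by blast
    then have "aff_dim ?G < DIM('a)" using face_of_aff_dim_lt[OF elem_convex[OF T1(1)] G(1)] elem_aff_dim[OF T1(1)] by simp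
    moreover have "\<not> aff_dim ?G \<le> int DIM('a) - 2"
      using z_thin T1 T'(2) G(1) unfolding thin_faces_def by blast
    ultimately have "aff_dim ?G = int DIM('a) - 1" by simp
    then have "?G facet_of T1" "?G facet_of T'"
      using G T1(3) T'(2) elem_aff_dim[OF T1(1)] elem_aff_dim[OF T'(1)] by (auto simp: facet_of_def)
    then show ?thesis using share[OF T1(1) T'(1)] T1(2) by metis
  qed (use T1 in simp)
  have exit: "\<forall>\<^sub>F \<tau> in at_right 0. z + \<tau> *\<^sub>R ?e \<notin> T'" if T': "T' \<in> \<T>" for T'
  proof (cases "z \<in> T'")
    case True
    then have "T' \<subseteq> C" using zT[OF T'] T' by (auto simp: C_def)
    then show ?thesis using leave by (auto elim!: eventually_mono)
  next
    case False then show ?thesis using closed_avoid elem_closed[OF T'] by blast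
  qed
  \<comment> \<open>All elements at z lie in C, which the segment leaves at z. So it leaves each of
    them, and some coordinate that vanishes at z must decrease.\<close>
  have neg: "\<exists>r\<in>verts T'. bary (verts T') r z = 0 \<and> bgrad (verts T') r \<bullet> ?e < 0" if T': "T' \<in> \<T>" "z \<in> T'" for T'
  proof (rule ccontr)
    assume "\<not> ?thesis"
    then have "\<forall>\<^sub>F \<tau> in at_right 0. z + \<tau> *\<^sub>R ?e \<in> T'" by (intro cone_enters[OF T']) force
    with exit[OF T'(1)] have "\<forall>\<^sub>F \<tau> in at_right (0::real). False" by eventually_elim simp
    then show False by simp
  qed
  obtain q where q: "q \<in> verts T1" "bary (verts T1) q z = 0" using neg[OF T1(1,3)] by blast
  define F where "F = convex hull (verts T1 - {q})"
  interpret S1: full_simplex "verts T1" by (rule verts_simplex[OF T1(1)])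
  have F: "F facet_of T1" unfolding F_def by (rule facet_conv[OF T1(1) q(1)])
  have zF: "z \<in> F" unfolding F_def S1.in_facet_iff[OF q(1)] using T1 q by simp
  \<comment> \<open>Suppose F contains a point of \<Omega>. Pushed slightly towards z it becomes a
    point \<open>w'\<close> of \<Omega> in the relative interior of F. The elements at
    \<open>w'\<close> have F as a facet, and the coordinate opposite F decreases along the direction
    of the segment for each of them. Hence a short step from \<open>w'\<close> leaves all elements
    while staying in \<Omega>, which they cover.\<close>
  have "F \<subseteq> frontier \<Omega>"
  proof (rule ccontr)
    assume "\<not> F \<subseteq> frontier \<Omega>"
    then obtain w where w: "w \<in> F" "w \<notin> frontier \<Omega>" by blast
    have "F \<subseteq> T1" using F by (simp add: facet_of_imp_subset)
    then have "w \<in> closure \<Omega>" using w Un_\<T> T1(1) by blast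
    then have w\<Omega>: "w \<in> \<Omega>" using w(2) open_\<Omega> by (auto simp: frontier_def interior_open)
    have zrel: "z \<in> rel_interior F"
    proof -
      have "0 < bary (verts T1) p z" if "p \<in> verts T1 - {q}" for p
      proof -
        have "0 \<le> bary (verts T1) p z" using T1 that S1.in_iff by simp
        moreover have "bary (verts T1) p z \<noteq> 0"
          using one_zero_coordinate[OF T1(1,3) z_thin _ q(1) _ q(2)] that by blast
        ultimately show ?thesis by simp
      qed
      moreover have "(\<Sum>p\<in>verts T1 - {q}. bary (verts T1) p z) = 1" "(\<Sum>p\<in>verts T1 - {q}. bary (verts T1) p z *\<^sub>R p) = z"
        using S1.sum1[of z] S1.repr[of z] q by (simp_all add: sum.remove[of "verts T1" q])
      ultimately show ?thesis
        unfolding F_def rel_interior_convex_hull_explicit[OF S1.facet_indep] mem_Collect_eq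
        by (intro exI[of _ "\<lambda>p. bary (verts T1) p z"]) auto
    qed
    have "\<forall>\<^sub>F t in at_right 0. w + t *\<^sub>R (z - w) \<notin> - \<Omega>"
      by (rule closed_avoid) (use w\<Omega> open_\<Omega> in auto)
    moreover have "\<forall>\<^sub>F t in at_right (0::real). t \<in> {0<..<1}"
      by (rule eventually_at_rightI[of 0 1]) auto
    ultimately have "\<forall>\<^sub>F t in at_right (0::real). t \<in> {0<..<1} \<and> w + t *\<^sub>R (z - w) \<in> \<Omega>"
      by eventually_elim simp
    then obtain t where t: "0 < t" "t < 1" "w + t *\<^sub>R (z - w) \<in> \<Omega>"
      using eventually_happens[of _ "at_right (0::real)"] by (auto simp: trivial_limit_at_right_real)
    define w' where "w' = w + t *\<^sub>R (z - w)"
    have w'rel: "w' \<in> rel_interior F"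
    proof -
      have "w - (1 - (1 - t)) *\<^sub>R (w - z) \<in> rel_interior F"
        by (rule rel_interior_convex_shrink) (use w(1) zrel t F_def in auto)
      then show ?thesis by (simp add: w'_def algebra_simps)
    qed
    have out: "\<forall>\<^sub>F \<tau> in at_right 0. w' + \<tau> *\<^sub>R ?e \<notin> T'" if T': "T' \<in> \<T>" for T'
    proof (cases "w' \<in> T'")
      case True
      interpret S': full_simplex "verts T'" by (rule verts_simplex[OF T'])
      have "F facet_of T'" using shared_facet[OF T1(1) T' F w'rel True] .
      then obtain q' where q': "q' \<in> verts T'" "F = convex hull (verts T' - {q'})" using facet_cases[OF T'] by blast
      have zT': "z \<in> T'" and z0: "bary (verts T') q' z = 0"
        using zF S'.in_facet_iff[OF q'(1), of z] q'(2) T' by simp_all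
      have "w' \<in> F" using w'rel rel_interior_subset by blast
      then have w0: "bary (verts T') q' w' = 0"
        using S'.in_facet_iff[OF q'(1), of w'] q'(2) by simp
      obtain r where r: "r \<in> verts T'" "bary (verts T') r z = 0" "bgrad (verts T') r \<bullet> ?e < 0" using neg[OF T' zT'] by blast
      have "r = q'" by (rule one_zero_coordinate[OF T' zT' z_thin r(1) q'(1) r(2) z0])
      then have "bary (verts T') q' (w' + \<tau> *\<^sub>R ?e) < 0" if "\<tau> > 0" for \<tau>
        using bary_diff[of "verts T'" q' "w' + \<tau> *\<^sub>R ?e" w'] w0 r(3) that by (simp add: mult_pos_neg)
      then have "w' + \<tau> *\<^sub>R ?e \<notin> T'" if "\<tau> > 0" for \<tau>
        using S'.in_iff[of "w' + \<tau> *\<^sub>R ?e"] T' q'(1) that by fastforce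
      then show ?thesis by (auto simp: eventually_at_filter)
    next
      case False then show ?thesis using closed_avoid elem_closed[OF T'] by blast
    qed
    have "\<forall>\<^sub>F \<tau> in at_right 0. \<forall>T'\<in>\<T>. w' + \<tau> *\<^sub>R ?e \<notin> T'"
      using out finite_\<T> by (intro eventually_ball_finite) auto
    moreover have "\<forall>\<^sub>F \<tau> in at_right 0. w' + \<tau> *\<^sub>R ?e \<notin> - \<Omega>"
      by (rule closed_avoid) (use t open_\<Omega> w'_def in auto)
    ultimately have "\<forall>\<^sub>F \<tau> in at_right (0::real). False"
      by eventually_elim (use Un_\<T> closure_subset in blast)
    then show False by simp
  qed
  then have "?c T1 = 0" by (rule bdry[OF T1(1) F])
  then show False using T1(2) c0 by simp
qed

end

section \<open>Existence of the discrete solutions\<close>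

definition lin_space :: "('x \<Rightarrow> real) set \<Rightarrow> bool" where
  "lin_space V \<longleftrightarrow> (\<lambda>x. 0) \<in> V \<and> (\<forall>v\<in>V. \<forall>w\<in>V. \<forall>c. (\<lambda>x. v x + c * w x) \<in> V)"

definition lin_form :: "('x \<Rightarrow> real) set \<Rightarrow> (('x \<Rightarrow> real) \<Rightarrow> real) \<Rightarrow> bool" where
  "lin_form V f \<longleftrightarrow> (\<forall>v\<in>V. \<forall>w\<in>V. \<forall>c. f (\<lambda>x. v x + c * w x) = f v + c * f w)"

text \<open>Only semidefinite: a function that vanishes in the element interiors has energy zero
  without being the zero function. For the same reason the spaces are infinite-dimensional as sets
  of functions.\<close>

definition semi_inner :: "('x \<Rightarrow> real) set \<Rightarrow> (('x \<Rightarrow> real) \<Rightarrow> ('x \<Rightarrow> real) \<Rightarrow> real) \<Rightarrow> bool" where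
  "semi_inner V s \<longleftrightarrow> (\<forall>u\<in>V. lin_form V (\<lambda>v. s v u)) \<and> (\<forall>u\<in>V. \<forall>v\<in>V. s u v = s v u) \<and> (\<forall>v\<in>V. 0 \<le> s v v)"

lemma lin_spaceD: "lin_space V \<Longrightarrow> v \<in> V \<Longrightarrow> w \<in> V \<Longrightarrow> (\<lambda>x. v x + c * w x) \<in> V"
  by (simp add: lin_space_def)

lemma lin_formD: "lin_form V f \<Longrightarrow> v \<in> V \<Longrightarrow> w \<in> V \<Longrightarrow> f (\<lambda>x. v x + c * w x) = f v + c * f w"
  by (simp add: lin_form_def)

lemma
  assumes s: "semi_inner V s"
  shows semi_inner_left: "u \<in> V \<Longrightarrow> v \<in> V \<Longrightarrow> w \<in> V \<Longrightarrow> s (\<lambda>x. v x + c * w x) u = s v u + c * s w u"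
    and semi_inner_sym: "u \<in> V \<Longrightarrow> v \<in> V \<Longrightarrow> s u v = s v u"
    and semi_inner_nonneg: "v \<in> V \<Longrightarrow> 0 \<le> s v v"
  using s by (auto simp: semi_inner_def lin_form_def)

lemma semi_inner_Cauchy_Schwarz:
  assumes V: "lin_space V" and s: "semi_inner V s" and uv: "u \<in> V" "v \<in> V"
  shows "(s u v)\<^sup>2 \<le> s u u * s v v"
proof (rule quadratic_nonneg_imp)
  fix t
  let ?w = "\<lambda>x. u x + t * v x"
  have w: "?w \<in> V" by (rule lin_spaceD[OF V uv])
  have "s ?w ?w = s u ?w + t * s v ?w" by (rule semi_inner_left[OF s w uv])
  also have "s u ?w = s u u + t * s v u"
    using semi_inner_left[OF s uv(1) uv] semi_inner_sym[OF s uv(1) w] by simp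
  also have "s v ?w = s u v + t * s v v"
    using semi_inner_left[OF s uv(2) uv] semi_inner_sym[OF s uv(2) w] by simp
  finally have "s ?w ?w = s u u + 2 * t * s u v + t\<^sup>2 * s v v"
    using semi_inner_sym[OF s uv] by (simp add: power2_eq_square algebra_simps)
  then show "0 \<le> s u u + 2 * t * s u v + t\<^sup>2 * s v v" using semi_inner_nonneg[OF s w] by simp
qed

text \<open>
  A Riesz representation for semi-inner products whose kernel has finite codimension, by induction
  on the number of functionals that cut out the kernel.
\<close>

lemma finite_riesz:
  fixes V :: "('x \<Rightarrow> real) set" and L :: "'i \<Rightarrow> ('x \<Rightarrow> real) \<Rightarrow> real"
  assumes "finite I" "lin_space V" "semi_inner V s" "\<And>i. lin_form V (L i)"
    and "\<And>v. v \<in> V \<Longrightarrow> (\<forall>i\<in>I. L i v = 0) \<Longrightarrow> s v v = 0"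
    and "lin_form V l" "\<And>v. v \<in> V \<Longrightarrow> s v v = 0 \<Longrightarrow> l v = 0"
  shows "\<exists>z\<in>V. \<forall>v\<in>V. s z v = l v"
  using assms
proof (induction I arbitrary: V l rule: finite_induct)
  case empty
  have 0: "s v v = 0" if "v \<in> V" for v using empty.prems(4)[OF that] by simp
  have z: "(\<lambda>x. 0) \<in> V" using empty.prems(1) by (simp add: lin_space_def)
  have "s (\<lambda>x. 0) v = l v" if v: "v \<in> V" for v
    using semi_inner_Cauchy_Schwarz[OF empty.prems(1,2) z v] 0[OF v] empty.prems(6)[OF v 0[OF v]] by simp
  then show ?case using z by blast
next
  case (insert j I)
  note V = insert.prems(1) and s = insert.prems(2) and L = insert.prems(3) and null = insert.prems(4)
    and l = insert.prems(5) and l0 = insert.prems(6)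
  define V' where "V' = {v\<in>V. L j v = 0}"
  have sub: "V' \<subseteq> V" by (auto simp: V'_def)
  have z0: "(\<lambda>x. 0) \<in> V" using V by (simp add: lin_space_def)
  have L0: "L j (\<lambda>x. 0) = 0" using lin_formD[OF L z0 z0, of j 1] by simp
  have V': "lin_space V'"
    unfolding lin_space_def V'_def using z0 L0 lin_spaceD[OF V] lin_formD[OF L[of j]] by auto
  have lf: "lin_form V f \<Longrightarrow> lin_form V' f" for f using sub by (auto simp: lin_form_def)
  have s': "semi_inner V' s" using s sub lf unfolding semi_inner_def by blast
  have null': "\<And>v. v \<in> V' \<Longrightarrow> (\<forall>i\<in>I. L i v = 0) \<Longrightarrow> s v v = 0" using null by (auto simp: V'_def)
  have IH: "\<exists>z\<in>V'. \<forall>v\<in>V'. s z v = f v" if "lin_form V f" "\<And>v. v \<in> V \<Longrightarrow> s v v = 0 \<Longrightarrow> f v = 0" for f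
    by (rule insert.IH[OF V' s' lf[OF L] null' lf[OF that(1)]]) (use that(2) sub in auto)
  obtain z' where z': "z' \<in> V'" "\<And>v. v \<in> V' \<Longrightarrow> s z' v = l v" using IH[OF l l0] by blast
  show ?case
  proof (cases "V' = V")
    case True then show ?thesis using z' by blast
  next
    case False
    then obtain w0 where w0: "w0 \<in> V" "L j w0 \<noteq> 0" by (auto simp: V'_def)
    have sw0: "lin_form V (\<lambda>v. s w0 v)"
      unfolding lin_form_def
    proof (intro ballI allI)
      fix a b c assume ab: "a \<in> V" "b \<in> V"
      show "s w0 (\<lambda>x. a x + c * b x) = s w0 a + c * s w0 b"
        unfolding semi_inner_sym[OF s w0(1) lin_spaceD[OF V ab]] semi_inner_sym[OF s w0(1) ab(1)]
          semi_inner_sym[OF s w0(1) ab(2)]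
        by (rule semi_inner_left[OF s w0(1) ab])
    qed
    have sw0': "s w0 v = 0" if "v \<in> V" "s v v = 0" for v
      using semi_inner_Cauchy_Schwarz[OF V s w0(1) that(1)] that(2) by simp
    obtain w1 where w1: "w1 \<in> V'" "\<And>v. v \<in> V' \<Longrightarrow> s w1 v = s w0 v"
      using IH[OF sw0 sw0'] by blast
    \<comment> \<open>The part of \<open>w0\<close> that is orthogonal to \<open>V'\<close>. It
      spans a complement of \<open>V'\<close>, since \<open>V'\<close> is the kernel of the single
      functional \<open>L j\<close>.\<close>
    define w where "w = (\<lambda>x. w0 x + (-1) * w1 x)"
    have w1V: "w1 \<in> V" using w1(1) sub by blast
    have wV: "w \<in> V" unfolding w_def by (rule lin_spaceD[OF V w0(1) w1V])
    have Lw: "L j w \<noteq> 0"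
      using lin_formD[OF L w0(1) w1V, of j "-1"] w1(1) w0(2) by (simp add: w_def V'_def)
    have orth: "s w v = 0" if v: "v \<in> V'" for v
    proof -
      have vV: "v \<in> V" using v sub by blast
      have "s w v = s w0 v + (-1) * s w1 v"
        unfolding w_def by (rule semi_inner_left[OF s vV w0(1) w1V])
      then show ?thesis using w1(2)[OF v] by simp
    qed
    have z'V: "z' \<in> V" using z'(1) sub by blast
    have decomp: "\<exists>v'\<in>V'. \<exists>t. v = (\<lambda>x. v' x + t * w x)" if v: "v \<in> V" for v
    proof -
      define t where "t = L j v / L j w"
      define v' where "v' = (\<lambda>x. v x + (- t) * w x)"
      have "v' \<in> V" unfolding v'_def by (rule lin_spaceD[OF V v wV])
      moreover have "L j v' = 0" using lin_formD[OF L v wV, of j "- t"] Lw by (simp add: v'_def t_def)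
      ultimately have "v' \<in> V'" by (simp add: V'_def)
      moreover have "v = (\<lambda>x. v' x + t * w x)" by (simp add: v'_def)
      ultimately show ?thesis by blast
    qed
    define k where "k = l w / s w w"
    define z where "z = (\<lambda>x. z' x + k * w x)"
    have zV: "z \<in> V" unfolding z_def by (rule lin_spaceD[OF V z'V wV])
    \<comment> \<open>If \<open>s w w\<close> is 0, then so is \<open>l w\<close> by assumption, and
      the default value k = 0 of the division is the right one.\<close>
    have kw: "k * s w w = l w" using l0[OF wV] by (cases "s w w = 0") (auto simp: k_def)
    have "s z v = l v" if v: "v \<in> V" for v
    proof -
      obtain v' t where vt: "v' \<in> V'" "v = (\<lambda>x. v' x + t * w x)" using decomp[OF v] by blast
      have v'V: "v' \<in> V" using vt(1) sub by blast
      have zv: "s z u = s z' u + k * s w u" if "u \<in> V" for u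
        unfolding z_def by (rule semi_inner_left[OF s that z'V wV])
      have "s z v = s v z" by (rule semi_inner_sym[OF s zV v])
      also have "\<dots> = s v' z + t * s w z"
        unfolding vt(2) by (rule semi_inner_left[OF s zV v'V wV])
      also have "s v' z = s z' v' + k * s w v'" using zv[OF v'V] semi_inner_sym[OF s v'V zV] by simp
      also have "s w z = s z' w + k * s w w" using zv[OF wV] semi_inner_sym[OF s wV zV] by simp
      also have "s z' w = 0" using orth[OF z'(1)] semi_inner_sym[OF s wV z'V] by simp
      finally have "s z v = l v' + t * l w" using orth[OF vt(1)] z'(2)[OF vt(1)] kw by simp
      also have "\<dots> = l v" unfolding vt(2) by (rule lin_formD[OF l v'V wV, symmetric])
      finally show ?thesis .
    qed
    then show ?thesis using zV by blast
  qed
qed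

section \<open>Functions with zero boundary values\<close>

lemma test_functions_lin:
  assumes "\<phi> \<in> test_functions S" "\<psi> \<in> test_functions S"
  shows "(\<lambda>x. \<phi> x + c * \<psi> x) \<in> test_functions S"
proof -
  let ?A = "closure {x. \<phi> x \<noteq> 0}" and ?B = "closure {x. \<psi> x \<noteq> 0}" and ?C = "closure {x. \<phi> x + c * \<psi> x \<noteq> 0}"
  have Ck: "Ck k (\<lambda>x. \<phi> x + c * \<psi> x)" for k
    using assms by (auto simp: test_functions_def intro!: Ck_add Ck_mult)
  have AB: "compact ?A" "compact ?B" "?A \<subseteq> S" "?B \<subseteq> S" using assms unfolding test_functions_def by blast+
  have "{x. \<phi> x + c * \<psi> x \<noteq> 0} \<subseteq> {x. \<phi> x \<noteq> 0} \<union> {x. \<psi> x \<noteq> 0}" by auto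
  from closure_mono[OF this] have sub: "?C \<subseteq> ?A \<union> ?B" by (simp only: closure_Un)
  have "compact ((?A \<union> ?B) \<inter> ?C)"
    by (intro compact_Int_closed compact_Un AB closed_closure)
  moreover have "(?A \<union> ?B) \<inter> ?C = ?C" using sub by (rule Int_absorb1)
  ultimately have "compact ?C" by (simp only:)
  with Ck sub AB show ?thesis unfolding test_functions_def mem_Collect_eq by blast
qed

lemma test_functions_zero: "(\<lambda>x. 0) \<in> test_functions S"
  by (simp add: test_functions_def)

lemma grad_lin:
  assumes "\<phi> differentiable (at x)" "\<psi> differentiable (at x)"
  shows "grad (\<lambda>x. \<phi> x + c * \<psi> x) x = grad \<phi> x + c *\<^sub>R grad \<psi> x"
proof (rule grad_unique)
  show "((\<lambda>x. \<phi> x + c * \<psi> x) has_derivative (\<bullet>) (grad \<phi> x + c *\<^sub>R grad \<psi> x)) (at x)"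
    using has_derivative_add[OF grad_has_derivative[OF assms(1)] has_derivative_mult_right[OF grad_has_derivative[OF assms(2)], of c]]
    by (simp add: inner_add_left[abs_def])
qed

lemma weak_gradient_diff:
  assumes "open S" "bounded S" "has_weak_gradient S v G" "has_weak_gradient S w H"
  shows "has_weak_gradient S (\<lambda>x. v x - w x) (\<lambda>x. G x - H x)"
  using weak_gradient_add_scaleR[OF assms, of "-1"] by simp

text \<open>Trades the selected weak gradient inside \<open>h1_norm\<close> for any weak gradient
  and the classical gradients of the test functions, and splits the convergence into two L2
  statements.\<close>

lemma H10_iff:
  assumes S: "open S" "bounded S"
  shows "v \<in> H10 S \<longleftrightarrow> (\<exists>G \<phi>. has_weak_gradient S v G \<and> (\<forall>n. \<phi> n \<in> test_functions S) \<and>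
     (\<lambda>n. l2_norm S (\<lambda>x. v x - \<phi> n x)) \<longlonglongrightarrow> 0 \<and> (\<lambda>n. l2_norm S (\<lambda>x. G x - grad (\<phi> n) x)) \<longlonglongrightarrow> 0)"
proof -
  have mS: "S \<in> sets lebesgue" using S(1) by (rule open_sets_lebesgue)
  have h1: "h1_norm S (\<lambda>x. v x - \<phi> x) = sqrt ((l2_norm S (\<lambda>x. v x - \<phi> x))\<^sup>2 + (l2_norm S (\<lambda>x. G x - grad \<phi> x))\<^sup>2)"
    if "has_weak_gradient S v G" "\<phi> \<in> test_functions S" for G \<phi>
  proof -
    have wg: "has_weak_gradient S (\<lambda>x. v x - \<phi> x) (\<lambda>x. G x - grad \<phi> x)"
      by (rule weak_gradient_diff[OF S that(1) weak_gradient_test[OF S that(2)]])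
    have "l2_norm S (\<lambda>x. G x - grad \<phi> x) = l2_norm S (weak_grad S (\<lambda>x. v x - \<phi> x))"
      by (rule l2_norm_cong_AE[OF _ weak_gradient_L2'[OF wg] mS])
         (rule eventually_mono[OF weak_grad_AE[OF S wg]], simp)
    then show ?thesis by (simp add: h1_norm_def)
  qed
  show ?thesis
  proof
    assume "v \<in> H10 S"
    then obtain G \<phi> where G: "has_weak_gradient S v G" and \<phi>: "\<And>n. \<phi> n \<in> test_functions S"
      and lim: "(\<lambda>n. h1_norm S (\<lambda>x. v x - \<phi> n x)) \<longlonglongrightarrow> 0"
      by (auto simp: H10_def H1_def)
    have "(\<lambda>n. l2_norm S (\<lambda>x. v x - \<phi> n x)) \<longlonglongrightarrow> 0"
      by (rule Lim_null_comparison[OF _ lim]) (auto simp: h1[OF G \<phi>] real_sqrt_sum_squares_ge1)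
    moreover have "(\<lambda>n. l2_norm S (\<lambda>x. G x - grad (\<phi> n) x)) \<longlonglongrightarrow> 0"
      by (rule Lim_null_comparison[OF _ lim]) (auto simp: h1[OF G \<phi>] real_sqrt_sum_squares_ge2)
    ultimately show "\<exists>G \<phi>. has_weak_gradient S v G \<and> (\<forall>n. \<phi> n \<in> test_functions S) \<and>
     (\<lambda>n. l2_norm S (\<lambda>x. v x - \<phi> n x)) \<longlonglongrightarrow> 0 \<and> (\<lambda>n. l2_norm S (\<lambda>x. G x - grad (\<phi> n) x)) \<longlonglongrightarrow> 0"
      using G \<phi> by blast
  next
    assume "\<exists>G \<phi>. has_weak_gradient S v G \<and> (\<forall>n. \<phi> n \<in> test_functions S) \<and>
     (\<lambda>n. l2_norm S (\<lambda>x. v x - \<phi> n x)) \<longlonglongrightarrow> 0 \<and> (\<lambda>n. l2_norm S (\<lambda>x. G x - grad (\<phi> n) x)) \<longlonglongrightarrow> 0"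
    then obtain G \<phi> where G: "has_weak_gradient S v G" and \<phi>: "\<And>n. \<phi> n \<in> test_functions S"
      and lim: "(\<lambda>n. l2_norm S (\<lambda>x. v x - \<phi> n x)) \<longlonglongrightarrow> 0" "(\<lambda>n. l2_norm S (\<lambda>x. G x - grad (\<phi> n) x)) \<longlonglongrightarrow> 0"
      by blast
    have "(\<lambda>n. h1_norm S (\<lambda>x. v x - \<phi> n x)) \<longlonglongrightarrow> sqrt (0\<^sup>2 + 0\<^sup>2)"
      unfolding h1[OF G \<phi>] by (intro tendsto_intros lim)
    then show "v \<in> H10 S" using G \<phi> by (auto simp: H10_def H1_def)
  qed
qed

lemma H10_weak_gradient: "v \<in> H10 S \<Longrightarrow> has_weak_gradient S v (weak_grad S v)"
  unfolding H10_def H1_def using weak_gradient_weak_grad by blast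

lemma H10_lin:
  assumes S: "open S" "bounded S" and v: "v \<in> H10 S" and w: "w \<in> H10 S"
  shows "(\<lambda>x. v x + c * w x) \<in> H10 S"
proof -
  obtain G \<phi> where G: "has_weak_gradient S v G" "\<And>n. \<phi> n \<in> test_functions S"
    "(\<lambda>n. l2_norm S (\<lambda>x. v x - \<phi> n x)) \<longlonglongrightarrow> 0" "(\<lambda>n. l2_norm S (\<lambda>x. G x - grad (\<phi> n) x)) \<longlonglongrightarrow> 0"
    using v unfolding H10_iff[OF S] by blast
  obtain H \<psi> where H: "has_weak_gradient S w H" "\<And>n. \<psi> n \<in> test_functions S"
    "(\<lambda>n. l2_norm S (\<lambda>x. w x - \<psi> n x)) \<longlonglongrightarrow> 0" "(\<lambda>n. l2_norm S (\<lambda>x. H x - grad (\<psi> n) x)) \<longlonglongrightarrow> 0"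
    using w unfolding H10_iff[OF S] by blast
  have le: "l2_norm S (\<lambda>x. (a x + c *\<^sub>R b x) - (a' x + c *\<^sub>R b' x)) \<le> l2_norm S (\<lambda>x. a x - a' x) + \<bar>c\<bar> * l2_norm S (\<lambda>x. b x - b' x)"
    if "a \<in> L2_space S" "a' \<in> L2_space S" "b \<in> L2_space S" "b' \<in> L2_space S" for a a' b b' :: "'a \<Rightarrow> 'b::euclidean_space"
  proof -
    have "(\<lambda>x. (a x + c *\<^sub>R b x) - (a' x + c *\<^sub>R b' x)) = (\<lambda>x. (a x - a' x) + c *\<^sub>R (b x - b' x))"
      by (simp add: algebra_simps)
    then show ?thesis
      using l2_norm_triangle[OF L2_diff[OF that(1,2)] L2_scaleR[OF L2_diff[OF that(3,4)], of c]]
      by (simp add: l2_norm_scaleR)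
  qed
  let ?\<chi> = "\<lambda>n x. \<phi> n x + c * \<psi> n x"
  have L: "v \<in> L2_space S" "w \<in> L2_space S" "G \<in> L2_space S" "H \<in> L2_space S"
    "\<And>n. \<phi> n \<in> L2_space S" "\<And>n. \<psi> n \<in> L2_space S" "\<And>n. grad (\<phi> n) \<in> L2_space S" "\<And>n. grad (\<psi> n) \<in> L2_space S"
    using G(1) H(1) weak_gradient_L2 weak_gradient_L2' test_L2[OF S] G(2) H(2) by blast+
  have "(\<lambda>n. l2_norm S (\<lambda>x. (v x + c * w x) - ?\<chi> n x)) \<longlonglongrightarrow> 0"
  proof (rule Lim_null_comparison)
    show "(\<lambda>n. l2_norm S (\<lambda>x. v x - \<phi> n x) + \<bar>c\<bar> * l2_norm S (\<lambda>x. w x - \<psi> n x)) \<longlonglongrightarrow> 0"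
      using tendsto_add[OF G(3) tendsto_mult_left[OF H(3), of "\<bar>c\<bar>"]] by simp
    show "\<forall>\<^sub>F n in sequentially. norm (l2_norm S (\<lambda>x. (v x + c * w x) - ?\<chi> n x)) \<le> l2_norm S (\<lambda>x. v x - \<phi> n x) + \<bar>c\<bar> * l2_norm S (\<lambda>x. w x - \<psi> n x)"
      using le[OF L(1,5,2,6)] by simp
  qed
  moreover have "(\<lambda>n. l2_norm S (\<lambda>x. (G x + c *\<^sub>R H x) - grad (?\<chi> n) x)) \<longlonglongrightarrow> 0"
  proof (rule Lim_null_comparison)
    show "(\<lambda>n. l2_norm S (\<lambda>x. G x - grad (\<phi> n) x) + \<bar>c\<bar> * l2_norm S (\<lambda>x. H x - grad (\<psi> n) x)) \<longlonglongrightarrow> 0"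
      using tendsto_add[OF G(4) tendsto_mult_left[OF H(4), of "\<bar>c\<bar>"]] by simp
    have "grad (?\<chi> n) x = grad (\<phi> n) x + c *\<^sub>R grad (\<psi> n) x" for n x
      using test_differentiable[OF G(2)] test_differentiable[OF H(2)] by (intro grad_lin)
    then show "\<forall>\<^sub>F n in sequentially. norm (l2_norm S (\<lambda>x. (G x + c *\<^sub>R H x) - grad (?\<chi> n) x)) \<le>
        l2_norm S (\<lambda>x. G x - grad (\<phi> n) x) + \<bar>c\<bar> * l2_norm S (\<lambda>x. H x - grad (\<psi> n) x)"
      using le[OF L(3,7,4,8)] by simp
  qed
  moreover have "has_weak_gradient S (\<lambda>x. v x + c * w x) (\<lambda>x. G x + c *\<^sub>R H x)"
    by (rule weak_gradient_add_scaleR[OF S G(1) H(1)])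
  moreover have "?\<chi> n \<in> test_functions S" for n by (rule test_functions_lin[OF G(2) H(2)])
  ultimately show ?thesis
    unfolding H10_iff[OF S] by (intro exI[of _ "\<lambda>x. G x + c *\<^sub>R H x"] exI[of _ ?\<chi>] conjI allI)
qed

lemma H10_zero:
  assumes S: "open S" "bounded S"
  shows "(\<lambda>x. 0) \<in> H10 S"
  unfolding H10_iff[OF S]
proof (intro exI conjI allI)
  show "has_weak_gradient S (\<lambda>x. 0) (grad (\<lambda>x. 0))"
    by (rule weak_gradient_test[OF S test_functions_zero])
  show "(\<lambda>x. 0) \<in> test_functions S" by (rule test_functions_zero)
qed (simp_all add: l2_norm_def)

context mesh
begin

lemma l2_norm_elem_le:
  assumes v: "v \<in> L2_space \<Omega>" and T: "T \<in> \<T>"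
  shows "l2_norm (interior T) v \<le> l2_norm \<Omega> v"
proof (rule power2_le_imp_le)
  have "(l2_norm (interior T) v)\<^sup>2 \<le> (\<Sum>T\<in>\<T>. (l2_norm (interior T) v)\<^sup>2)"
    by (rule member_le_sum[OF T]) (use finite_\<T> in auto)
  then show "(l2_norm (interior T) v)\<^sup>2 \<le> (l2_norm \<Omega> v)\<^sup>2" by (simp add: l2_norm_elem[OF v])
qed simp

lemma facet_verts_eq:
  assumes "T \<in> \<T>" "T' \<in> \<T>" "convex hull (verts T - {p}) = convex hull (verts T' - {p'})"
  shows "verts T - {p} = verts T' - {p'}"
  using full_simplex.facet_verts[OF verts_simplex[OF assms(1)], of p]
    full_simplex.facet_verts[OF verts_simplex[OF assms(2)], of p'] assms(3) by metis

lemma test_matched: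
  assumes \<phi>: "\<phi> \<in> test_functions \<Omega>"
  shows "matched \<phi> (grad \<phi>)"
  unfolding matched_def
proof (intro conjI ballI impI)
  show "has_broken_gradient \<T> \<phi> (grad \<phi>)"
    by (rule weak_gradient_broken[OF weak_gradient_test[OF open_\<Omega> bounded_\<Omega> \<phi>]])
  have d: "(\<phi> has_derivative (\<lambda>h. grad \<phi> x \<bullet> h)) (at x)" for x
    by (rule grad_has_derivative[OF test_differentiable[OF \<phi>]])
  obtain B where B: "\<And>x. norm (grad \<phi> x) \<le> B" using test_grad_bounded[OF \<phi>] by blast
  {
    fix T T' p p' assume h: "T \<in> \<T>" "T' \<in> \<T>" "p \<in> verts T" "p' \<in> verts T'"
      and eq: "convex hull (verts T - {p}) = convex hull (verts T' - {p'})"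
    let ?Q = "verts T - {p}"
    have V: "verts T = insert p ?Q" "verts T' = insert p' ?Q"
      using h facet_verts_eq[OF h(1,2) eq] by auto
    show "face_mean (verts T) p \<phi> (grad \<phi>) = face_mean (verts T') p' \<phi> (grad \<phi>)"
      using face_mean_match[of p ?Q p' \<phi> "grad \<phi>" B, folded V] verts_simplex[OF h(1)] verts_simplex[OF h(2)]
        facet_verts_eq[OF h(1,2) eq] d test_grad_continuous[OF \<phi>] B by auto
  next
    fix T p assume h: "T \<in> \<T>" "p \<in> verts T" "convex hull (verts T - {p}) \<subseteq> frontier \<Omega>"
    let ?Q = "verts T - {p}"
    have V: "verts T = insert p ?Q" using h by auto
    obtain L where L: "\<And>x y. \<bar>\<phi> x - \<phi> y\<bar> \<le> L * norm (x - y)" using test_lipschitz[OF \<phi>] by blast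
    have "\<phi> x = 0" if "x \<in> convex hull ?Q" for x
    proof (rule test_zero_outside[OF \<phi>])
      have "x \<in> frontier \<Omega>" using h(3) that by blast
      then show "x \<notin> \<Omega>" using open_\<Omega> by (simp add: frontier_def interior_open)
    qed
    then show "face_mean (verts T) p \<phi> (grad \<phi>) = 0"
      using face_mean_zero[of p ?Q \<phi> "grad \<phi>" L, folded V] verts_simplex[OF h(1)] d test_grad_continuous[OF \<phi>] L by blast
  }
qed

text \<open>Test functions are matched, because they are smooth across interior facets and vanish on
  the boundary. Facet means are continuous in the pair of function and gradient, so the property
  survives the limit.\<close>

lemma H10_matched:
  assumes v: "v \<in> H10 \<Omega>" and G: "has_weak_gradient \<Omega> v G"
  shows "matched v G"
proof -
  obtain G' \<phi> where G': "has_weak_gradient \<Omega> v G'" and \<phi>: "\<And>n. \<phi> n \<in> test_functions \<Omega>"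
    and lim: "(\<lambda>n. l2_norm \<Omega> (\<lambda>x. v x - \<phi> n x)) \<longlonglongrightarrow> 0" "(\<lambda>n. l2_norm \<Omega> (\<lambda>x. G' x - grad (\<phi> n) x)) \<longlonglongrightarrow> 0"
    using v unfolding H10_iff[OF open_\<Omega> bounded_\<Omega>] by blast
  have ae: "AE x in lebesgue_on \<Omega>. G' x = G x" by (rule weak_gradient_unique[OF open_\<Omega> bounded_\<Omega> G' G])
  have b: "has_broken_gradient \<T> v G'" "has_broken_gradient \<T> v G" using G G' weak_gradient_broken by auto
  have b\<phi>: "has_broken_gradient \<T> (\<phi> n) (grad (\<phi> n))" for n using matched_broken[OF test_matched[OF \<phi>]] .
  have fm: "(\<lambda>n. face_mean (verts T) p (\<phi> n) (grad (\<phi> n))) \<longlonglongrightarrow> face_mean (verts T) p v G" if T: "T \<in> \<T>" for T p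
  proof -
    interpret S: full_simplex "verts T" by (rule verts_simplex[OF T])
    have eT: "convex hull (verts T) = T" using T by simp
    note LG = broken_elem_L2[OF b(1) T] and L\<phi> = broken_elem_L2[OF b\<phi> T]
    have eq: "face_mean (verts T) p v G' = face_mean (verts T) p v G"
      using S.face_mean_cong_AE[OF LG, of v G p] AE_elemD[OF ae T] unfolding eT by simp
    obtain C where C: "\<And>v G. v \<in> L2_space (interior T) \<Longrightarrow> G \<in> L2_space (interior T) \<Longrightarrow>
        \<bar>face_mean (verts T) p v G\<bar> \<le> C * (l2_norm (interior T) v + l2_norm (interior T) G)"
      using S.face_mean_bound[of p] unfolding eT by blast
    have "(\<lambda>n. face_mean (verts T) p (\<phi> n) (grad (\<phi> n)) - face_mean (verts T) p v G') \<longlonglongrightarrow> 0"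
    proof (rule Lim_null_comparison)
      show "(\<lambda>n. \<bar>C\<bar> * (l2_norm \<Omega> (\<lambda>x. v x - \<phi> n x) + l2_norm \<Omega> (\<lambda>x. G' x - grad (\<phi> n) x))) \<longlonglongrightarrow> 0"
        using tendsto_mult_left[OF tendsto_add[OF lim], of "\<bar>C\<bar>"] by simp
      show "\<forall>\<^sub>F n in sequentially. norm (face_mean (verts T) p (\<phi> n) (grad (\<phi> n)) - face_mean (verts T) p v G')
          \<le> \<bar>C\<bar> * (l2_norm \<Omega> (\<lambda>x. v x - \<phi> n x) + l2_norm \<Omega> (\<lambda>x. G' x - grad (\<phi> n) x))"
      proof (intro always_eventually allI)
        fix n
        let ?w = "\<lambda>x. v x - \<phi> n x" and ?H = "\<lambda>x. G' x - grad (\<phi> n) x"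
        have w: "?w \<in> L2_space (interior T)" "?H \<in> L2_space (interior T)"
          using LG L\<phi>[of n] unfolding eT by (auto intro: L2_diff)
        have w\<Omega>: "?w \<in> L2_space \<Omega>" "?H \<in> L2_space \<Omega>"
          using broken_L2[OF b(1)] broken_L2'[OF b(1)] broken_L2[OF b\<phi>[of n]] broken_L2'[OF b\<phi>[of n]] by (auto intro: L2_diff)
        have "face_mean (verts T) p ?w ?H = face_mean (verts T) p v G' - face_mean (verts T) p (\<phi> n) (grad (\<phi> n))"
          by (rule S.face_mean_diff[OF LG L\<phi>])
        then have "norm (face_mean (verts T) p (\<phi> n) (grad (\<phi> n)) - face_mean (verts T) p v G') = \<bar>face_mean (verts T) p ?w ?H\<bar>"
          by simp
        also have "\<dots> \<le> C * (l2_norm (interior T) ?w + l2_norm (interior T) ?H)" by (rule C[OF w])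
        also have "\<dots> \<le> \<bar>C\<bar> * (l2_norm \<Omega> ?w + l2_norm \<Omega> ?H)"
          using l2_norm_elem_le[OF w\<Omega>(1) T] l2_norm_elem_le[OF w\<Omega>(2) T] by (intro mult_mono add_mono) auto
        finally show "norm (face_mean (verts T) p (\<phi> n) (grad (\<phi> n)) - face_mean (verts T) p v G') \<le> \<bar>C\<bar> * (l2_norm \<Omega> ?w + l2_norm \<Omega> ?H)" .
      qed
    qed
    then show ?thesis unfolding eq by (rule LIM_zero_cancel)
  qed
  show ?thesis
    unfolding matched_def
  proof (intro conjI ballI impI)
    fix T T' p p' assume h: "T \<in> \<T>" "T' \<in> \<T>" "p \<in> verts T" "p' \<in> verts T'" "convex hull (verts T - {p}) = convex hull (verts T' - {p'})"
    have "face_mean (verts T) p (\<phi> n) (grad (\<phi> n)) = face_mean (verts T') p' (\<phi> n) (grad (\<phi> n))" for n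
      using test_matched[OF \<phi>[of n]] h unfolding matched_def by blast
    then show "face_mean (verts T) p v G = face_mean (verts T') p' v G"
      using fm[OF h(1), of p] fm[OF h(2), of p'] LIMSEQ_unique by simp
  next
    fix T p assume h: "T \<in> \<T>" "p \<in> verts T" "convex hull (verts T - {p}) \<subseteq> frontier \<Omega>"
    have "face_mean (verts T) p (\<phi> n) (grad (\<phi> n)) = 0" for n
      using test_matched[OF \<phi>[of n]] h unfolding matched_def by blast
    then show "face_mean (verts T) p v G = 0"
      using fm[OF h(1), of p] by (simp add: LIMSEQ_const_iff)
  qed (rule b(2))
qed

lemma H10_matched_weak_grad: "v \<in> H10 \<Omega> \<Longrightarrow> matched v (weak_grad \<Omega> v)"
  by (rule H10_matched) (auto intro: H10_weak_gradient)

text \<open>Allows conforming functions to be inserted into the Crouzeix--Raviart equation, on which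
  both error estimates rely.\<close>

lemma conforming_cr:
  assumes "v \<in> conforming_space \<Omega> \<T>"
  shows "v \<in> cr_space \<Omega> \<T>"
proof -
  have v: "v \<in> H10 \<Omega>" "v \<in> piecewise_affine \<T>" using assms by (auto simp: conforming_space_def)
  have m: "matched v (weak_grad \<Omega> v)" by (rule H10_matched_weak_grad[OF v(1)])
  then show ?thesis using matched_pw_affine_iff[OF v(2) matched_broken[OF m]] by blast
qed

section \<open>Solvability of the discrete problems\<close>

definition elem_val :: "'a set \<Rightarrow> ('a \<Rightarrow> real) \<Rightarrow> real" where
  "elem_val T g = (SOME c. \<forall>x\<in>interior T. g x = c)"

lemma elem_val_eq:
  assumes "g \<in> piecewise_constant \<T>" "T \<in> \<T>" "x \<in> interior T"
  shows "g x = elem_val T g"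
proof -
  have "\<exists>c. \<forall>x\<in>interior T. g x = c" using assms by (simp add: piecewise_constant_def)
  then have "\<forall>x\<in>interior T. g x = elem_val T g" unfolding elem_val_def by (rule someI_ex)
  then show ?thesis using assms by blast
qed

lemma AE_elemI':
  assumes "\<And>x. x \<in> interior T \<Longrightarrow> P x"
  shows "AE x in lebesgue_on (interior T). P x"
  using assms by (simp add: AE_lebesgue_on[OF elem_sets])

lemma pw_const_L2:
  assumes g: "g \<in> piecewise_constant \<T>"
  shows "g \<in> L2_space \<Omega>"
proof (rule L2_elemI)
  fix T assume T: "T \<in> \<T>"
  have "(\<lambda>x. elem_val T g) \<in> L2_space (interior T)"
    using elem_bounded[OF T] elem_sets by (intro L2_continuous) auto
  then show "g \<in> L2_space (interior T)"
    by (rule L2_cong_AE[OF _ elem_sets]) (rule AE_elemI', simp add: elem_val_eq[OF g T])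
qed

lemma pw_const_inner:
  assumes g: "g \<in> piecewise_constant \<T>" and w: "w \<in> L2_space \<Omega>"
  shows "l2_inner \<Omega> g w = (\<Sum>T\<in>\<T>. elem_val T g * (\<integral>x. w x \<partial>lebesgue_on (interior T)))"
proof -
  have "l2_inner (interior T) g w = elem_val T g * (\<integral>x. w x \<partial>lebesgue_on (interior T))" if T: "T \<in> \<T>" for T
  proof -
    have "l2_inner (interior T) g w = (\<integral>x. elem_val T g * w x \<partial>lebesgue_on (interior T))"
      unfolding l2_inner_def by (rule Bochner_Integration.integral_cong) (auto simp: elem_val_eq[OF g T])
    then show ?thesis by simp
  qed
  then show ?thesis by (simp add: l2_inner_elem[OF pw_const_L2[OF g] w])
qed

lemma pw_grad_L2: "v \<in> piecewise_affine \<T> \<Longrightarrow> pw_grad \<T> v \<in> L2_space \<Omega>"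
  using broken_L2'[OF pw_affine_gradient] .

lemma pw_affine_L2: "v \<in> piecewise_affine \<T> \<Longrightarrow> v \<in> L2_space \<Omega>"
  using broken_L2[OF pw_affine_gradient] .

lemma pw_grad_inner:
  assumes v: "v \<in> piecewise_affine \<T>" and G: "G \<in> L2_space \<Omega>"
  shows "l2_inner \<Omega> (pw_grad \<T> v) G = (\<Sum>T\<in>\<T>. \<integral>x. G x \<bullet> elem_grad T v \<partial>lebesgue_on (interior T))"
proof -
  have "l2_inner (interior T) (pw_grad \<T> v) G = (\<integral>x. G x \<bullet> elem_grad T v \<partial>lebesgue_on (interior T))" if T: "T \<in> \<T>" for T
    unfolding l2_inner_def by (rule Bochner_Integration.integral_cong) (auto simp: pw_grad_elem[OF T] inner_commute)
  then show ?thesis by (simp add: l2_inner_elem[OF pw_grad_L2[OF v] G])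
qed

lemma measure_elem: "T \<in> \<T> \<Longrightarrow> measure lborel T = measure lebesgue (interior T)"
  using full_simplex.measure_K[OF verts_simplex, of T] by simp

lemma measure_elem_pos: "T \<in> \<T> \<Longrightarrow> 0 < measure lebesgue (interior T)"
  using full_simplex.measure_K[OF verts_simplex, of T] full_simplex.measure_pos[OF verts_simplex, of T] by simp

lemma integral_const_elem: "T \<in> \<T> \<Longrightarrow> (\<integral>x. c \<partial>lebesgue_on (interior T)) = measure lebesgue (interior T) * (c :: real)"
  using elem_lmeasurable by (simp add: measure_restrict_space elem_sets)

lemma pw_grad_inner_pw:
  assumes v: "v \<in> piecewise_affine \<T>" and w: "w \<in> piecewise_affine \<T>"
  shows "l2_inner \<Omega> (pw_grad \<T> v) (pw_grad \<T> w) = (\<Sum>T\<in>\<T>. measure lebesgue (interior T) * (elem_grad T v \<bullet> elem_grad T w))"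
proof -
  have "(\<integral>x. pw_grad \<T> w x \<bullet> elem_grad T v \<partial>lebesgue_on (interior T)) = measure lebesgue (interior T) * (elem_grad T v \<bullet> elem_grad T w)" if T: "T \<in> \<T>" for T
  proof -
    have "(\<integral>x. pw_grad \<T> w x \<bullet> elem_grad T v \<partial>lebesgue_on (interior T)) = (\<integral>x. elem_grad T v \<bullet> elem_grad T w \<partial>lebesgue_on (interior T))"
      by (rule Bochner_Integration.integral_cong) (auto simp: pw_grad_elem[OF T] inner_commute)
    then show ?thesis by (simp only: integral_const_elem[OF T])
  qed
  then show ?thesis by (simp add: pw_grad_inner[OF v pw_grad_L2[OF w]])
qed

lemma broken_inner_pw:
  assumes v: "v \<in> piecewise_affine \<T>" and w: "w \<in> piecewise_affine \<T>"
  shows "l2_inner \<Omega> (broken_grad \<T> v) (broken_grad \<T> w) = l2_inner \<Omega> (pw_grad \<T> v) (pw_grad \<T> w)"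
proof (rule sym, rule l2_inner_cong_AE)
  show "AE x in lebesgue_on \<Omega>. pw_grad \<T> v x = broken_grad \<T> v x" "AE x in lebesgue_on \<Omega>. pw_grad \<T> w x = broken_grad \<T> w x"
    by (rule eventually_mono[OF broken_grad_AE[OF pw_affine_gradient[OF v]]], simp)
       (rule eventually_mono[OF broken_grad_AE[OF pw_affine_gradient[OF w]]], simp)
qed (use pw_grad_L2 v w \<Omega>_sets in auto)

text \<open>Zero energy forces zero gradient on every element of positive measure; the remaining
  constants vanish by \<open>cr_kernel\<close>, which is where the boundary condition acts.\<close>

lemma cr_norm_zero:
  assumes v: "v \<in> cr_space \<Omega> \<T>" and 0: "l2_inner \<Omega> (pw_grad \<T> v) (pw_grad \<T> v) = 0" and T: "T \<in> \<T>" and x: "x \<in> interior T"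
  shows "v x = 0"
proof -
  have pa: "v \<in> piecewise_affine \<T>" using v by (rule cr_pw_affine)
  have "(\<Sum>T\<in>\<T>. measure lebesgue (interior T) * (elem_grad T v \<bullet> elem_grad T v)) = 0"
    using 0 unfolding pw_grad_inner_pw[OF pa pa] .
  then have "\<forall>T\<in>\<T>. measure lebesgue (interior T) * (elem_grad T v \<bullet> elem_grad T v) = 0"
    by (subst (asm) sum_nonneg_eq_0_iff[OF finite_\<T>]) auto
  then have g0: "elem_grad T v = 0" if "T \<in> \<T>" for T using measure_elem_pos[OF that] that by fastforce
  have "elem_off T v = 0" by (rule cr_kernel[OF v g0 T])
  then show ?thesis using pw_affine_eq[OF pa T x] g0[OF T] by (simp add: elem_ext_def)
qed

lemma pw_grad_lin:
  assumes "v \<in> piecewise_affine \<T>" "w \<in> piecewise_affine \<T>"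
  shows "pw_grad \<T> (\<lambda>x. v x + c * w x) = (\<lambda>x. pw_grad \<T> v x + c *\<^sub>R pw_grad \<T> w x)"
proof
  fix x
  show "pw_grad \<T> (\<lambda>x. v x + c * w x) x = pw_grad \<T> v x + c *\<^sub>R pw_grad \<T> w x"
    unfolding pw_grad_def scaleR_sum_right sum.distrib[symmetric]
    by (rule sum.cong) (auto simp: elem_grad_lin[OF assms] scaleR_add_right)
qed

text \<open>Stated for subspaces of the Crouzeix--Raviart space so that it yields the conforming
  solution as well.\<close>

lemma riesz_cr:
  assumes V: "lin_space V" "V \<subseteq> cr_space \<Omega> \<T>" and g: "g \<in> L2_space \<Omega>"
  shows "\<exists>z\<in>V. \<forall>v\<in>V. l2_inner \<Omega> (pw_grad \<T> z) (pw_grad \<T> v) = l2_inner \<Omega> g v"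
\<comment> \<open>The components of the element gradients are finitely many functionals that control
  the energy. The factor 0 for sets outside the mesh makes every member of the family linear, as the
  representation lemma requires; there the selected gradient is arbitrary.\<close>
proof (rule finite_riesz[where I = "\<T> \<times> Basis" and L = "\<lambda>(T, b) v. elem_grad T v \<bullet> b * (if T \<in> \<T> then 1 else 0)"])
  have pa: "v \<in> piecewise_affine \<T>" if "v \<in> V" for v using that V(2) cr_pw_affine by blast
  show "finite (\<T> \<times> (Basis :: 'a set))" using finite_\<T> by simp
  show "semi_inner V (\<lambda>v w. l2_inner \<Omega> (pw_grad \<T> v) (pw_grad \<T> w))"
    unfolding semi_inner_def lin_form_def
  proof (intro conjI ballI allI)
    fix u v w c assume "u \<in> V" "v \<in> V" "w \<in> V"
    then have p: "u \<in> piecewise_affine \<T>" "v \<in> piecewise_affine \<T>" "w \<in> piecewise_affine \<T>" using pa by auto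
    then show "l2_inner \<Omega> (pw_grad \<T> (\<lambda>x. v x + c * w x)) (pw_grad \<T> u) =
        l2_inner \<Omega> (pw_grad \<T> v) (pw_grad \<T> u) + c * l2_inner \<Omega> (pw_grad \<T> w) (pw_grad \<T> u)"
      by (simp add: pw_grad_lin l2_inner_add_left L2_scaleR pw_grad_L2 l2_inner_scaleR_left)
  next
    fix v show "0 \<le> l2_inner \<Omega> (pw_grad \<T> v) (pw_grad \<T> v)"
      unfolding l2_norm_sq[symmetric] by simp
  qed (rule l2_inner_commute)
  show "lin_form V (case i of (T, b) \<Rightarrow> \<lambda>v. elem_grad T v \<bullet> b * (if T \<in> \<T> then 1 else 0))" for i
    unfolding lin_form_def using pa by (auto simp: elem_grad_lin inner_add_left split: prod.split)
  show "l2_inner \<Omega> (pw_grad \<T> v) (pw_grad \<T> v) = 0"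
    if v: "v \<in> V" and 0: "\<forall>i\<in>\<T> \<times> Basis. (case i of (T, b) \<Rightarrow> \<lambda>v. elem_grad T v \<bullet> b * (if T \<in> \<T> then 1 else 0)) v = 0" for v
  proof -
    have "elem_grad T v = 0" if "T \<in> \<T>" for T
      by (rule euclidean_eqI) (use 0 that in auto)
    then show ?thesis unfolding pw_grad_inner_pw[OF pa[OF v] pa[OF v]] by simp
  qed
  show "lin_form V (l2_inner \<Omega> g)"
    unfolding lin_form_def
  proof (intro ballI allI)
    fix v w c assume "v \<in> V" "w \<in> V"
    then have L: "v \<in> L2_space \<Omega>" "w \<in> L2_space \<Omega>" using pa pw_affine_L2 by auto
    show "l2_inner \<Omega> g (\<lambda>x. v x + c * w x) = l2_inner \<Omega> g v + c * l2_inner \<Omega> g w"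
      using l2_inner_add_right[OF L(1) L2_scaleR[OF L(2), of c] g] l2_inner_scaleR_left[of \<Omega> c w g]
      by (simp add: l2_inner_commute[of \<Omega> g])
  qed
  \<comment> \<open>A function of zero energy vanishes almost everywhere, so the right-hand side
    does not see it.\<close>
  show "l2_inner \<Omega> g v = 0" if v: "v \<in> V" and 0: "l2_inner \<Omega> (pw_grad \<T> v) (pw_grad \<T> v) = 0" for v
  proof -
    have "v x = 0" if "T \<in> \<T>" "x \<in> interior T" for T x using cr_norm_zero[OF _ 0 that] v V(2) by blast
    then have "AE x in lebesgue_on \<Omega>. 0 = v x" by (intro AE_elemI AE_elemI') simp
    then have "l2_inner \<Omega> g (\<lambda>x. 0) = l2_inner \<Omega> g v"
      using g \<Omega>_sets by (intro l2_inner_cong_AE) auto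
    then show ?thesis by (simp add: l2_inner_def)
  qed
qed (rule V(1))

lemma cr_lin_space: "lin_space (cr_space \<Omega> \<T>)"
proof -
  have "(\<lambda>x. 0) \<in> cr_space \<Omega> \<T>"
  proof -
    have "(\<lambda>x. 0) \<in> conforming_space \<Omega> \<T>"
      using H10_zero[OF open_\<Omega> bounded_\<Omega>] by (auto simp: conforming_space_def piecewise_affine_def intro!: exI[of _ 0])
    then show ?thesis by (rule conforming_cr)
  qed
  then show ?thesis by (simp add: lin_space_def cr_lin)
qed

lemma conforming_lin_space: "lin_space (conforming_space \<Omega> \<T>)"
  unfolding lin_space_def conforming_space_def
  using H10_zero[OF open_\<Omega> bounded_\<Omega>] H10_lin[OF open_\<Omega> bounded_\<Omega>] pw_affine_lin
  by (auto simp: piecewise_affine_def intro!: exI[of _ 0])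

lemma conforming_grad_AE:
  assumes "v \<in> conforming_space \<Omega> \<T>"
  shows "AE x in lebesgue_on \<Omega>. weak_grad \<Omega> v x = pw_grad \<T> v x"
proof (rule broken_gradient_unique)
  show "has_broken_gradient \<T> v (weak_grad \<Omega> v)"
    using assms by (auto simp: conforming_space_def intro: weak_gradient_broken H10_weak_gradient)
  show "has_broken_gradient \<T> v (pw_grad \<T> v)"
    using assms by (auto simp: conforming_space_def intro: pw_affine_gradient)
qed

text \<open>Without existence the selected \<open>z_cr\<close> would have no known property.\<close>

lemma z_cr_solution:
  assumes g: "g \<in> L2_space \<Omega>"
  shows "cr_solution \<Omega> \<T> g (z_cr \<Omega> \<T> g)"
proof -
  obtain z where z: "z \<in> cr_space \<Omega> \<T>" "\<And>v. v \<in> cr_space \<Omega> \<T> \<Longrightarrow> l2_inner \<Omega> (pw_grad \<T> z) (pw_grad \<T> v) = l2_inner \<Omega> g v"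
    using riesz_cr[OF cr_lin_space subset_refl g] by blast
  then have "cr_solution \<Omega> \<T> g z"
    unfolding cr_solution_def using broken_inner_pw cr_pw_affine by simp
  then show ?thesis unfolding z_cr_def by (rule someI[where P = "cr_solution \<Omega> \<T> g"])
qed

lemma z_conf_solution:
  assumes g: "g \<in> L2_space \<Omega>"
  shows "conforming_solution \<Omega> \<T> g (z_conf \<Omega> \<T> g)"
proof -
  obtain z where z: "z \<in> conforming_space \<Omega> \<T>"
    "\<And>v. v \<in> conforming_space \<Omega> \<T> \<Longrightarrow> l2_inner \<Omega> (pw_grad \<T> z) (pw_grad \<T> v) = l2_inner \<Omega> g v"
    using riesz_cr[OF conforming_lin_space _ g] conforming_cr by blast
  have "l2_inner \<Omega> (weak_grad \<Omega> z) (weak_grad \<Omega> v) = l2_inner \<Omega> (pw_grad \<T> z) (pw_grad \<T> v)"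
    if v: "v \<in> conforming_space \<Omega> \<T>" for v
  proof (rule l2_inner_cong_AE[OF conforming_grad_AE[OF z(1)] conforming_grad_AE[OF v] _ _ \<Omega>_sets])
    show "weak_grad \<Omega> z \<in> L2_space \<Omega>" "weak_grad \<Omega> v \<in> L2_space \<Omega>"
      using z(1) v by (auto simp: conforming_space_def intro: weak_gradient_L2' H10_weak_gradient)
  qed
  then have "conforming_solution \<Omega> \<T> g z"
    unfolding conforming_solution_def using z by simp
  then show ?thesis unfolding z_conf_def by (rule someI[where P = "conforming_solution \<Omega> \<T> g"])
qed

end

context mesh
begin

section \<open>The Marini flux\<close>

text \<open>An explicit elementwise mean. It shows that the property selected in
  \<open>P0_projection\<close> can be met, and it serves as the projection of the test function in
  the residual.\<close>

definition pw_mean :: "('a \<Rightarrow> real) \<Rightarrow> 'a \<Rightarrow> real" where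
  "pw_mean w x = (\<Sum>T\<in>\<T>. indicator (interior T) x *\<^sub>R
     ((\<integral>x. w x \<partial>lebesgue_on (interior T)) / measure lebesgue (interior T)))"

lemma pw_mean_elem:
  "T \<in> \<T> \<Longrightarrow> x \<in> interior T \<Longrightarrow> pw_mean w x = (\<integral>x. w x \<partial>lebesgue_on (interior T)) / measure lebesgue (interior T)"
  unfolding pw_mean_def by (rule elem_sum)

lemma pw_mean_const: "pw_mean w \<in> piecewise_constant \<T>"
  unfolding piecewise_constant_def using pw_mean_elem by blast

lemma pw_mean_zero:
  assumes w: "w \<in> L2_space \<Omega>" and T: "T \<in> \<T>"
  shows "(\<integral>x. w x - pw_mean w x \<partial>lebesgue_on (interior T)) = 0"
proof -
  let ?m = "(\<integral>x. w x \<partial>lebesgue_on (interior T)) / measure lebesgue (interior T)"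
  have i: "integrable (lebesgue_on (interior T)) w" "integrable (lebesgue_on (interior T)) (\<lambda>x. ?m)"
    using L2_integrable[OF L2_elem[OF w T] elem_lmeasurable[OF T]]
      integrable_bounded_lebesgue_on[OF elem_lmeasurable[OF T], of "\<lambda>x. ?m" "\<bar>?m\<bar>"] by auto
  have "(\<integral>x. w x - pw_mean w x \<partial>lebesgue_on (interior T)) = (\<integral>x. w x - ?m \<partial>lebesgue_on (interior T))"
    by (rule Bochner_Integration.integral_cong) (auto simp: pw_mean_elem[OF T])
  also have "\<dots> = (\<integral>x. w x \<partial>lebesgue_on (interior T)) - measure lebesgue (interior T) * ?m"
    using i by (subst Bochner_Integration.integral_diff) (simp_all only: integral_const_elem[OF T])
  finally show ?thesis using measure_elem_pos[OF T] by simp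
qed

lemma P0_projection_spec:
  assumes f: "f \<in> L2_space \<Omega>"
  shows "P0_projection \<Omega> \<T> f \<in> piecewise_constant \<T>"
    and "g \<in> piecewise_constant \<T> \<Longrightarrow> l2_inner \<Omega> (\<lambda>x. f x - P0_projection \<Omega> \<T> f x) g = 0"
proof -
  have "l2_inner \<Omega> (\<lambda>x. f x - pw_mean f x) g = 0" if g: "g \<in> piecewise_constant \<T>" for g
  proof -
    have L: "(\<lambda>x. f x - pw_mean f x) \<in> L2_space \<Omega>"
      using f pw_const_L2[OF pw_mean_const] by (rule L2_diff)
    show ?thesis
      unfolding l2_inner_commute[of \<Omega> _ g] pw_const_inner[OF g L] by (simp add: pw_mean_zero[OF f])
  qed
  then have "pw_mean f \<in> piecewise_constant \<T> \<and> (\<forall>g\<in>piecewise_constant \<T>. l2_inner \<Omega> (\<lambda>x. f x - pw_mean f x) g = 0)"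
    using pw_mean_const by blast
  then have "P0_projection \<Omega> \<T> f \<in> piecewise_constant \<T> \<and>
      (\<forall>g\<in>piecewise_constant \<T>. l2_inner \<Omega> (\<lambda>x. f x - P0_projection \<Omega> \<T> f x) g = 0)"
    unfolding P0_projection_def
    by (rule someI[where P = "\<lambda>p. p \<in> piecewise_constant \<T> \<and> (\<forall>g\<in>piecewise_constant \<T>. l2_inner \<Omega> (\<lambda>x. f x - p x) g = 0)"])
  then show "P0_projection \<Omega> \<T> f \<in> piecewise_constant \<T>"
    and "g \<in> piecewise_constant \<T> \<Longrightarrow> l2_inner \<Omega> (\<lambda>x. f x - P0_projection \<Omega> \<T> f x) g = 0"
    by blast+
qed

lemma z_cr_space: "g \<in> piecewise_constant \<T> \<Longrightarrow> z_cr \<Omega> \<T> g \<in> cr_space \<Omega> \<T>"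
  using z_cr_solution[OF pw_const_L2] by (simp add: cr_solution_def)

lemma z_cr_eq:
  assumes g: "g \<in> piecewise_constant \<T>" and v: "v \<in> cr_space \<Omega> \<T>"
  shows "l2_inner \<Omega> (pw_grad \<T> (z_cr \<Omega> \<T> g)) (pw_grad \<T> v) = l2_inner \<Omega> g v"
  using z_cr_solution[OF pw_const_L2[OF g]] v broken_inner_pw[OF cr_pw_affine[OF z_cr_space[OF g]] cr_pw_affine[OF v]]
  by (simp add: cr_solution_def)

lemma z_conf_space: "g \<in> piecewise_constant \<T> \<Longrightarrow> z_conf \<Omega> \<T> g \<in> conforming_space \<Omega> \<T>"
  using z_conf_solution[OF pw_const_L2] by (simp add: conforming_solution_def)

lemma marini_AE:
  assumes g: "g \<in> piecewise_constant \<T>" and T: "T \<in> \<T>"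
  shows "AE x in lebesgue_on (interior T). marini_flux \<Omega> \<T> g x =
    elem_grad T (z_cr \<Omega> \<T> g) - (elem_val T g / real DIM('a)) *\<^sub>R (x - barycentre T)"
proof -
  have pa: "z_cr \<Omega> \<T> g \<in> piecewise_affine \<T>" using cr_pw_affine[OF z_cr_space[OF g]] .
  have "AE x in lebesgue_on (interior T). broken_grad \<T> (z_cr \<Omega> \<T> g) x = pw_grad \<T> (z_cr \<Omega> \<T> g) x"
    by (rule AE_elemD[OF broken_grad_AE[OF pw_affine_gradient[OF pa]] T])
  then show ?thesis
    unfolding AE_lebesgue_on[OF elem_sets]
  proof (rule eventually_mono, intro impI)
    fix x assume *: "x \<in> interior T \<longrightarrow> broken_grad \<T> (z_cr \<Omega> \<T> g) x = pw_grad \<T> (z_cr \<Omega> \<T> g) x"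
      and x: "x \<in> interior T"
    have "broken_grad \<T> (z_cr \<Omega> \<T> g) x = elem_grad T (z_cr \<Omega> \<T> g)"
      using * x pw_grad_elem[OF T x] by simp
    then show "marini_flux \<Omega> \<T> g x = elem_grad T (z_cr \<Omega> \<T> g) - (elem_val T g / real DIM('a)) *\<^sub>R (x - barycentre T)"
      unfolding marini_flux_def elem_sum[OF T x, of "\<lambda>T. (g x / real DIM('a)) *\<^sub>R (x - barycentre T)"]
      by (simp only: elem_val_eq[OF g T x])
  qed
qed

lemma marini_elem_L2:
  assumes T: "T \<in> \<T>"
  shows "(\<lambda>x. a - c *\<^sub>R (x - b)) \<in> L2_space (interior T)"
  using elem_bounded[OF T] elem_sets by (intro L2_continuous continuous_intros)

lemma marini_L2:
  assumes g: "g \<in> piecewise_constant \<T>"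
  shows "marini_flux \<Omega> \<T> g \<in> L2_space \<Omega>"
proof (rule L2_elemI)
  fix T assume T: "T \<in> \<T>"
  show "marini_flux \<Omega> \<T> g \<in> L2_space (interior T)"
    by (rule L2_cong_AE[OF marini_elem_L2[OF T] elem_sets])
       (rule eventually_mono[OF marini_AE[OF g T]], simp)
qed

text \<open>
  The Marini flux is \<open>H(div)\<close>-conforming with divergence \<open>-g\<close>: its pairing with \<open>\<nabla>w\<close> only sees the
  Crouzeix--Raviart interpolant of \<open>w\<close>, against which the discrete equation can be tested.
\<close>

lemma marini_orthogonality:
  assumes g: "g \<in> piecewise_constant \<T>" and m: "matched w G"
  shows "l2_inner \<Omega> (marini_flux \<Omega> \<T> g) G = l2_inner \<Omega> g w"
proof -
  let ?z = "z_cr \<Omega> \<T> g" and ?I = "cr_interp w G" and ?d = "real DIM('a)"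
  have wG: "w \<in> L2_space \<Omega>" "G \<in> L2_space \<Omega>"
    using broken_L2[OF matched_broken[OF m]] broken_L2'[OF matched_broken[OF m]] by auto
  have I: "?I \<in> cr_space \<Omega> \<T>" by (rule cr_interp_space[OF m])
  have paz: "?z \<in> piecewise_affine \<T>" using cr_pw_affine[OF z_cr_space[OF g]] .
  have paI: "?I \<in> piecewise_affine \<T>" using cr_pw_affine[OF I] .
  have elem: "l2_inner (interior T) (marini_flux \<Omega> \<T> g) G =
      measure lebesgue (interior T) * (elem_grad T ?z \<bullet> elem_grad T ?I)
      - elem_val T g * (\<integral>x. ?I x \<partial>lebesgue_on (interior T)) + elem_val T g * (\<integral>x. w x \<partial>lebesgue_on (interior T))"
    if T: "T \<in> \<T>" for T
  proof -
    interpret S: full_simplex "verts T" by (rule verts_simplex[OF T])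
    have eT: "convex hull (verts T) = T" using T by simp
    let ?K = "interior T" and ?a = "elem_grad T ?z" and ?c = "elem_val T g"
    have L: "w \<in> L2_space ?K" "G \<in> L2_space ?K" using wG T L2_elem by auto
    have sh: "(\<lambda>x. x - barycentre T) \<in> L2_space ?K" using S.L2_shift unfolding eT .
    have ca: "(\<lambda>x. ?a) \<in> L2_space ?K" using S.L2_const unfolding eT .
    have "l2_inner ?K (marini_flux \<Omega> \<T> g) G = l2_inner ?K (\<lambda>x. ?a - (?c / ?d) *\<^sub>R (x - barycentre T)) G"
      by (rule l2_inner_cong_AE[OF marini_AE[OF g T] _ L2_elem[OF marini_L2[OF g] T] L(2) elem_sets]) simp
    also have "\<dots> = l2_inner ?K (\<lambda>x. ?a) G - (?c / ?d) * l2_inner ?K (\<lambda>x. x - barycentre T) G"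
      by (simp add: l2_inner_diff_left ca L2_scaleR[OF sh] L(2) l2_inner_scaleR_left)
    also have "l2_inner ?K (\<lambda>x. ?a) G = measure lebesgue ?K * (?a \<bullet> elem_grad T ?I)"
      using S.interp_grad_integral[unfolded eT, OF L, of ?a]
      by (simp add: l2_inner_def cr_interp_elem(2)[OF T] measure_elem[OF T] inner_commute)
    \<comment> \<open>The first moment of G about the barycentre is d times the difference between
      the integrals of the interpolant and of w, by \<open>interp_integral\<close>.\<close>
    also have "(?c / ?d) * l2_inner ?K (\<lambda>x. x - barycentre T) G = ?c * (\<integral>x. ?I x \<partial>lebesgue_on ?K) - ?c * (\<integral>x. w x \<partial>lebesgue_on ?K)"
    proof -
      have "(\<integral>x. ?I x \<partial>lebesgue_on ?K) = (\<integral>x. interp (verts T) (\<lambda>p. face_mean (verts T) p w G) x \<partial>lebesgue_on ?K)"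
        by (rule Bochner_Integration.integral_cong) (auto simp: cr_interp_elem(1)[OF T])
      also have "\<dots> = (\<integral>x. w x \<partial>lebesgue_on ?K) + (1 / ?d) * (\<integral>x. G x \<bullet> (x - barycentre T) \<partial>lebesgue_on ?K)"
        using S.interp_integral[unfolded eT, OF L] .
      finally have "(\<integral>x. ?I x \<partial>lebesgue_on ?K) - (\<integral>x. w x \<partial>lebesgue_on ?K) = (1 / ?d) * l2_inner ?K (\<lambda>x. x - barycentre T) G"
        by (simp add: l2_inner_def inner_commute)
      then have "?c * ((\<integral>x. ?I x \<partial>lebesgue_on ?K) - (\<integral>x. w x \<partial>lebesgue_on ?K)) = ?c * ((1 / ?d) * l2_inner ?K (\<lambda>x. x - barycentre T) G)"
        by (simp only:)
      then show ?thesis by (simp add: right_diff_distrib)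
    qed
    finally show ?thesis by simp
  qed
  have "l2_inner \<Omega> (marini_flux \<Omega> \<T> g) G = (\<Sum>T\<in>\<T>. l2_inner (interior T) (marini_flux \<Omega> \<T> g) G)"
    by (rule l2_inner_elem[OF marini_L2[OF g] wG(2)])
  also have "\<dots> = (\<Sum>T\<in>\<T>. measure lebesgue (interior T) * (elem_grad T ?z \<bullet> elem_grad T ?I)
      - elem_val T g * (\<integral>x. ?I x \<partial>lebesgue_on (interior T)) + elem_val T g * (\<integral>x. w x \<partial>lebesgue_on (interior T)))"
    by (rule sum.cong[OF refl]) (rule elem)
  also have "\<dots> = l2_inner \<Omega> (pw_grad \<T> ?z) (pw_grad \<T> ?I) - l2_inner \<Omega> g ?I + l2_inner \<Omega> g w"
    by (simp add: sum.distrib sum_subtractf pw_grad_inner_pw[OF paz paI] pw_const_inner[OF g pw_affine_L2[OF paI]] pw_const_inner[OF g wG(1)])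
  finally show ?thesis using z_cr_eq[OF g I] by simp
qed

text \<open>The integral of v over one element is represented in the energy product by the discrete
  solution for the indicator of that element, so Cauchy--Schwarz bounds it by the energy norm of v.
  Only finitely many elements have to be treated.\<close>

lemma discrete_friedrichs:
  obtains C where "0 \<le> C" "\<And>g v. g \<in> piecewise_constant \<T> \<Longrightarrow> v \<in> cr_space \<Omega> \<T> \<Longrightarrow>
    \<bar>l2_inner \<Omega> g v\<bar> \<le> C * l2_norm \<Omega> g * l2_norm \<Omega> (pw_grad \<T> v)"
proof -
  have "\<exists>R\<ge>0. \<forall>v\<in>cr_space \<Omega> \<T>. \<bar>\<integral>x. v x \<partial>lebesgue_on (interior T)\<bar> \<le> R * l2_norm \<Omega> (pw_grad \<T> v)" if T: "T \<in> \<T>" for T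
  proof -
    let ?g = "\<lambda>x. indicator (interior T) x :: real"
    have g: "?g \<in> piecewise_constant \<T>"
    proof -
      have "?g x = (if T' = T then 1 else 0)" if "T' \<in> \<T>" "x \<in> interior T'" for T' x
        using elem_disjoint[OF that(1) T that(2)] that(2) by (auto simp: indicator_def)
      then show ?thesis unfolding piecewise_constant_def by blast
    qed
    have "\<bar>\<integral>x. v x \<partial>lebesgue_on (interior T)\<bar> \<le> l2_norm \<Omega> (pw_grad \<T> (z_cr \<Omega> \<T> ?g)) * l2_norm \<Omega> (pw_grad \<T> v)"
      if v: "v \<in> cr_space \<Omega> \<T>" for v
    proof -
      have "elem_val T' ?g = (if T' = T then 1 else 0)" if T': "T' \<in> \<T>" for T'
      proof -
        obtain x where x: "x \<in> interior T'" using elem_nonempty[OF T'] by blast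
        have "elem_val T' ?g = ?g x" by (rule elem_val_eq[OF g T' x, symmetric])
        also have "\<dots> = (if T' = T then 1 else 0)"
          using elem_disjoint[OF T' T x] x by (cases "T' = T") (simp_all add: indicator_def, blast)
        finally show ?thesis .
      qed
      then have "l2_inner \<Omega> ?g v = (\<Sum>T'\<in>\<T>. if T' = T then \<integral>x. v x \<partial>lebesgue_on (interior T') else 0)"
        unfolding pw_const_inner[OF g pw_affine_L2[OF cr_pw_affine[OF v]]] by (intro sum.cong) auto
      then have "l2_inner \<Omega> ?g v = (\<integral>x. v x \<partial>lebesgue_on (interior T))"
        using T finite_\<T> by simp
      then show ?thesis
        using z_cr_eq[OF g v] l2_Cauchy_Schwarz[OF pw_grad_L2 pw_grad_L2, OF cr_pw_affine[OF z_cr_space[OF g]] cr_pw_affine[OF v]] by simp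
    qed
    then show ?thesis by (intro exI[of _ "l2_norm \<Omega> (pw_grad \<T> (z_cr \<Omega> \<T> ?g))"]) simp
  qed
  then obtain R where R: "\<And>T. T \<in> \<T> \<Longrightarrow> 0 \<le> R T"
    "\<And>T v. T \<in> \<T> \<Longrightarrow> v \<in> cr_space \<Omega> \<T> \<Longrightarrow> \<bar>\<integral>x. v x \<partial>lebesgue_on (interior T)\<bar> \<le> R T * l2_norm \<Omega> (pw_grad \<T> v)"
    by metis
  let ?\<mu> = "\<lambda>T. measure lebesgue (interior T)"
  define C where "C = (\<Sum>T\<in>\<T>. R T / sqrt (?\<mu> T))"
  have "0 \<le> C" unfolding C_def using R(1) by (intro sum_nonneg) auto
  moreover have "\<bar>l2_inner \<Omega> g v\<bar> \<le> C * l2_norm \<Omega> g * l2_norm \<Omega> (pw_grad \<T> v)"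
    if g: "g \<in> piecewise_constant \<T>" and v: "v \<in> cr_space \<Omega> \<T>" for g v
  proof -
    \<comment> \<open>On one element g is constant, so its value is controlled by its L2 norm and
      the square root of the volume.\<close>
    have val: "\<bar>elem_val T g\<bar> \<le> l2_norm \<Omega> g / sqrt (?\<mu> T)" if T: "T \<in> \<T>" for T
    proof -
      have "(l2_norm (interior T) g)\<^sup>2 = (\<integral>x. (elem_val T g)\<^sup>2 \<partial>lebesgue_on (interior T))"
        unfolding l2_norm_sq l2_inner_def
        by (rule Bochner_Integration.integral_cong) (auto simp: elem_val_eq[OF g T] power2_eq_square)
      also have "\<dots> = (sqrt (?\<mu> T) * \<bar>elem_val T g\<bar>)\<^sup>2"
        by (simp only: integral_const_elem[OF T]) (simp add: power_mult_distrib)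
      finally have "l2_norm (interior T) g = sqrt (?\<mu> T) * \<bar>elem_val T g\<bar>"
        by (rule power2_eq_imp_eq) auto
      then show ?thesis using l2_norm_elem_le[OF pw_const_L2[OF g] T] measure_elem_pos[OF T] by (simp add: field_simps)
    qed
    have "\<bar>l2_inner \<Omega> g v\<bar> \<le> (\<Sum>T\<in>\<T>. \<bar>elem_val T g * (\<integral>x. v x \<partial>lebesgue_on (interior T))\<bar>)"
      unfolding pw_const_inner[OF g pw_affine_L2[OF cr_pw_affine[OF v]]] by (rule sum_abs)
    also have "\<dots> \<le> (\<Sum>T\<in>\<T>. l2_norm \<Omega> g / sqrt (?\<mu> T) * (R T * l2_norm \<Omega> (pw_grad \<T> v)))"
      unfolding abs_mult using val R(2)[OF _ v] by (intro sum_mono mult_mono) auto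
    also have "\<dots> = C * l2_norm \<Omega> g * l2_norm \<Omega> (pw_grad \<T> v)"
      unfolding C_def sum_distrib_right by (rule sum.cong) auto
    finally show ?thesis .
  qed
  ultimately show ?thesis using that by blast
qed

text \<open>Bounds the set whose supremum is \<open>kappa_M\<close>. Each discrete gradient
  contributes C, the explicit affine correction of the Marini flux contributes R.\<close>

lemma marini_conforming_bound:
  obtains C where "0 \<le> C" "\<And>g. g \<in> piecewise_constant \<T> \<Longrightarrow>
    l2_norm \<Omega> (\<lambda>x. marini_flux \<Omega> \<T> g x - weak_grad \<Omega> (z_conf \<Omega> \<T> g) x) \<le> C * l2_norm \<Omega> g"
proof -
  obtain C where C: "0 \<le> C" "\<And>g v. g \<in> piecewise_constant \<T> \<Longrightarrow> v \<in> cr_space \<Omega> \<T> \<Longrightarrow>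
    \<bar>l2_inner \<Omega> g v\<bar> \<le> C * l2_norm \<Omega> g * l2_norm \<Omega> (pw_grad \<T> v)" using discrete_friedrichs by blast
  obtain B where B: "\<And>x. x \<in> \<Omega> \<Longrightarrow> norm x \<le> B" using bounded_\<Omega> by (auto simp: bounded_iff)
  \<comment> \<open>A bound on the distance of a point of \<Omega> from any element barycentre; the
    sum over all barycentres dominates each of them.\<close>
  define R where "R = \<bar>B\<bar> + (\<Sum>T\<in>\<T>. norm (barycentre T))"
  have R0: "0 \<le> R" unfolding R_def by (intro add_nonneg_nonneg sum_nonneg) auto
  have "l2_norm \<Omega> (\<lambda>x. marini_flux \<Omega> \<T> g x - weak_grad \<Omega> (z_conf \<Omega> \<T> g) x) \<le> (C + R + C) * l2_norm \<Omega> g"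
    if g: "g \<in> piecewise_constant \<T>" for g
  proof -
    let ?z = "z_cr \<Omega> \<T> g" and ?b = "z_conf \<Omega> \<T> g"
    have z: "?z \<in> cr_space \<Omega> \<T>" by (rule z_cr_space[OF g])
    have b: "?b \<in> conforming_space \<Omega> \<T>" by (rule z_conf_space[OF g])
    have bc: "?b \<in> cr_space \<Omega> \<T>" by (rule conforming_cr[OF b])
    have pz: "pw_grad \<T> ?z \<in> L2_space \<Omega>"
      using pw_grad_L2 cr_pw_affine z by blast
    have wb: "weak_grad \<Omega> ?b \<in> L2_space \<Omega>"
      using b by (auto simp: conforming_space_def intro: weak_gradient_L2' H10_weak_gradient)
    \<comment> \<open>Testing the equation with its own solution gives n^2 <= C |g| n, and one
      factor n cancels unless it is zero.\<close>
    have stab: "l2_norm \<Omega> (pw_grad \<T> v) \<le> C * l2_norm \<Omega> g"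
      if v: "v \<in> cr_space \<Omega> \<T>" and e: "l2_inner \<Omega> (pw_grad \<T> v) (pw_grad \<T> v) = l2_inner \<Omega> g v" for v
    proof -
      let ?n = "l2_norm \<Omega> (pw_grad \<T> v)"
      have "?n * ?n \<le> (C * l2_norm \<Omega> g) * ?n"
        using C(2)[OF g v] e l2_norm_sq[of \<Omega> "pw_grad \<T> v"] by (simp add: power2_eq_square)
      then show ?thesis
      proof (cases "?n = 0")
        case True
        then show ?thesis using C(1) by simp
      next
        case False
        then have "0 < ?n" by (simp add: less_le)
        with \<open>?n * ?n \<le> (C * l2_norm \<Omega> g) * ?n\<close> show ?thesis by (simp only: mult_le_cancel_right_pos)
      qed
    qed
    have nz: "l2_norm \<Omega> (pw_grad \<T> ?z) \<le> C * l2_norm \<Omega> g" by (rule stab[OF z z_cr_eq[OF g z]])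
    have nb: "l2_norm \<Omega> (pw_grad \<T> ?b) \<le> C * l2_norm \<Omega> g"
    proof (rule stab[OF bc])
      have "l2_inner \<Omega> (pw_grad \<T> ?b) (pw_grad \<T> ?b) = l2_inner \<Omega> (weak_grad \<Omega> ?b) (weak_grad \<Omega> ?b)"
        by (rule l2_inner_cong_AE[OF conforming_grad_AE[OF b] conforming_grad_AE[OF b] wb wb \<Omega>_sets, symmetric])
      then show "l2_inner \<Omega> (pw_grad \<T> ?b) (pw_grad \<T> ?b) = l2_inner \<Omega> g ?b"
        using z_conf_solution[OF pw_const_L2[OF g]] b by (simp add: conforming_solution_def)
    qed
    let ?q = "\<lambda>x. pw_grad \<T> ?z x - marini_flux \<Omega> \<T> g x"
    have qL: "?q \<in> L2_space \<Omega>" by (rule L2_diff[OF pz marini_L2[OF g]])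
    have nq: "l2_norm \<Omega> ?q \<le> R * l2_norm \<Omega> g"
    proof -
      have "l2_norm \<Omega> ?q \<le> l2_norm \<Omega> (\<lambda>x. R *\<^sub>R g x)"
      proof (rule l2_norm_mono_AE[OF qL L2_scaleR[OF pw_const_L2[OF g]]], rule AE_elemI)
        fix T assume T: "T \<in> \<T>"
        have le: "norm ((elem_val T g / real DIM('a)) *\<^sub>R (x - barycentre T)) \<le> \<bar>R * elem_val T g\<bar>"
          if x: "x \<in> interior T" for x
        proof -
          have "norm x \<le> \<bar>B\<bar>" using B[of x] elem_subset[OF T] x by fastforce
          moreover have "norm (barycentre T) \<le> (\<Sum>T\<in>\<T>. norm (barycentre T))"
            by (rule member_le_sum[OF T]) (use finite_\<T> in auto)
          ultimately have "norm (x - barycentre T) \<le> R"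
            using norm_triangle_ineq4[of x "barycentre T"] by (simp add: R_def)
          moreover have "\<bar>elem_val T g / real DIM('a)\<bar> \<le> \<bar>elem_val T g\<bar>"
            using DIM_positive[where 'a='a] by (simp add: divide_le_eq mult_le_cancel_left1)
          ultimately have "\<bar>elem_val T g / real DIM('a)\<bar> * norm (x - barycentre T) \<le> \<bar>elem_val T g\<bar> * R"
            by (intro mult_mono) auto
          then show ?thesis using R0 by (simp add: abs_mult mult.commute)
        qed
        show "AE x in lebesgue_on (interior T). norm (?q x) \<le> norm (R *\<^sub>R g x)"
          using marini_AE[OF g T] unfolding AE_lebesgue_on[OF elem_sets]
        proof (rule eventually_mono, intro impI)
          fix x assume a: "x \<in> interior T \<longrightarrow> marini_flux \<Omega> \<T> g x =
              elem_grad T ?z - (elem_val T g / real DIM('a)) *\<^sub>R (x - barycentre T)" and x: "x \<in> interior T"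
          then have "?q x = (elem_val T g / real DIM('a)) *\<^sub>R (x - barycentre T)"
            by (simp add: pw_grad_elem[OF T])
          then show "norm (?q x) \<le> norm (R *\<^sub>R g x)"
            using le[OF x] elem_val_eq[OF g T x] by simp
        qed
      qed
      then show ?thesis using R0 by (simp add: l2_norm_scaleR[of _ R g, simplified])
    qed
    have "l2_norm \<Omega> (\<lambda>x. marini_flux \<Omega> \<T> g x - weak_grad \<Omega> ?b x) = l2_norm \<Omega> (\<lambda>x. (pw_grad \<T> ?z x - ?q x) - weak_grad \<Omega> ?b x)"
      by simp
    also have "\<dots> \<le> (l2_norm \<Omega> (pw_grad \<T> ?z) + l2_norm \<Omega> ?q) + l2_norm \<Omega> (weak_grad \<Omega> ?b)"
      using l2_norm_triangle_diff[OF L2_diff[OF pz qL] wb] l2_norm_triangle_diff[OF pz qL] by linarith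
    also have "l2_norm \<Omega> (weak_grad \<Omega> ?b) = l2_norm \<Omega> (pw_grad \<T> ?b)"
      by (rule l2_norm_cong_AE[OF conforming_grad_AE[OF b] wb \<Omega>_sets])
    finally show ?thesis using nz nq nb by (simp add: distrib_right)
  qed
  then show ?thesis using that C(1) R0 by (metis add_nonneg_nonneg)
qed

section \<open>Error estimates\<close>

lemma l2_norm_const_pos:
  fixes a :: "'b::euclidean_space"
  assumes T: "T \<in> \<T>" and a: "a \<noteq> 0"
  shows "0 < l2_norm (interior T) (\<lambda>x. a)"
  unfolding l2_norm_def integral_const_elem[OF T] using measure_elem_pos[OF T] a by simp

text \<open>Passing between the supremum and the inequality needs the set to be bounded and
  nonempty, and any v with nonzero gradient to be admissible, that is not almost everywhere zero.
  The latter is uniqueness of weak gradients.\<close>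

lemma
  assumes T: "T \<in> \<T>"
  shows poincare_const_nonneg: "0 \<le> poincare_const T"
    and poincare_const_bound: "has_weak_gradient (interior T) v G \<Longrightarrow> (\<integral>x. v x \<partial>lebesgue_on (interior T)) = 0 \<Longrightarrow>
      l2_norm (interior T) v \<le> poincare_const T * l2_norm (interior T) G"
proof -
  let ?K = "interior T"
  define P where "P = {l2_norm ?K v / l2_norm ?K (weak_grad ?K v) | v. v \<in> H1 ?K \<and>
    \<not> (AE x in lebesgue_on ?K. v x = 0) \<and> (\<integral>x. v x \<partial>lebesgue_on ?K) = 0}"
  note O = open_interior[of T] elem_bounded[OF T]
  obtain C where C: "0 \<le> C" "\<And>v G. has_weak_gradient ?K v G \<Longrightarrow> (\<integral>x. v x \<partial>lebesgue_on ?K) = 0 \<Longrightarrow>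
      l2_norm ?K v \<le> C * l2_norm ?K G"
    by (rule poincare_convex[OF O(1) convex_interior[OF elem_convex[OF T]] O(2) elem_nonempty[OF T]]) (rule that)
  have le: "r \<le> C" if r: "r \<in> P" for r
  proof -
    obtain v where v: "r = l2_norm ?K v / l2_norm ?K (weak_grad ?K v)" "v \<in> H1 ?K" "(\<integral>x. v x \<partial>lebesgue_on ?K) = 0"
      using r unfolding P_def by blast
    obtain G where "has_weak_gradient ?K v G" using v(2) by (auto simp: H1_def)
    from C(2)[OF weak_gradient_weak_grad[OF this] v(3)] show ?thesis
      unfolding v(1) using C(1) l2_norm_nonneg[of ?K "weak_grad ?K v"]
      by (cases "l2_norm ?K (weak_grad ?K v) = 0") (simp_all add: divide_le_eq less_le)
  qed
  then have bdd: "bdd_above P" by (rule bdd_aboveI)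
  have S: "poincare_const T = Sup P" unfolding poincare_const_def P_def ..
  have not0: "\<not> (AE x in lebesgue_on ?K. v x = 0)" if v: "has_weak_gradient ?K v G" and G: "0 < l2_norm ?K G" for v G
  proof
    assume z: "AE x in lebesgue_on ?K. v x = 0"
    have "has_weak_gradient ?K (\<lambda>x. 0) G"
      by (rule weak_gradient_cong_AE[OF O v z]) simp
    moreover have "has_weak_gradient ?K (\<lambda>x. 0) (\<lambda>x. 0)"
      using weak_gradient_affine[OF O, of 0 0] by simp
    ultimately have "AE x in lebesgue_on ?K. G x = 0" by (rule weak_gradient_unique[OF O])
    then show False using l2_norm_AE_zero[OF _ elem_sets] G by fastforce
  qed
  have upper: "l2_norm ?K v / l2_norm ?K G \<le> poincare_const T"
    if v: "has_weak_gradient ?K v G" and m: "(\<integral>x. v x \<partial>lebesgue_on ?K) = 0" and G: "0 < l2_norm ?K G" for v G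
  proof -
    have "v \<in> H1 ?K" using v by (auto simp: H1_def)
    then have "l2_norm ?K v / l2_norm ?K (weak_grad ?K v) \<in> P"
      unfolding P_def using not0[OF v G] m by blast
    moreover have "l2_norm ?K (weak_grad ?K v) = l2_norm ?K G"
      by (rule l2_norm_cong_AE[OF weak_grad_AE[OF O v] weak_gradient_L2'[OF weak_gradient_weak_grad[OF v]] elem_sets])
    ultimately show ?thesis unfolding S using cSup_upper[OF _ bdd] by auto
  qed
  show "l2_norm ?K v \<le> poincare_const T * l2_norm ?K G"
    if v: "has_weak_gradient ?K v G" and m: "(\<integral>x. v x \<partial>lebesgue_on ?K) = 0"
  proof (cases "l2_norm ?K G = 0")
    \<comment> \<open>With zero gradient the quotient carries no information, as division by zero
      gives 0; the a priori constant C shows directly that v has norm zero.\<close>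
    case True
    then show ?thesis using C(2)[OF v m] by simp
  next
    case False
    then have "0 < l2_norm ?K G" by (simp add: less_le)
    then show ?thesis using upper[OF v m] by (simp add: divide_le_eq)
  qed
  \<comment> \<open>A linear function minus its mean provides a member of the set, whose quotient is
    nonnegative.\<close>
  show "0 \<le> poincare_const T"
  proof -
    obtain b :: 'a where b: "b \<in> Basis" using nonempty_Basis by blast
    define c where "c = (\<integral>x. b \<bullet> x \<partial>lebesgue_on ?K) / measure lebesgue ?K"
    have w: "has_weak_gradient ?K (\<lambda>x. b \<bullet> x + - c) (\<lambda>x. b)" by (rule weak_gradient_affine[OF O])
    have i: "integrable (lebesgue_on ?K) (\<lambda>x. b \<bullet> x)" "integrable (lebesgue_on ?K) (\<lambda>x. - c)"
      using L2_integrable[OF weak_gradient_L2[OF weak_gradient_affine[OF O, of b 0]] elem_lmeasurable[OF T]]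
        integrable_bounded_lebesgue_on[OF elem_lmeasurable[OF T], of "\<lambda>x. - c" "\<bar>c\<bar>"] by auto
    have "(\<integral>x. b \<bullet> x + - c \<partial>lebesgue_on ?K) = (\<integral>x. b \<bullet> x \<partial>lebesgue_on ?K) + measure lebesgue ?K * - c"
      using i by (subst Bochner_Integration.integral_add) (simp_all only: integral_const_elem[OF T])
    then have m: "(\<integral>x. b \<bullet> x + - c \<partial>lebesgue_on ?K) = 0"
      using measure_elem_pos[OF T] by (simp add: c_def)
    have "0 \<le> l2_norm ?K (\<lambda>x. b \<bullet> x + - c) / l2_norm ?K (\<lambda>x. b)" by simp
    also have "\<dots> \<le> poincare_const T"
      by (rule upper[OF w m l2_norm_const_pos[OF T nonzero_Basis[OF b]]])
    finally show ?thesis .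
  qed
qed

lemma
  shows max_poincare_const_ge: "T \<in> \<T> \<Longrightarrow> poincare_const T \<le> max_poincare_const \<T>"
    and max_poincare_const_nonneg: "0 \<le> max_poincare_const \<T>"
proof -
  show ge: "poincare_const T \<le> max_poincare_const \<T>" if "T \<in> \<T>" for T
    unfolding max_poincare_const_def using that finite_\<T> by (intro Max_ge) auto
  obtain T where "T \<in> \<T>" using \<T>_nonempty by blast
  then show "0 \<le> max_poincare_const \<T>" using poincare_const_nonneg ge order_trans by blast
qed

text \<open>The supremum is finite by \<open>marini_conforming_bound\<close>; the constant function
  1 shows that the set is nonempty. For g of norm zero the inequality comes from the a priori bound
  rather than from the quotient.\<close>

lemma
  shows kappa_M_nonneg: "0 \<le> kappa_M \<Omega> \<T>"
    and kappa_M_bound: "g \<in> piecewise_constant \<T> \<Longrightarrow>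
      l2_norm \<Omega> (\<lambda>x. marini_flux \<Omega> \<T> g x - weak_grad \<Omega> (z_conf \<Omega> \<T> g) x) \<le> kappa_M \<Omega> \<T> * l2_norm \<Omega> g"
proof -
  let ?n = "\<lambda>g. l2_norm \<Omega> (\<lambda>x. marini_flux \<Omega> \<T> g x - weak_grad \<Omega> (z_conf \<Omega> \<T> g) x)"
  define P where "P = {?n g / l2_norm \<Omega> g | g. g \<in> piecewise_constant \<T> \<and> \<not> (AE x in lebesgue_on \<Omega>. g x = 0)}"
  obtain C where C: "0 \<le> C" "\<And>g. g \<in> piecewise_constant \<T> \<Longrightarrow> ?n g \<le> C * l2_norm \<Omega> g"
    using marini_conforming_bound by blast
  have "r \<le> C" if r: "r \<in> P" for r
  proof -
    obtain g where g: "r = ?n g / l2_norm \<Omega> g" "g \<in> piecewise_constant \<T>" using r unfolding P_def by blast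
    show ?thesis
      unfolding g(1) using C(1) C(2)[OF g(2)] l2_norm_nonneg[of \<Omega> g]
      by (cases "l2_norm \<Omega> g = 0") (simp_all add: divide_le_eq less_le)
  qed
  then have bdd: "bdd_above P" by (rule bdd_aboveI)
  have S: "kappa_M \<Omega> \<T> = Sup P" unfolding kappa_M_def P_def ..
  have upper: "?n g / l2_norm \<Omega> g \<le> kappa_M \<Omega> \<T>" if g: "g \<in> piecewise_constant \<T>" "0 < l2_norm \<Omega> g" for g
  proof -
    have "\<not> (AE x in lebesgue_on \<Omega>. g x = 0)" using l2_norm_AE_zero[OF _ \<Omega>_sets, of g] g(2) by fastforce
    then have "?n g / l2_norm \<Omega> g \<in> P" unfolding P_def using g(1) by blast
    then show ?thesis unfolding S using bdd by (rule cSup_upper)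
  qed
  show "?n g \<le> kappa_M \<Omega> \<T> * l2_norm \<Omega> g" if g: "g \<in> piecewise_constant \<T>"
  proof (cases "l2_norm \<Omega> g = 0")
    case True
    then show ?thesis using C(2)[OF g] by simp
  next
    case False
    then have "0 < l2_norm \<Omega> g" by (simp add: less_le)
    then show ?thesis using upper[OF g] by (simp add: divide_le_eq)
  qed
  show "0 \<le> kappa_M \<Omega> \<T>"
  proof -
    obtain T where T: "T \<in> \<T>" using \<T>_nonempty by blast
    have g: "(\<lambda>x. 1) \<in> piecewise_constant \<T>" by (simp add: piecewise_constant_def)
    have "0 < l2_norm (interior T) (\<lambda>x. 1 :: real)" by (rule l2_norm_const_pos[OF T]) simp
    also have "\<dots> \<le> l2_norm \<Omega> (\<lambda>x. 1 :: real)" by (rule l2_norm_elem_le[OF pw_const_L2[OF g] T])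
    finally have "?n (\<lambda>x. 1) / l2_norm \<Omega> (\<lambda>x. 1 :: real) \<le> kappa_M \<Omega> \<T>" by (rule upper[OF g])
    moreover have "0 \<le> ?n (\<lambda>x. 1) / l2_norm \<Omega> (\<lambda>x. 1 :: real)" by simp
    ultimately show ?thesis by linarith
  qed
qed

lemma broken_poincare:
  assumes w: "has_broken_gradient \<T> w G"
  shows "l2_norm \<Omega> (\<lambda>x. w x - pw_mean w x) \<le> max_poincare_const \<T> * l2_norm \<Omega> G"
proof (rule power2_le_imp_le)
  let ?r = "\<lambda>x. w x - pw_mean w x" and ?C = "max_poincare_const \<T>"
  have r: "?r \<in> L2_space \<Omega>" by (rule L2_diff[OF broken_L2[OF w] pw_const_L2[OF pw_mean_const]])
  have "(l2_norm \<Omega> ?r)\<^sup>2 = (\<Sum>T\<in>\<T>. (l2_norm (interior T) ?r)\<^sup>2)" by (rule l2_norm_elem[OF r])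
  also have "\<dots> \<le> (\<Sum>T\<in>\<T>. (?C * l2_norm (interior T) G)\<^sup>2)"
  proof (rule sum_mono, rule power_mono)
    fix T assume T: "T \<in> \<T>"
    note O = open_interior[of T] elem_bounded[OF T]
    let ?m = "(\<integral>x. w x \<partial>lebesgue_on (interior T)) / measure lebesgue (interior T)"
    have "has_weak_gradient (interior T) w G" using w T by (simp add: has_broken_gradient_def)
    from weak_gradient_diff[OF O this weak_gradient_affine[OF O, of 0 ?m]]
    have "has_weak_gradient (interior T) ?r G"
      by (rule weak_gradient_cong[OF O]) (simp_all add: pw_mean_elem[OF T])
    then have "l2_norm (interior T) ?r \<le> poincare_const T * l2_norm (interior T) G"
      using pw_mean_zero[OF broken_L2[OF w] T] by (rule poincare_const_bound[OF T])
    also have "\<dots> \<le> ?C * l2_norm (interior T) G"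
      by (rule mult_right_mono[OF max_poincare_const_ge[OF T] l2_norm_nonneg])
    finally show "l2_norm (interior T) ?r \<le> ?C * l2_norm (interior T) G" .
  qed simp
  also have "\<dots> = (?C * l2_norm \<Omega> G)\<^sup>2"
    by (simp add: power_mult_distrib l2_norm_elem[OF broken_L2'[OF w]] sum_distrib_left)
  finally show "(l2_norm \<Omega> ?r)\<^sup>2 \<le> (?C * l2_norm \<Omega> G)\<^sup>2" .
  show "0 \<le> ?C * l2_norm \<Omega> G" using max_poincare_const_nonneg by simp
qed

lemma P0_L2: "f \<in> L2_space \<Omega> \<Longrightarrow> P0_projection \<Omega> \<T> f \<in> L2_space \<Omega>"
  by (rule pw_const_L2[OF P0_projection_spec(1)])

lemma residual_bound:
  assumes f: "f \<in> L2_space \<Omega>" and m: "matched w G"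
  defines "b \<equiv> z_conf \<Omega> \<T> (P0_projection \<Omega> \<T> f)"
  shows "\<bar>l2_inner \<Omega> f w - l2_inner \<Omega> (weak_grad \<Omega> b) G\<bar> \<le> error_bound \<Omega> \<T> f * l2_norm \<Omega> G"
proof -
  let ?g = "P0_projection \<Omega> \<T> f"
  let ?\<sigma> = "marini_flux \<Omega> \<T> ?g" and ?r = "\<lambda>x. w x - pw_mean w x"
  note g = P0_projection_spec(1)[OF f] and br = matched_broken[OF m]
  note w = broken_L2[OF br] and G = broken_L2'[OF br]
  have mean: "pw_mean w \<in> L2_space \<Omega>" by (rule pw_const_L2[OF pw_mean_const])
  have fg: "(\<lambda>x. f x - ?g x) \<in> L2_space \<Omega>" by (rule L2_diff[OF f P0_L2[OF f]])
  have bL: "weak_grad \<Omega> b \<in> L2_space \<Omega>"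
    using z_conf_space[OF g] weak_gradient_L2'[OF H10_weak_gradient, of b \<Omega>] unfolding b_def conforming_space_def by blast
  have "l2_inner \<Omega> f w = l2_inner \<Omega> (\<lambda>x. f x - ?g x) w + l2_inner \<Omega> ?g w"
    by (simp add: l2_inner_diff_left[OF f P0_L2[OF f] w])
  \<comment> \<open>Subtracting the elementwise mean of w is free, since the data oscillation is
    orthogonal to piecewise constants. It makes the Poincare inequality applicable.\<close>
  also have "l2_inner \<Omega> (\<lambda>x. f x - ?g x) w = l2_inner \<Omega> (\<lambda>x. f x - ?g x) ?r"
    unfolding l2_inner_diff_right[OF w mean fg] P0_projection_spec(2)[OF f pw_mean_const] by simp
  also have "l2_inner \<Omega> ?g w = l2_inner \<Omega> ?\<sigma> G" by (rule marini_orthogonality[OF g m, symmetric])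
  finally have "l2_inner \<Omega> f w - l2_inner \<Omega> (weak_grad \<Omega> b) G =
      l2_inner \<Omega> (\<lambda>x. f x - ?g x) ?r + l2_inner \<Omega> (\<lambda>x. ?\<sigma> x - weak_grad \<Omega> b x) G"
    by (simp add: l2_inner_diff_left[OF marini_L2[OF g] bL G])
  moreover have "\<bar>l2_inner \<Omega> (\<lambda>x. f x - ?g x) ?r\<bar> \<le> l2_norm \<Omega> (\<lambda>x. f x - ?g x) * (max_poincare_const \<T> * l2_norm \<Omega> G)"
    by (rule order_trans[OF l2_Cauchy_Schwarz[OF fg L2_diff[OF w mean]]
        mult_left_mono[OF broken_poincare[OF br] l2_norm_nonneg]])
  moreover have "\<bar>l2_inner \<Omega> (\<lambda>x. ?\<sigma> x - weak_grad \<Omega> b x) G\<bar> \<le> (kappa_M \<Omega> \<T> * l2_norm \<Omega> ?g) * l2_norm \<Omega> G"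
    unfolding b_def
    by (rule order_trans[OF l2_Cauchy_Schwarz[OF L2_diff[OF marini_L2[OF g] bL[unfolded b_def]] G]
        mult_right_mono[OF kappa_M_bound[OF g] l2_norm_nonneg]])
  ultimately show ?thesis unfolding error_bound_def by (simp add: algebra_simps)
qed

lemma error_bound_nonneg: "0 \<le> error_bound \<Omega> \<T> f"
  unfolding error_bound_def using max_poincare_const_nonneg kappa_M_nonneg by simp

text \<open>Cauchy--Schwarz in the plane, combined with the Pythagorean identity for the orthogonal
  splitting of f.\<close>

lemma error_bound_le:
  assumes f: "f \<in> L2_space \<Omega>"
  shows "error_bound \<Omega> \<T> f \<le> M_const \<Omega> \<T> * l2_norm \<Omega> f"
proof -
  let ?g = "P0_projection \<Omega> \<T> f" and ?C = "max_poincare_const \<T>" and ?k = "kappa_M \<Omega> \<T>"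
  define p q where "p = l2_norm \<Omega> (\<lambda>x. f x - ?g x)" and "q = l2_norm \<Omega> ?g"
  have fg: "(\<lambda>x. f x - ?g x) \<in> L2_space \<Omega>" by (rule L2_diff[OF f P0_L2[OF f]])
  have n: "(l2_norm \<Omega> f)\<^sup>2 = p\<^sup>2 + q\<^sup>2"
    using l2_norm_add_scaleR_sq[OF fg P0_L2[OF f], of 1] P0_projection_spec[OF f] by (simp add: p_def q_def)
  \<comment> \<open>The difference of the two sides is (C q - k p)^2.\<close>
  have "(?C * p + ?k * q)\<^sup>2 \<le> (?C\<^sup>2 + ?k\<^sup>2) * (p\<^sup>2 + q\<^sup>2)"
    using zero_le_power2[of "?C * q - ?k * p"] by (simp add: power2_eq_square algebra_simps)
  also have "\<dots> = (M_const \<Omega> \<T> * l2_norm \<Omega> f)\<^sup>2"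
    unfolding n[symmetric] M_const_def by (simp add: power_mult_distrib)
  finally have "?C * p + ?k * q \<le> M_const \<Omega> \<T> * l2_norm \<Omega> f"
    by (rule power2_le_imp_le) (simp add: M_const_def)
  then show ?thesis by (simp add: error_bound_def p_def q_def)
qed

lemma cr_solution_test:
  assumes c: "cr_solution \<Omega> \<T> f c" and v: "v \<in> cr_space \<Omega> \<T>"
  shows "l2_inner \<Omega> (pw_grad \<T> c) (pw_grad \<T> v) = l2_inner \<Omega> f v"
  using c v broken_inner_pw[of c v] by (simp add: cr_solution_def cr_pw_affine)

lemma cr_solution_test_conforming:
  assumes c: "cr_solution \<Omega> \<T> f c" and v: "v \<in> conforming_space \<Omega> \<T>"
  shows "l2_inner \<Omega> (pw_grad \<T> c) (weak_grad \<Omega> v) = l2_inner \<Omega> f v"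
proof -
  have "l2_inner \<Omega> (pw_grad \<T> c) (weak_grad \<Omega> v) = l2_inner \<Omega> (pw_grad \<T> c) (pw_grad \<T> v)"
  proof (rule l2_inner_cong_AE[OF _ conforming_grad_AE[OF v] _ _ \<Omega>_sets])
    show "pw_grad \<T> c \<in> L2_space \<Omega>" using c by (intro pw_grad_L2 cr_pw_affine) (simp add: cr_solution_def)
    show "weak_grad \<Omega> v \<in> L2_space \<Omega>"
      using v weak_gradient_L2'[OF H10_weak_gradient, of v \<Omega>] unfolding conforming_space_def by blast
  qed simp
  then show ?thesis using cr_solution_test[OF c conforming_cr[OF v]] by simp
qed

lemma matched_diff: "matched v G \<Longrightarrow> matched w H \<Longrightarrow> matched (\<lambda>x. v x - w x) (\<lambda>x. G x - H x)"
  using matched_lin[of v G w H "-1"] by simp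

text \<open>Applying the residual bound to the sum of the two differences, instead of bounding each
  separately and using the triangle inequality, is what saves the factor 2.\<close>

lemma energy_error:
  assumes f: "f \<in> L2_space \<Omega>" and u: "weak_solution \<Omega> f u" and c: "cr_solution \<Omega> \<T> f c"
  shows "l2_norm \<Omega> (\<lambda>x. weak_grad \<Omega> u x - pw_grad \<T> c x) \<le> error_bound \<Omega> \<T> f"
proof -
  define b where "b = z_conf \<Omega> \<T> (P0_projection \<Omega> \<T> f)"
  define \<alpha> \<beta> where "\<alpha> = (\<lambda>x. u x - b x)" and "\<beta> = (\<lambda>x. c x - b x)"
  define g\<alpha> g\<beta> where "g\<alpha> = (\<lambda>x. weak_grad \<Omega> u x - weak_grad \<Omega> b x)" and "g\<beta> = (\<lambda>x. pw_grad \<T> c x - weak_grad \<Omega> b x)"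
  let ?E = "error_bound \<Omega> \<T> f"
  have uH: "u \<in> H10 \<Omega>" using u by (simp add: weak_solution_def)
  have bV: "b \<in> conforming_space \<Omega> \<T>" unfolding b_def by (rule z_conf_space[OF P0_projection_spec(1)[OF f]])
  then have bH: "b \<in> H10 \<Omega>" by (simp add: conforming_space_def)
  have cV: "c \<in> cr_space \<Omega> \<T>" using c by (simp add: cr_solution_def)
  note mu = H10_matched_weak_grad[OF uH] and mb = H10_matched_weak_grad[OF bH] and mc = cr_matched[OF cV]
  have m\<alpha>: "matched \<alpha> g\<alpha>" unfolding \<alpha>_def g\<alpha>_def by (rule matched_diff[OF mu mb])
  have m\<beta>: "matched \<beta> g\<beta>" unfolding \<beta>_def g\<beta>_def by (rule matched_diff[OF mc mb])
  note L = broken_L2[OF matched_broken] and L' = broken_L2'[OF matched_broken]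
  have ms: "matched (\<lambda>x. \<alpha> x + \<beta> x) (\<lambda>x. g\<alpha> x + g\<beta> x)" using matched_lin[OF m\<alpha> m\<beta>, of 1] by simp
  have e\<alpha>: "l2_inner \<Omega> g\<alpha> g\<alpha> = l2_inner \<Omega> f \<alpha> - l2_inner \<Omega> (weak_grad \<Omega> b) g\<alpha>"
  proof -
    have "l2_inner \<Omega> g\<alpha> g\<alpha> = l2_inner \<Omega> (weak_grad \<Omega> u) g\<alpha> - l2_inner \<Omega> (weak_grad \<Omega> b) g\<alpha>"
      using l2_inner_diff_left[OF L'[OF mu] L'[OF mb] L'[OF m\<alpha>]] by (simp add: g\<alpha>_def)
    also have "l2_inner \<Omega> (weak_grad \<Omega> u) g\<alpha> = l2_inner \<Omega> (weak_grad \<Omega> u) (weak_grad \<Omega> u) - l2_inner \<Omega> (weak_grad \<Omega> u) (weak_grad \<Omega> b)"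
      using l2_inner_diff_right[OF L'[OF mu] L'[OF mb] L'[OF mu]] by (simp add: g\<alpha>_def)
    also have "\<dots> = l2_inner \<Omega> f \<alpha>"
      using u uH bH l2_inner_diff_right[OF L[OF mu] L[OF mb] f] by (simp add: weak_solution_def \<alpha>_def)
    finally show ?thesis .
  qed
  have e\<beta>: "l2_inner \<Omega> g\<beta> g\<beta> = l2_inner \<Omega> f \<beta> - l2_inner \<Omega> (weak_grad \<Omega> b) g\<beta>"
  proof -
    have "l2_inner \<Omega> g\<beta> g\<beta> = l2_inner \<Omega> (pw_grad \<T> c) g\<beta> - l2_inner \<Omega> (weak_grad \<Omega> b) g\<beta>"
      using l2_inner_diff_left[OF L'[OF mc] L'[OF mb] L'[OF m\<beta>]] by (simp add: g\<beta>_def)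
    also have "l2_inner \<Omega> (pw_grad \<T> c) g\<beta> = l2_inner \<Omega> (pw_grad \<T> c) (pw_grad \<T> c) - l2_inner \<Omega> (pw_grad \<T> c) (weak_grad \<Omega> b)"
      using l2_inner_diff_right[OF L'[OF mc] L'[OF mb] L'[OF mc]] by (simp add: g\<beta>_def)
    also have "\<dots> = l2_inner \<Omega> f \<beta>"
      using cr_solution_test[OF c cV] cr_solution_test_conforming[OF c bV] l2_inner_diff_right[OF L[OF mc] L[OF mb] f]
      by (simp add: \<beta>_def)
    finally show ?thesis .
  qed
  define A where "A = (l2_norm \<Omega> g\<alpha>)\<^sup>2 + (l2_norm \<Omega> g\<beta>)\<^sup>2"
  define t where "t = l2_inner \<Omega> g\<alpha> g\<beta>"
  define s where "s = l2_norm \<Omega> (\<lambda>x. g\<alpha> x + g\<beta> x)"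
  have "A = l2_inner \<Omega> f (\<lambda>x. \<alpha> x + \<beta> x) - l2_inner \<Omega> (weak_grad \<Omega> b) (\<lambda>x. g\<alpha> x + g\<beta> x)"
    unfolding A_def l2_norm_sq e\<alpha> e\<beta>
    by (simp add: l2_inner_add_right[OF L[OF m\<alpha>] L[OF m\<beta>] f] l2_inner_add_right[OF L'[OF m\<alpha>] L'[OF m\<beta>] L'[OF mb]])
  then have A: "A \<le> ?E * s" using residual_bound[OF f ms] unfolding b_def s_def by linarith
  have A0: "0 \<le> A" by (simp add: A_def)
  have s2: "s\<^sup>2 = A + 2 * t"
    using l2_norm_add_scaleR_sq[OF L'[OF m\<alpha>] L'[OF m\<beta>], of 1] by (simp add: s_def A_def t_def)
  have d2: "(l2_norm \<Omega> (\<lambda>x. g\<alpha> x - g\<beta> x))\<^sup>2 = A - 2 * t"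
    using l2_norm_add_scaleR_sq[OF L'[OF m\<alpha>] L'[OF m\<beta>], of "-1"] by (simp add: A_def t_def)
  have "A - 2 * t \<le> ?E\<^sup>2"
  \<comment> \<open>The squared norms of difference and sum multiply to (A - 2t)(A + 2t) = A^2 -
    4t^2, which is at most A^2 and hence at most E^2 s^2; it remains to divide by s^2. If s = 0,
    then A <= 0 forces A = 0, and t = 0 follows.\<close>
  proof (cases "s = 0")
    case True
    then show ?thesis using A A0 s2 by simp
  next
    case False
    then have pos: "0 < s\<^sup>2" by simp
    have "(A - 2 * t) * s\<^sup>2 \<le> A\<^sup>2" unfolding s2 by (simp add: power2_eq_square algebra_simps)
    also have "\<dots> \<le> (?E * s)\<^sup>2" by (rule power_mono[OF A A0])
    finally have "(A - 2 * t) * s\<^sup>2 \<le> ?E\<^sup>2 * s\<^sup>2" by (simp add: power_mult_distrib)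
    then show ?thesis using pos by (simp only: mult_le_cancel_right_pos)
  qed
  then have "l2_norm \<Omega> (\<lambda>x. g\<alpha> x - g\<beta> x) \<le> ?E"
    unfolding d2[symmetric] by (rule power2_le_imp_le[OF _ error_bound_nonneg])
  then show ?thesis by (simp add: g\<alpha>_def g\<beta>_def)
qed

text \<open>The conforming discrete solution b for the projected error takes the place of a
  continuous dual solution, so no elliptic regularity enters. One factor \<open>M_const\<close>
  stems from the error bound of e, the other from the energy estimate for f.\<close>

lemma duality_error:
  assumes f: "f \<in> L2_space \<Omega>" and u: "weak_solution \<Omega> f u" and c: "cr_solution \<Omega> \<T> f c"
  shows "l2_norm \<Omega> (\<lambda>x. u x - c x) \<le> (M_const \<Omega> \<T>)\<^sup>2 * l2_norm \<Omega> f"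
proof -
  define e where "e = (\<lambda>x. u x - c x)"
  define G where "G = (\<lambda>x. weak_grad \<Omega> u x - pw_grad \<T> c x)"
  define b where "b = z_conf \<Omega> \<T> (P0_projection \<Omega> \<T> e)"
  let ?M = "M_const \<Omega> \<T>"
  have M0: "0 \<le> ?M" by (simp add: M_const_def)
  have uH: "u \<in> H10 \<Omega>" using u by (simp add: weak_solution_def)
  have cV: "c \<in> cr_space \<Omega> \<T>" using c by (simp add: cr_solution_def)
  note mu = H10_matched_weak_grad[OF uH] and mc = cr_matched[OF cV]
  have m: "matched e G" unfolding e_def G_def by (rule matched_diff[OF mu mc])
  note L' = broken_L2'[OF matched_broken]
  have eL: "e \<in> L2_space \<Omega>" by (rule broken_L2[OF matched_broken[OF m]])
  have bV: "b \<in> conforming_space \<Omega> \<T>" unfolding b_def by (rule z_conf_space[OF P0_projection_spec(1)[OF eL]])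
  then have bH: "b \<in> H10 \<Omega>" by (simp add: conforming_space_def)
  have "l2_inner \<Omega> (weak_grad \<Omega> b) G = l2_inner \<Omega> (weak_grad \<Omega> b) (weak_grad \<Omega> u) - l2_inner \<Omega> (weak_grad \<Omega> b) (pw_grad \<T> c)"
    unfolding G_def by (rule l2_inner_diff_right[OF L'[OF mu] L'[OF mc] L'[OF H10_matched_weak_grad[OF bH]]])
  also have "\<dots> = 0"
    using u bH cr_solution_test_conforming[OF c bV]
    by (simp add: weak_solution_def l2_inner_commute[of \<Omega> "weak_grad \<Omega> b"])
  finally have "l2_norm \<Omega> e * l2_norm \<Omega> e \<le> error_bound \<Omega> \<T> e * l2_norm \<Omega> G"
    using residual_bound[OF eL m] l2_norm_sq[of \<Omega> e] unfolding b_def by (simp add: power2_eq_square)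
  also have "\<dots> \<le> (?M * l2_norm \<Omega> e) * error_bound \<Omega> \<T> f"
    using error_bound_le[OF eL] energy_error[OF f u c] M0 unfolding G_def by (intro mult_mono) auto
  also have "\<dots> \<le> (?M * l2_norm \<Omega> e) * (?M * l2_norm \<Omega> f)"
    using error_bound_le[OF f] M0 by (intro mult_left_mono) auto
  finally have *: "l2_norm \<Omega> e * l2_norm \<Omega> e \<le> (?M\<^sup>2 * l2_norm \<Omega> f) * l2_norm \<Omega> e"
    by (simp add: power2_eq_square mult_ac)
  have "l2_norm \<Omega> e \<le> ?M\<^sup>2 * l2_norm \<Omega> f"
  proof (cases "l2_norm \<Omega> e = 0")
    case True
    then show ?thesis by simp
  next
    case False
    then have "0 < l2_norm \<Omega> e" by (simp add: less_le)
    with * show ?thesis by (simp only: mult_le_cancel_right_pos)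
  qed
  then show ?thesis unfolding e_def .
qed

lemma broken_seminorm_error:
  assumes u: "u \<in> H10 \<Omega>" and c: "c \<in> cr_space \<Omega> \<T>"
  shows "broken_h1_seminorm \<Omega> \<T> (\<lambda>x. u x - c x) = l2_norm \<Omega> (\<lambda>x. weak_grad \<Omega> u x - pw_grad \<T> c x)"
proof -
  have b: "has_broken_gradient \<T> (\<lambda>x. u x - c x) (\<lambda>x. weak_grad \<Omega> u x - pw_grad \<T> c x)"
    by (rule matched_broken[OF matched_diff[OF H10_matched_weak_grad[OF u] cr_matched[OF c]]])
  show ?thesis
    unfolding broken_h1_seminorm_def
    by (rule l2_norm_cong_AE[OF _ broken_L2'[OF b] \<Omega>_sets, symmetric])
       (rule eventually_mono[OF broken_grad_AE[OF b]], simp)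
qed

end

theorem theorem4p8:
  fixes \<Omega> :: "'a::euclidean_space set" and \<T> :: "'a set set"
    and f u u\<^sub>C\<^sub>R :: "'a \<Rightarrow> real"
  assumes "DIM('a) = 2 \<or> DIM('a) = 3"
    and "polyhedral_lipschitz_domain \<Omega>"
    and "simplicial_mesh \<Omega> \<T>"
    and "f \<in> L2_space \<Omega>"
    and "weak_solution \<Omega> f u"
    and "cr_solution \<Omega> \<T> f u\<^sub>C\<^sub>R"
  shows "broken_h1_seminorm \<Omega> \<T> (\<lambda>x. u x - u\<^sub>C\<^sub>R x) \<le> 2 * error_bound \<Omega> \<T> f
    \<and> 2 * error_bound \<Omega> \<T> f \<le> 2 * M_const \<Omega> \<T> * l2_norm \<Omega> f
    \<and> l2_norm \<Omega> (\<lambda>x. u x - u\<^sub>C\<^sub>R x) \<le> (M_const \<Omega> \<T>)\<^sup>2 * l2_norm \<Omega> f"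
proof -
  interpret mesh \<Omega> \<T> by unfold_locales (use assms in auto)
  have "u \<in> H10 \<Omega>" "u\<^sub>C\<^sub>R \<in> cr_space \<Omega> \<T>"
    using assms(5,6) by (simp_all add: weak_solution_def cr_solution_def)
  \<comment> \<open>The energy estimate holds with factor 1; nonnegativity of the bound then gives
    the stated factor 2.\<close>
  then have "broken_h1_seminorm \<Omega> \<T> (\<lambda>x. u x - u\<^sub>C\<^sub>R x) \<le> error_bound \<Omega> \<T> f"
    using energy_error[OF assms(4-6)] by (simp add: broken_seminorm_error)
  then show ?thesis
    using error_bound_nonneg[of f] error_bound_le[OF assms(4)] duality_error[OF assms(4-6)] by simp
qed

end
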